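(* $g_{\mathcal{SEG}}(n) = 2^{\Theta(n)}$; that is, there exist constants $c_1, c_2 > 0$ and $n_0$ such that for all $n \geq n_0$, $2^{c_1 n} \leq g_{\mathcal{SEG}}(n) \leq 2^{c_2 n}$.
   Context: The intersection graph of a tuple of sets $(A(v) : v \in V)$ is the graph with vertex set $V$ in which distinct $u,v$ are adjacent iff $A(u)\cap A(v) \neq \emptyset$; the tuple is then said to realize the graph. A segment graph is a graph that is (isomorphic to) the intersection graph of finitely many closed line segments in $\mathbb{R}^2$. Let $\mathcal{SEG}(n)$ be the set of segment graphs with $n$ vertices. The bit size of an integer $n$ is $\mathrm{bitsize}(n) := 1 + \lceil \log_2(|n|+1)\rceil$, and the bit size of a rational number $q = \frac{n}{m}$, with $n,m$ relatively prime integers ($m\ge 1$), is $\mathrm{bitsize}(q) := \mathrm{bitsize}(n) + \mathrm{bitsize}(m)$. For a segment graph $G$, $g_{\mathcal{SEG}}(G)$ denotes the minimum, over all realizations of $G$ by closed line segments with both endpoints in $\mathbb{Q}^2$, of the sum of the bit sizes of all the coordinates of the endpoints (such realizations exist for every segment graph). Let $g_{\mathcal{SEG}}(n) := \max_{G \in \mathcal{SEG}(n)} g_{\mathcal{SEG}}(G)$. *)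

theory Defs
  imports "HOL-Analysis.Analysis"
begin

record 'v graph =
  verts :: "'v set"
  edges :: "'v set set"

definition simple_graph :: "'v graph \<Rightarrow> bool" where
  "simple_graph G \<longleftrightarrow>
     finite (verts G) \<and> (\<forall>e\<in>edges G. e \<subseteq> verts G \<and> card e = 2)"

definition isomorphic :: "'v graph \<Rightarrow> 'w graph \<Rightarrow> bool" where
  "isomorphic G H \<longleftrightarrow>
     (\<exists>f. bij_betw f (verts G) (verts H) \<and> edges H = (\<lambda>e. f ` e) ` edges G)"

definition intersection_graph :: "'v set \<Rightarrow> ('v \<Rightarrow> 'p set) \<Rightarrow> 'v graph" where
  "intersection_graph V A =
     \<lparr>verts = V, edges = {{u, v} |u v. u \<in> V \<and> v \<in> V \<and> u \<noteq> v \<and> A u \<inter> A v \<noteq> {}}\<rparr>"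

definition realizes :: "('v \<Rightarrow> 'p set) \<Rightarrow> 'v graph \<Rightarrow> bool" where
  "realizes A G \<longleftrightarrow> G = intersection_graph (verts G) A"

text \<open>
  The plane is the Euclidean space \<^typ>\<open>real \<times> real\<close>. Line segments are nondegenerate,
  whereas the library's \<^const>\<open>closed_segment\<close> also covers single points.
\<close>

definition is_line_segment :: "(real \<times> real) set \<Rightarrow> bool" where
  "is_line_segment S \<longleftrightarrow> (\<exists>a b. a \<noteq> b \<and> S = closed_segment a b)"

definition segment_graph :: "'v graph \<Rightarrow> bool" where
  "segment_graph G \<longleftrightarrow>
     simple_graph G \<and>
     (\<exists>(W :: 'v set) A. finite W \<and> (\<forall>w\<in>W. is_line_segment (A w)) \<and>
        isomorphic (intersection_graph W A) G)"

text \<open>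
  Vertices are taken to be natural numbers, so that the graphs with \<open>n\<close> vertices form a set;
  every finite graph is isomorphic to one of this form.
\<close>

definition SEG :: "nat \<Rightarrow> nat graph set" where
  "SEG n = {G. segment_graph G \<and> card (verts G) = n}"

definition bitsize_int :: "int \<Rightarrow> nat" where
  "bitsize_int n = 1 + nat \<lceil>log 2 (real_of_int \<bar>n\<bar> + 1)\<rceil>"

text \<open>\<^const>\<open>quotient_of\<close> yields the reduced fraction with positive denominator.\<close>

definition bitsize_rat :: "rat \<Rightarrow> nat" where
  "bitsize_rat q = (case quotient_of q of (n, m) \<Rightarrow> bitsize_int n + bitsize_int m)"

definition bitsize_point :: "rat \<times> rat \<Rightarrow> nat" where
  "bitsize_point p = bitsize_rat (fst p) + bitsize_rat (snd p)"

definition real_point :: "rat \<times> rat \<Rightarrow> real \<times> real" where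
  "real_point p = (of_rat (fst p), of_rat (snd p))"

definition rational_realization ::
    "('v \<Rightarrow> rat \<times> rat) \<Rightarrow> ('v \<Rightarrow> rat \<times> rat) \<Rightarrow> 'v graph \<Rightarrow> bool" where
  "rational_realization P Q G \<longleftrightarrow>
     (\<forall>v\<in>verts G. P v \<noteq> Q v) \<and>
     realizes (\<lambda>v. closed_segment (real_point (P v)) (real_point (Q v))) G"

definition g_SEG_graph :: "'v graph \<Rightarrow> nat" where
  "g_SEG_graph G =
     (LEAST s. \<exists>P Q. rational_realization P Q G \<and>
        s = (\<Sum>v\<in>verts G. bitsize_point (P v) + bitsize_point (Q v)))"

text \<open>
  \<^term>\<open>SEG n\<close> is infinite, but \<^const>\<open>g_SEG_graph\<close> is invariant under isomorphism and there
  are finitely many isomorphism types of graphs with \<open>n\<close> vertices, so the maximum is over a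
  finite set of values.
\<close>

definition g_SEG :: "nat \<Rightarrow> nat" where
  "g_SEG n = Max (g_SEG_graph ` SEG n)"

end

(*
Upper bound. Perturb a realization so that all segments are non-vertical and all intersections are
proper crossings. In terms of slopes, intercepts and end abscissae, the graph is then determined by
the signs of linearly many unknowns in quadratics whose coefficients have absolute sum at most 4. A
finite family of integer quadratics that is positive somewhere in the unit box has a point in the
box where all its members exceed a bound 1/M with log M = 2^O(n), independently of the size of the
family: maximise the minimum of the slightly shifted quadratics; the Fritz John conditions at a
maximiser involve at most k+1 of them, and a small integer polynomial relation between these and the
maximum, obtained from Siegel's lemma, would fail if the maximum were too small. The shifts are
widely separated powers of an infinitesimal, which makes all other terms of the relation negligible.
Rounding the unknowns to multiples of 2^-q with q about log M finishes the proof.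

Lower bound. A graph with O(K) vertices is drawn such that in every realization three segments bound
a triangle that contains a part of the realization on which most other segments act as full lines;
this uses the Jordan curve theorem in the form that K(3,3)-like configurations are not planar. Within
the triangle, orders of crossings along four walls are enforced by auxiliary segments. In affine
coordinates given by the walls, these orders force K successive squarings of a ratio, so two disjoint
segments have a distance that is by a factor of 2^(2^(K-1)) below the length of a third one. Disjoint
segments with rational endpoints of total bit size S have distance at least 2^-(3S+2), hence S grows
exponentially in K.
*)
theory Submission
  imports Defs "HOL-Library.Multiset"
begin

section \<open>Perturbation of segments\<close>

text \<open>In the upper bound, the number of sign conditions is quadratic in the number of vertices
  and must not enter the exponent. This is why a segment has only four unknowns and why a maximiser
  is described by few active conditions. Its critical system may be singular, with solutions that
  are not isolated, so elimination could degenerate. Siegel's lemma yields a nonzero relation in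
  every case, and the separated shifts prevent its terms from cancelling at the maximiser. In the
  lower bound, adjacency says on which side of a segment a point lies only where the segment acts as
  a full line; elsewhere every order condition can be bypassed around an end. So confinement has to
  precede all arithmetic. Squaring cannot start from the ratio 1; a first step on a wall of its own
  produces a ratio of at least 2 through the inequality of arithmetic and geometric means. A given
  realization may be degenerate, so the argument runs in a nearby generic one, and only the distance
  estimate is carried back, by a limit.\<close>

definition gap :: "(nat \<Rightarrow> real) \<Rightarrow> (nat \<Rightarrow> real) \<Rightarrow> nat \<Rightarrow> nat \<Rightarrow> real \<Rightarrow> real" where
  "gap a b i j x = (a i - a j) * x + (b i - b j)"

text \<open>Two graphs over intervals meet iff the difference changes sign on the common interval.\<close>

definition meets :: "(nat \<Rightarrow> real) \<Rightarrow> (nat \<Rightarrow> real) \<Rightarrow> (nat \<Rightarrow> real) \<Rightarrow> (nat \<Rightarrow> real) \<Rightarrow> nat \<Rightarrow> nat \<Rightarrow> bool" where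
  "meets a b l r i j \<longleftrightarrow> max (l i) (l j) \<le> min (r i) (r j) \<and>
     gap a b i j (max (l i) (l j)) * gap a b i j (min (r i) (r j)) \<le> 0"

definition crosses :: "(nat \<Rightarrow> real) \<Rightarrow> (nat \<Rightarrow> real) \<Rightarrow> (nat \<Rightarrow> real) \<Rightarrow> (nat \<Rightarrow> real) \<Rightarrow> nat \<Rightarrow> nat \<Rightarrow> bool" where
  "crosses a b l r i j \<longleftrightarrow> max (l i) (l j) < min (r i) (r j) \<and>
     gap a b i j (max (l i) (l j)) * gap a b i j (min (r i) (r j)) < 0"

lemma gap_swap: "gap a b j i x = - gap a b i j x" by (simp add: gap_def algebra_simps)

lemma meets_swap: "meets a b l r j i = meets a b l r i j"
  by (simp add: meets_def gap_swap [of a b j i] max.commute min.commute)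

lemma crosses_swap: "crosses a b l r j i = crosses a b l r i j"
  by (simp add: crosses_def gap_swap [of a b j i] max.commute min.commute)

lemma crosses_imp_meets: "crosses a b l r i j \<Longrightarrow> meets a b l r i j" by (auto simp: crosses_def meets_def)

lemma crosses_slopes: "crosses a b l r i j \<Longrightarrow> a i \<noteq> a j"
  by (auto simp: crosses_def gap_def mult_less_0_iff)

lemma meets_iff_ex:
  "meets a b l r i j \<longleftrightarrow> (\<exists>x. l i \<le> x \<and> x \<le> r i \<and> l j \<le> x \<and> x \<le> r j \<and> a i * x + b i = a j * x + b j)"
proof
  assume m: "meets a b l r i j"
  define L R where "L = max (l i) (l j)" and "R = min (r i) (r j)"
  have LR: "L \<le> R" "gap a b i j L * gap a b i j R \<le> 0" using m by (auto simp: meets_def L_def R_def)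
  have "continuous_on {L..R} (gap a b i j)" unfolding gap_def by (intro continuous_intros)
  moreover have "gap a b i j L \<le> 0 \<and> 0 \<le> gap a b i j R \<or> gap a b i j R \<le> 0 \<and> 0 \<le> gap a b i j L"
    using LR(2) by (auto simp: mult_le_0_iff)
  ultimately obtain x where "L \<le> x" "x \<le> R" "gap a b i j x = 0"
    using IVT' [of "gap a b i j" L 0 R] IVT2' [of "gap a b i j" R 0 L] LR(1) by blast
  then show "\<exists>x. l i \<le> x \<and> x \<le> r i \<and> l j \<le> x \<and> x \<le> r j \<and> a i * x + b i = a j * x + b j"
    unfolding L_def R_def gap_def by (intro exI [of _ x]) (auto simp: algebra_simps)
next
  assume "\<exists>x. l i \<le> x \<and> x \<le> r i \<and> l j \<le> x \<and> x \<le> r j \<and> a i * x + b i = a j * x + b j"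
  then obtain x where x: "l i \<le> x" "x \<le> r i" "l j \<le> x" "x \<le> r j" "a i * x + b i = a j * x + b j" by blast
  define L R where "L = max (l i) (l j)" and "R = min (r i) (r j)"
  have LR: "L \<le> x" "x \<le> R" using x by (auto simp: L_def R_def)
  have g: "gap a b i j y = (a i - a j) * (y - x)" for y using x(5) by (simp add: gap_def algebra_simps)
  have "gap a b i j L * gap a b i j R = (a i - a j)\<^sup>2 * ((L - x) * (R - x))" by (simp add: g power2_eq_square)
  also have "\<dots> \<le> 0" using LR by (intro mult_nonneg_nonpos mult_nonpos_nonneg) auto
  finally show "meets a b l r i j" using LR by (simp add: meets_def L_def R_def)
qed

text \<open>Segment \<open>i\<close> is extended by \<open>\<eta>\<close> on both sides and turned about its old right end by a slope that
  decreases rapidly along the order of the right ends, so that overlapping collinear segments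
  cross near the smaller of their right ends.\<close>

lemma eventually_pair:
  fixes P :: "nat \<Rightarrow> nat \<Rightarrow> real \<Rightarrow> bool"
  assumes "finite V" "\<And>i j. i \<in> V \<Longrightarrow> j \<in> V \<Longrightarrow> i \<noteq> j \<Longrightarrow> eventually (P i j) F"
  shows "eventually (\<lambda>t. \<forall>i\<in>V. \<forall>j\<in>V. i \<noteq> j \<longrightarrow> P i j t) F"
  using assms by (auto intro!: eventually_ball_finite simp: eventually_conj_iff)

lemma perturb:
  fixes a b l r :: "nat \<Rightarrow> real"
  assumes V: "finite V" and lr: "\<And>i. i \<in> V \<Longrightarrow> l i < r i" and \<delta>: "\<delta> > 0"
  obtains a' b' l' r' where "\<And>i. i \<in> V \<Longrightarrow> \<bar>a' i - a i\<bar> < \<delta> \<and> \<bar>b' i - b i\<bar> < \<delta> \<and> \<bar>l' i - l i\<bar> < \<delta> \<and> \<bar>r' i - r i\<bar> < \<delta>"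
    "\<And>i. i \<in> V \<Longrightarrow> l' i < r' i"
    "\<And>i j. i \<in> V \<Longrightarrow> j \<in> V \<Longrightarrow> i \<noteq> j \<Longrightarrow> meets a b l r i j \<Longrightarrow> crosses a' b' l' r' i j"
    "\<And>i j. i \<in> V \<Longrightarrow> j \<in> V \<Longrightarrow> i \<noteq> j \<Longrightarrow> \<not> meets a b l r i j \<Longrightarrow> \<not> meets a' b' l' r' i j"
proof -
  define l1 where "l1 \<eta> i = l i - \<eta>" for \<eta> i
  define r1 where "r1 \<eta> i = r i + \<eta>" for \<eta> i
  have lim1: "((\<lambda>\<eta>. max (l1 \<eta> i) (l1 \<eta> j)) \<longlongrightarrow> max (l i) (l j)) (at_right 0)"
     "((\<lambda>\<eta>. min (r1 \<eta> i) (r1 \<eta> j)) \<longlongrightarrow> min (r i) (r j)) (at_right 0)" for i j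
    unfolding l1_def r1_def by (auto intro!: tendsto_eq_intros)
  have "eventually (\<lambda>\<eta>. \<forall>i\<in>V. \<forall>j\<in>V. i \<noteq> j \<longrightarrow> \<not> meets a b l r i j \<longrightarrow> \<not> meets a b (l1 \<eta>) (r1 \<eta>) i j) (at_right 0)"
  proof (rule eventually_pair [OF V])
    fix i j assume "i \<in> V" "j \<in> V" "i \<noteq> j"
    show "eventually (\<lambda>\<eta>. \<not> meets a b l r i j \<longrightarrow> \<not> meets a b (l1 \<eta>) (r1 \<eta>) i j) (at_right 0)"
    proof (cases "meets a b l r i j")
      case False
      then consider "min (r i) (r j) < max (l i) (l j)"
        | "0 < gap a b i j (max (l i) (l j)) * gap a b i j (min (r i) (r j))" by (force simp: meets_def)
      then show ?thesis
      proof cases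
        case 1
        then have "eventually (\<lambda>\<eta>. 0 < max (l1 \<eta> i) (l1 \<eta> j) - min (r1 \<eta> i) (r1 \<eta> j)) (at_right 0)"
          by (intro order_tendstoD(1) [OF tendsto_diff [OF lim1]]) simp
        then show ?thesis by eventually_elim (auto simp: meets_def)
      next
        case 2
        have "((\<lambda>\<eta>. gap a b i j (max (l1 \<eta> i) (l1 \<eta> j)) * gap a b i j (min (r1 \<eta> i) (r1 \<eta> j))) \<longlongrightarrow>
          gap a b i j (max (l i) (l j)) * gap a b i j (min (r i) (r j))) (at_right 0)"
          unfolding gap_def by (intro tendsto_intros lim1)
        then have "eventually (\<lambda>\<eta>. 0 < gap a b i j (max (l1 \<eta> i) (l1 \<eta> j)) * gap a b i j (min (r1 \<eta> i) (r1 \<eta> j))) (at_right 0)"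
          by (rule order_tendstoD(1) [OF _ 2])
        then show ?thesis by eventually_elim (auto simp: meets_def)
      qed
    qed simp
  qed
  moreover have "eventually (\<lambda>\<eta>::real. \<eta> < \<delta>) (at_right 0)" using \<delta> eventually_at_right by blast
  moreover have "eventually (\<lambda>\<eta>::real. \<eta> > 0) (at_right 0)" by (rule eventually_at_right_less)
  ultimately have "eventually (\<lambda>\<eta>. (\<forall>i\<in>V. \<forall>j\<in>V. i \<noteq> j \<longrightarrow> \<not> meets a b l r i j \<longrightarrow> \<not> meets a b (l1 \<eta>) (r1 \<eta>) i j) \<and> \<eta> < \<delta> \<and> \<eta> > 0) (at_right 0)"
    by eventually_elim auto
  from eventually_happens' [OF trivial_limit_at_right_real this]
  obtain \<eta> where "(\<forall>i\<in>V. \<forall>j\<in>V. i \<noteq> j \<longrightarrow> \<not> meets a b l r i j \<longrightarrow> \<not> meets a b (l1 \<eta>) (r1 \<eta>) i j) \<and> \<eta> < \<delta> \<and> \<eta> > 0" ..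
  then have \<eta>: "\<eta> > 0" "\<eta> < \<delta>"
    "\<And>i j. i \<in> V \<Longrightarrow> j \<in> V \<Longrightarrow> i \<noteq> j \<Longrightarrow> \<not> meets a b l r i j \<Longrightarrow> \<not> meets a b (l1 \<eta>) (r1 \<eta>) i j"
    by simp_all
  \<comment> \<open>\<open>m\<close> bounds the differences of right ends, and
    \<open>\<rho> * (m + \<eta>) = \<eta> / 2\<close>. In \<open>turned\<close> this keeps the
    offset caused by the smaller turn below the relative turn over the length
    \<open>\<eta>\<close>.\<close>
  define m where "m = 1 + (\<Sum>i\<in>V. \<bar>r i\<bar>) * 2"
  have m: "m \<ge> 1" "\<And>i j. i \<in> V \<Longrightarrow> j \<in> V \<Longrightarrow> r j - r i \<le> m"
  proof -
    show "m \<ge> 1" by (simp add: m_def sum_nonneg)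
    fix i j assume "i \<in> V" "j \<in> V"
    then have "\<bar>r i\<bar> \<le> (\<Sum>i\<in>V. \<bar>r i\<bar>)" "\<bar>r j\<bar> \<le> (\<Sum>i\<in>V. \<bar>r i\<bar>)" using V by (auto intro!: member_le_sum)
    then show "r j - r i \<le> m" by (simp add: m_def)
  qed
  define \<rho> where "\<rho> = \<eta> / (2 * (m + \<eta>))"
  have \<rho>: "0 < \<rho>" "\<rho> < 1" "\<rho> * m < (1 - \<rho>) * \<eta>"
    using \<eta> m(1) by (auto simp: \<rho>_def divide_simps)
  \<comment> \<open>Ties of right ends are broken by the index, so that any two distinct segments
    are comparable.\<close>
  define before where "before j i \<longleftrightarrow> r j < r i \<or> r j = r i \<and> j < i" for i j
  define c where "c i = \<rho> ^ card {k\<in>V. before k i}" for i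
  have cpos: "c i > 0" for i using \<rho> by (simp add: c_def)
  have cc: "c j \<le> \<rho> * c i" if "i \<in> V" "j \<in> V" "before i j" for i j
  proof -
    have "{k\<in>V. before k i} \<subset> {k\<in>V. before k j}" using that by (auto simp: before_def)
    then have "card {k\<in>V. before k i} < card {k\<in>V. before k j}" using V by (intro psubset_card_mono) auto
    then have "\<rho> ^ card {k\<in>V. before k j} \<le> \<rho> ^ Suc (card {k\<in>V. before k i})" using \<rho> by (intro power_decreasing) auto
    then show ?thesis by (simp add: c_def)
  qed
  define a2 where "a2 \<kappa> i = a i + \<kappa> * c i" for \<kappa> i
  define b2 where "b2 \<kappa> i = b i - \<kappa> * c i * r i" for \<kappa> i
  have lim2: "((\<lambda>\<kappa>. gap (a2 \<kappa>) (b2 \<kappa>) i j x) \<longlongrightarrow> gap a b i j x) (at_right 0)" for i j x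
    unfolding gap_def a2_def b2_def by (auto intro!: tendsto_eq_intros)
  have turned: "crosses (a2 \<kappa>) (b2 \<kappa>) (l1 \<eta>) (r1 \<eta>) i j"
    if ij: "i \<in> V" "j \<in> V" "before i j" "meets a b l r i j" "a i = a j" "\<kappa> > 0" for \<kappa> i j
  proof -
    let ?L = "max (l1 \<eta> i) (l1 \<eta> j)" and ?R = "min (r1 \<eta> i) (r1 \<eta> j)"
    \<comment> \<open>Parallel graphs that meet are collinear. Up to the factor
      \<open>\<kappa>\<close>, the new difference is \<open>(c i - c j) * (x - r i)\<close> plus a
      small nonnegative constant; it changes sign within \<open>\<eta>\<close> of
      \<open>r i\<close>.\<close>
    have "b i = b j" "max (l i) (l j) \<le> r i" using ij(4,5) by (auto simp: meets_def gap_def mult_le_0_iff)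
    then have g: "gap (a2 \<kappa>) (b2 \<kappa>) i j x = \<kappa> * ((c i - c j) * (x - r i) + c j * (r j - r i))" for x
      using ij(5) by (simp add: gap_def a2_def b2_def algebra_simps)
    have rij: "r i \<le> r j" using ij(3) by (auto simp: before_def)
    have R: "?R = r i + \<eta>" and L: "?L \<le> r i - \<eta>" using rij \<open>max (l i) (l j) \<le> r i\<close> by (auto simp: r1_def l1_def)
    have d: "c j \<le> \<rho> * c i" "c j < c i" using cc [OF ij(1-3)] \<rho> cpos [of i] by (auto intro: le_less_trans)
    have "c j * (r j - r i) \<le> (\<rho> * c i) * m" using d(1) m(2) [OF ij(1,2)] rij cpos [of i] \<rho> by (intro mult_mono) auto
    also have "\<dots> = c i * (\<rho> * m)" by simp
    also have "\<dots> < c i * ((1 - \<rho>) * \<eta>)" using \<rho>(3) cpos by simp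
    also have "\<dots> = (c i - \<rho> * c i) * \<eta>" by (simp add: algebra_simps)
    also have "\<dots> \<le> (c i - c j) * \<eta>" using d(1) \<eta>(1) by (intro mult_right_mono) auto
    finally have 1: "c j * (r j - r i) < (c i - c j) * \<eta>" .
    have "(c i - c j) * (?L - r i) \<le> (c i - c j) * (- \<eta>)" using L d(2) by (intro mult_left_mono) auto
    then have "(c i - c j) * (?L - r i) + c j * (r j - r i) < 0" using 1 by linarith
    then have gL: "gap (a2 \<kappa>) (b2 \<kappa>) i j ?L < 0" unfolding g using ij(6) by (simp add: mult_pos_neg)
    have "0 \<le> c j * (r j - r i)" using cpos [of j] rij by simp
    then have "0 < (c i - c j) * (?R - r i) + c j * (r j - r i)" unfolding R using d(2) \<eta>(1) by (simp add: add_pos_nonneg)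
    then have gR: "gap (a2 \<kappa>) (b2 \<kappa>) i j ?R > 0" unfolding g using ij(6) by simp
    show ?thesis unfolding crosses_def using gL gR L R \<eta>(1) by (auto intro: mult_neg_pos)
  qed
  have ext: "crosses a b (l1 \<eta>) (r1 \<eta>) i j" if "meets a b l r i j" "a i \<noteq> a j" for i j
  proof -
    define L R where "L = max (l i) (l j)" and "R = min (r i) (r j)"
    have LR: "max (l1 \<eta> i) (l1 \<eta> j) = L - \<eta>" "min (r1 \<eta> i) (r1 \<eta> j) = R + \<eta>"
      by (auto simp: L_def R_def l1_def r1_def)
    have m: "L \<le> R" "gap a b i j L * gap a b i j R \<le> 0" using that(1) by (auto simp: meets_def L_def R_def)
    define s where "s = a i - a j"
    have g: "gap a b i j (L - \<eta>) = gap a b i j L - s * \<eta>" "gap a b i j (R + \<eta>) = gap a b i j L + s * (R - L) + s * \<eta>"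
      "gap a b i j R = gap a b i j L + s * (R - L)"
      by (auto simp: gap_def s_def algebra_simps)
    \<comment> \<open>The extension lowers the product of the two end values by a positive amount,
      so a mere touching becomes a proper crossing.\<close>
    have "(gap a b i j L - s * \<eta>) * (gap a b i j L + s * (R - L) + s * \<eta>)
      = gap a b i j L * gap a b i j R - s\<^sup>2 * (\<eta> * (R - L) + \<eta>\<^sup>2)" unfolding g(3) by (simp add: power2_eq_square algebra_simps)
    moreover have "s\<^sup>2 * (\<eta> * (R - L) + \<eta>\<^sup>2) > 0" using that(2) \<eta>(1) m(1) by (auto simp: s_def intro!: mult_pos_pos add_nonneg_pos)
    ultimately show ?thesis unfolding crosses_def LR g(1,2) using m \<eta>(1) by auto
  qed
  have "eventually (\<lambda>\<kappa>. \<forall>i\<in>V. \<forall>j\<in>V. i \<noteq> j \<longrightarrow>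
      (meets a b l r i j \<longrightarrow> crosses (a2 \<kappa>) (b2 \<kappa>) (l1 \<eta>) (r1 \<eta>) i j) \<and>
      (\<not> meets a b l r i j \<longrightarrow> \<not> meets (a2 \<kappa>) (b2 \<kappa>) (l1 \<eta>) (r1 \<eta>) i j)) (at_right 0)"
  proof (rule eventually_pair [OF V])
    fix i j assume ij: "i \<in> V" "j \<in> V" "i \<noteq> j"
    let ?L = "max (l1 \<eta> i) (l1 \<eta> j)" and ?R = "min (r1 \<eta> i) (r1 \<eta> j)"
    let ?p = "\<lambda>\<kappa>. gap (a2 \<kappa>) (b2 \<kappa>) i j ?L * gap (a2 \<kappa>) (b2 \<kappa>) i j ?R"
    have lim: "(?p \<longlongrightarrow> gap a b i j ?L * gap a b i j ?R) (at_right 0)" by (intro tendsto_intros lim2)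
    consider "\<not> meets a b l r i j" | "meets a b l r i j" "a i \<noteq> a j" | "meets a b l r i j" "a i = a j" by blast
    then show "eventually (\<lambda>\<kappa>. (meets a b l r i j \<longrightarrow> crosses (a2 \<kappa>) (b2 \<kappa>) (l1 \<eta>) (r1 \<eta>) i j) \<and>
      (\<not> meets a b l r i j \<longrightarrow> \<not> meets (a2 \<kappa>) (b2 \<kappa>) (l1 \<eta>) (r1 \<eta>) i j)) (at_right 0)"
    proof cases
      case 1
      show ?thesis
      proof (cases "?L \<le> ?R")
        case True
        then have "0 < gap a b i j ?L * gap a b i j ?R" using \<eta>(3) [OF ij 1] by (force simp: meets_def)
        then have "eventually (\<lambda>\<kappa>. 0 < ?p \<kappa>) (at_right 0)" by (rule order_tendstoD(1) [OF lim])
        then show ?thesis by eventually_elim (use 1 in \<open>auto simp: meets_def\<close>)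
      qed (use 1 in \<open>auto simp: meets_def\<close>)
    next
      case 2
      have "gap a b i j ?L * gap a b i j ?R < 0" "?L < ?R" using ext [OF 2] by (auto simp: crosses_def)
      then have "eventually (\<lambda>\<kappa>. ?p \<kappa> < 0) (at_right 0)" by (intro order_tendstoD(2) [OF lim])
      then show ?thesis by eventually_elim (use 2 \<open>?L < ?R\<close> in \<open>auto simp: crosses_def\<close>)
    next
      case 3
      have "before i j \<or> before j i" using ij(3) by (auto simp: before_def)
      then have "crosses (a2 \<kappa>) (b2 \<kappa>) (l1 \<eta>) (r1 \<eta>) i j" if "\<kappa> > 0" for \<kappa>
        using turned [of i j \<kappa>] turned [of j i \<kappa>] ij 3 that by (auto simp: meets_swap crosses_swap)
      then show ?thesis using 3 eventually_at_right_less [of 0] by (auto elim: eventually_mono)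
    qed
  qed
  moreover have "eventually (\<lambda>\<kappa>. \<forall>i\<in>V. \<bar>a2 \<kappa> i - a i\<bar> < \<delta> \<and> \<bar>b2 \<kappa> i - b i\<bar> < \<delta>) (at_right 0)"
  proof (intro eventually_ball_finite V ballI eventually_conj)
    fix i
    have "((\<lambda>\<kappa>. \<bar>a2 \<kappa> i - a i\<bar>) \<longlongrightarrow> 0) (at_right 0)" "((\<lambda>\<kappa>. \<bar>b2 \<kappa> i - b i\<bar>) \<longlongrightarrow> 0) (at_right 0)"
      unfolding a2_def b2_def by (auto intro!: tendsto_eq_intros)
    then show "eventually (\<lambda>\<kappa>. \<bar>a2 \<kappa> i - a i\<bar> < \<delta>) (at_right 0)" "eventually (\<lambda>\<kappa>. \<bar>b2 \<kappa> i - b i\<bar> < \<delta>) (at_right 0)"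
      using \<delta> by (auto intro: order_tendstoD(2))
  qed
  ultimately have "eventually (\<lambda>\<kappa>. (\<forall>i\<in>V. \<forall>j\<in>V. i \<noteq> j \<longrightarrow>
      (meets a b l r i j \<longrightarrow> crosses (a2 \<kappa>) (b2 \<kappa>) (l1 \<eta>) (r1 \<eta>) i j) \<and>
      (\<not> meets a b l r i j \<longrightarrow> \<not> meets (a2 \<kappa>) (b2 \<kappa>) (l1 \<eta>) (r1 \<eta>) i j)) \<and>
      (\<forall>i\<in>V. \<bar>a2 \<kappa> i - a i\<bar> < \<delta> \<and> \<bar>b2 \<kappa> i - b i\<bar> < \<delta>)) (at_right 0)"
    by eventually_elim auto
  from eventually_happens' [OF trivial_limit_at_right_real this]
  obtain \<kappa> where \<kappa>: "(\<forall>i\<in>V. \<forall>j\<in>V. i \<noteq> j \<longrightarrow>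
      (meets a b l r i j \<longrightarrow> crosses (a2 \<kappa>) (b2 \<kappa>) (l1 \<eta>) (r1 \<eta>) i j) \<and>
      (\<not> meets a b l r i j \<longrightarrow> \<not> meets (a2 \<kappa>) (b2 \<kappa>) (l1 \<eta>) (r1 \<eta>) i j)) \<and>
      (\<forall>i\<in>V. \<bar>a2 \<kappa> i - a i\<bar> < \<delta> \<and> \<bar>b2 \<kappa> i - b i\<bar> < \<delta>)" ..
  show ?thesis
  proof (rule that [of "a2 \<kappa>" "b2 \<kappa>" "l1 \<eta>" "r1 \<eta>"])
    fix i assume "i \<in> V"
    then show "\<bar>a2 \<kappa> i - a i\<bar> < \<delta> \<and> \<bar>b2 \<kappa> i - b i\<bar> < \<delta> \<and> \<bar>l1 \<eta> i - l i\<bar> < \<delta> \<and> \<bar>r1 \<eta> i - r i\<bar> < \<delta>"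
      using \<kappa> \<eta>(1,2) by (simp add: l1_def r1_def)
    show "l1 \<eta> i < r1 \<eta> i" using lr [OF \<open>i \<in> V\<close>] \<eta>(1) by (simp add: l1_def r1_def)
  qed (use \<kappa> in auto)
qed

section \<open>Representations indexed by the vertices, and segments as graphs of affine
  functions\<close>

lemma intersection_graph_cong:
  assumes "\<And>u v. u \<in> V \<Longrightarrow> v \<in> V \<Longrightarrow> u \<noteq> v \<Longrightarrow> (A u \<inter> A v \<noteq> {}) = (B u \<inter> B v \<noteq> {})"
  shows "intersection_graph V A = intersection_graph V B"
proof -
  have "(u \<in> V \<and> v \<in> V \<and> u \<noteq> v \<and> A u \<inter> A v \<noteq> {}) = (u \<in> V \<and> v \<in> V \<and> u \<noteq> v \<and> B u \<inter> B v \<noteq> {})" for u v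
    using assms [of u v] by blast
  then show ?thesis unfolding intersection_graph_def by (simp only:)
qed

lemma intersection_graph_eqD:
  assumes "intersection_graph V A = intersection_graph V B" "u \<in> V" "v \<in> V" "u \<noteq> v"
  shows "(A u \<inter> A v \<noteq> {}) = (B u \<inter> B v \<noteq> {})"
proof -
  have *: "(A u \<inter> A v \<noteq> {}) = ({u, v} \<in> edges (intersection_graph V A))" if "u \<in> V" "v \<in> V" "u \<noteq> v" for A u v
    using that by (auto simp: intersection_graph_def doubleton_eq_iff Int_commute)
  show ?thesis unfolding * [OF assms(2-)] assms(1) by simp
qed

lemma verts_intersection_graph [simp]: "verts (intersection_graph V A) = V"
  by (simp add: intersection_graph_def)

text \<open>The definition only provides an isomorphic intersection graph on some index set
  \<open>W\<close>. Transporting the segments along the inverse isomorphism makes \<open>G\<close>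
  itself the intersection graph of segments indexed by its own vertices.\<close>

lemma SEG_realization:
  assumes "G \<in> SEG n"
  obtains p q where "finite (verts G)" "card (verts G) = n" "\<And>v. v \<in> verts G \<Longrightarrow> p v \<noteq> (q v :: real \<times> real)"
    "G = intersection_graph (verts G) (\<lambda>v. closed_segment (p v) (q v))"
proof -
  obtain W :: "nat set" and A where W: "finite (verts G)" "card (verts G) = n" "finite W" "\<And>w. w \<in> W \<Longrightarrow> is_line_segment (A w)"
    "isomorphic (intersection_graph W A) G"
    using assms unfolding SEG_def segment_graph_def simple_graph_def by blast
  then obtain f where f: "bij_betw f W (verts G)" "edges G = (\<lambda>e. f ` e) ` edges (intersection_graph W A)"
    unfolding isomorphic_def by auto
  define g where "g = inv_into W f"
  have g: "g v \<in> W" "f (g v) = v" if "v \<in> verts G" for v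
    using f(1) that by (auto simp: g_def bij_betw_def f_inv_into_f inv_into_into)
  have gf: "g (f w) = w" if "w \<in> W" for w using f(1) that by (auto simp: g_def bij_betw_def)
  have "\<forall>v. \<exists>a b. v \<in> verts G \<longrightarrow> a \<noteq> b \<and> A (g v) = closed_segment a b" using W(4) g(1) unfolding is_line_segment_def by blast
  then obtain p q where pq: "\<And>v. v \<in> verts G \<Longrightarrow> p v \<noteq> q v \<and> A (g v) = closed_segment (p v) (q v)" by metis
  have "edges G = {{u, v} |u v. u \<in> verts G \<and> v \<in> verts G \<and> u \<noteq> v \<and> A (g u) \<inter> A (g v) \<noteq> {}}" (is "_ = ?R")
  proof
    show "edges G \<subseteq> ?R"
    proof
      fix e assume "e \<in> edges G"
      then obtain u v where uv: "u \<in> W" "v \<in> W" "u \<noteq> v" "A u \<inter> A v \<noteq> {}" "e = {f u, f v}"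
        unfolding f(2) by (auto simp: intersection_graph_def)
      moreover from uv have "f u \<in> verts G" "f v \<in> verts G" "f u \<noteq> f v" using f(1) by (auto simp: bij_betw_def inj_on_eq_iff)
      moreover from uv gf have "A (g (f u)) \<inter> A (g (f v)) \<noteq> {}" by simp
      ultimately show "e \<in> ?R" unfolding mem_Collect_eq by (intro exI [of _ "f u"] exI [of _ "f v"]) simp
    qed
    show "?R \<subseteq> edges G"
    proof
      fix e assume "e \<in> ?R"
      then obtain u v where uv: "u \<in> verts G" "v \<in> verts G" "u \<noteq> v" "A (g u) \<inter> A (g v) \<noteq> {}" "e = {u, v}" by auto
      then have gg: "g u \<in> W" "g v \<in> W" "g u \<noteq> g v" using g [of u] g [of v] by auto
      have "{g u, g v} \<in> {{u, v} |u v. u \<in> W \<and> v \<in> W \<and> u \<noteq> v \<and> A u \<inter> A v \<noteq> {}}"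
        unfolding mem_Collect_eq by (intro exI [of _ "g u"] exI [of _ "g v"]) (use gg uv in simp)
      then have "{g u, g v} \<in> edges (intersection_graph W A)" by (simp add: intersection_graph_def)
      moreover have "f ` {g u, g v} = e" using uv g by auto
      ultimately show "e \<in> edges G" unfolding f(2) by blast
    qed
  qed
  then have "G = intersection_graph (verts G) (\<lambda>v. A (g v))" by (simp add: intersection_graph_def)
  also have "\<dots> = intersection_graph (verts G) (\<lambda>v. closed_segment (p v) (q v))" using pq by (intro intersection_graph_cong) auto
  finally show ?thesis using that W(1,2) pq by blast
qed

definition shear :: "real \<Rightarrow> real \<times> real \<Rightarrow> real \<times> real" where "shear c p = (fst p + c * snd p, snd p)"

lemma linear_shear: "linear (shear c)"
  by (rule linearI) (auto simp: shear_def algebra_simps prod_eq_iff)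

lemma inj_shear: "inj (shear c)" by (rule injI) (auto simp: shear_def prod_eq_iff)

definition graph_seg :: "real \<Rightarrow> real \<Rightarrow> real \<Rightarrow> real \<Rightarrow> (real \<times> real) set" where
  "graph_seg a b l r = {(x, a * x + b) |x. l \<le> x \<and> x \<le> r}"

lemma graph_seg_closed_segment:
  assumes "l \<le> r" shows "graph_seg a b l r = closed_segment (l, a * l + b) (r, a * r + b)"
proof
  show "graph_seg a b l r \<subseteq> closed_segment (l, a * l + b) (r, a * r + b)"
  proof
    fix z assume "z \<in> graph_seg a b l r"
    then obtain x where x: "z = (x, a * x + b)" "l \<le> x" "x \<le> r" by (auto simp: graph_seg_def)
    show "z \<in> closed_segment (l, a * l + b) (r, a * r + b)"
    proof (cases "l = r")
      case True
      then show ?thesis using x by auto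
    next
      case False
      define u where "u = (x - l) / (r - l)"
      have "u * (r - l) = x - l" using False by (simp add: u_def)
      then have "x = (1 - u) * l + u * r" by (simp add: algebra_simps)
      moreover have "a * ((1 - u) * l + u * r) + b = (1 - u) * (a * l + b) + u * (a * r + b)" by (simp add: algebra_simps)
      moreover have "0 \<le> u" "u \<le> 1" using x assms False by (auto simp: u_def divide_simps)
      ultimately show ?thesis unfolding in_segment x(1) by (intro exI [of _ u]) auto
    qed
  qed
  show "closed_segment (l, a * l + b) (r, a * r + b) \<subseteq> graph_seg a b l r"
  proof
    fix z assume "z \<in> closed_segment (l, a * l + b) (r, a * r + b)"
    then obtain u where u: "0 \<le> u" "u \<le> 1" "z = (1 - u) *\<^sub>R (l, a * l + b) + u *\<^sub>R (r, a * r + b)" by (auto simp: in_segment)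
    have "l \<le> (1 - u) * l + u * r" "(1 - u) * l + u * r \<le> r"
      using assms u(1,2) mult_left_mono [of l r u] mult_left_mono [of l r "1 - u"] by (auto simp: algebra_simps)
    moreover have "z = ((1 - u) * l + u * r, a * ((1 - u) * l + u * r) + b)" unfolding u(3) by (simp add: algebra_simps)
    ultimately show "z \<in> graph_seg a b l r" unfolding graph_seg_def by blast
  qed
qed

lemma graph_seg_meets: "(graph_seg (a i) (b i) (l i) (r i) \<inter> graph_seg (a j) (b j) (l j) (r j) \<noteq> {}) = meets a b l r i j"
  unfolding meets_iff_ex by (auto simp: graph_seg_def)

lemma nonvertical_is_graph:
  fixes p q :: "real \<times> real"
  assumes "fst p \<noteq> fst q"
  shows "\<exists>a b l r. l < r \<and> closed_segment p q = graph_seg a b l r"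
proof -
  have *: "\<exists>a b l r. l < r \<and> closed_segment p q = graph_seg a b l r" if "fst p < fst q" for p q :: "real \<times> real"
  proof -
    define a where "a = (snd q - snd p) / (fst q - fst p)"
    define b where "b = snd p - a * fst p"
    have "p = (fst p, a * fst p + b)" by (simp add: b_def)
    moreover have "a * (fst q - fst p) = snd q - snd p" using that by (simp add: a_def)
    then have "q = (fst q, a * fst q + b)" by (simp add: b_def prod_eq_iff algebra_simps)
    ultimately have "closed_segment p q = graph_seg a b (fst p) (fst q)"
      using graph_seg_closed_segment [of "fst p" "fst q" a b] that by simp
    then show ?thesis using that by blast
  qed
  show ?thesis
  proof (cases "fst p < fst q")
    case False
    then have "fst q < fst p" using assms by simp
    then show ?thesis using * [of q p] by (simp add: closed_segment_commute)
  qed (rule *)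
qed

text \<open>Each segment becomes vertical for at most one \<open>c\<close>, so all but finitely many
  shears work. The bound \<open>\<delta>\<close> on \<open>c\<close> serves the lower bound, where
  distances must be almost preserved.\<close>

lemma sheared_graphs:
  fixes p q :: "nat \<Rightarrow> real \<times> real"
  assumes V: "finite V" and pq: "\<And>v. v \<in> V \<Longrightarrow> p v \<noteq> q v" and \<delta>: "\<delta> > 0"
  obtains c a b l r where "0 < c" "c < \<delta>" "\<And>v. v \<in> V \<Longrightarrow> l v < r v"
    "\<And>v. v \<in> V \<Longrightarrow> shear c ` closed_segment (p v) (q v) = graph_seg (a v) (b v) (l v) (r v)"
proof -
  define bad where "bad = (\<lambda>v. - (fst (p v) - fst (q v)) / (snd (p v) - snd (q v))) ` V"
  have "infinite {0<..<\<delta>}" using \<delta> by (simp add: infinite_Ioo)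
  then obtain c where c: "c \<in> {0<..<\<delta>}" "c \<notin> bad"
    using V unfolding bad_def by (meson finite_imageI infinite_super subsetI)
  have nv: "fst (shear c (p v)) \<noteq> fst (shear c (q v))" if "v \<in> V" for v
  proof
    assume "fst (shear c (p v)) = fst (shear c (q v))"
    then have e: "c * (snd (p v) - snd (q v)) = - (fst (p v) - fst (q v))" by (simp add: shear_def algebra_simps)
    show False
    proof (cases "snd (p v) = snd (q v)")
      case True
      then show ?thesis using e pq [OF that] by (simp add: prod_eq_iff)
    next
      case False
      then have "c = - (fst (p v) - fst (q v)) / (snd (p v) - snd (q v))" using e by (simp add: field_simps)
      then show ?thesis using c(2) that by (auto simp: bad_def)
    qed
  qed
  have im: "shear c ` closed_segment (p v) (q v) = closed_segment (shear c (p v)) (shear c (q v))" for v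
    by (rule closed_segment_linear_image [OF linear_shear, symmetric])
  have "\<forall>v. \<exists>a b l r. v \<in> V \<longrightarrow> l < r \<and> shear c ` closed_segment (p v) (q v) = graph_seg a b l r"
    unfolding im using nonvertical_is_graph nv by blast
  then obtain a b l r where "\<And>v. v \<in> V \<Longrightarrow> l v < r v \<and> shear c ` closed_segment (p v) (q v) = graph_seg (a v) (b v) (l v) (r v)" by metis
  then show ?thesis using c by (intro that [where c = c and a = a and b = b and l = l and r = r]) auto
qed

lemma shear_image_meets: "(shear c ` S \<inter> shear c ` T \<noteq> {}) = (S \<inter> T \<noteq> {})"
  by (simp flip: image_Int [OF inj_shear])

section \<open>Positivity gaps for integer quadratics\<close>

text \<open>Homogeneous integer forms of degree \<open>d\<close> in the variables \<open>x 0, \<dots>, x (m - 1)\<close> whose coefficients have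
  absolute sum at most \<open>H\<close>; monomials are multisets of variables.\<close>

definition int_form :: "nat \<Rightarrow> nat \<Rightarrow> int \<Rightarrow> ((nat \<Rightarrow> real) \<Rightarrow> real) \<Rightarrow> bool" where
  "int_form m d H F \<longleftrightarrow> (\<exists>c :: nat multiset \<Rightarrow> int. (\<Sum>\<alpha>\<in>multisets_of_size {..<m} d. \<bar>c \<alpha>\<bar>) \<le> H \<and>
     (\<forall>x. F x = (\<Sum>\<alpha>\<in>multisets_of_size {..<m} d. of_int (c \<alpha>) * (\<Prod>i\<in>#\<alpha>. x i))))"

section \<open>Arithmetic of integer forms\<close>

lemma fin_ms [simp]: "finite (multisets_of_size {..<m::nat} d)" by (intro finite_multisets_of_size) simp

lemma int_form_mono: "int_form m d H F \<Longrightarrow> H \<le> H' \<Longrightarrow> int_form m d H' F"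
  unfolding int_form_def by (meson order_trans)

lemma int_form_var: "i < m \<Longrightarrow> int_form m 1 1 (\<lambda>x. x i)"
proof -
  assume i: "i < m"
  have mem: "{#i#} \<in> multisets_of_size {..<m} 1" using i by (auto simp: multisets_of_size_def)
  let ?c = "\<lambda>\<alpha>. if \<alpha> = {#i#} then 1 else 0 :: int"
  have "(\<Sum>\<alpha>\<in>multisets_of_size {..<m} 1. \<bar>?c \<alpha>\<bar>) = (\<Sum>\<alpha>\<in>{{#i#}}. 1)"
    using mem by (intro sum.mono_neutral_cong_right) auto
  moreover have "(\<Sum>\<alpha>\<in>multisets_of_size {..<m} 1. of_int (?c \<alpha>) * (\<Prod>i\<in>#\<alpha>. x i)) = (\<Sum>\<alpha>\<in>{{#i#}}. x i)" for x :: "nat \<Rightarrow> real"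
    using mem by (intro sum.mono_neutral_cong_right) auto
  ultimately show ?thesis unfolding int_form_def by (intro exI [of _ ?c]) auto
qed

lemma int_form_zero: "int_form m d 0 (\<lambda>x. 0)"
  unfolding int_form_def by (intro exI [of _ "\<lambda>_. 0"]) auto

lemma int_form_add:
  assumes "int_form m d H F" "int_form m d H' G" shows "int_form m d (H + H') (\<lambda>x. F x + G x)"
proof -
  obtain c c' where c: "(\<Sum>\<alpha>\<in>multisets_of_size {..<m} d. \<bar>c \<alpha>\<bar>) \<le> H" "(\<Sum>\<alpha>\<in>multisets_of_size {..<m} d. \<bar>c' \<alpha>\<bar>) \<le> H'"
    "\<And>x. F x = (\<Sum>\<alpha>\<in>multisets_of_size {..<m} d. of_int (c \<alpha>) * (\<Prod>i\<in>#\<alpha>. x i))"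
    "\<And>x. G x = (\<Sum>\<alpha>\<in>multisets_of_size {..<m} d. of_int (c' \<alpha>) * (\<Prod>i\<in>#\<alpha>. x i))"
    using assms unfolding int_form_def by blast
  have "(\<Sum>\<alpha>\<in>multisets_of_size {..<m} d. \<bar>c \<alpha> + c' \<alpha>\<bar>) \<le> (\<Sum>\<alpha>\<in>multisets_of_size {..<m} d. \<bar>c \<alpha>\<bar> + \<bar>c' \<alpha>\<bar>)"
    by (intro sum_mono abs_triangle_ineq)
  then show ?thesis unfolding int_form_def using c
    by (intro exI [of _ "\<lambda>\<alpha>. c \<alpha> + c' \<alpha>"]) (simp add: sum.distrib algebra_simps)
qed

lemma int_form_scale:
  assumes "int_form m d H F" shows "int_form m d (\<bar>k\<bar> * H) (\<lambda>x. of_int k * F x)"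
proof -
  obtain c where c: "(\<Sum>\<alpha>\<in>multisets_of_size {..<m} d. \<bar>c \<alpha>\<bar>) \<le> H"
    "\<And>x. F x = (\<Sum>\<alpha>\<in>multisets_of_size {..<m} d. of_int (c \<alpha>) * (\<Prod>i\<in>#\<alpha>. x i))"
    using assms unfolding int_form_def by blast
  then show ?thesis unfolding int_form_def
    by (intro exI [of _ "\<lambda>\<alpha>. k * c \<alpha>"]) (auto simp: abs_mult sum_distrib_left mult.assoc intro!: mult_left_mono simp flip: sum_distrib_left)
qed

lemma int_form_diff:
  assumes "int_form m d H F" "int_form m d H' G" shows "int_form m d (H + H') (\<lambda>x. F x - G x)"
  using int_form_add [OF assms(1) int_form_scale [OF assms(2), of "-1"]] by simp

lemma int_form_sum:
  assumes "finite A" "\<And>i. i \<in> A \<Longrightarrow> int_form m d (H i) (F i)" shows "int_form m d (\<Sum>i\<in>A. H i) (\<lambda>x. \<Sum>i\<in>A. F i x)"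
  using assms by (induction A rule: finite_induct) (auto intro: int_form_add int_form_zero)

text \<open>Collecting the pairs of monomials with the same product can only lower the sum of
  absolute values by cancellation, so this norm is submultiplicative.\<close>

lemma int_form_mult:
  assumes "int_form m d H F" "int_form m e H' G" shows "int_form m (d + e) (H * H') (\<lambda>x. F x * G x)"
proof -
  let ?A = "multisets_of_size {..<m} d" and ?B = "multisets_of_size {..<m} e" and ?C = "multisets_of_size {..<m} (d + e)"
  obtain c c' where c: "(\<Sum>\<alpha>\<in>?A. \<bar>c \<alpha>\<bar>) \<le> H" "(\<Sum>\<alpha>\<in>?B. \<bar>c' \<alpha>\<bar>) \<le> H'"
    "\<And>x. F x = (\<Sum>\<alpha>\<in>?A. of_int (c \<alpha>) * (\<Prod>i\<in>#\<alpha>. x i))"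
    "\<And>x. G x = (\<Sum>\<alpha>\<in>?B. of_int (c' \<alpha>) * (\<Prod>i\<in>#\<alpha>. x i))"
    using assms unfolding int_form_def by blast
  define g where "g = (\<lambda>p :: nat multiset \<times> nat multiset. fst p + snd p)"
  have g: "g ` (?A \<times> ?B) \<subseteq> ?C" by (auto simp: g_def multisets_of_size_def)
  define C where "C \<gamma> = (\<Sum>p\<in>{p \<in> ?A \<times> ?B. g p = \<gamma>}. c (fst p) * c' (snd p))" for \<gamma>
  have grp: "(\<Sum>\<gamma>\<in>?C. \<Sum>p\<in>{p \<in> ?A \<times> ?B. g p = \<gamma>}. u p) = (\<Sum>p\<in>?A \<times> ?B. u p)" for u :: "_ \<Rightarrow> 'z::comm_monoid_add"
    by (rule sum.group [OF _ _ g]) auto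
  have "(\<Sum>\<gamma>\<in>?C. \<bar>C \<gamma>\<bar>) \<le> (\<Sum>\<gamma>\<in>?C. \<Sum>p\<in>{p \<in> ?A \<times> ?B. g p = \<gamma>}. \<bar>c (fst p) * c' (snd p)\<bar>)"
    unfolding C_def by (intro sum_mono sum_abs)
  also have "\<dots> = (\<Sum>p\<in>?A \<times> ?B. \<bar>c (fst p)\<bar> * \<bar>c' (snd p)\<bar>)" by (simp only: grp abs_mult)
  also have "\<dots> = (\<Sum>\<alpha>\<in>?A. \<bar>c \<alpha>\<bar>) * (\<Sum>\<alpha>\<in>?B. \<bar>c' \<alpha>\<bar>)" by (simp add: sum_product sum.cartesian_product case_prod_unfold)
  also have "\<dots> \<le> H * H'" using c(1,2) by (intro mult_mono order.trans [OF _ c(1)] sum_nonneg) auto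
  finally have "(\<Sum>\<gamma>\<in>?C. \<bar>C \<gamma>\<bar>) \<le> H * H'" .
  moreover have "F x * G x = (\<Sum>\<gamma>\<in>?C. of_int (C \<gamma>) * (\<Prod>i\<in>#\<gamma>. x i))" for x
  proof -
    have "(\<Sum>\<gamma>\<in>?C. of_int (C \<gamma>) * (\<Prod>i\<in>#\<gamma>. x i))
      = (\<Sum>\<gamma>\<in>?C. \<Sum>p\<in>{p \<in> ?A \<times> ?B. g p = \<gamma>}. of_int (c (fst p) * c' (snd p)) * (\<Prod>i\<in>#g p. x i))"
      unfolding C_def of_int_sum sum_distrib_right by (intro sum.cong) auto
    also have "\<dots> = (\<Sum>p\<in>?A \<times> ?B. of_int (c (fst p) * c' (snd p)) * (\<Prod>i\<in>#g p. x i))" by (rule grp)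
    also have "\<dots> = (\<Sum>p\<in>?A \<times> ?B. (of_int (c (fst p)) * (\<Prod>i\<in>#fst p. x i)) * (of_int (c' (snd p)) * (\<Prod>i\<in>#snd p. x i)))"
      by (intro sum.cong) (auto simp: g_def)
    also have "\<dots> = F x * G x" unfolding c(3,4) by (simp add: sum_product sum.cartesian_product case_prod_unfold)
    finally show ?thesis by simp
  qed
  ultimately show ?thesis unfolding int_form_def by blast
qed

lemma int_form_prod_mset:
  assumes "\<And>i. i \<in># \<alpha> \<Longrightarrow> int_form m d H (\<phi> i)"
  shows "int_form m (d * size \<alpha>) (H ^ size \<alpha>) (\<lambda>x. \<Prod>i\<in>#\<alpha>. \<phi> i x)"
  using assms
proof (induction \<alpha>)
  case empty
  have "multisets_of_size {..<m} 0 = {{#}}" by simp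
  then show ?case unfolding int_form_def by (intro exI [of _ "\<lambda>_. 1"]) simp
next
  case (add i \<alpha>)
  then show ?case using int_form_mult [of m d H "\<phi> i" "d * size \<alpha>" "H ^ size \<alpha>" "\<lambda>x. \<Prod>i\<in>#\<alpha>. \<phi> i x"] by auto
qed

text \<open>Siegel's lemma: there are more products of \<open>D\<close> of the forms than twice the number of
  monomials occurring in them, so two small integer combinations coincide.\<close>

lemma small_annihilator:
  assumes \<phi>: "\<And>i. i < m' \<Longrightarrow> int_form m d H (\<phi> i)" and H: "H \<ge> 1" and m: "m > 0"
    and NM: "2 * card (multisets_of_size {..<m} (d * D)) \<le> card (multisets_of_size {..<m'} D)"
  defines "N \<equiv> card (multisets_of_size {..<m'} D)"
  defines "T \<equiv> 2 * int N * H ^ D"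
  shows "\<exists>c :: nat multiset \<Rightarrow> int. (\<exists>\<alpha>\<in>multisets_of_size {..<m'} D. c \<alpha> \<noteq> 0) \<and> (\<forall>\<alpha>\<in>multisets_of_size {..<m'} D. \<bar>c \<alpha>\<bar> \<le> T) \<and>
    (\<forall>x. (\<Sum>\<alpha>\<in>multisets_of_size {..<m'} D. of_int (c \<alpha>) * (\<Prod>i\<in>#\<alpha>. \<phi> i x)) = 0)"
proof -
  let ?A = "multisets_of_size {..<m'} D" and ?G = "multisets_of_size {..<m} (d * D)"
  define M where "M = card ?G"
  have "int_form m (d * D) (H ^ D) (\<lambda>x. \<Prod>i\<in>#\<alpha>. \<phi> i x)" if "\<alpha> \<in> ?A" for \<alpha>
    using int_form_prod_mset [of \<alpha> m d H \<phi>] \<phi> that by (auto simp: multisets_of_size_def)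
  then have "\<forall>\<alpha>. \<exists>e. \<alpha> \<in> ?A \<longrightarrow> (\<Sum>\<gamma>\<in>?G. \<bar>e \<gamma>\<bar>) \<le> H ^ D \<and> (\<forall>x. (\<Prod>i\<in>#\<alpha>. \<phi> i x) = (\<Sum>\<gamma>\<in>?G. of_int (e \<gamma>) * (\<Prod>i\<in>#\<gamma>. x i)))"
    unfolding int_form_def by blast
  then obtain e where e: "\<And>\<alpha>. \<alpha> \<in> ?A \<Longrightarrow> (\<Sum>\<gamma>\<in>?G. \<bar>e \<alpha> \<gamma>\<bar>) \<le> H ^ D"
    "\<And>\<alpha> x. \<alpha> \<in> ?A \<Longrightarrow> (\<Prod>i\<in>#\<alpha>. \<phi> i x) = (\<Sum>\<gamma>\<in>?G. of_int (e \<alpha> \<gamma>) * (\<Prod>i\<in>#\<gamma>. x i))" by metis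
  have T0: "T \<ge> 0" using H by (simp add: T_def)
  define f where "f c = restrict (\<lambda>\<gamma>. \<Sum>\<alpha>\<in>?A. c \<alpha> * e \<alpha> \<gamma>) ?G" for c :: "nat multiset \<Rightarrow> int"
  define Dom where "Dom = ?A \<rightarrow>\<^sub>E {0..T}"
  \<comment> \<open>\<open>T\<close> is chosen so that \<open>2 * B = T * T\<close>. Then the box of
    possible values has \<open>(T * T + 1) ^ M < (T + 1) ^ (2 * M) \<le> (T + 1) ^ N\<close> points,
    fewer than the domain.\<close>
  define B where "B = int N * (T * H ^ D)"
  have B: "2 * B = T * T" by (simp add: B_def T_def algebra_simps)
  have Me: "multisets_of_size {..<m} (d * D) \<noteq> {}"
  proof -
    have "replicate_mset (d * D) 0 \<in> ?G" using m by (auto simp: multisets_of_size_def)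
    then show ?thesis by auto
  qed
  then have M1: "M > 0" by (simp add: M_def card_gt_0_iff)
  have f: "f ` Dom \<subseteq> ?G \<rightarrow>\<^sub>E {-B..B}"
  proof
    fix y assume "y \<in> f ` Dom"
    then obtain c where c: "c \<in> Dom" "y = f c" by auto
    have "\<bar>\<Sum>\<alpha>\<in>?A. c \<alpha> * e \<alpha> \<gamma>\<bar> \<le> B" if "\<gamma> \<in> ?G" for \<gamma>
    proof -
      have "\<bar>\<Sum>\<alpha>\<in>?A. c \<alpha> * e \<alpha> \<gamma>\<bar> \<le> (\<Sum>\<alpha>\<in>?A. \<bar>c \<alpha>\<bar> * \<bar>e \<alpha> \<gamma>\<bar>)" by (rule order.trans [OF sum_abs]) (simp add: abs_mult)
      also have "\<dots> \<le> (\<Sum>\<alpha>\<in>?A. T * H ^ D)"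
      proof (intro sum_mono mult_mono)
        fix \<alpha> assume a: "\<alpha> \<in> ?A"
        show "\<bar>c \<alpha>\<bar> \<le> T" using c(1) a by (auto simp: Dom_def PiE_def Pi_def)
        have "\<bar>e \<alpha> \<gamma>\<bar> \<le> (\<Sum>\<gamma>\<in>?G. \<bar>e \<alpha> \<gamma>\<bar>)" using that by (intro member_le_sum) auto
        then show "\<bar>e \<alpha> \<gamma>\<bar> \<le> H ^ D" using e(1) [OF a] by linarith
      qed (use T0 in auto)
      also have "\<dots> = B" by (simp add: B_def N_def)
      finally show ?thesis .
    qed
    then show "y \<in> ?G \<rightarrow>\<^sub>E {-B..B}" unfolding c(2) f_def by (auto simp: abs_le_iff) (smt (verit))
  qed
  have "\<not> inj_on f Dom"
  proof
    assume "inj_on f Dom"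
    then have "card Dom \<le> card (?G \<rightarrow>\<^sub>E {-B..B})" using f by (intro card_inj_on_le) (auto intro!: finite_PiE)
    then have "nat (T + 1) ^ N \<le> nat (2 * B + 1) ^ M" by (simp add: Dom_def card_PiE N_def M_def)
    moreover have "nat (2 * B + 1) ^ M < nat ((T + 1)\<^sup>2) ^ M"
    proof (intro power_strict_mono)
      have Tp: "0 < T" using H NM M1 by (auto simp: T_def N_def M_def)
      then have "0 < T * T + T * 2" by (simp add: add_pos_pos)
      then show "nat (2 * B + 1) < nat ((T + 1)\<^sup>2)" using Tp unfolding B by (simp add: power2_eq_square algebra_simps)
    qed (use M1 in auto)
    moreover have "nat ((T + 1)\<^sup>2) ^ M = nat (T + 1) ^ (2 * M)" using T0 by (simp add: nat_power_eq power_mult)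
    moreover have "nat (T + 1) ^ (2 * M) \<le> nat (T + 1) ^ N" using NM T0 by (intro power_increasing) (auto simp: N_def M_def)
    ultimately show False by linarith
  qed
  then obtain c c' where cc: "c \<in> Dom" "c' \<in> Dom" "f c = f c'" "c \<noteq> c'" by (auto simp: inj_on_def)
  define b where "b \<alpha> = c \<alpha> - c' \<alpha>" for \<alpha>
  have "\<exists>\<alpha>\<in>?A. b \<alpha> \<noteq> 0"
  proof (rule ccontr)
    assume "\<not> ?thesis"
    then have "c = c'" using cc(1,2) unfolding Dom_def by (intro PiE_ext) (auto simp: b_def)
    then show False using cc(4) by simp
  qed
  moreover have "\<bar>b \<alpha>\<bar> \<le> T" if "\<alpha> \<in> ?A" for \<alpha>
  proof -
    have "c \<alpha> \<in> {0..T}" "c' \<alpha> \<in> {0..T}" using cc that by (auto simp: Dom_def)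
    then show ?thesis by (auto simp: b_def)
  qed
  moreover have "(\<Sum>\<alpha>\<in>?A. of_int (b \<alpha>) * (\<Prod>i\<in>#\<alpha>. \<phi> i x)) = 0" for x
  proof -
    have z: "(\<Sum>\<alpha>\<in>?A. b \<alpha> * e \<alpha> \<gamma>) = 0" if "\<gamma> \<in> ?G" for \<gamma>
      using fun_cong [OF cc(3), of \<gamma>] that by (simp add: f_def b_def left_diff_distrib sum_subtractf)
    have "(\<Sum>\<alpha>\<in>?A. of_int (b \<alpha>) * (\<Prod>i\<in>#\<alpha>. \<phi> i x)) = (\<Sum>\<alpha>\<in>?A. \<Sum>\<gamma>\<in>?G. of_int (b \<alpha> * e \<alpha> \<gamma>) * (\<Prod>i\<in>#\<gamma>. x i))"
      by (intro sum.cong refl) (simp add: e(2) sum_distrib_left mult.assoc)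
    also have "\<dots> = (\<Sum>\<gamma>\<in>?G. of_int (\<Sum>\<alpha>\<in>?A. b \<alpha> * e \<alpha> \<gamma>) * (\<Prod>i\<in>#\<gamma>. x i))"
      by (subst sum.swap) (simp add: sum_distrib_right)
    also have "\<dots> = 0" using z by simp
    finally show ?thesis .
  qed
  ultimately show ?thesis by blast
qed

text \<open>Enough room for Siegel's lemma with \<open>K + 2\<close> forms in \<open>K + 1\<close> variables.\<close>

lemma monomial_count:
  assumes d: "d \<ge> 1" and D: "D = 2 * (K + 1) * d ^ K"
  shows "2 * card (multisets_of_size {..<K + 1} (d * D)) \<le> card (multisets_of_size {..<K + 2} D)"
proof -
  have M: "card (multisets_of_size {..<K + 1} (d * D)) = (K + d * D) choose K"
    using binomial_symmetric [of "d * D" "K + d * D"] by (simp add: card_multisets_of_size)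
  have N: "card (multisets_of_size {..<K + 2} D) = (K + 1 + D) choose (K + 1)"
    using binomial_symmetric [of D "K + 1 + D"] by (simp add: card_multisets_of_size del: binomial_Suc_Suc)
  \<comment> \<open>Both binomials are products of \<open>K\<close> quotients, and each quotient on
    the left is at most \<open>d\<close> times its partner on the right.\<close>
  have 1: "real ((K + d * D) choose K) \<le> real d ^ K * real ((K + D) choose K)"
  proof -
    have "real ((K + d * D) choose K) = (\<Prod>i<K. (real (K + d * D) - real i) / (real K - real i))"
      by (simp add: binomial_altdef_of_nat atLeast0LessThan)
    also have "\<dots> \<le> (\<Prod>i<K. real d * ((real (K + D) - real i) / (real K - real i)))"
    proof (intro prod_mono conjI)
      fix i assume i: "i \<in> {..<K}"
      then show "0 \<le> (real (K + d * D) - real i) / (real K - real i)" by (intro divide_nonneg_nonneg) (auto simp: add_increasing2)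
      have "1 * (real K - real i) \<le> real d * (real K - real i)" using d i by (intro mult_right_mono) auto
      then have "real (K + d * D) - real i \<le> real d * (real (K + D) - real i)" by (simp add: algebra_simps)
      then have "(real (K + d * D) - real i) / (real K - real i) \<le> (real d * (real (K + D) - real i)) / (real K - real i)"
        using i by (intro divide_right_mono) auto
      then show "(real (K + d * D) - real i) / (real K - real i) \<le> real d * ((real (K + D) - real i) / (real K - real i))" by simp
    qed
    also have "\<dots> = real d ^ K * real ((K + D) choose K)"
      by (simp only: prod.distrib) (simp add: binomial_altdef_of_nat atLeast0LessThan)
    finally show ?thesis .
  qed
  \<comment> \<open>Absorption turns one more variable into the factor
    \<open>(K + 1 + D) / (K + 1)\<close>; the choice of \<open>D\<close> makes it at least
    \<open>2 * d ^ K\<close>.\<close>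
  have "(K + 1) * ((K + 1 + D) choose (K + 1)) = (K + 1 + D) * ((K + D) choose K)"
    using Suc_times_binomial_eq [of "K + D" K] by (simp add: mult.commute)
  then have "real (K + 1) * real ((K + 1 + D) choose (K + 1)) = real (K + 1 + D) * real ((K + D) choose K)"
    by (metis of_nat_mult)
  also have "\<dots> \<ge> real D * real ((K + D) choose K)" by (intro mult_right_mono) auto
  also have "real D * real ((K + D) choose K) = real (K + 1) * (2 * (real d ^ K * real ((K + D) choose K)))"
    by (simp add: D algebra_simps)
  finally have "2 * (real d ^ K * real ((K + D) choose K)) \<le> real ((K + 1 + D) choose (K + 1))"
    by (simp only: mult_le_cancel_left_pos of_nat_0_less_iff zero_less_Suc Suc_eq_plus1 [symmetric])
  then have "2 * real ((K + d * D) choose K) \<le> real ((K + 1 + D) choose (K + 1))" using 1 by linarith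
  then show ?thesis unfolding M N by linarith
qed

text \<open>Uniqueness of digits in base \<open>B\<close>: at the largest position with different
  digits, all lower positions together contribute at most \<open>B ^ k - 1\<close>. It is used to
  read off the exponents of a monomial from a single power of \<open>s\<close>.\<close>

lemma base_representation:
  fixes n n' :: "'i \<Rightarrow> nat"
  assumes I: "finite I" "inj_on e I" and n: "\<And>i. i \<in> I \<Longrightarrow> n i \<le> D \<and> n' i \<le> D" and B: "B > D"
    and eq: "(\<Sum>i\<in>I. n i * B ^ e i) = (\<Sum>i\<in>I. n' i * B ^ e i)" and i: "i \<in> I"
  shows "n i = n' i"
proof (rule ccontr)
  assume "n i \<noteq> n' i"
  define Z where "Z = {j\<in>I. n j \<noteq> n' j}"
  have Z: "finite Z" "Z \<noteq> {}" "Z \<subseteq> I" using I i \<open>n i \<noteq> n' i\<close> by (auto simp: Z_def)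
  define k where "k = Max (e ` Z)"
  have "k \<in> e ` Z" unfolding k_def using Z by (intro Max_in) auto
  then obtain j where j: "j \<in> Z" "k = e j" by auto
  have kmax: "e l \<le> k" if "l \<in> Z" for l unfolding k_def using Z that by auto
  define \<delta> where "\<delta> l = int (n l) - int (n' l)" for l
  have \<delta>: "\<bar>\<delta> l\<bar> \<le> int D" if "l \<in> I" for l using n [OF that] by (auto simp: \<delta>_def)
  have "int (\<Sum>i\<in>I. n i * B ^ e i) = int (\<Sum>i\<in>I. n' i * B ^ e i)" using eq by simp
  then have "(\<Sum>l\<in>I. \<delta> l * int B ^ e l) = 0" by (simp add: \<delta>_def left_diff_distrib sum_subtractf)
  also have "(\<Sum>l\<in>I. \<delta> l * int B ^ e l) = (\<Sum>l\<in>Z. \<delta> l * int B ^ e l)"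
    using I by (intro sum.mono_neutral_right) (auto simp: Z_def \<delta>_def)
  also have "\<dots> = \<delta> j * int B ^ k + (\<Sum>l\<in>Z - {j}. \<delta> l * int B ^ e l)" using Z j by (simp add: sum.remove)
  finally have "\<bar>\<delta> j * int B ^ k\<bar> = \<bar>\<Sum>l\<in>Z - {j}. \<delta> l * int B ^ e l\<bar>" by linarith
  also have "\<dots> \<le> (\<Sum>l\<in>Z - {j}. \<bar>\<delta> l * int B ^ e l\<bar>)" by (rule sum_abs)
  also have "\<dots> \<le> (\<Sum>l\<in>Z - {j}. int D * int B ^ e l)"
    using Z \<delta> by (intro sum_mono) (auto simp: abs_mult intro!: mult_right_mono)
  also have "\<dots> = (\<Sum>m\<in>e ` (Z - {j}). int D * int B ^ m)"
    using I Z by (subst sum.reindex) (auto intro: inj_on_subset)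
  also have "\<dots> \<le> (\<Sum>m<k. int D * int B ^ m)"
  proof (intro sum_mono2)
    have "e l \<noteq> k" if "l \<in> Z - {j}" for l using that j Z I by (auto dest: inj_onD)
    then show "e ` (Z - {j}) \<subseteq> {..<k}" using kmax by (fastforce simp: le_neq_implies_less)
  qed auto
  also have "\<dots> \<le> (\<Sum>m<k. (int B - 1) * int B ^ m)" using B by (intro sum_mono mult_right_mono) auto
  also have "\<dots> = int B ^ k - 1" by (simp add: power_diff_1_eq sum_distrib_left)
  finally have "\<bar>\<delta> j\<bar> * int B ^ k < int B ^ k" by (simp add: abs_mult)
  moreover have "\<bar>\<delta> j\<bar> \<ge> 1" using j by (auto simp: Z_def \<delta>_def)
  ultimately show False using mult_right_mono [of 1 "\<bar>\<delta> j\<bar>" "int B ^ k"] by simp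
qed

text \<open>If all but one of the forms take values that are widely separated powers of a tiny \<open>s\<close>, then in the
  annihilating relation a single monomial dominates unless the remaining value is not too small.\<close>

lemma separated_value_bound:
  assumes \<phi>: "\<And>i. i < K + 2 \<Longrightarrow> int_form (K + 1) d H (\<phi> i)" and H: "H \<ge> 1" and d: "d \<ge> 1"
    and D: "D = 2 * (K + 1) * d ^ K" and N: "N = card (multisets_of_size {..<K + 2} D)" and T: "T = 2 * int N * H ^ D"
    and e: "inj_on e {..<K}" and B: "B > D"
    and v: "\<And>i. i < K \<Longrightarrow> \<phi> i x = s ^ (B ^ e i)" "\<phi> K x = z" "\<phi> (K + 1) x = 1"
    and s: "0 < s" "s * (4 * real N * of_int T) \<le> c ^ D" and c: "0 < c" "c \<le> z"
  shows "1 \<le> z * (4 * real N * of_int T)"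
proof (rule ccontr)
  \<comment> \<open>The a priori bound \<open>c\<close> on \<open>z\<close> carries no quantitative
    information; it governs how small \<open>s\<close> must be and disappears from the
    conclusion.\<close>
  assume small: "\<not> 1 \<le> z * (4 * real N * of_int T)"
  let ?A = "multisets_of_size {..<K + 2} D"
  have "0 < K + 1" by simp
  from small_annihilator [OF \<phi> H this monomial_count [OF d D], folded N, folded T]
  obtain a where a0: "(\<exists>\<alpha>\<in>?A. a \<alpha> \<noteq> 0) \<and> (\<forall>\<alpha>\<in>?A. \<bar>a \<alpha>\<bar> \<le> T) \<and>
    (\<forall>x. (\<Sum>\<alpha>\<in>?A. of_int (a \<alpha>) * (\<Prod>i\<in>#\<alpha>. \<phi> i x)) = 0)" ..
  then have a: "\<exists>\<alpha>\<in>?A. a \<alpha> \<noteq> 0" "\<And>\<alpha>. \<alpha> \<in> ?A \<Longrightarrow> \<bar>a \<alpha>\<bar> \<le> T"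
    "(\<Sum>\<alpha>\<in>?A. of_int (a \<alpha>) * (\<Prod>i\<in>#\<alpha>. \<phi> i x)) = 0" by simp_all
  have N1: "N \<ge> 1" using a(1) unfolding N by (auto simp: Suc_le_eq card_gt_0_iff)
  have "0 < 2 * int N * H ^ D" using N1 H by simp
  then have T1: "T \<ge> 1" unfolding T by linarith
  have NT: "real N * of_int T \<ge> 1" using N1 T1 mult_mono [of 1 "real N" 1 "of_int T"] by simp
  have z: "0 < z" "z < 1"
  proof -
    show "0 < z" using c by simp
    have "z * 1 \<le> z * (4 * real N * of_int T)" using NT \<open>0 < z\<close> by (intro mult_left_mono) auto
    then show "z < 1" using small by simp
  qed
  have cD: "c ^ D \<le> 1" using c z by (intro power_le_one) auto
  have s1: "s \<le> 1"
  proof -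
    have "s * 1 \<le> s * (4 * real N * of_int T)" using NT s(1) by (intro mult_left_mono) auto
    then show ?thesis using s(2) cD by simp
  qed
  define E where "E \<alpha> = (\<Sum>i<K. count \<alpha> i * B ^ e i)" for \<alpha>
  have val: "(\<Prod>i\<in>#\<alpha>. \<phi> i x) = s ^ E \<alpha> * z ^ count \<alpha> K" if "\<alpha> \<in> ?A" for \<alpha>
  proof -
    have sub: "set_mset \<alpha> \<subseteq> {..<K + 2}" using that by (auto simp: multisets_of_size_def)
    have "(\<Prod>i\<in>#\<alpha>. \<phi> i x) = (\<Prod>i\<in>set_mset \<alpha>. \<phi> i x ^ count \<alpha> i)" by (simp add: image_prod_mset_multiplicity)
    also have "\<dots> = (\<Prod>i<K + 2. \<phi> i x ^ count \<alpha> i)"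
      using sub by (intro prod.mono_neutral_left) (auto simp: not_in_iff)
    also have "\<dots> = (\<Prod>i<K. \<phi> i x ^ count \<alpha> i) * z ^ count \<alpha> K" using v(2,3) by simp
    also have "(\<Prod>i<K. \<phi> i x ^ count \<alpha> i) = (\<Prod>i<K. s ^ (count \<alpha> i * B ^ e i))"
      using v(1) by (intro prod.cong) (auto simp: mult.commute simp flip: power_mult)
    also have "\<dots> = s ^ E \<alpha>" by (simp add: E_def power_sum)
    finally show ?thesis .
  qed
  \<comment> \<open>The last form has the value 1 and leaves no trace in the value of a monomial,
    but its multiplicity is determined by the total degree \<open>D\<close>.\<close>
  have inj: "\<alpha> = \<beta>" if "\<alpha> \<in> ?A" "\<beta> \<in> ?A" "E \<alpha> = E \<beta>" "count \<alpha> K = count \<beta> K" for \<alpha> \<beta>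
  proof (rule multiset_eqI)
    fix i
    have bd: "count \<alpha> i \<le> D \<and> count \<beta> i \<le> D" for i using that(1,2) count_le_size [of \<alpha> i] count_le_size [of \<beta> i] by (auto simp: multisets_of_size_def)
    have 1: "count \<alpha> i = count \<beta> i" if "i < K" for i
      using base_representation [OF _ e, of "count \<alpha>" D "count \<beta>" B i] bd B \<open>E \<alpha> = E \<beta>\<close> that by (auto simp: E_def)
    have sz: "D = (\<Sum>i<K. count \<gamma> i) + count \<gamma> K + count \<gamma> (K + 1)" if "\<gamma> \<in> ?A" for \<gamma>
    proof -
      have "D = (\<Sum>i\<in>set_mset \<gamma>. count \<gamma> i)" using that by (simp add: multisets_of_size_def size_multiset_overloaded_eq)
      also have "\<dots> = (\<Sum>i<K + 2. count \<gamma> i)" using that by (intro sum.mono_neutral_left) (auto simp: multisets_of_size_def not_in_iff)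
      finally show ?thesis by simp
    qed
    have "(\<Sum>i<K. count \<alpha> i) = (\<Sum>i<K. count \<beta> i)" using 1 by (intro sum.cong) auto
    then have 2: "count \<alpha> (K + 1) = count \<beta> (K + 1)" using sz [OF that(1)] sz [OF that(2)] that(4) by linarith
    have 3: "count \<gamma> i = 0" if "\<gamma> \<in> ?A" "i \<ge> K + 2" for \<gamma> using that by (auto simp: multisets_of_size_def count_eq_zero_iff)
    consider "i < K" | "i = K" | "i = K + 1" | "i \<ge> K + 2" by linarith
    then show "count \<alpha> i = count \<beta> i" using 1 2 3 that by cases auto
  qed
  define Z where "Z = {\<alpha>\<in>?A. a \<alpha> \<noteq> 0}"
  have Z: "finite Z" "Z \<noteq> {}" using a(1) by (auto simp: Z_def)
  \<comment> \<open>The dominant monomial has the least power of \<open>s\<close> and then the least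
    power of \<open>z\<close>. Powers of \<open>s\<close> come first because
    \<open>s * (4 * N * T) \<le> c ^ D \<le> z ^ D\<close>, so one more factor \<open>s\<close>
    outweighs every power of \<open>z\<close> that can occur.\<close>
  obtain \<mu> where \<mu>: "\<mu> \<in> Z" "\<And>\<alpha>. \<alpha> \<in> Z \<Longrightarrow> E \<mu> < E \<alpha> \<or> E \<mu> = E \<alpha> \<and> count \<mu> K \<le> count \<alpha> K"
  proof -
    define m where "m = Min (E ` Z)"
    have m: "m \<in> E ` Z" "\<And>\<alpha>. \<alpha> \<in> Z \<Longrightarrow> m \<le> E \<alpha>" unfolding m_def using Z by auto
    define Z1 where "Z1 = {\<alpha>\<in>Z. E \<alpha> = m}"
    have Z1: "finite Z1" "Z1 \<noteq> {}" using Z m(1) by (auto simp: Z1_def)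
    define q where "q = Min ((\<lambda>\<alpha>. count \<alpha> K) ` Z1)"
    have q: "q \<in> (\<lambda>\<alpha>. count \<alpha> K) ` Z1" "\<And>\<alpha>. \<alpha> \<in> Z1 \<Longrightarrow> q \<le> count \<alpha> K" unfolding q_def using Z1 by auto
    then obtain \<mu> where \<mu>: "\<mu> \<in> Z1" "count \<mu> K = q" by auto
    show ?thesis
    proof (rule that)
      show "\<mu> \<in> Z" using \<mu> by (simp add: Z1_def)
      fix \<alpha> assume "\<alpha> \<in> Z"
      then show "E \<mu> < E \<alpha> \<or> E \<mu> = E \<alpha> \<and> count \<mu> K \<le> count \<alpha> K"
        using m(2) [of \<alpha>] q(2) [of \<alpha>] \<mu> by (auto simp: Z1_def)
    qed
  qed
  have \<mu>A: "\<mu> \<in> ?A" "a \<mu> \<noteq> 0" using \<mu>(1) by (auto simp: Z_def)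
  define u where "u = s ^ E \<mu> * z ^ count \<mu> K"
  have u: "u > 0" using s z by (simp add: u_def)
  have small_term: "s ^ E \<alpha> * z ^ count \<alpha> K \<le> u / (4 * real N * of_int T) + u * z" if \<alpha>Z: "\<alpha> \<in> Z" "\<alpha> \<noteq> \<mu>" for \<alpha>
  proof -
    have \<alpha>: "\<alpha> \<in> ?A" using \<alpha>Z(1) by (simp add: Z_def)
    have P: "0 < 4 * real N * of_int T" using N1 T1 by (intro mult_pos_pos) auto
    consider "E \<mu> < E \<alpha>" | "E \<mu> = E \<alpha>" "count \<mu> K < count \<alpha> K"
      using \<mu>(2) [OF \<alpha>Z(1)] inj [OF \<alpha> \<mu>A(1)] \<alpha>Z(2) by (metis le_neq_implies_less)
    then show ?thesis
    proof cases
      case 1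
      then have "s ^ E \<alpha> \<le> s ^ Suc (E \<mu>)" using s s1 by (intro power_decreasing) auto
      then have "s ^ E \<alpha> * z ^ count \<alpha> K \<le> s ^ Suc (E \<mu>) * 1" using z s by (intro mult_mono) (auto simp: power_le_one)
      also have "\<dots> = s ^ E \<mu> * s" by simp
      also have "\<dots> \<le> s ^ E \<mu> * (z ^ count \<mu> K / (4 * real N * of_int T))"
      proof (intro mult_left_mono)
        have "s * (4 * real N * of_int T) \<le> z ^ D" using s(2) power_mono [of c z D] c by linarith
        also have "z ^ D \<le> z ^ count \<mu> K"
          using z \<mu>A(1) count_le_size [of \<mu> K] by (intro power_decreasing) (auto simp: multisets_of_size_def)
        finally show "s \<le> z ^ count \<mu> K / (4 * real N * of_int T)" using P by (simp add: pos_le_divide_eq)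
      qed (use s in auto)
      finally have "s ^ E \<alpha> * z ^ count \<alpha> K \<le> s ^ E \<mu> * (z ^ count \<mu> K / (4 * real N * of_int T))" .
      then show ?thesis using u z P by (simp add: u_def add_increasing2)
    next
      case 2
      then have "z ^ count \<alpha> K \<le> z ^ Suc (count \<mu> K)" using z by (intro power_decreasing) auto
      then have "s ^ E \<alpha> * z ^ count \<alpha> K \<le> u * z" using s 2 by (simp add: u_def mult.assoc mult_left_mono mult.commute)
      then show ?thesis using u P by (simp add: add_increasing)
    qed
  qed
  have "(\<Sum>\<alpha>\<in>Z. of_int (a \<alpha>) * (s ^ E \<alpha> * z ^ count \<alpha> K)) = (\<Sum>\<alpha>\<in>?A. of_int (a \<alpha>) * (s ^ E \<alpha> * z ^ count \<alpha> K))"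
    by (intro sum.mono_neutral_left) (auto simp: Z_def)
  also have "\<dots> = 0" using a(3) by (simp add: val)
  finally have "of_int (a \<mu>) * u + (\<Sum>\<alpha>\<in>Z - {\<mu>}. of_int (a \<alpha>) * (s ^ E \<alpha> * z ^ count \<alpha> K)) = 0"
    using Z(1) \<mu>(1) by (simp add: sum.remove u_def)
  then have "\<bar>of_int (a \<mu>) * u\<bar> = \<bar>\<Sum>\<alpha>\<in>Z - {\<mu>}. of_int (a \<alpha>) * (s ^ E \<alpha> * z ^ count \<alpha> K)\<bar>" by linarith
  also have "\<dots> \<le> (\<Sum>\<alpha>\<in>Z - {\<mu>}. \<bar>of_int (a \<alpha>) * (s ^ E \<alpha> * z ^ count \<alpha> K)\<bar>)" by (rule sum_abs)
  also have "\<dots> \<le> (\<Sum>\<alpha>\<in>Z - {\<mu>}. of_int T * (u / (4 * real N * of_int T) + u * z))"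
  proof (intro sum_mono)
    fix \<alpha> assume \<alpha>: "\<alpha> \<in> Z - {\<mu>}"
    then have "\<bar>of_int (a \<alpha>) :: real\<bar> \<le> of_int T" using a(2) [of \<alpha>] by (simp add: Z_def flip: of_int_abs)
    then show "\<bar>of_int (a \<alpha>) * (s ^ E \<alpha> * z ^ count \<alpha> K)\<bar> \<le> of_int T * (u / (4 * real N * of_int T) + u * z)"
      unfolding abs_mult using small_term [of \<alpha>] \<alpha> s z T1 by (intro mult_mono) (auto simp: abs_mult)
  qed
  also have "\<dots> = real (card (Z - {\<mu>})) * (of_int T * (u / (4 * real N * of_int T) + u * z))" by simp
  also have "\<dots> \<le> real N * (of_int T * (u / (4 * real N * of_int T) + u * z))"
  proof (intro mult_right_mono)
    have "card (Z - {\<mu>}) \<le> N" unfolding N by (intro card_mono) (auto simp: Z_def)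
    then show "real (card (Z - {\<mu>})) \<le> real N" by simp
    show "0 \<le> of_int T * (u / (4 * real N * of_int T) + u * z)" using T1 u z by simp
  qed
  \<comment> \<open>By \<open>small\<close> the second summand is below \<open>u / 4\<close>, so the
    other monomials add up to less than \<open>u / 2\<close>.\<close>
  also have "\<dots> = u / 4 + u * (z * (4 * real N * of_int T)) / 4" using N1 T1 by (simp add: field_simps)
  finally have "\<bar>of_int (a \<mu>) * u\<bar> \<le> u / 4 + u * (z * (4 * real N * of_int T)) / 4" .
  moreover have "u * (z * (4 * real N * of_int T)) < u * 1" using small u by (intro mult_strict_left_mono) auto
  ultimately have "\<bar>of_int (a \<mu>) * u\<bar> < u" using u by linarith
  moreover have "\<bar>of_int (a \<mu>) :: real\<bar> \<ge> 1" using \<mu>A(2) by (simp flip: of_int_abs)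
  ultimately show False using u mult_right_mono [of 1 "\<bar>of_int (a \<mu>)\<bar>" u] by (simp add: abs_mult)
qed

section \<open>Compactness, a theorem of the alternative, and reduction of multipliers\<close>

lemma compact_function_box:
  fixes S :: "'i \<Rightarrow> 'a::topological_space set"
  assumes "\<And>i. compact (S i)" shows "compact {x. \<forall>i. x i \<in> S i}"
proof -
  \<comment> \<open>Tychonoff's theorem; the topology of the function type is the product
    topology.\<close>
  have "compactin (product_topology (\<lambda>i::'i. euclidean :: 'a topology) UNIV) (PiE UNIV S)"
    using assms by (simp add: compactin_PiE)
  then show ?thesis by (simp add: euclidean_product_topology PiE_def Pi_def)
qed

lemma continuous_on_coordinate [continuous_intros]: "continuous_on S (\<lambda>x :: 'i \<Rightarrow> 'a::topological_space. x i)"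
  by (rule continuous_on_subset [OF continuous_on_product_coordinates]) simp

lemma continuous_on_Min_family:
  fixes f :: "'j \<Rightarrow> 'x::topological_space \<Rightarrow> real"
  assumes "finite J" "J \<noteq> {}" "\<And>j. j \<in> J \<Longrightarrow> continuous_on S (f j)"
  shows "continuous_on S (\<lambda>x. Min ((\<lambda>j. f j x) ` J))"
  using assms
proof (induction J rule: finite_ne_induct)
  case (insert j J)
  then have "continuous_on S (\<lambda>x. min (f j x) (Min ((\<lambda>j. f j x) ` J)))" by (intro continuous_on_min) auto
  then show ?case using insert by simp
qed simp

text \<open>Take the point \<open>W \<xi>\<close> of least norm in the convex hull of the vectors
  \<open>G j\<close>. If it is 0, the second alternative holds. Otherwise moving towards
  \<open>G j\<close> does not shorten it, so its scalar product with \<open>G j\<close> is at least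
  its squared norm, and \<open>v = W \<xi>\<close> works.\<close>

lemma gordan:
  fixes G :: "nat \<Rightarrow> nat \<Rightarrow> real"
  assumes A: "finite A" "A \<noteq> {}"
  obtains v where "\<And>j. j \<in> A \<Longrightarrow> (\<Sum>i<k. G j i * v i) > 0"
  | \<xi> where "\<And>j. j \<in> A \<Longrightarrow> \<xi> j \<ge> 0" "(\<Sum>j\<in>A. \<xi> j) = 1" "\<And>i. i < k \<Longrightarrow> (\<Sum>j\<in>A. \<xi> j * G j i) = 0"
proof -
  define W where "W \<xi> i = (\<Sum>j\<in>A. \<xi> j * G j i)" for \<xi> :: "nat \<Rightarrow> real" and i
  define \<Delta> where "\<Delta> = {\<xi> :: nat \<Rightarrow> real. (\<forall>j. \<xi> j \<in> (if j \<in> A then {0..1} else {0}))} \<inter> {\<xi>. (\<Sum>j\<in>A. \<xi> j) = 1}"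
  have "closed {\<xi> :: nat \<Rightarrow> real. (\<Sum>j\<in>A. \<xi> j) = 1}" by (intro closed_Collect_eq continuous_intros)
  then have comp: "compact \<Delta>" unfolding \<Delta>_def by (intro compact_Int_closed compact_function_box) auto
  obtain a where a: "a \<in> A" using A by auto
  have "(\<lambda>j. if j = a then 1 else 0) \<in> \<Delta>" using a A by (auto simp: \<Delta>_def)
  then have ne: "\<Delta> \<noteq> {}" by auto
  have "continuous_on \<Delta> (\<lambda>\<xi>. \<Sum>i<k. (W \<xi> i)\<^sup>2)" unfolding W_def by (intro continuous_intros)
  then obtain \<xi> where \<xi>: "\<xi> \<in> \<Delta>" "\<And>\<mu>. \<mu> \<in> \<Delta> \<Longrightarrow> (\<Sum>i<k. (W \<xi> i)\<^sup>2) \<le> (\<Sum>i<k. (W \<mu> i)\<^sup>2)"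
    using continuous_attains_inf [OF comp ne] by blast
  show thesis
  proof (cases "(\<Sum>i<k. (W \<xi> i)\<^sup>2) = 0")
    case True
    then have "\<forall>i\<in>{..<k}. (W \<xi> i)\<^sup>2 = 0" by (subst (asm) sum_nonneg_eq_0_iff) auto
    then show thesis using that(2) [of \<xi>] \<xi>(1) by (auto simp: \<Delta>_def W_def split: if_splits)
  next
    case False
    then have pos: "(\<Sum>i<k. (W \<xi> i)\<^sup>2) > 0" by (simp add: sum_nonneg less_le)
    have "(\<Sum>i<k. G j i * W \<xi> i) > 0" if j: "j \<in> A" for j
    proof -
      define p where "p = (\<Sum>i<k. (G j i - W \<xi> i) * W \<xi> i)"
      define s where "s = (\<Sum>i<k. (G j i - W \<xi> i)\<^sup>2)"
      have main: "0 \<le> 2 * p + t * s" if t: "0 < t" "t \<le> 1" for t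
      proof -
        define \<mu> where "\<mu> l = (1 - t) * \<xi> l + (if l = j then t else 0)" for l
        have "\<mu> l \<in> {0..1}" if "l \<in> A" for l
        proof -
          have l: "0 \<le> \<xi> l" "\<xi> l \<le> 1" using \<xi>(1) that by (auto simp: \<Delta>_def split: if_splits)
          then have "0 \<le> (1 - t) * \<xi> l" "(1 - t) * \<xi> l \<le> 1 - t" using t by (auto simp: mult_left_le)
          then show ?thesis using t by (auto simp: \<mu>_def)
        qed
        moreover have "\<mu> l = 0" if "l \<notin> A" for l using \<xi>(1) that j by (auto simp: \<Delta>_def \<mu>_def split: if_splits)
        moreover have sm: "(\<Sum>l\<in>A. \<mu> l * g l) = (1 - t) * (\<Sum>l\<in>A. \<xi> l * g l) + t * g j" for g
        proof -
          have "(\<Sum>l\<in>A. \<mu> l * g l) = (\<Sum>l\<in>A. (1 - t) * (\<xi> l * g l)) + (\<Sum>l\<in>A. if l = j then t * g l else 0)"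
            unfolding sum.distrib [symmetric] by (intro sum.cong) (auto simp: \<mu>_def algebra_simps)
          then show ?thesis using A j by (simp add: sum_distrib_left)
        qed
        moreover have "(\<Sum>l\<in>A. \<mu> l) = 1" using sm [of "\<lambda>_. 1"] \<xi>(1) by (simp add: \<Delta>_def)
        ultimately have "\<mu> \<in> \<Delta>" by (auto simp: \<Delta>_def)
        then have "(\<Sum>i<k. (W \<xi> i)\<^sup>2) \<le> (\<Sum>i<k. (W \<mu> i)\<^sup>2)" by (rule \<xi>(2))
        also have "(\<Sum>i<k. (W \<mu> i)\<^sup>2) = (\<Sum>i<k. (W \<xi> i)\<^sup>2 + t * (2 * ((G j i - W \<xi> i) * W \<xi> i) + t * (G j i - W \<xi> i)\<^sup>2))"
        proof (intro sum.cong refl)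
          fix i
          have Wm: "W \<mu> i = W \<xi> i + t * (G j i - W \<xi> i)" using sm [of "\<lambda>l. G l i"] by (simp add: W_def algebra_simps)
          show "(W \<mu> i)\<^sup>2 = (W \<xi> i)\<^sup>2 + t * (2 * ((G j i - W \<xi> i) * W \<xi> i) + t * (G j i - W \<xi> i)\<^sup>2)"
            unfolding Wm by (simp add: power2_eq_square algebra_simps)
        qed
        also have "\<dots> = (\<Sum>i<k. (W \<xi> i)\<^sup>2) + t * (2 * p + t * s)"
          unfolding sum.distrib p_def s_def sum_distrib_left [symmetric] by simp
        finally show ?thesis using t by (simp add: zero_le_mult_iff)
      qed
      have "p \<ge> 0"
      proof (rule ccontr)
        assume "\<not> p \<ge> 0"
        then have pn: "p < 0" by simp
        have s0: "s \<ge> 0" by (simp add: s_def sum_nonneg)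
        define t where "t = min 1 (- p / (s + 1))"
        have t: "0 < t" "t \<le> 1" "t \<le> - p / (s + 1)" using pn s0 by (auto simp: t_def divide_neg_pos)
        have "t * s \<le> - p / (s + 1) * s" using t s0 by (intro mult_right_mono) auto
        also have "\<dots> \<le> - p" using pn s0 by (simp add: divide_simps)
        finally show False using main [OF t(1,2)] pn by linarith
      qed
      moreover have "p = (\<Sum>i<k. G j i * W \<xi> i) - (\<Sum>i<k. (W \<xi> i)\<^sup>2)"
        by (simp add: p_def left_diff_distrib sum_subtractf power2_eq_square)
      ultimately show ?thesis using pos by linarith
    qed
    then show thesis by (rule that(1))
  qed
qed

text \<open>Gaussian elimination: an equation with a nonzero coefficient is solved for one unknown,
  which is substituted into the others.\<close>

lemma linear_dependence:
  fixes A :: "'i \<Rightarrow> 'j \<Rightarrow> real"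
  assumes "finite I" "finite J" "card I < card J"
  shows "\<exists>\<mu>. (\<exists>j\<in>J. \<mu> j \<noteq> 0) \<and> (\<forall>i\<in>I. (\<Sum>j\<in>J. \<mu> j * A i j) = 0)"
  using assms
proof (induction I arbitrary: A J rule: finite_induct)
  case empty
  then have "J \<noteq> {}" by auto
  then show ?case by (intro exI [of _ "\<lambda>_. 1"]) auto
next
  case (insert i I)
  show ?case
  proof (cases "\<forall>j\<in>J. A i j = 0")
    case True
    have "card I < card J" using insert by simp
    then obtain \<mu> where "\<exists>j\<in>J. \<mu> j \<noteq> 0" "\<forall>i\<in>I. (\<Sum>j\<in>J. \<mu> j * A i j) = 0" using insert.IH [of J A] insert.prems by auto
    then show ?thesis using True by (intro exI [of _ \<mu>]) auto
  next
    case False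
    then obtain j0 where j0: "j0 \<in> J" "A i j0 \<noteq> 0" by auto
    define J' where "J' = J - {j0}"
    have J': "finite J'" "card I < card J'" "J = insert j0 J'" "j0 \<notin> J'" using insert j0 by (auto simp: J'_def)
    obtain \<mu> where \<mu>: "\<exists>j\<in>J'. \<mu> j \<noteq> 0" "\<forall>i'\<in>I. (\<Sum>j\<in>J'. \<mu> j * (A i' j - A i' j0 * A i j / A i j0)) = 0"
      using insert.IH [OF J'(1,2), of "\<lambda>i' j. A i' j - A i' j0 * A i j / A i j0"] by auto
    define m where "m = - (\<Sum>j\<in>J'. \<mu> j * A i j) / A i j0"
    define \<nu> where "\<nu> = \<mu>(j0 := m)"
    have s: "(\<Sum>j\<in>J. \<nu> j * g j) = m * g j0 + (\<Sum>j\<in>J'. \<mu> j * g j)" for g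
    proof -
      have "(\<Sum>j\<in>J'. \<nu> j * g j) = (\<Sum>j\<in>J'. \<mu> j * g j)" using J'(4) by (intro sum.cong) (auto simp: \<nu>_def)
      then show ?thesis using J' by (simp add: \<nu>_def)
    qed
    have "(\<Sum>j\<in>J. \<nu> j * A i j) = 0" unfolding s using j0 by (simp add: m_def)
    moreover have "(\<Sum>j\<in>J. \<nu> j * A i' j) = 0" if "i' \<in> I" for i'
    proof -
      have "(\<Sum>j\<in>J'. \<mu> j * (A i' j - A i' j0 * A i j / A i j0)) = (\<Sum>j\<in>J'. \<mu> j * A i' j) + m * A i' j0"
        by (simp add: right_diff_distrib sum_subtractf m_def sum_divide_distrib sum_distrib_left sum_distrib_right sum_negf ac_simps)
      then show ?thesis unfolding s using \<mu>(2) that by simp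
    qed
    moreover have "\<exists>j\<in>J. \<nu> j \<noteq> 0" using \<mu>(1) J' by (auto simp: \<nu>_def)
    ultimately show ?thesis by (intro exI [of _ \<nu>]) auto
  qed
qed

text \<open>Caratheodory's reduction: with more than \<open>k + 1\<close> multipliers there is an
  affine dependence, along which the multipliers are moved until the first one vanishes. The extra
  row of ones in \<open>H\<close> preserves their sum. This is what makes the final bound
  independent of the size of the family.\<close>

lemma small_support:
  fixes G :: "nat \<Rightarrow> nat \<Rightarrow> real"
  assumes "finite A" "\<And>j. j \<in> A \<Longrightarrow> \<xi> j \<ge> 0" "(\<Sum>j\<in>A. \<xi> j) = 1" "\<And>i. i < k \<Longrightarrow> (\<Sum>j\<in>A. \<xi> j * G j i) = w i"
  shows "\<exists>B \<mu>. B \<subseteq> A \<and> card B \<le> k + 1 \<and> (\<forall>j\<in>B. \<mu> j \<ge> 0) \<and> (\<Sum>j\<in>B. \<mu> j) = 1 \<and> (\<forall>i<k. (\<Sum>j\<in>B. \<mu> j * G j i) = w i)"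
  using assms
proof (induction "card A" arbitrary: A \<xi> rule: less_induct)
  case less
  show ?case
  proof (cases "card A \<le> k + 1")
    case True
    then show ?thesis using less.prems by (intro exI [of _ A] exI [of _ \<xi>]) auto
  next
    case False
    define H where "H i j = (if i < k then G j i else 1)" for i j
    obtain \<nu> where \<nu>: "\<exists>j\<in>A. \<nu> j \<noteq> 0" "\<forall>i\<in>{..k}. (\<Sum>j\<in>A. \<nu> j * H i j) = 0"
      using linear_dependence [of "{..k}" A H] less.prems(1) False by auto
    have \<nu>1: "(\<Sum>j\<in>A. \<nu> j) = 0" using \<nu>(2) [rule_format, of k] by (simp add: H_def)
    have \<nu>G: "(\<Sum>j\<in>A. \<nu> j * G j i) = 0" if "i < k" for i using \<nu>(2) [rule_format, of i] that by (simp add: H_def)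
    have "\<exists>j\<in>A. \<nu> j < 0"
    proof (rule ccontr)
      assume "\<not> ?thesis"
      then have "\<forall>j\<in>A. \<nu> j = 0" using \<nu>1 less.prems(1) by (subst (asm) sum_nonneg_eq_0_iff) (auto simp: not_less)
      then show False using \<nu>(1) by auto
    qed
    define Z where "Z = {j\<in>A. \<nu> j < 0}"
    have Z: "finite Z" "Z \<noteq> {}" using less.prems(1) \<open>\<exists>j\<in>A. \<nu> j < 0\<close> by (auto simp: Z_def)
    define \<theta> where "\<theta> = Min ((\<lambda>j. \<xi> j / (- \<nu> j)) ` Z)"
    have \<theta>: "\<theta> \<in> (\<lambda>j. \<xi> j / (- \<nu> j)) ` Z" "\<And>j. j \<in> Z \<Longrightarrow> \<theta> \<le> \<xi> j / (- \<nu> j)" unfolding \<theta>_def using Z by auto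
    then obtain j0 where j0: "j0 \<in> Z" "\<theta> = \<xi> j0 / (- \<nu> j0)" by auto
    have "\<theta> \<ge> 0" unfolding j0(2) using j0(1) less.prems(2) by (intro divide_nonneg_pos) (auto simp: Z_def)
    define \<mu> where "\<mu> j = \<xi> j + \<theta> * \<nu> j" for j
    have \<mu>0: "\<mu> j0 = 0" using j0 by (auto simp: \<mu>_def Z_def)
    have \<mu>p: "\<mu> j \<ge> 0" if "j \<in> A" for j
    proof (cases "\<nu> j < 0")
      case True
      then have "\<theta> \<le> \<xi> j / (- \<nu> j)" using \<theta>(2) that by (auto simp: Z_def)
      then show ?thesis using True by (simp add: \<mu>_def divide_simps)
    qed (use \<open>\<theta> \<ge> 0\<close> less.prems(2) that in \<open>auto simp: \<mu>_def\<close>)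
    have sm: "(\<Sum>j\<in>A - {j0}. \<mu> j * g j) = (\<Sum>j\<in>A. \<xi> j * g j) + \<theta> * (\<Sum>j\<in>A. \<nu> j * g j)" for g
    proof -
      have "(\<Sum>j\<in>A - {j0}. \<mu> j * g j) = (\<Sum>j\<in>A. \<mu> j * g j)" using \<mu>0 less.prems(1) by (intro sum.mono_neutral_left) auto
      also have "\<dots> = (\<Sum>j\<in>A. \<xi> j * g j) + \<theta> * (\<Sum>j\<in>A. \<nu> j * g j)"
        by (simp add: \<mu>_def sum_distrib_left flip: sum.distrib) (simp add: algebra_simps)
      finally show ?thesis .
    qed
    have c: "card (A - {j0}) < card A" using j0 less.prems(1) by (intro psubset_card_mono) (auto simp: Z_def)
    have "(\<Sum>j\<in>A - {j0}. \<mu> j) = 1" using sm [of "\<lambda>_. 1"] \<nu>1 less.prems(3) by simp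
    moreover have "(\<Sum>j\<in>A - {j0}. \<mu> j * G j i) = w i" if "i < k" for i using sm [of "\<lambda>j. G j i"] \<nu>G less.prems(4) that by simp
    ultimately have "\<exists>B \<mu>. B \<subseteq> A - {j0} \<and> card B \<le> k + 1 \<and> (\<forall>j\<in>B. \<mu> j \<ge> 0) \<and> (\<Sum>j\<in>B. \<mu> j) = 1 \<and> (\<forall>i<k. (\<Sum>j\<in>B. \<mu> j * G j i) = w i)"
      using less.prems(1) \<mu>p by (intro less.hyps [OF c]) auto
    then obtain B \<mu>' where "B \<subseteq> A - {j0} \<and> card B \<le> k + 1 \<and> (\<forall>j\<in>B. \<mu>' j \<ge> 0) \<and> (\<Sum>j\<in>B. \<mu>' j) = 1 \<and> (\<forall>i<k. (\<Sum>j\<in>B. \<mu>' j * G j i) = w i)"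
      by (elim exE)
    then show ?thesis by (intro exI [of _ B] exI [of _ \<mu>']) auto
  qed
qed

section \<open>Quadratics and the critical system of their shifted minimum\<close>

definition quad :: "int \<Rightarrow> (nat \<Rightarrow> int) \<Rightarrow> (nat \<Rightarrow> nat \<Rightarrow> int) \<Rightarrow> nat \<Rightarrow> (nat \<Rightarrow> real) \<Rightarrow> real" where
  "quad c0 c1 c2 k x = of_int c0 + (\<Sum>i<k. of_int (c1 i) * x i) + (\<Sum>i<k. \<Sum>l<k. of_int (c2 i l) * (x i * x l))"

definition quad_grad :: "(nat \<Rightarrow> int) \<Rightarrow> (nat \<Rightarrow> nat \<Rightarrow> int) \<Rightarrow> nat \<Rightarrow> (nat \<Rightarrow> real) \<Rightarrow> nat \<Rightarrow> real" where
  "quad_grad c1 c2 k x i = of_int (c1 i) + (\<Sum>l<k. of_int (c2 i l + c2 l i) * x l)"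

lemma quad_cong: "(\<And>i. i < k \<Longrightarrow> x i = y i) \<Longrightarrow> quad c0 c1 c2 k x = quad c0 c1 c2 k y"
  unfolding quad_def by (intro arg_cong2 [where f = "(+)"] sum.cong refl) auto

lemma quad_expand:
  "quad c0 c1 c2 k (\<lambda>i. x i + \<tau> * v i) = quad c0 c1 c2 k x + \<tau> * (\<Sum>i<k. quad_grad c1 c2 k x i * v i)
     + \<tau>\<^sup>2 * (\<Sum>i<k. \<Sum>l<k. of_int (c2 i l) * (v i * v l))"
proof -
  have "(\<Sum>i<k. \<Sum>l<k. real_of_int (c2 i l) * ((x i + \<tau> * v i) * (x l + \<tau> * v l)))
    = (\<Sum>i<k. \<Sum>l<k. of_int (c2 i l) * (x i * x l)) + \<tau> * (\<Sum>i<k. \<Sum>l<k. of_int (c2 i l) * (v i * x l))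
      + \<tau> * (\<Sum>i<k. \<Sum>l<k. of_int (c2 i l) * (x i * v l)) + \<tau>\<^sup>2 * (\<Sum>i<k. \<Sum>l<k. of_int (c2 i l) * (v i * v l))"
    unfolding sum_distrib_left sum.distrib [symmetric] by (intro sum.cong refl) (simp add: power2_eq_square algebra_simps)
  moreover have "(\<Sum>i<k. \<Sum>l<k. real_of_int (c2 i l) * (x i * v l)) = (\<Sum>i<k. \<Sum>l<k. of_int (c2 l i) * (v i * x l))"
    by (subst sum.swap) (simp add: mult.commute)
  moreover have "(\<Sum>i<k. quad_grad c1 c2 k x i * v i) = (\<Sum>i<k. of_int (c1 i) * v i)
      + (\<Sum>i<k. \<Sum>l<k. of_int (c2 i l) * (v i * x l)) + (\<Sum>i<k. \<Sum>l<k. of_int (c2 l i) * (v i * x l))"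
    unfolding quad_grad_def sum.distrib [symmetric]
    by (intro sum.cong refl) (simp add: sum_distrib_left sum_distrib_right distrib_left distrib_right sum.distrib ac_simps)
  moreover have "(\<Sum>i<k. real_of_int (c1 i) * (x i + \<tau> * v i)) = (\<Sum>i<k. of_int (c1 i) * x i) + \<tau> * (\<Sum>i<k. of_int (c1 i) * v i)"
    by (simp add: sum_distrib_left distrib_left sum.distrib ac_simps)
  ultimately show ?thesis unfolding quad_def by (simp add: algebra_simps)
qed

lemma continuous_on_quad [continuous_intros]: "continuous_on S (quad c0 c1 c2 k)"
  unfolding quad_def by (intro continuous_intros)

text \<open>Multipliers at a maximiser of the perturbed minimum \<open>min\<^sub>j (q\<^sub>j - \<epsilon>\<^sub>j) + \<eta> \<bullet> x\<close>.\<close>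

lemma perturbed_maximin:
  fixes c0 :: "nat \<Rightarrow> int" and c1 :: "nat \<Rightarrow> nat \<Rightarrow> int" and c2 :: "nat \<Rightarrow> nat \<Rightarrow> nat \<Rightarrow> int" and \<epsilon> \<eta> xs :: "nat \<Rightarrow> real"
    and k M :: nat
  defines "q \<equiv> \<lambda>j. quad (c0 j) (c1 j) (c2 j) k"
  assumes M: "M > 0" and box: "\<And>i. i < k \<Longrightarrow> \<exists>j<M. \<forall>x. q j x = 1 - (x i)\<^sup>2"
    and xs: "\<And>j. j < M \<Longrightarrow> q j xs \<ge> 2 * c" and c: "c > 0"
    and \<epsilon>: "\<And>j. j < M \<Longrightarrow> 0 \<le> \<epsilon> j \<and> \<epsilon> j \<le> s" and \<eta>: "\<And>i. i < k \<Longrightarrow> 0 \<le> \<eta> i \<and> \<eta> i \<le> s"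
    and s: "s * (2 * real k + 1) \<le> c"
  obtains x t B \<mu> where "B \<subseteq> {..<M}" "card B \<le> k + 1" "\<And>j. j \<in> B \<Longrightarrow> \<mu> j \<ge> 0" "(\<Sum>j\<in>B. \<mu> j) = 1"
    "\<And>i. i < k \<Longrightarrow> (\<Sum>j\<in>B. \<mu> j * quad_grad (c1 j) (c2 j) k x i) = - \<eta> i"
    "\<And>j. j \<in> B \<Longrightarrow> q j x - \<epsilon> j = t" "\<And>j. j < M \<Longrightarrow> q j x - \<epsilon> j \<ge> t" "t \<ge> c"
proof -
  define m where "m x = Min ((\<lambda>j. q j x - \<epsilon> j) ` {..<M})" for x
  have m_le: "m x \<le> q j x - \<epsilon> j" if "j < M" for x j unfolding m_def using that by auto
  have m_ge: "a \<le> m x" if "\<And>j. j < M \<Longrightarrow> a \<le> q j x - \<epsilon> j" for a x unfolding m_def by (subst Min_ge_iff) (use that M in \<open>auto simp: lessThan_empty_iff\<close>)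
  have m_gr: "a < m x" if "\<And>j. j < M \<Longrightarrow> a < q j x - \<epsilon> j" for a x unfolding m_def by (subst Min_gr_iff) (use that M in \<open>auto simp: lessThan_empty_iff\<close>)
  define F where "F x = m x + (\<Sum>i<k. \<eta> i * x i)" for x
  define Q where "Q = {x :: nat \<Rightarrow> real. \<forall>i. x i \<in> (if i < k then {-1..1} else {0})}"
  have comp: "compact Q" unfolding Q_def by (intro compact_function_box) auto
  have contF: "continuous_on Q F" unfolding F_def m_def q_def
    by (intro continuous_intros continuous_on_Min_family) (use M in auto)
  define x0 where "x0 i = (if i < k then xs i else 0)" for i
  have qx0: "q j x0 = q j xs" for j unfolding q_def by (intro quad_cong) (simp add: x0_def)
  \<comment> \<open>The box constraints belong to the family themselves, so a point where all
    members are positive lies in the interior of the box. Hence the box adds no multipliers of its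
    own at the maximiser.\<close>
  have inQ: "\<bar>y i\<bar> < 1" if y: "\<And>j. j < M \<Longrightarrow> q j y > 0" and i: "i < k" for y i
  proof -
    obtain j where j: "j < M" "q j y = 1 - (y i)\<^sup>2" using box [OF i] by blast
    then have "(y i)\<^sup>2 < 1" using y [OF j(1)] by simp
    then show ?thesis by (simp add: abs_square_less_1)
  qed
  have "q j x0 > 0" if "j < M" for j using xs [OF that] c qx0 by (metis less_le_trans mult_pos_pos zero_less_numeral)
  then have "\<bar>x0 i\<bar> < 1" if "i < k" for i using inQ that by auto
  then have x0Q: "x0 \<in> Q" unfolding Q_def by (auto simp: abs_le_iff x0_def less_imp_le abs_less_iff)
  obtain x where x: "x \<in> Q" "\<And>y. y \<in> Q \<Longrightarrow> F y \<le> F x"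
    using continuous_attains_sup [OF comp _ contF] x0Q by (metis empty_iff)
  have lin: "\<bar>\<Sum>i<k. \<eta> i * y i\<bar> \<le> real k * s" if "y \<in> Q" for y
  proof -
    have "\<bar>\<Sum>i<k. \<eta> i * y i\<bar> \<le> (\<Sum>i<k. \<bar>\<eta> i * y i\<bar>)" by (rule sum_abs)
    also have "\<dots> \<le> (\<Sum>i<k. s * 1)"
    proof (intro sum_mono)
      fix i assume i: "i \<in> {..<k}"
      have "y i \<in> (if i < k then {-1..1} else {0})" using that by (simp add: Q_def)
      then have "\<bar>y i\<bar> \<le> 1" "\<bar>\<eta> i\<bar> \<le> s" using i \<eta> [of i] by (auto simp: abs_le_iff)
      then show "\<bar>\<eta> i * y i\<bar> \<le> s * 1" unfolding abs_mult by (intro mult_mono) auto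
    qed
    finally show ?thesis by simp
  qed
  define t where "t = m x"
  \<comment> \<open>At \<open>x0\<close> the minimum is at least \<open>2 * c - s\<close>, and the
    linear term costs at most \<open>k * s\<close> at each of the two points; the hypothesis on
    \<open>s\<close> absorbs the loss.\<close>
  have tc: "t \<ge> c"
  proof -
    have "2 * c - s \<le> m x0" using xs \<epsilon> qx0 by (intro m_ge) (smt (verit))
    then have "2 * c - s - real k * s \<le> F x0" using lin [OF x0Q] by (simp add: F_def)
    also have "\<dots> \<le> F x" by (rule x(2) [OF x0Q])
    also have "\<dots> \<le> t + real k * s" using lin [OF x(1)] by (simp add: F_def t_def)
    finally show ?thesis using s by (simp add: algebra_simps)
  qed
  have xin: "\<bar>x i\<bar> < 1" if "i < k" for i
  proof (rule inQ [OF _ that])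
    fix j assume "j < M"
    then show "q j x > 0" using m_le [of j x] \<epsilon> [of j] tc c by (simp add: t_def)
  qed
  define A where "A = {j. j < M \<and> q j x - \<epsilon> j = t}"
  have A: "finite A" by (simp add: A_def)
  have "t \<in> (\<lambda>j. q j x - \<epsilon> j) ` {..<M}" unfolding t_def m_def using M by (intro Min_in) auto
  then have Ane: "A \<noteq> {}" by (auto simp: A_def)
  define G where "G j i = quad_grad (c1 j) (c2 j) k x i + \<eta> i" for j i
  \<comment> \<open>A direction with positive scalar product with all active gradients would be an
    ascent direction of \<open>F\<close>. Inactive members keep their distance for small
    \<open>\<tau>\<close>.\<close>
  obtain \<xi> where \<xi>: "\<And>j. j \<in> A \<Longrightarrow> \<xi> j \<ge> 0" "(\<Sum>j\<in>A. \<xi> j) = 1" "\<And>i. i < k \<Longrightarrow> (\<Sum>j\<in>A. \<xi> j * G j i) = 0"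
  proof (rule gordan [OF A Ane, of G k])
    fix v assume v: "\<And>j. j \<in> A \<Longrightarrow> (\<Sum>i<k. G j i * v i) > 0"
    define y where "y \<tau> i = x i + \<tau> * (if i < k then v i else 0)" for \<tau> i
    let ?v = "\<lambda>i. if i < k then v i else 0"
    define V where "V j = (\<Sum>i<k. \<Sum>l<k. of_int (c2 j i l) * (?v i * ?v l))" for j
    have qy: "q j (y \<tau>) = q j x + \<tau> * (\<Sum>i<k. quad_grad (c1 j) (c2 j) k x i * v i) + \<tau>\<^sup>2 * V j" for j \<tau>
      unfolding q_def y_def V_def quad_expand by simp
    define \<Phi> where "\<Phi> j \<tau> = q j (y \<tau>) - \<epsilon> j + (\<Sum>i<k. \<eta> i * y \<tau> i)" for j \<tau>
    have \<Phi>: "\<Phi> j \<tau> = (q j x - \<epsilon> j + (\<Sum>i<k. \<eta> i * x i)) + \<tau> * ((\<Sum>i<k. G j i * v i) + \<tau> * V j)" for j \<tau>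
    proof -
      have "(\<Sum>i<k. \<eta> i * y \<tau> i) = (\<Sum>i<k. \<eta> i * x i) + \<tau> * (\<Sum>i<k. \<eta> i * v i)"
        by (simp add: y_def distrib_left sum.distrib sum_distrib_left ac_simps)
      moreover have "(\<Sum>i<k. G j i * v i) = (\<Sum>i<k. quad_grad (c1 j) (c2 j) k x i * v i) + (\<Sum>i<k. \<eta> i * v i)"
        by (simp add: G_def distrib_right sum.distrib)
      ultimately show ?thesis by (simp add: \<Phi>_def qy power2_eq_square algebra_simps)
    qed
    have Fx: "F x = t + (\<Sum>i<k. \<eta> i * x i)" by (simp add: F_def t_def)
    have "eventually (\<lambda>\<tau>. \<forall>j\<in>{..<M}. F x < \<Phi> j \<tau>) (at_right 0)"
    proof (intro eventually_ball_finite ballI)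
      fix j assume j: "j \<in> {..<M}"
      show "eventually (\<lambda>\<tau>. F x < \<Phi> j \<tau>) (at_right 0)"
      proof (cases "j \<in> A")
        case True
        have "((\<lambda>\<tau>. (\<Sum>i<k. G j i * v i) + \<tau> * V j) \<longlongrightarrow> (\<Sum>i<k. G j i * v i) + 0 * V j) (at_right 0)"
          by (intro tendsto_intros)
        then have "eventually (\<lambda>\<tau>. 0 < (\<Sum>i<k. G j i * v i) + \<tau> * V j) (at_right 0)"
          using v [OF True] by (intro order_tendstoD(1)) auto
        then show ?thesis using eventually_at_right_less [of 0]
        proof eventually_elim
          case (elim \<tau>)
          then show ?case unfolding \<Phi> Fx using True by (simp add: A_def)
        qed
      next
        case False
        then have "F x < q j x - \<epsilon> j + (\<Sum>i<k. \<eta> i * x i)" using m_le [of j x] j by (auto simp: A_def Fx t_def)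
        moreover have "((\<lambda>\<tau>. (q j x - \<epsilon> j + (\<Sum>i<k. \<eta> i * x i)) + \<tau> * ((\<Sum>i<k. G j i * v i) + \<tau> * V j)) \<longlongrightarrow>
            (q j x - \<epsilon> j + (\<Sum>i<k. \<eta> i * x i)) + 0 * ((\<Sum>i<k. G j i * v i) + 0 * V j)) (at_right 0)"
          by (intro tendsto_intros)
        ultimately show ?thesis unfolding \<Phi> by (intro order_tendstoD(1)) auto
      qed
    qed simp
    moreover have "eventually (\<lambda>\<tau>. \<forall>i\<in>{..<k}. \<bar>y \<tau> i\<bar> < 1) (at_right 0)"
    proof (intro eventually_ball_finite ballI)
      fix i assume i: "i \<in> {..<k}"
      have "((\<lambda>\<tau>. \<bar>x i + \<tau> * ?v i\<bar>) \<longlongrightarrow> \<bar>x i + 0 * ?v i\<bar>) (at_right 0)" by (intro tendsto_intros)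
      then show "eventually (\<lambda>\<tau>. \<bar>y \<tau> i\<bar> < 1) (at_right 0)"
        unfolding y_def using xin [of i] i by (intro order_tendstoD(2)) auto
    qed simp
    ultimately have "eventually (\<lambda>\<tau>. (\<forall>j\<in>{..<M}. F x < \<Phi> j \<tau>) \<and> (\<forall>i\<in>{..<k}. \<bar>y \<tau> i\<bar> < 1)) (at_right 0)"
      by eventually_elim auto
    from eventually_happens' [OF trivial_limit_at_right_real this]
    obtain \<tau> where \<tau>: "(\<forall>j\<in>{..<M}. F x < \<Phi> j \<tau>) \<and> (\<forall>i\<in>{..<k}. \<bar>y \<tau> i\<bar> < 1)" ..
    have "y \<tau> i = 0" if i: "\<not> i < k" for i
    proof -
      have "x i \<in> (if i < k then {-1..1} else {0})" using x(1) by (simp add: Q_def)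
      then show ?thesis using i by (simp add: y_def)
    qed
    then have "y \<tau> \<in> Q" using \<tau> by (auto simp: Q_def abs_less_iff less_imp_le)
    moreover have "F x - (\<Sum>i<k. \<eta> i * y \<tau> i) < m (y \<tau>)" using \<tau> by (intro m_gr) (auto simp: \<Phi>_def algebra_simps)
    then have "F x < F (y \<tau>)" by (simp add: F_def)
    ultimately show thesis using x(2) by (meson not_le)
  qed (rule that)
  have gr: "(\<Sum>j\<in>A. \<xi> j * quad_grad (c1 j) (c2 j) k x i) = - \<eta> i" if "i < k" for i
  proof -
    have "(\<Sum>j\<in>A. \<xi> j * G j i) = (\<Sum>j\<in>A. \<xi> j * quad_grad (c1 j) (c2 j) k x i) + (\<Sum>j\<in>A. \<xi> j) * \<eta> i"
      by (simp add: G_def distrib_left sum.distrib sum_distrib_right)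
    then show ?thesis using \<xi>(2,3) that by simp
  qed
  have "\<exists>B \<mu>. B \<subseteq> A \<and> card B \<le> k + 1 \<and> (\<forall>j\<in>B. \<mu> j \<ge> 0) \<and> (\<Sum>j\<in>B. \<mu> j) = 1 \<and>
     (\<forall>i<k. (\<Sum>j\<in>B. \<mu> j * quad_grad (c1 j) (c2 j) k x i) = - \<eta> i)"
    by (rule small_support [OF A, of \<xi>]) (use \<xi> gr in auto)
  then obtain B \<mu> where B: "B \<subseteq> A \<and> card B \<le> k + 1 \<and> (\<forall>j\<in>B. \<mu> j \<ge> 0) \<and> (\<Sum>j\<in>B. \<mu> j) = 1 \<and>
     (\<forall>i<k. (\<Sum>j\<in>B. \<mu> j * quad_grad (c1 j) (c2 j) k x i) = - \<eta> i)" by (elim exE)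
  show ?thesis
    by (rule that [of B \<mu> x t]) (use B tc m_le in \<open>auto simp: A_def t_def\<close>)
qed

text \<open>The degree in Siegel's lemma for quadratic forms, \<open>d = 2\<close>, with the largest
  possible number \<open>K = 2 * k + 1\<close> of separated values: \<open>k\<close> gradient
  equations and at most \<open>k + 1\<close> active quadratics.\<close>

definition D_bound :: "nat \<Rightarrow> nat" where "D_bound k = 2 * (2 * k + 2) * 2 ^ (2 * k + 1)"

text \<open>A bound for \<open>4 * N * T = 8 * N * N * H ^ D\<close>, where
  \<open>N \<le> 2 ^ (2 * k + 2 + D_bound k)\<close> and \<open>H = 4 * (k + 1) * h\<close>.\<close>

definition gap_bound :: "nat \<Rightarrow> nat \<Rightarrow> nat" where
  "gap_bound k h = 2 ^ (3 + 2 * (2 * k + 2 + D_bound k)) * (4 * (k + 1) * h) ^ D_bound k"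

text \<open>\<open>X K\<close> is the homogenising variable, later evaluated at 1.\<close>

lemma int_form_linear:
  assumes "K < m" "k \<le> m"
  shows "int_form m 1 (\<bar>a\<bar> + (\<Sum>l<k. \<bar>b l\<bar>)) (\<lambda>X. of_int a * X K + (\<Sum>l<k. of_int (b l) * X l))"
proof -
  have "int_form m 1 (\<bar>a\<bar> * 1) (\<lambda>X. of_int a * X K)" by (intro int_form_scale int_form_var assms)
  moreover have "int_form m 1 (\<Sum>l<k. \<bar>b l\<bar> * 1) (\<lambda>X. \<Sum>l<k. of_int (b l) * X l)"
    using assms by (intro int_form_sum int_form_scale int_form_var) auto
  ultimately show ?thesis using int_form_add by fastforce
qed

lemma int_form_var2: "i < m \<Longrightarrow> l < m \<Longrightarrow> int_form m 2 1 (\<lambda>X. X i * X l)"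
  using int_form_mult [OF int_form_var [of i m] int_form_var [of l m]] by (simp add: numeral_2_eq_2)

lemma int_form_quad:
  assumes "K < m" "k \<le> m"
  shows "int_form m 2 (\<bar>c0\<bar> + (\<Sum>i<k. \<bar>c1 i\<bar>) + (\<Sum>i<k. \<Sum>l<k. \<bar>c2 i l\<bar>))
    (\<lambda>X. of_int c0 * (X K * X K) + (\<Sum>i<k. of_int (c1 i) * (X i * X K)) + (\<Sum>i<k. \<Sum>l<k. of_int (c2 i l) * (X i * X l)))"
proof -
  have "int_form m 2 (\<bar>c0\<bar> * 1) (\<lambda>X. of_int c0 * (X K * X K))" by (intro int_form_scale int_form_var2 assms)
  moreover have "int_form m 2 (\<Sum>i<k. \<bar>c1 i\<bar> * 1) (\<lambda>X. \<Sum>i<k. of_int (c1 i) * (X i * X K))"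
    using assms by (intro int_form_sum int_form_scale int_form_var2) auto
  moreover have "int_form m 2 (\<Sum>i<k. \<Sum>l<k. \<bar>c2 i l\<bar> * 1) (\<lambda>X. \<Sum>i<k. \<Sum>l<k. of_int (c2 i l) * (X i * X l))"
    using assms by (intro int_form_sum int_form_scale int_form_var2) auto
  ultimately show ?thesis using int_form_add [OF int_form_add] by fastforce
qed

lemma bound_estimate:
  assumes K: "K \<le> 2 * k + 1" and D: "D = 2 * (K + 1) * 2 ^ K" and N: "N = card (multisets_of_size {..<K + 2} D)"
    and T: "T = 2 * int N * int (4 * (k + 1) * h) ^ D" and h: "h \<ge> 1"
  shows "D \<le> D_bound k" "4 * real N * of_int T \<le> real (gap_bound k h)"
proof -
  have pw: "(2::nat) ^ K \<le> 2 ^ (2 * k + 1)" by (rule power_increasing [OF K]) (rule one_le_numeral)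
  have "2 * (K + 1) \<le> 2 * (2 * k + 2)" using K by simp
  then show DD: "D \<le> D_bound k" unfolding D D_bound_def using pw by (rule mult_le_mono)
  have "N = (K + 1 + D) choose D" using N by (simp add: card_multisets_of_size)
  also have "\<dots> \<le> 2 ^ (K + 1 + D)" by (rule binomial_le_pow2)
  also have "\<dots> \<le> 2 ^ (2 * k + 2 + D_bound k)" by (rule power_increasing) (use K DD in linarith, rule one_le_numeral)
  finally have N2: "N \<le> 2 ^ (2 * k + 2 + D_bound k)" .
  have "8 * N * N * (4 * (k + 1) * h) ^ D \<le> 8 * 2 ^ (2 * k + 2 + D_bound k) * 2 ^ (2 * k + 2 + D_bound k) * (4 * (k + 1) * h) ^ D_bound k"
  proof (rule mult_le_mono)
    show "8 * N * N \<le> 8 * 2 ^ (2 * k + 2 + D_bound k) * 2 ^ (2 * k + 2 + D_bound k)"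
      using N2 by (intro mult_le_mono order_refl)
    show "(4 * (k + 1) * h) ^ D \<le> (4 * (k + 1) * h) ^ D_bound k"
      by (rule power_increasing [OF DD]) (use h in \<open>simp add: Suc_le_eq\<close>)
  qed
  also have "\<dots> = gap_bound k h"
  proof -
    have "(2::nat) ^ (3 + 2 * E) = 8 * 2 ^ E * 2 ^ E" for E unfolding mult_2 power_add by simp
    then show ?thesis by (simp only: gap_bound_def)
  qed
  finally have "real (8 * N * N * (4 * (k + 1) * h) ^ D) \<le> real (gap_bound k h)" by (simp only: of_nat_le_iff)
  moreover have "4 * real N * of_int T = real (8 * N * N * (4 * (k + 1) * h) ^ D)" unfolding T by simp
  ultimately show "4 * real N * of_int T \<le> real (gap_bound k h)" by (simp only:)
qed

text \<open>The system satisfied by a maximiser, with \<open>t\<close> and all but one of the multipliers as additional unknowns,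
  consists of as many forms as there are unknowns; \<open>t\<close> itself is the remaining form.\<close>

lemma critical_value_bound:
  fixes c0 :: "nat \<Rightarrow> int" and c1 :: "nat \<Rightarrow> nat \<Rightarrow> int" and c2 :: "nat \<Rightarrow> nat \<Rightarrow> nat \<Rightarrow> int" and k h :: nat
  assumes h: "h \<ge> 1" "\<And>j. j \<in> B \<Longrightarrow> \<bar>c0 j\<bar> + (\<Sum>i<k. \<bar>c1 j i\<bar>) + (\<Sum>i<k. \<Sum>l<k. \<bar>c2 j i l\<bar>) \<le> int h"
    and B: "finite B" "card B \<le> k + 1" "(\<Sum>j\<in>B. \<mu> j) = 1"
    and grad: "\<And>i. i < k \<Longrightarrow> (\<Sum>j\<in>B. \<mu> j * quad_grad (c1 j) (c2 j) k x i) = - (s ^ (b ^ i))"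
    and act: "\<And>j. j \<in> B \<Longrightarrow> quad (c0 j) (c1 j) (c2 j) k x - s ^ (b ^ (k + j)) = t"
    and b: "b > D_bound k" and s: "0 < s" "s * real (gap_bound k h) \<le> c ^ D_bound k" and c: "0 < c" "c \<le> 1" "c \<le> t"
  shows "1 \<le> t * real (gap_bound k h)"
proof -
  define p where "p = card B"
  have "B \<noteq> {}" using B(3) by auto
  then have p: "p \<ge> 1" "p \<le> k + 1" using B by (auto simp: p_def Suc_le_eq card_gt_0_iff)
  obtain \<sigma> where \<sigma>: "bij_betw \<sigma> {..<p} B" using ex_bij_betw_nat_finite [OF B(1)] by (auto simp: p_def atLeast0LessThan)
  have \<sigma>B: "\<sigma> r \<in> B" if "r < p" for r using \<sigma> that by (auto simp: bij_betw_def)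
  define K where "K = k + p"
  \<comment> \<open>The multiplier of \<open>\<sigma> 0\<close> is eliminated by the condition that
    the multipliers sum to 1; its slot \<open>k\<close> holds \<open>t\<close> instead.\<close>
  define X where "X i = (if i < k then x i else if i = k then t else if i < K then \<mu> (\<sigma> (i - k)) else 1)" for i
  define D where "D = 2 * (K + 1) * 2 ^ K"
  define N where "N = card (multisets_of_size {..<K + 2} D)"
  define H where "H = int (4 * (k + 1) * h)"
  define T where "T = 2 * int N * H ^ D"
  have est: "D \<le> D_bound k" "4 * real N * of_int T \<le> real (gap_bound k h)"
    using bound_estimate [OF _ D_def N_def T_def [unfolded H_def] h(1)] p by (auto simp: K_def)
  define gh where "gh j i Y = of_int (c1 j i) * Y K + (\<Sum>l<k. of_int (c2 j i l + c2 j l i) * Y l)" for j i and Y :: "nat \<Rightarrow> real"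
  define qh where "qh j Y = of_int (c0 j) * (Y K * Y K) + (\<Sum>i<k. of_int (c1 j i) * (Y i * Y K)) + (\<Sum>i<k. \<Sum>l<k. of_int (c2 j i l) * (Y i * Y l))" for j and Y :: "nat \<Rightarrow> real"
  \<comment> \<open>The gradient equations get a minus sign, which makes their value the positive
    number \<open>s ^ (b ^ i)\<close>. The active quadratics minus \<open>t\<close> follow, then
    \<open>t\<close> and the constant 1, both homogenised.\<close>
  define \<phi> where "\<phi> i Y = (if i < k then - (gh (\<sigma> 0) i Y * Y K + (\<Sum>r\<in>{1..<p}. Y (k + r) * (gh (\<sigma> r) i Y - gh (\<sigma> 0) i Y)))
     else if i < K then qh (\<sigma> (i - k)) Y - Y k * Y K else if i = K then Y k * Y K else Y K * Y K)" for i and Y :: "nat \<Rightarrow> real"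
  have ghf: "int_form (K + 1) 1 (2 * int h) (gh j i)" if "j \<in> B" "i < k" for j i
  proof -
    have "int_form (K + 1) 1 (\<bar>c1 j i\<bar> + (\<Sum>l<k. \<bar>c2 j i l + c2 j l i\<bar>)) (gh j i)"
      unfolding gh_def by (intro int_form_linear) (auto simp: K_def)
    moreover have "\<bar>c1 j i\<bar> + (\<Sum>l<k. \<bar>c2 j i l + c2 j l i\<bar>) \<le> 2 * int h"
    proof -
      have "(\<Sum>l<k. \<bar>c2 j i l + c2 j l i\<bar>) \<le> (\<Sum>l<k. \<bar>c2 j i l\<bar>) + (\<Sum>l<k. \<bar>c2 j l i\<bar>)"
        unfolding sum.distrib [symmetric] by (intro sum_mono abs_triangle_ineq)
      moreover have "(\<Sum>l<k. \<bar>c2 j i l\<bar>) \<le> (\<Sum>i<k. \<Sum>l<k. \<bar>c2 j i l\<bar>)" using that by (intro member_le_sum [of i]) (auto intro: sum_nonneg)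
      moreover have "(\<Sum>l<k. \<bar>c2 j l i\<bar>) \<le> (\<Sum>i<k. \<Sum>l<k. \<bar>c2 j i l\<bar>)" using that by (intro sum_mono member_le_sum) auto
      moreover have "\<bar>c1 j i\<bar> \<le> (\<Sum>i<k. \<bar>c1 j i\<bar>)" using that by (intro member_le_sum) auto
      moreover have "0 \<le> (\<Sum>i<k. \<bar>c1 j i\<bar>)" by (simp add: sum_nonneg)
      ultimately show ?thesis using h(2) [OF that(1)] abs_ge_zero [of "c0 j"] by linarith
    qed
    ultimately show ?thesis by (rule int_form_mono)
  qed
  have qhf: "int_form (K + 1) 2 (int h) (qh j)" if "j \<in> B" for j
    unfolding qh_def by (rule int_form_mono [OF int_form_quad h(2) [OF that]]) (auto simp: K_def)
  have Hge: "2 * int h + int (p - 1) * (4 * int h) \<le> H" "int h + 1 \<le> H" "1 \<le> H"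
  proof -
    have He: "H = int k * (4 * int h) + 4 * int h" by (simp add: H_def algebra_simps)
    have "int (p - 1) * (4 * int h) \<le> int k * (4 * int h)" using p by (intro mult_right_mono) auto
    then show "2 * int h + int (p - 1) * (4 * int h) \<le> H" unfolding He by linarith
    have "0 \<le> int k * (4 * int h)" by simp
    then show "int h + 1 \<le> H" "1 \<le> H" using h(1) unfolding He by linarith+
  qed
  have \<phi>f: "int_form (K + 1) 2 H (\<phi> i)" if i: "i < K + 2" for i
  proof -
    consider "i < k" | "k \<le> i" "i < K" | "i = K" | "i = K + 1" using i by linarith
    then show ?thesis
    proof cases
      case 1
      have g0: "\<sigma> 0 \<in> B" using \<sigma>B p by auto
      have "int_form (K + 1) (1 + 1) (2 * int h * 1) (\<lambda>Y. gh (\<sigma> 0) i Y * Y K)"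
        by (intro int_form_mult ghf g0 1 int_form_var) auto
      moreover have "int_form (K + 1) (1 + 1) (\<Sum>r\<in>{1..<p}. 1 * (2 * int h + 2 * int h)) (\<lambda>Y. \<Sum>r\<in>{1..<p}. Y (k + r) * (gh (\<sigma> r) i Y - gh (\<sigma> 0) i Y))"
        by (intro int_form_sum int_form_mult int_form_diff ghf g0 1 int_form_var \<sigma>B) (auto simp: K_def)
      ultimately have "int_form (K + 1) (1 + 1) (\<bar>-1\<bar> * (2 * int h * 1 + (\<Sum>r\<in>{1..<p}. 1 * (2 * int h + 2 * int h)))) (\<lambda>Y. of_int (-1) * (gh (\<sigma> 0) i Y * Y K + (\<Sum>r\<in>{1..<p}. Y (k + r) * (gh (\<sigma> r) i Y - gh (\<sigma> 0) i Y))))"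
        by (intro int_form_scale int_form_add)
      then have "int_form (K + 1) 2 (2 * int h + int (p - 1) * (4 * int h)) (\<phi> i)" using 1 by (simp add: \<phi>_def [abs_def] numeral_2_eq_2)
      then show ?thesis using Hge(1) by (rule int_form_mono)
    next
      case 2
      then have "int_form (K + 1) 2 (int h + 1) (\<lambda>Y. qh (\<sigma> (i - k)) Y - Y k * Y K)"
        by (intro int_form_diff qhf \<sigma>B int_form_var2) (auto simp: K_def)
      then have "int_form (K + 1) 2 (int h + 1) (\<phi> i)" using 2 by (simp add: \<phi>_def [abs_def])
      then show ?thesis using Hge(2) by (rule int_form_mono)
    next
      case 3
      have "int_form (K + 1) 2 1 (\<lambda>Y. Y k * Y K)" by (intro int_form_var2) (auto simp: K_def)
      then have "int_form (K + 1) 2 1 (\<phi> i)" using 3 by (simp add: \<phi>_def [abs_def] K_def)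
      then show ?thesis using Hge(3) by (rule int_form_mono)
    next
      case 4
      have "int_form (K + 1) 2 1 (\<lambda>Y. Y K * Y K)" by (intro int_form_var2) (auto simp: K_def)
      then have "int_form (K + 1) 2 1 (\<phi> i)" using 4 by (simp add: \<phi>_def [abs_def] K_def)
      then show ?thesis using Hge(3) by (rule int_form_mono)
    qed
  qed
  have XK: "X K = 1" "X k = t" using p by (auto simp: X_def K_def)
  have Xx: "X i = x i" if "i < k" for i using that by (simp add: X_def)
  have ghX: "gh j i X = quad_grad (c1 j) (c2 j) k x i" for j i
    unfolding gh_def quad_grad_def XK using Xx by simp
  have qhX: "qh j X = quad (c0 j) (c1 j) (c2 j) k x" for j
    unfolding qh_def quad_def XK using Xx by simp
  \<comment> \<open>The shift of a quadratic is attached to its original index, so after renumbering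
    by \<open>\<sigma>\<close> the exponents are still distinct, though not consecutive.\<close>
  define e where "e i = (if i < k then i else k + \<sigma> (i - k))" for i
  have e: "inj_on e {..<K}"
  proof (rule inj_onI)
    fix i l assume il: "i \<in> {..<K}" "l \<in> {..<K}" "e i = e l"
    have "i - k = l - k" if "k \<le> i" "k \<le> l"
    proof -
      have "\<sigma> (i - k) = \<sigma> (l - k)" "i - k \<in> {..<p}" "l - k \<in> {..<p}" using il that by (auto simp: e_def K_def)
      then show ?thesis using \<sigma> by (auto simp: bij_betw_def dest: inj_onD)
    qed
    then show "i = l" using il(3) by (auto simp: e_def split: if_splits)
  qed
  have val: "\<phi> i X = s ^ (b ^ e i)" if i: "i < K" for i
  proof (cases "i < k")
    case True
    have "(\<Sum>j\<in>B. \<mu> j * quad_grad (c1 j) (c2 j) k x i) = (\<Sum>r<p. \<mu> (\<sigma> r) * gh (\<sigma> r) i X)"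
      unfolding ghX by (rule sum.reindex_bij_betw [OF \<sigma>, symmetric])
    moreover have "{..<p} = insert 0 {1..<p}" using p by auto
    moreover have "(\<Sum>r<p. \<mu> (\<sigma> r)) = 1" using sum.reindex_bij_betw [OF \<sigma>, of \<mu>] B(3) by simp
    ultimately have s1: "\<mu> (\<sigma> 0) * gh (\<sigma> 0) i X + (\<Sum>r\<in>{1..<p}. \<mu> (\<sigma> r) * gh (\<sigma> r) i X) = - (s ^ (b ^ i))"
      and s2: "\<mu> (\<sigma> 0) = 1 - (\<Sum>r\<in>{1..<p}. \<mu> (\<sigma> r))" using grad [OF True] by simp_all
    have "(\<Sum>r\<in>{1..<p}. X (k + r) * (gh (\<sigma> r) i X - gh (\<sigma> 0) i X)) = (\<Sum>r\<in>{1..<p}. \<mu> (\<sigma> r) * (gh (\<sigma> r) i X - gh (\<sigma> 0) i X))"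
      by (intro sum.cong) (auto simp: X_def K_def)
    also have "\<dots> = (\<Sum>r\<in>{1..<p}. \<mu> (\<sigma> r) * gh (\<sigma> r) i X) - (\<Sum>r\<in>{1..<p}. \<mu> (\<sigma> r)) * gh (\<sigma> 0) i X"
      by (simp add: right_diff_distrib sum_subtractf sum_distrib_right)
    finally show ?thesis using s1 True unfolding s2 by (simp add: \<phi>_def XK e_def algebra_simps)
  next
    case False
    then have "\<sigma> (i - k) \<in> B" using \<sigma>B i by (auto simp: K_def)
    then show ?thesis using act [of "\<sigma> (i - k)"] False i by (simp add: \<phi>_def qhX XK e_def)
  qed
  have "c ^ D_bound k \<le> c ^ D" using c est(1) by (intro power_decreasing) auto
  moreover have "s * (4 * real N * of_int T) \<le> s * real (gap_bound k h)" using est(2) s(1) by (intro mult_left_mono) auto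
  ultimately have "s * (4 * real N * of_int T) \<le> c ^ D" using s(2) by linarith
  moreover have "k < K" using p by (simp add: K_def)
  then have "\<phi> K X = t" "\<phi> (K + 1) X = 1" by (simp_all add: \<phi>_def XK)
  ultimately have "1 \<le> t * (4 * real N * of_int T)"
    by (intro separated_value_bound [OF \<phi>f Hge(3) _ D_def N_def T_def e _ val _ _ s(1) _ c(1,3)])
      (use b est(1) in simp_all)
  also have "\<dots> \<le> t * real (gap_bound k h)" using est(2) c by (intro mult_left_mono) auto
  finally show ?thesis .
qed

text \<open>\<open>c\<close> is taken from the given positive point, and \<open>s\<close> is then
  small enough for both the maximin argument and the domination by one monomial; neither survives in
  the bound. The base \<open>b = D_bound k + 1\<close> exceeds every multiplicity in a monomial of
  degree at most \<open>D_bound k\<close>, as unique digits require.\<close>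

theorem positive_quadratics_gap:
  fixes c0 :: "nat \<Rightarrow> int" and c1 :: "nat \<Rightarrow> nat \<Rightarrow> int" and c2 :: "nat \<Rightarrow> nat \<Rightarrow> nat \<Rightarrow> int" and k h M :: nat
  defines "q \<equiv> \<lambda>j. quad (c0 j) (c1 j) (c2 j) k"
  assumes h: "h \<ge> 1" "\<And>j. j < M \<Longrightarrow> \<bar>c0 j\<bar> + (\<Sum>i<k. \<bar>c1 j i\<bar>) + (\<Sum>i<k. \<Sum>l<k. \<bar>c2 j i l\<bar>) \<le> int h"
    and M: "M > 0" and box: "\<And>i. i < k \<Longrightarrow> \<exists>j<M. \<forall>x. q j x = 1 - (x i)\<^sup>2"
    and xs: "\<And>j. j < M \<Longrightarrow> q j xs > 0"
  obtains x where "\<And>j. j < M \<Longrightarrow> 1 \<le> q j x * real (gap_bound k h)"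
proof -
  define c where "c = min 1 (Min ((\<lambda>j. q j xs) ` {..<M}) / 2)"
  have Mi: "Min ((\<lambda>j. q j xs) ` {..<M}) > 0" using M xs by (subst Min_gr_iff) (auto simp: lessThan_empty_iff)
  have c: "0 < c" "c \<le> 1" using Mi by (auto simp: c_def)
  have cq: "2 * c \<le> q j xs" if "j < M" for j
  proof -
    have "Min ((\<lambda>j. q j xs) ` {..<M}) \<le> q j xs" using that by (intro Min_le) auto
    then show ?thesis by (simp add: c_def min_def)
  qed
  define G where "G = real (gap_bound k h)"
  have "gap_bound k h \<ge> 1" using h(1) by (simp add: gap_bound_def Suc_le_eq)
  then have G: "G \<ge> 1" by (simp add: G_def)
  define s where "s = min (c / (2 * real k + 1)) (c ^ D_bound k / G)"
  have s: "0 < s" "s * (2 * real k + 1) \<le> c" "s * G \<le> c ^ D_bound k"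
  proof -
    show "0 < s" using c G by (simp add: s_def)
    have "s \<le> c / (2 * real k + 1)" "s \<le> c ^ D_bound k / G" by (simp_all add: s_def)
    then show "s * (2 * real k + 1) \<le> c" "s * G \<le> c ^ D_bound k" using G by (simp_all add: pos_le_divide_eq)
  qed
  have "s * 1 \<le> s * (2 * real k + 1)" using s(1) by (intro mult_left_mono) auto
  then have s1: "s \<le> 1" using s(2) c by linarith
  define b where "b = D_bound k + 1"
  have pw: "0 \<le> s ^ (b ^ n) \<and> s ^ (b ^ n) \<le> s" for n
  proof -
    have "s ^ (b ^ n) \<le> s ^ 1" using s s1 by (intro power_decreasing) (auto simp: b_def Suc_le_eq)
    then show ?thesis using s by simp
  qed
  show ?thesis
  proof (rule perturbed_maximin [where \<epsilon> = "\<lambda>j. s ^ (b ^ (k + j))" and \<eta> = "\<lambda>i. s ^ (b ^ i)" and s = s and c = c and xs = xs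
          and ?c0.0 = c0 and ?c1.0 = c1 and ?c2.0 = c2 and k = k and M = M,
        OF M box [unfolded q_def] cq [unfolded q_def] c(1) pw pw s(2)])
    fix x t B and \<mu> :: "nat \<Rightarrow> real"
    assume 1: "B \<subseteq> {..<M}" "card B \<le> k + 1" "(\<Sum>j\<in>B. \<mu> j) = 1"
      and 2: "\<And>i. i < k \<Longrightarrow> (\<Sum>j\<in>B. \<mu> j * quad_grad (c1 j) (c2 j) k x i) = - (s ^ (b ^ i))"
      and 3: "\<And>j. j \<in> B \<Longrightarrow> quad (c0 j) (c1 j) (c2 j) k x - s ^ (b ^ (k + j)) = t"
      and 4: "\<And>j. j < M \<Longrightarrow> t \<le> quad (c0 j) (c1 j) (c2 j) k x - s ^ (b ^ (k + j))" and 5: "c \<le> t"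
    have B: "finite B" using 1(1) finite_subset by blast
    have 6: "\<bar>c0 j\<bar> + (\<Sum>i<k. \<bar>c1 j i\<bar>) + (\<Sum>i<k. \<Sum>l<k. \<bar>c2 j i l\<bar>) \<le> int h" if "j \<in> B" for j
      using h(2) 1(1) that by blast
    have Db: "D_bound k < b" by (simp add: b_def)
    have "1 \<le> t * real (gap_bound k h)"
      by (rule critical_value_bound [where B = B and \<mu> = \<mu> and x = x and s = s and b = b and c = c and ?c0.0 = c0 and ?c1.0 = c1 and ?c2.0 = c2,
          OF h(1) 6 B 1(2,3) 2 3 Db s(1) s(3) [unfolded G_def] c 5]) assumption+
    then have "1 \<le> t * G" by (simp add: G_def)
    show thesis
    proof (rule that)
      fix j assume "j < M"
      then have "t \<le> q j x" using 4 [of j] pw [of "k + j"] by (simp add: q_def)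
      then have "t * G \<le> q j x * G" using G by (intro mult_right_mono) auto
      then show "1 \<le> q j x * real (gap_bound k h)" using \<open>1 \<le> t * G\<close> by (simp add: G_def)
    qed
  qed assumption+
qed

section \<open>Short realizations\<close>

type_synonym qpoly = "int \<times> (nat \<Rightarrow> int) \<times> (nat \<Rightarrow> nat \<Rightarrow> int)"

definition qval :: "nat \<Rightarrow> qpoly \<Rightarrow> (nat \<Rightarrow> real) \<Rightarrow> real" where
  "qval k P = quad (fst P) (fst (snd P)) (snd (snd P)) k"

definition qnorm :: "nat \<Rightarrow> qpoly \<Rightarrow> int" where
  "qnorm k P = \<bar>fst P\<bar> + (\<Sum>i<k. \<bar>fst (snd P) i\<bar>) + (\<Sum>i<k. \<Sum>l<k. \<bar>snd (snd P) i l\<bar>)"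

definition qneg :: "qpoly \<Rightarrow> qpoly" where
  "qneg P = (- fst P, \<lambda>i. - fst (snd P) i, \<lambda>i l. - snd (snd P) i l)"

lemma qval_qneg [simp]: "qval k (qneg P) x = - qval k P x"
  by (simp add: qval_def qneg_def quad_def sum_negf)

lemma qnorm_qneg [simp]: "qnorm k (qneg P) = qnorm k P"
  by (simp add: qnorm_def qneg_def)

definition dl :: "nat \<Rightarrow> nat \<Rightarrow> int" where "dl i j = (if i = j then 1 else 0)"

lemma sum_dl [simp]: "u < k \<Longrightarrow> (\<Sum>i<k. real_of_int (dl i u) * f i) = f u" "u < k \<Longrightarrow> (\<Sum>i<k. f i * real_of_int (dl i u)) = f u"
  "u < k \<Longrightarrow> (\<Sum>i<k. dl i u) = 1"
  by (simp_all add: dl_def if_distrib if_distribR cong: if_cong)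

lemma dl_nonneg [simp]: "0 \<le> dl i j" "\<bar>dl i j\<bar> = dl i j" by (simp_all add: dl_def)

definition lin :: "nat \<Rightarrow> nat \<Rightarrow> qpoly" where "lin u v = (0, \<lambda>i. dl i u - dl i v, \<lambda>i l. 0)"

text \<open>With slope and intercept of segment \<open>i\<close> in the unknowns
  \<open>4 * i\<close> and \<open>4 * i + 1\<close>, this is the \<open>gap\<close> of segments
  \<open>i\<close> and \<open>j\<close> at the abscissa in the unknown \<open>w\<close>.\<close>

definition gp :: "nat \<Rightarrow> nat \<Rightarrow> nat \<Rightarrow> qpoly" where
  "gp i j w = (0, \<lambda>t. dl t (4 * i + 1) - dl t (4 * j + 1), \<lambda>t u. (dl t (4 * i) - dl t (4 * j)) * dl u w)"

definition bx :: "nat \<Rightarrow> qpoly" where "bx i = (1, \<lambda>t. 0, \<lambda>t u. - dl t i * dl u i)"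

lemma qval_lin: "u < k \<Longrightarrow> v < k \<Longrightarrow> qval k (lin u v) x = x u - x v"
  by (simp add: qval_def lin_def quad_def left_diff_distrib sum_subtractf)

lemma sum_dl2: "u < k \<Longrightarrow> w < k \<Longrightarrow> (\<Sum>i<k. \<Sum>l<k. real_of_int (dl i u * dl l w) * (x i * x l)) = x u * x w"
proof -
  assume u: "u < k" "w < k"
  have "(\<Sum>i<k. \<Sum>l<k. real_of_int (dl i u * dl l w) * (x i * x l)) = (\<Sum>i<k. real_of_int (dl i u) * x i) * (\<Sum>l<k. real_of_int (dl l w) * x l)"
    by (simp add: sum_product ac_simps)
  then show ?thesis using u by simp
qed

lemma qval_bx: "i < k \<Longrightarrow> qval k (bx i) x = 1 - (x i)\<^sup>2"
  using sum_dl2 [of i k i x] by (simp add: qval_def bx_def quad_def sum_negf power2_eq_square)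

lemma qval_gp: "4 * i + 1 < k \<Longrightarrow> 4 * j + 1 < k \<Longrightarrow> w < k \<Longrightarrow>
  qval k (gp i j w) x = (x (4 * i) - x (4 * j)) * x w + (x (4 * i + 1) - x (4 * j + 1))"
  using sum_dl2 [of "4 * i" k w x] sum_dl2 [of "4 * j" k w x]
  by (simp add: qval_def gp_def quad_def left_diff_distrib sum_subtractf)

lemma sum_dl_diff: "u < k \<Longrightarrow> v < k \<Longrightarrow> (\<Sum>i<k. \<bar>dl i u - dl i v\<bar>) \<le> 2"
proof -
  assume uv: "u < k" "v < k"
  have "(\<Sum>i<k. \<bar>dl i u - dl i v\<bar>) \<le> (\<Sum>i<k. dl i u + dl i v)" by (intro sum_mono) (simp add: dl_def)
  also have "\<dots> = 2" using uv by (simp add: sum.distrib)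
  finally show ?thesis .
qed

lemma qnorm_bounds:
  "u < k \<Longrightarrow> v < k \<Longrightarrow> qnorm k (lin u v) \<le> 4"
  "i < k \<Longrightarrow> qnorm k (bx i) \<le> 4"
  "4 * i + 1 < k \<Longrightarrow> 4 * j + 1 < k \<Longrightarrow> w < k \<Longrightarrow> qnorm k (gp i j w) \<le> 4"
proof -
  show "u < k \<Longrightarrow> v < k \<Longrightarrow> qnorm k (lin u v) \<le> 4" using sum_dl_diff [of u k v] by (simp add: qnorm_def lin_def)
  show "i < k \<Longrightarrow> qnorm k (bx i) \<le> 4" by (simp add: qnorm_def bx_def abs_mult flip: sum_product sum_distrib_left)
  show "4 * i + 1 < k \<Longrightarrow> 4 * j + 1 < k \<Longrightarrow> w < k \<Longrightarrow> qnorm k (gp i j w) \<le> 4"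
    using sum_dl_diff [of "4 * i + 1" k "4 * j + 1"] sum_dl_diff [of "4 * i" k "4 * j"]
    by (simp add: qnorm_def gp_def abs_mult flip: sum_distrib_left)
qed

lemma positive_family_gap:
  assumes F: "finite F" "\<And>P. P \<in> F \<Longrightarrow> qnorm k P \<le> int h" "h \<ge> 1" "\<And>i. i < k \<Longrightarrow> bx i \<in> F" "k > 0"
    and pos: "\<And>P. P \<in> F \<Longrightarrow> qval k P X > 0"
  obtains x where "\<And>P. P \<in> F \<Longrightarrow> 1 \<le> qval k P x * real (gap_bound k h)"
proof -
  obtain e where e: "bij_betw e {..<card F} F" using ex_bij_betw_nat_finite [OF F(1)] by (auto simp: atLeast0LessThan)
  have eF: "e j \<in> F" if "j < card F" for j using e that by (auto simp: bij_betw_def)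
  have "F \<noteq> {}" using F(4,5) by auto
  then have M: "card F > 0" using F(1) by (simp add: card_gt_0_iff)
  obtain x where x: "\<And>j. j < card F \<Longrightarrow> 1 \<le> quad (fst (e j)) (fst (snd (e j))) (snd (snd (e j))) k x * real (gap_bound k h)"
  proof (rule positive_quadratics_gap [where h = h and M = "card F" and k = k and xs = X and ?c0.0 = "\<lambda>j. fst (e j)"
        and ?c1.0 = "\<lambda>j. fst (snd (e j))" and ?c2.0 = "\<lambda>j. snd (snd (e j))"])
    show "\<exists>j<card F. \<forall>x. quad (fst (e j)) (fst (snd (e j))) (snd (snd (e j))) k x = 1 - (x i)\<^sup>2" if i: "i < k" for i
    proof -
      obtain j where j: "j < card F" "e j = bx i" using e F(4) [OF i] by (metis bij_betw_imp_surj_on imageE lessThan_iff)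
      then show ?thesis using qval_bx [OF i] unfolding qval_def by (intro exI [of _ j]) auto
    qed
  qed (use F(2,3) M pos eF in \<open>auto simp: qnorm_def qval_def\<close>)
  show ?thesis
  proof (rule that)
    fix P assume "P \<in> F"
    then obtain j where "j < card F" "e j = P" using e by (metis bij_betw_imp_surj_on imageE lessThan_iff)
    then show "1 \<le> qval k P x * real (gap_bound k h)" using x [of j] by (simp add: qval_def)
  qed
qed

lemma qval_lipschitz:
  assumes \<rho>: "\<rho> \<ge> 0" and x: "\<And>i. i < k \<Longrightarrow> \<bar>x i\<bar> \<le> 1 \<and> \<bar>y i\<bar> \<le> 1 \<and> \<bar>x i - y i\<bar> \<le> \<rho>"
  shows "\<bar>qval k P x - qval k P y\<bar> \<le> 2 * \<rho> * of_int (qnorm k P)"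
proof -
  obtain c0 c1 c2 where P: "P = (c0, c1, c2)" by (cases P)
  have 1: "\<bar>(\<Sum>i<k. of_int (c1 i) * x i) - (\<Sum>i<k. of_int (c1 i) * y i)\<bar> \<le> (\<Sum>i<k. of_int \<bar>c1 i\<bar> * (2 * \<rho>))"
    unfolding sum_subtractf [symmetric]
  proof (intro order.trans [OF sum_abs] sum_mono)
    fix i assume i: "i \<in> {..<k}"
    have "\<bar>of_int (c1 i) * x i - of_int (c1 i) * y i\<bar> = of_int \<bar>c1 i\<bar> * \<bar>x i - y i\<bar>" by (simp add: abs_mult flip: right_diff_distrib)
    also have "\<dots> \<le> of_int \<bar>c1 i\<bar> * (2 * \<rho>)" using x [of i] i \<rho> by (intro mult_left_mono) auto
    finally show "\<bar>of_int (c1 i) * x i - of_int (c1 i) * y i\<bar> \<le> of_int \<bar>c1 i\<bar> * (2 * \<rho>)" .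
  qed
  have 2: "\<bar>(\<Sum>i<k. \<Sum>l<k. of_int (c2 i l) * (x i * x l)) - (\<Sum>i<k. \<Sum>l<k. of_int (c2 i l) * (y i * y l))\<bar>
    \<le> (\<Sum>i<k. \<Sum>l<k. of_int \<bar>c2 i l\<bar> * (2 * \<rho>))"
    unfolding sum_subtractf [symmetric]
  proof (intro order.trans [OF sum_abs] sum_mono)
    fix i l assume i: "i \<in> {..<k}" "l \<in> {..<k}"
    have "x i * x l - y i * y l = (x i - y i) * x l + y i * (x l - y l)" by (simp add: algebra_simps)
    then have "\<bar>x i * x l - y i * y l\<bar> \<le> \<bar>x i - y i\<bar> * \<bar>x l\<bar> + \<bar>y i\<bar> * \<bar>x l - y l\<bar>" by (metis abs_mult abs_triangle_ineq)
    also have "\<dots> \<le> \<rho> * 1 + 1 * \<rho>" using x [of i] x [of l] i \<rho> by (intro add_mono mult_mono) auto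
    finally have *: "\<bar>x i * x l - y i * y l\<bar> \<le> 2 * \<rho>" by simp
    have "\<bar>of_int (c2 i l) * (x i * x l) - of_int (c2 i l) * (y i * y l)\<bar> = of_int \<bar>c2 i l\<bar> * \<bar>x i * x l - y i * y l\<bar>"
      by (simp add: abs_mult flip: right_diff_distrib)
    also have "\<dots> \<le> of_int \<bar>c2 i l\<bar> * (2 * \<rho>)" using * by (intro mult_left_mono) auto
    finally show "\<bar>of_int (c2 i l) * (x i * x l) - of_int (c2 i l) * (y i * y l)\<bar> \<le> of_int \<bar>c2 i l\<bar> * (2 * \<rho>)" .
  qed
  have "\<bar>qval k P x - qval k P y\<bar> \<le> (\<Sum>i<k. of_int \<bar>c1 i\<bar> * (2 * \<rho>)) + (\<Sum>i<k. \<Sum>l<k. of_int \<bar>c2 i l\<bar> * (2 * \<rho>))"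
    using 1 2 unfolding qval_def quad_def P by simp
  also have "\<dots> = 2 * \<rho> * of_int (qnorm k P - \<bar>c0\<bar>)"
    by (simp add: qnorm_def P sum_distrib_left sum_distrib_right algebra_simps)
  also have "\<dots> \<le> 2 * \<rho> * of_int (qnorm k P)"
    using \<rho> by (intro mult_left_mono) auto
  finally show ?thesis .
qed

definition av :: "(nat \<Rightarrow> real) \<Rightarrow> nat \<Rightarrow> real" where "av X i = X (4 * i)"
definition bv :: "(nat \<Rightarrow> real) \<Rightarrow> nat \<Rightarrow> real" where "bv X i = X (4 * i + 1)"
definition lv :: "(nat \<Rightarrow> real) \<Rightarrow> nat \<Rightarrow> real" where "lv X i = X (4 * i + 2)"
definition rv :: "(nat \<Rightarrow> real) \<Rightarrow> nat \<Rightarrow> real" where "rv X i = X (4 * i + 3)"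

definition endpoints :: "nat \<Rightarrow> nat set" where "endpoints n = (\<Union>i<n. {4 * i + 2, 4 * i + 3})"

definition family :: "nat \<Rightarrow> qpoly set" where
  "family n = (\<Union>u\<in>endpoints n. \<Union>v\<in>endpoints n. {lin u v}) \<union> (\<Union>i<n. \<Union>j<n. \<Union>w\<in>endpoints n. {gp i j w})"

lemma endpoints_less: "u \<in> endpoints n \<Longrightarrow> u < 4 * n" by (auto simp: endpoints_def)

lemma finite_family: "finite (family n)" by (simp add: family_def endpoints_def)

lemma qnorm_family: "P \<in> family n \<Longrightarrow> qnorm (4 * n) P \<le> 4"
  unfolding family_def using endpoints_less by (auto intro!: qnorm_bounds)

text \<open>Proper crossings and strict misses are decided by nonzero members of
  \<open>family\<close> alone: the relevant comparisons of ends and the signs of \<open>gap\<close>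
  at these ends. Values that vanish at \<open>X\<close> may therefore take any sign at
  \<open>Y\<close>.\<close>

lemma same_signs_same_meets:
  assumes sg: "\<And>P. P \<in> family n \<Longrightarrow> qval (4 * n) P X \<noteq> 0 \<Longrightarrow> sgn (qval (4 * n) P Y) = sgn (qval (4 * n) P X)"
    and ij: "i < n" "j < n" and lr: "\<And>i. i < n \<Longrightarrow> lv X i < rv X i"
  shows "lv Y i < rv Y i"
    "crosses (av X) (bv X) (lv X) (rv X) i j \<Longrightarrow> meets (av Y) (bv Y) (lv Y) (rv Y) i j"
    "\<not> meets (av X) (bv X) (lv X) (rv X) i j \<Longrightarrow> \<not> meets (av Y) (bv Y) (lv Y) (rv Y) i j"
proof -
  have lt: "Y u < Y v" if "u \<in> endpoints n" "v \<in> endpoints n" "X u < X v" for u v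
  proof -
    have "lin u v \<in> family n" unfolding family_def using that(1,2) by blast
    then have "sgn (Y u - Y v) = sgn (X u - X v)"
      using sg [of "lin u v"] that endpoints_less by (simp add: qval_lin)
    then show ?thesis using that(3) by (simp add: sgn_if split: if_splits)
  qed
  have gs: "sgn (gap (av Y) (bv Y) i j (Y w)) = sgn (gap (av X) (bv X) i j (X w))"
    if "w \<in> endpoints n" "gap (av X) (bv X) i j (X w) \<noteq> 0" for w
  proof -
    have "gp i j w \<in> family n" unfolding family_def using that(1) ij by blast
    moreover have "qval (4 * n) (gp i j w) Z = gap (av Z) (bv Z) i j (Z w)" for Z
      using ij endpoints_less [OF that(1)] by (subst qval_gp) (auto simp: gap_def av_def bv_def)
    ultimately show ?thesis using sg [of "gp i j w"] that(2) by simp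
  qed
  have ends: "4 * i + 2 \<in> endpoints n" "4 * i + 3 \<in> endpoints n" "4 * j + 2 \<in> endpoints n" "4 * j + 3 \<in> endpoints n"
    using ij by (auto simp: endpoints_def)
  define LX RX LY RY where "LX = max (lv X i) (lv X j)" and "RX = min (rv X i) (rv X j)"
    and "LY = max (lv Y i) (lv Y j)" and "RY = min (rv Y i) (rv Y j)"
  have L: "sgn (gap (av Y) (bv Y) i j LY) = sgn (gap (av X) (bv X) i j LX)" if "gap (av X) (bv X) i j LX \<noteq> 0"
  proof -
    \<comment> \<open>If the two left ends tie for \<open>X\<close>, either index represents
      \<open>LX\<close>, and \<open>w\<close> is the one that represents \<open>LY\<close>.\<close>
    obtain w where "w \<in> {4 * i + 2, 4 * j + 2}" "LX = X w" "LY = Y w"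
      using lt [OF ends(1,3)] lt [OF ends(3,1)] unfolding LX_def LY_def lv_def
      by (metis insert_iff linorder_neqE_linordered_idom max.absorb1 max.absorb2 max.idem max_def order_less_imp_le)
    then show ?thesis using gs [of w] ends that by auto
  qed
  have R: "sgn (gap (av Y) (bv Y) i j RY) = sgn (gap (av X) (bv X) i j RX)" if "gap (av X) (bv X) i j RX \<noteq> 0"
  proof -
    obtain w where "w \<in> {4 * i + 3, 4 * j + 3}" "RX = X w" "RY = Y w"
      using lt [OF ends(2,4)] lt [OF ends(4,2)] unfolding RX_def RY_def rv_def
      by (metis insert_iff linorder_neqE_linordered_idom min.absorb1 min.absorb2 min.idem min_def order_less_imp_le)
    then show ?thesis using gs [of w] ends that by auto
  qed
  show "lv Y i < rv Y i" using lt [OF ends(1,2)] lr [OF ij(1)] by (simp add: lv_def rv_def)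
  have prod: "sgn (gap (av Y) (bv Y) i j LY * gap (av Y) (bv Y) i j RY) = sgn (gap (av X) (bv X) i j LX * gap (av X) (bv X) i j RX)"
    if "gap (av X) (bv X) i j LX * gap (av X) (bv X) i j RX \<noteq> 0"
    using L R that by (simp add: sgn_mult)
  show "meets (av Y) (bv Y) (lv Y) (rv Y) i j" if c: "crosses (av X) (bv X) (lv X) (rv X) i j"
  proof -
    have X: "LX < RX" "gap (av X) (bv X) i j LX * gap (av X) (bv X) i j RX < 0"
      using c by (auto simp: crosses_def LX_def RX_def)
    then have "LY < RY" using lt [OF ends(1,2)] lt [OF ends(1,4)] lt [OF ends(3,2)] lt [OF ends(3,4)]
      by (auto simp: LX_def RX_def LY_def RY_def lv_def rv_def)
    moreover have "gap (av Y) (bv Y) i j LY * gap (av Y) (bv Y) i j RY < 0"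
      using prod X(2) by (metis less_irrefl sgn_less)
    ultimately show ?thesis by (simp add: meets_def LY_def RY_def)
  qed
  show "\<not> meets (av Y) (bv Y) (lv Y) (rv Y) i j" if c: "\<not> meets (av X) (bv X) (lv X) (rv X) i j"
  proof (cases "LX \<le> RX")
    case True
    then have "gap (av X) (bv X) i j LX * gap (av X) (bv X) i j RX > 0" using c by (force simp: meets_def LX_def RX_def)
    then have "gap (av Y) (bv Y) i j LY * gap (av Y) (bv Y) i j RY > 0"
      using prod by (metis less_irrefl sgn_greater)
    then show ?thesis by (auto simp: meets_def LY_def RY_def)
  next
    case False
    then have "RY < LY" using lt [OF ends(2,1)] lt [OF ends(2,3)] lt [OF ends(4,1)] lt [OF ends(4,3)]
      by (auto simp: LX_def RX_def LY_def RY_def lv_def rv_def not_le less_max_iff_disj min_less_iff_disj)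
    then show ?thesis by (auto simp: meets_def LY_def RY_def)
  qed
qed

text \<open>The map \<open>(x, y)\<close> to \<open>(\<epsilon> x, \<epsilon>^2 y)\<close>
  multiplies slopes and abscissae by \<open>\<epsilon>\<close> and intercepts by
  \<open>\<epsilon>^2\<close>. It moves all unknowns into the unit box without changing the
  incidences.\<close>

lemma scaled_crosses:
  assumes "\<epsilon> > 0"
  shows "crosses (\<lambda>i. \<epsilon> * a i) (\<lambda>i. \<epsilon>\<^sup>2 * b i) (\<lambda>i. \<epsilon> * l i) (\<lambda>i. \<epsilon> * r i) i j = crosses a b l r i j"
    "meets (\<lambda>i. \<epsilon> * a i) (\<lambda>i. \<epsilon>\<^sup>2 * b i) (\<lambda>i. \<epsilon> * l i) (\<lambda>i. \<epsilon> * r i) i j = meets a b l r i j"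
proof -
  have g: "gap (\<lambda>i. \<epsilon> * a i) (\<lambda>i. \<epsilon>\<^sup>2 * b i) i j (\<epsilon> * x) = \<epsilon>\<^sup>2 * gap a b i j x" for x
    by (simp add: gap_def power2_eq_square algebra_simps)
  have m: "max (\<epsilon> * x) (\<epsilon> * y) = \<epsilon> * max x y" "min (\<epsilon> * x) (\<epsilon> * y) = \<epsilon> * min x y" for x y
    using assms by (auto simp: max_def min_def)
  have p: "(\<epsilon>\<^sup>2 * x) * (\<epsilon>\<^sup>2 * y) = \<epsilon> ^ 4 * (x * y)" for x y by (simp add: power2_eq_square power4_eq_xxxx)
  show "crosses (\<lambda>i. \<epsilon> * a i) (\<lambda>i. \<epsilon>\<^sup>2 * b i) (\<lambda>i. \<epsilon> * l i) (\<lambda>i. \<epsilon> * r i) i j = crosses a b l r i j"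
    "meets (\<lambda>i. \<epsilon> * a i) (\<lambda>i. \<epsilon>\<^sup>2 * b i) (\<lambda>i. \<epsilon> * l i) (\<lambda>i. \<epsilon> * r i) i j = meets a b l r i j"
    unfolding crosses_def meets_def m g p using assms by (simp_all add: mult_less_0_iff mult_le_0_iff)
qed

text \<open>There are four unknowns per segment and quadratics of coefficient sum at most 4, hence
  \<open>gap_bound (4 * n) 4\<close>. A point with all values above the reciprocal of this number
  tolerates rounding of its coordinates.\<close>

lemma dyadic_parameters:
  fixes a b l r :: "nat \<Rightarrow> real"
  assumes lr: "\<And>i. i < n \<Longrightarrow> l i < r i" and n: "n > 0"
    and strict: "\<And>i j. i < n \<Longrightarrow> j < n \<Longrightarrow> i \<noteq> j \<Longrightarrow> crosses a b l r i j \<or> \<not> meets a b l r i j"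
    and q: "8 * gap_bound (4 * n) 4 < 2 ^ q"
  obtains Z :: "nat \<Rightarrow> int" where "\<And>i. i < 4 * n \<Longrightarrow> \<bar>Z i\<bar> \<le> 2 ^ q"
    "\<And>i. i < n \<Longrightarrow> lv (\<lambda>i. of_int (Z i) / 2 ^ q) i < rv (\<lambda>i. of_int (Z i) / 2 ^ q) i"
    "\<And>i j. i < n \<Longrightarrow> j < n \<Longrightarrow> i \<noteq> j \<Longrightarrow>
      meets (av (\<lambda>i. of_int (Z i) / 2 ^ q)) (bv (\<lambda>i. of_int (Z i) / 2 ^ q)) (lv (\<lambda>i. of_int (Z i) / 2 ^ q)) (rv (\<lambda>i. of_int (Z i) / 2 ^ q)) i j
      = meets a b l r i j"
proof -
  define m where "m = 1 + (\<Sum>i<n. \<bar>a i\<bar> + \<bar>b i\<bar> + \<bar>l i\<bar> + \<bar>r i\<bar>)"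
  have mb: "\<bar>a i\<bar> < m \<and> \<bar>b i\<bar> < m \<and> \<bar>l i\<bar> < m \<and> \<bar>r i\<bar> < m" if "i < n" for i
  proof -
    have "\<bar>a i\<bar> + \<bar>b i\<bar> + \<bar>l i\<bar> + \<bar>r i\<bar> \<le> (\<Sum>i<n. \<bar>a i\<bar> + \<bar>b i\<bar> + \<bar>l i\<bar> + \<bar>r i\<bar>)"
      using that by (intro member_le_sum) auto
    then show ?thesis unfolding m_def by linarith
  qed
  have m1: "m \<ge> 1" unfolding m_def by (simp add: sum_nonneg)
  define \<epsilon> where "\<epsilon> = 1 / m"
  have \<epsilon>: "\<epsilon> > 0" "\<epsilon> \<le> 1" using m1 by (auto simp: \<epsilon>_def)
  define X where "X u = (let i = u div 4 in if u mod 4 = 0 then \<epsilon> * a i else if u mod 4 = 1 then \<epsilon>\<^sup>2 * b i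
     else if u mod 4 = 2 then \<epsilon> * l i else \<epsilon> * r i)" for u
  have Xv: "av X = (\<lambda>i. \<epsilon> * a i)" "bv X = (\<lambda>i. \<epsilon>\<^sup>2 * b i)" "lv X = (\<lambda>i. \<epsilon> * l i)" "rv X = (\<lambda>i. \<epsilon> * r i)"
  proof -
    have "(4 * i + 1) div 4 = i" "(4 * i + 2) div 4 = i" "(4 * i + 3) div 4 = i" "(4 * i + 1) mod 4 = 1"
      "(4 * i + 2) mod 4 = 2" "(4 * i + 3) mod 4 = 3" for i :: nat by presburger+
    then show "av X = (\<lambda>i. \<epsilon> * a i)" "bv X = (\<lambda>i. \<epsilon>\<^sup>2 * b i)" "lv X = (\<lambda>i. \<epsilon> * l i)" "rv X = (\<lambda>i. \<epsilon> * r i)"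
      unfolding X_def av_def bv_def lv_def rv_def Let_def fun_eq_iff by simp_all
  qed
  have Xb: "\<bar>X u\<bar> < 1" if "u < 4 * n" for u
  proof -
    have i: "u div 4 < n" using that by auto
    have e1: "\<bar>\<epsilon> * t\<bar> < 1" if "\<bar>t\<bar> < m" for t using that m1 by (simp add: \<epsilon>_def abs_mult)
    have e2: "\<bar>\<epsilon>\<^sup>2 * t\<bar> < 1" if "\<bar>t\<bar> < m" for t
    proof -
      have "\<bar>\<epsilon>\<^sup>2 * t\<bar> = \<epsilon> * \<bar>\<epsilon> * t\<bar>" using \<epsilon> by (simp add: power2_eq_square abs_mult)
      also have "\<dots> \<le> 1 * \<bar>\<epsilon> * t\<bar>" using \<epsilon> by (intro mult_right_mono) auto
      finally show ?thesis using e1 [OF that] by simp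
    qed
    show ?thesis using mb [OF i] e1 e2 by (simp add: X_def Let_def)
  qed
  \<comment> \<open>Each member of \<open>family\<close> enters with the sign that makes it positive
    at \<open>X\<close>. Those vanishing there are left out, since only nonzero signs have to be
    kept.\<close>
  define F where "F = {P \<in> family n. qval (4 * n) P X > 0} \<union> qneg ` {P \<in> family n. qval (4 * n) P X < 0} \<union> bx ` {..<4 * n}"
  have F: "finite F" "\<And>P. P \<in> F \<Longrightarrow> qnorm (4 * n) P \<le> int 4" "\<And>i. i < 4 * n \<Longrightarrow> bx i \<in> F"
    using finite_family qnorm_family qnorm_bounds(2) by (auto simp: F_def)
  have Fpos: "qval (4 * n) P X > 0" if "P \<in> F" for P
    using that Xb by (auto simp: F_def qval_bx abs_square_less_1)
  obtain x where x: "\<And>P. P \<in> F \<Longrightarrow> 1 \<le> qval (4 * n) P x * real (gap_bound (4 * n) 4)"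
    by (rule positive_family_gap [OF F(1,2) _ F(3) _ Fpos]) (use n in auto)
  have G: "gap_bound (4 * n) 4 > 0" by (simp add: gap_bound_def)
  have xpos: "qval (4 * n) P x > 0" if "P \<in> F" for P
    using x [OF that] G by (metis less_le_trans of_nat_0_less_iff zero_less_mult_pos2 zero_less_one)
  have xb: "\<bar>x u\<bar> < 1" if "u < 4 * n" for u
    using xpos [OF F(3) [OF that]] that by (simp add: qval_bx abs_square_less_1)
  define Z where "Z u = \<lfloor>x u * 2 ^ q\<rfloor>" for u
  define Y where "Y u = real_of_int (Z u) / 2 ^ q" for u
  have Zb: "\<bar>Z u\<bar> \<le> 2 ^ q" if "u < 4 * n" for u
  proof -
    have "\<bar>x u * 2 ^ q\<bar> \<le> 2 ^ q" using xb [OF that] by (simp add: abs_mult)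
    then have u: "x u * 2 ^ q \<le> 2 ^ q" and l: "- (2 ^ q) \<le> x u * 2 ^ q" by linarith+
    have "real_of_int (Z u) \<le> 2 ^ q" using u unfolding Z_def by linarith
    then have "real_of_int (Z u) \<le> real_of_int (2 ^ q)" by simp
    then have "Z u \<le> 2 ^ q" by (simp only: of_int_le_iff)
    moreover have "- (2 ^ q) \<le> Z u" using l unfolding Z_def by (simp add: le_floor_iff)
    ultimately have "- (2 ^ q) \<le> Z u" "Z u \<le> 2 ^ q" by auto
    then show ?thesis by simp
  qed
  have Yx: "\<bar>x u\<bar> \<le> 1 \<and> \<bar>Y u\<bar> \<le> 1 \<and> \<bar>x u - Y u\<bar> \<le> 1 / 2 ^ q" if "u < 4 * n" for u
  proof -
    have "\<bar>real_of_int (Z u)\<bar> \<le> 2 ^ q" using Zb [OF that] by (metis of_int_abs of_int_le_iff of_int_numeral of_int_power)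
    then have "\<bar>Y u\<bar> \<le> 1" by (simp add: Y_def abs_divide)
    moreover have "\<bar>x u * 2 ^ q - of_int (Z u)\<bar> \<le> 1" unfolding Z_def by linarith
    then have "\<bar>x u - Y u\<bar> \<le> 1 / 2 ^ q" by (simp add: Y_def field_simps abs_divide flip: abs_mult)
    ultimately show ?thesis using xb [OF that] by simp
  qed
  have Ypos: "qval (4 * n) P Y > 0" if P: "P \<in> F" for P
  proof -
    \<comment> \<open>Rounding moves each unknown by at most \<open>1 / 2 ^ q\<close>, and hence a
      quadratic of norm at most 4 by at most \<open>8 / 2 ^ q\<close>.\<close>
    have "\<bar>qval (4 * n) P x - qval (4 * n) P Y\<bar> \<le> 2 * (1 / 2 ^ q) * of_int (qnorm (4 * n) P)"
      by (rule qval_lipschitz) (use Yx in auto)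
    also have "\<dots> \<le> 2 * (1 / 2 ^ q) * 4" using F(2) [OF P] by (intro mult_left_mono) auto
    also have "\<dots> = 8 / 2 ^ q" by simp
    also have "\<dots> < 1 / real (gap_bound (4 * n) 4)"
    proof -
      have "real (8 * gap_bound (4 * n) 4) < real (2 ^ q)" using q by (simp only: of_nat_less_iff)
      then show ?thesis using G by (simp add: field_simps)
    qed
    also have "\<dots> \<le> qval (4 * n) P x" using x [OF P] G by (simp add: field_simps)
    finally show ?thesis by linarith
  qed
  have sg: "sgn (qval (4 * n) P Y) = sgn (qval (4 * n) P X)" if "P \<in> family n" "qval (4 * n) P X \<noteq> 0" for P
  proof (cases "qval (4 * n) P X > 0")
    case True
    then show ?thesis using Ypos [of P] that by (simp add: F_def)
  next
    case False
    then have "qval (4 * n) P X < 0" using that by simp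
    then show ?thesis using Ypos [of "qneg P"] that by (simp add: F_def)
  qed
  have lrX: "lv X i < rv X i" if "i < n" for i using lr [OF that] \<epsilon> by (simp add: Xv)
  note ss = same_signs_same_meets [OF sg _ _ lrX, simplified Xv scaled_crosses [OF \<epsilon>(1)]]
  show ?thesis
  proof (rule that [of Z])
    show "\<bar>Z i\<bar> \<le> 2 ^ q" if "i < 4 * n" for i by (rule Zb [OF that])
    have YZ: "(\<lambda>i. of_int (Z i) / 2 ^ q) = Y" by (simp add: Y_def fun_eq_iff)
    show "lv (\<lambda>i. of_int (Z i) / 2 ^ q) i < rv (\<lambda>i. of_int (Z i) / 2 ^ q) i" if "i < n" for i
      unfolding YZ using ss(1) that by blast
    show "meets (av (\<lambda>i. of_int (Z i) / 2 ^ q)) (bv (\<lambda>i. of_int (Z i) / 2 ^ q)) (lv (\<lambda>i. of_int (Z i) / 2 ^ q)) (rv (\<lambda>i. of_int (Z i) / 2 ^ q)) i j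
      = meets a b l r i j" if "i < n" "j < n" "i \<noteq> j" for i j
      unfolding YZ using ss(2,3) [of i j] strict [OF that] crosses_imp_meets that by blast
  qed
qed

section \<open>Bit sizes of dyadic rationals\<close>

lemma bitsize_int_le:
  assumes "\<bar>z\<bar> \<le> 2 ^ m" shows "bitsize_int z \<le> m + 2"
proof -
  have "real_of_int \<bar>z\<bar> \<le> real_of_int (2 ^ m)" using assms by (simp only: of_int_le_iff)
  then have "real_of_int \<bar>z\<bar> \<le> 2 ^ m" by simp
  moreover have "(1 :: real) \<le> 2 ^ m" by simp
  ultimately have "real_of_int \<bar>z\<bar> + 1 \<le> 2 ^ Suc m" unfolding power_Suc by linarith
  then have "log 2 (real_of_int \<bar>z\<bar> + 1) \<le> log 2 (2 ^ Suc m)" by (subst log_le_cancel_iff) auto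
  also have "\<dots> = real (Suc m)" by (subst log_nat_power) auto
  finally have "log 2 (real_of_int \<bar>z\<bar> + 1) \<le> real (Suc m)" .
  then have "\<lceil>log 2 (real_of_int \<bar>z\<bar> + 1)\<rceil> \<le> int (Suc m)" by linarith
  then show ?thesis unfolding bitsize_int_def by linarith
qed

text \<open>Passing to lowest terms divides numerator and denominator by a common positive integer,
  so neither grows.\<close>

lemma quotient_of_le:
  assumes "r * of_int d = of_int z" "d > 0" "quotient_of r = (u, w)"
  shows "\<bar>u\<bar> \<le> \<bar>z\<bar>" "\<bar>w\<bar> \<le> d"
proof -
  have w: "w > 0" "coprime u w" using quotient_of_denom_pos quotient_of_coprime assms(3) by auto
  have "r * of_int w = of_int u" using quotient_of_div [OF assms(3)] w(1) by simp
  then have "of_int (u * d) = (of_int (z * w) :: rat)" using assms(1) by (metis mult.commute mult.left_commute of_int_mult)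
  then have e: "u * d = z * w" by (simp only: of_int_eq_iff)
  then have "w dvd u * d" by simp
  then have "w dvd d" using w(2) by (metis coprime_commute coprime_dvd_mult_right_iff)
  then obtain k where k: "d = w * k" by (auto simp: dvd_def)
  then have "k > 0" using assms(2) w(1) by (simp add: zero_less_mult_iff)
  have "z = u * k" using e w(1) unfolding k by (simp add: mult.left_commute mult.commute)
  then have "\<bar>z\<bar> = \<bar>u\<bar> * k" using \<open>k > 0\<close> by (simp add: abs_mult)
  then show "\<bar>u\<bar> \<le> \<bar>z\<bar>" using mult_left_mono [of 1 k "\<bar>u\<bar>"] \<open>k > 0\<close> by simp
  show "\<bar>w\<bar> \<le> d" using mult_left_mono [of 1 k w] w(1) \<open>k > 0\<close> unfolding k by simp
qed

lemma bitsize_rat_le: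
  assumes "\<bar>z\<bar> \<le> 2 ^ k" "m \<le> k" shows "bitsize_rat (of_int z / 2 ^ m) \<le> 2 * k + 4"
proof -
  obtain u w where q: "quotient_of (of_int z / 2 ^ m) = (u, w)" by (cases "quotient_of (of_int z / 2 ^ m)")
  have "\<bar>u\<bar> \<le> \<bar>z\<bar>" "\<bar>w\<bar> \<le> 2 ^ m" using quotient_of_le [OF _ _ q, of "2 ^ m" z] by auto
  moreover have "(2 :: int) ^ m \<le> 2 ^ k" using assms(2) by (intro power_increasing) auto
  ultimately have "\<bar>u\<bar> \<le> 2 ^ k" "\<bar>w\<bar> \<le> 2 ^ k" using assms(1) by linarith+
  then have "bitsize_int u \<le> k + 2" "bitsize_int w \<le> k + 2" by - (rule bitsize_int_le, assumption)+
  then show ?thesis unfolding bitsize_rat_def q by simp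
qed

text \<open>The exponent in the estimate of \<open>8 * gap_bound k 4\<close> for
  \<open>k = 4 * n\<close>, using \<open>4 * (k + 1) * 4 \<le> 2 ^ (k + 4)\<close>. The 7 consists
  of 3 for the factor 8, 3 from \<open>gap_bound\<close>, and 1 for strictness.\<close>

definition seg_bits :: "nat \<Rightarrow> nat" where
  "seg_bits n = 7 + 2 * (2 * (4 * n) + 2 + D_bound (4 * n)) + (4 * n + 4) * D_bound (4 * n)"

lemma gap_bound_less: "8 * gap_bound (4 * n) 4 < 2 ^ seg_bits n"
proof -
  define k where "k = 4 * n"
  define D where "D = D_bound k"
  have "k + 1 \<le> 2 ^ k" by (simp add: Suc_le_eq)
  then have "4 * (k + 1) * 4 \<le> 2 ^ (k + 4)" by (simp add: power_add)
  then have "(4 * (k + 1) * 4) ^ D \<le> (2 ^ (k + 4)) ^ D" by (rule power_mono) simp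
  also have "\<dots> = 2 ^ ((k + 4) * D)" by (simp only: power_mult)
  finally have "8 * gap_bound k 4 \<le> 2 ^ 3 * (2 ^ (3 + 2 * (2 * k + 2 + D)) * 2 ^ ((k + 4) * D))"
    unfolding gap_bound_def D_def [symmetric] by simp
  also have "\<dots> = 2 ^ (3 + (3 + 2 * (2 * k + 2 + D)) + (k + 4) * D)" by (simp only: power_add mult.assoc)
  also have "\<dots> < 2 ^ seg_bits n" unfolding seg_bits_def k_def [symmetric] D_def [symmetric]
    by (rule power_strict_increasing) auto
  finally show ?thesis unfolding k_def .
qed

lemma seg_bits_le: "seg_bits n \<le> 2 ^ (16 * n + 7)"
proof -
  define k where "k = 4 * n"
  have k: "k + 1 \<le> 2 ^ k" by (simp add: Suc_le_eq)
  have D: "D_bound k \<le> 2 ^ (3 * k + 3)"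
  proof -
    have "D_bound k = 4 * (k + 1) * 2 ^ (2 * k + 1)" by (simp add: D_bound_def algebra_simps)
    also have "\<dots> \<le> 4 * 2 ^ k * 2 ^ (2 * k + 1)" using k by simp
    also have "\<dots> = 2 ^ (2 + k + (2 * k + 1))" by (simp only: power_add) simp
    also have "2 + k + (2 * k + 1) = 3 * k + 3" by simp
    finally show ?thesis .
  qed
  have "k + 4 \<le> 4 * (k + 1)" by simp
  also have "\<dots> \<le> 2 ^ 2 * 2 ^ k" using k by simp
  also have "\<dots> = 2 ^ (k + 2)" by (simp add: power_add)
  finally have "k + 4 \<le> 2 ^ (k + 2)" .
  then have "(k + 4) * D_bound k \<le> 2 ^ (k + 2) * 2 ^ (3 * k + 3)" using D by (rule mult_le_mono)
  also have "\<dots> = 2 ^ (4 * k + 5)" by (simp only: flip: power_add) (simp add: algebra_simps)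
  finally have a: "(k + 4) * D_bound k \<le> 2 ^ (4 * k + 5)" .
  have "2 * D_bound k \<le> 2 * 2 ^ (3 * k + 3)" using D by linarith
  also have "\<dots> = 2 ^ Suc (3 * k + 3)" by (rule power_Suc [symmetric])
  also have "\<dots> \<le> 2 ^ (4 * k + 5)" by (rule power_increasing) auto
  finally have b: "2 * D_bound k \<le> 2 ^ (4 * k + 5)" .
  have "2 * (2 * k + 2) \<le> 2 ^ (k + 2)" using k by (simp add: power_add)
  also have "\<dots> \<le> 2 ^ (4 * k + 5)" by (rule power_increasing) auto
  finally have c: "2 * (2 * k + 2) \<le> 2 ^ (4 * k + 5)" .
  have d: "7 \<le> (2 ^ (4 * k + 5) :: nat)"
    using power_increasing [of 3 "4 * k + 5" "2 :: nat"] by simp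
  have "u1 + u2 + u3 + u4 \<le> 4 * t" if "u1 \<le> t" "u2 \<le> t" "u3 \<le> t" "u4 \<le> t" for u1 u2 u3 u4 t :: nat using that by linarith
  then have "7 + 2 * (2 * k + 2) + 2 * D_bound k + (k + 4) * D_bound k \<le> 4 * 2 ^ (4 * k + 5)" using d c b a by this
  then have "seg_bits n \<le> 4 * 2 ^ (4 * k + 5)" unfolding seg_bits_def k_def [symmetric] by (simp only: distrib_left add.assoc)
  also have "\<dots> = 2 ^ (4 * k + 5 + 2)" by (simp only: power_add) simp
  also have "\<dots> = 2 ^ (16 * n + 7)" by (simp add: k_def)
  finally show ?thesis .
qed

theorem short_realization:
  assumes G: "G \<in> SEG n" and n: "n > 0"
  shows "\<exists>P Q. rational_realization P Q G \<and> (\<Sum>v\<in>verts G. bitsize_point (P v) + bitsize_point (Q v)) \<le> 2 ^ (29 * n)"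
proof -
  define V where "V = verts G"
  obtain p q where V: "finite V" "card V = n" "\<And>v. v \<in> V \<Longrightarrow> p v \<noteq> (q v :: real \<times> real)"
    and Gi: "G = intersection_graph V (\<lambda>v. closed_segment (p v) (q v))"
    unfolding V_def using SEG_realization [OF G] by metis
  obtain c a b l r where lr: "\<And>v. v \<in> V \<Longrightarrow> l v < r v" and sh: "\<And>v. v \<in> V \<Longrightarrow> shear c ` closed_segment (p v) (q v) = graph_seg (a v) (b v) (l v) (r v)"
    by (rule sheared_graphs [where p = p and q = q, OF V(1,3) zero_less_one]) metis+
  have Gm: "(closed_segment (p u) (q u) \<inter> closed_segment (p v) (q v) \<noteq> {}) = meets a b l r u v" if "u \<in> V" "v \<in> V" for u v
    using shear_image_meets [of c "closed_segment (p u) (q u)" "closed_segment (p v) (q v)"]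
    unfolding sh [OF that(1)] sh [OF that(2)] graph_seg_meets by simp
  obtain h where h: "bij_betw h V {..<n}" using V(1,2) by (metis bij_betw_iff_card card_lessThan finite_lessThan)
  define h' where "h' = inv_into V h"
  have h': "h' i \<in> V" if "i < n" for i using h that by (auto simp: h'_def bij_betw_def inv_into_into)
  have hh: "h v < n" "h' (h v) = v" if "v \<in> V" for v using h that by (auto simp: h'_def bij_betw_def)
  have inj: "h u \<noteq> h v" if "u \<in> V" "v \<in> V" "u \<noteq> v" for u v using h that by (auto simp: bij_betw_def inj_on_eq_iff)
  have mh: "meets (a \<circ> h') (b \<circ> h') (l \<circ> h') (r \<circ> h') i j = meets a b l r (h' i) (h' j)" for i j
    by (simp add: meets_def gap_def)
  have lr': "(l \<circ> h') i < (r \<circ> h') i" if "i \<in> {..<n}" for i using lr h' that by simp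
  obtain a' b' l' r' where lr1: "\<And>i. i \<in> {..<n} \<Longrightarrow> l' i < r' i"
    and c1: "\<And>i j. i \<in> {..<n} \<Longrightarrow> j \<in> {..<n} \<Longrightarrow> i \<noteq> j \<Longrightarrow> meets (a \<circ> h') (b \<circ> h') (l \<circ> h') (r \<circ> h') i j \<Longrightarrow> crosses a' b' l' r' i j"
    and c2: "\<And>i j. i \<in> {..<n} \<Longrightarrow> j \<in> {..<n} \<Longrightarrow> i \<noteq> j \<Longrightarrow> \<not> meets (a \<circ> h') (b \<circ> h') (l \<circ> h') (r \<circ> h') i j \<Longrightarrow> \<not> meets a' b' l' r' i j"
    by (rule perturb [where a = "a \<circ> h'" and b = "b \<circ> h'", OF finite_lessThan lr' zero_less_one]) (auto simp only:)
  have strict: "crosses a' b' l' r' i j \<or> \<not> meets a' b' l' r' i j" if "i < n" "j < n" "i \<noteq> j" for i j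
    using c1 [of i j] c2 [of i j] that by auto
  have same: "meets a' b' l' r' i j = meets a b l r (h' i) (h' j)" if "i < n" "j < n" "i \<noteq> j" for i j
    using c1 [of i j] c2 [of i j] that crosses_imp_meets [of a' b' l' r' i j] unfolding mh by auto
  define s where "s = seg_bits n"
  have lr2: "l' i < r' i" if "i < n" for i using lr1 that by simp
  obtain Z :: "nat \<Rightarrow> int" where Z: "\<And>i. i < 4 * n \<Longrightarrow> \<bar>Z i\<bar> \<le> 2 ^ s"
    and Zlr: "\<And>i. i < n \<Longrightarrow> lv (\<lambda>i. of_int (Z i) / 2 ^ s) i < rv (\<lambda>i. of_int (Z i) / 2 ^ s) i"
    and Zm: "\<And>i j. i < n \<Longrightarrow> j < n \<Longrightarrow> i \<noteq> j \<Longrightarrow>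
      meets (av (\<lambda>i. of_int (Z i) / 2 ^ s)) (bv (\<lambda>i. of_int (Z i) / 2 ^ s)) (lv (\<lambda>i. of_int (Z i) / 2 ^ s)) (rv (\<lambda>i. of_int (Z i) / 2 ^ s)) i j
      = meets a' b' l' r' i j"
    by (rule dyadic_parameters [OF lr2 n strict]) (use gap_bound_less s_def in auto)
  define W :: "nat \<Rightarrow> real" where "W i = of_int (Z i) / 2 ^ s" for i
  \<comment> \<open>The ordinate on line \<open>i\<close> above the abscissa
    \<open>x / 2 ^ s\<close>, brought to the common denominator \<open>2 ^ (2 * s)\<close>.\<close>
  define Y where "Y i x = (of_int (Z (4 * i) * x + Z (4 * i + 1) * 2 ^ s) / 2 ^ (2 * s) :: rat)" for i x
  define Pt where "Pt i x = (of_int x / 2 ^ s :: rat, Y i x)" for i x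
  have real: "real_point (Pt i x) = (of_int x / 2 ^ s, av W i * (of_int x / 2 ^ s) + bv W i)" for i x
    by (simp add: Pt_def Y_def real_point_def of_rat_divide of_rat_add of_rat_mult of_rat_power av_def bv_def W_def field_simps power_add power_mult power2_eq_square)
  have bits: "bitsize_point (Pt i x) \<le> 10 * s + 16" if i: "i < n" and x: "\<bar>x\<bar> \<le> 2 ^ s" for i x
  proof -
    have p: "(2 :: int) ^ (2 * s + 1) = 2 * (2 ^ s * 2 ^ s)"
    proof -
      have "2 * s + 1 = Suc (s + s)" by simp
      then show ?thesis by (simp only: power_Suc power_add)
    qed
    have Zi: "\<bar>Z (4 * i)\<bar> \<le> 2 ^ s" "\<bar>Z (4 * i + 1)\<bar> \<le> 2 ^ s" using i by (auto intro: Z)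
    have "\<bar>Z (4 * i) * x\<bar> \<le> 2 ^ s * 2 ^ s" unfolding abs_mult using x Zi(1) by (intro mult_mono) auto
    moreover have "\<bar>Z (4 * i + 1) * 2 ^ s\<bar> \<le> 2 ^ s * 2 ^ s" unfolding abs_mult using Zi(2) by (intro mult_mono) auto
    ultimately have "\<bar>Z (4 * i) * x + Z (4 * i + 1) * 2 ^ s\<bar> \<le> 2 ^ (2 * s + 1)" unfolding p by linarith
    then have "bitsize_rat (Y i x) \<le> 2 * (2 * s + 1) + 4" unfolding Y_def by (rule bitsize_rat_le) simp
    moreover have "bitsize_rat (of_int x / 2 ^ s) \<le> 2 * s + 4" by (rule bitsize_rat_le [OF x]) simp
    ultimately show ?thesis by (simp add: bitsize_point_def Pt_def)
  qed
  define P Q where "P v = Pt (h v) (Z (4 * h v + 2))" and "Q v = Pt (h v) (Z (4 * h v + 3))" for v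
  have seg: "closed_segment (real_point (P v)) (real_point (Q v)) = graph_seg (av W (h v)) (bv W (h v)) (lv W (h v)) (rv W (h v))"
    if "v \<in> V" for v
  proof -
    have "lv W (h v) < rv W (h v)" using Zlr [OF hh(1) [OF that]] by (simp add: W_def [abs_def])
    then show ?thesis unfolding P_def Q_def real by (simp add: graph_seg_closed_segment lv_def rv_def W_def)
  qed
  have PQ: "P v \<noteq> Q v" if "v \<in> V" for v
  proof
    assume "P v = Q v"
    then have "real_point (P v) = real_point (Q v)" by simp
    moreover have "lv W (h v) < rv W (h v)" using Zlr [OF hh(1) [OF that]] by (simp add: W_def [abs_def])
    ultimately show False unfolding P_def Q_def real by (simp add: lv_def rv_def W_def)
  qed
  have "G = intersection_graph V (\<lambda>v. closed_segment (real_point (P v)) (real_point (Q v)))"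
    unfolding Gi
  proof (rule intersection_graph_cong)
    fix u v assume uv: "u \<in> V" "v \<in> V" "u \<noteq> v"
    have "meets (av W) (bv W) (lv W) (rv W) (h u) (h v) = meets a b l r u v"
      using Zm [OF hh(1) hh(1) inj] same [OF hh(1) hh(1) inj] uv hh(2) by (simp add: W_def [abs_def])
    then show "(closed_segment (p u) (q u) \<inter> closed_segment (p v) (q v) \<noteq> {}) =
        (closed_segment (real_point (P u)) (real_point (Q u)) \<inter> closed_segment (real_point (P v)) (real_point (Q v)) \<noteq> {})"
      unfolding Gm [OF uv(1,2)] seg [OF uv(1)] seg [OF uv(2)] graph_seg_meets by simp
  qed
  then have R: "rational_realization P Q G" using PQ by (simp add: rational_realization_def realizes_def V_def)
  have "(\<Sum>v\<in>V. bitsize_point (P v) + bitsize_point (Q v)) \<le> (\<Sum>v\<in>V. (10 * s + 16) + (10 * s + 16))"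
    unfolding P_def Q_def by (intro sum_mono add_mono bits Z hh(1)) (use hh(1) in force)+
  also have "\<dots> = n * (20 * s + 32)" using V(2) by simp
  also have "\<dots> \<le> 2 ^ n * (2 ^ 5 * s)"
    by (rule mult_le_mono) (use less_exp [of n] in \<open>auto simp: s_def seg_bits_def\<close>)
  also have "\<dots> \<le> 2 ^ n * (2 ^ 5 * 2 ^ (16 * n + 7))" using seg_bits_le by (simp add: s_def)
  also have "\<dots> = 2 ^ (n + (5 + (16 * n + 7)))" by (simp only: power_add)
  \<comment> \<open>The exponent is \<open>17 * n + 12\<close>, and
    \<open>n \<ge> 1\<close>.\<close>
  also have "\<dots> \<le> 2 ^ (29 * n)" by (rule power_increasing) (use n in auto)
  finally show ?thesis using R unfolding V_def by blast
qed

section \<open>Confinement by a triangle of segments\<close>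

lemma Jordan_curve_sides:
  fixes g h :: "real \<Rightarrow> complex"
  assumes "arc g" "arc h" "pathstart g = a" "pathfinish g = b" "pathstart h = a" "pathfinish h = b"
    and gh: "path_image g \<inter> path_image h = {a,b}"
    and A: "connected A" "A \<inter> (path_image g \<union> path_image h) = {}"
    and C: "connected C" "C \<inter> (path_image g \<union> path_image h) = {}" "closure C \<inter> A \<noteq> {}"
  obtains X Y where "open X" "connected X" "open Y" "connected Y" "Y \<noteq> {}" "X \<inter> Y = {}"
    "X \<union> Y = - (path_image g \<union> path_image h)"
    "path_image g \<union> path_image h \<subseteq> closure Y" "A \<subseteq> X" "C \<subseteq> X" "C \<noteq> {}"
proof -
  let ?\<Gamma> = "path_image g \<union> path_image h"
  have sp: "simple_path (g +++ reversepath h)"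
    using assms by (intro simple_path_join_loop) (auto simp: arc_reversepath)
  have im: "path_image (g +++ reversepath h) = ?\<Gamma>"
    using assms by (simp add: path_image_join)
  have loop: "pathfinish (g +++ reversepath h) = pathstart (g +++ reversepath h)"
    using assms by simp
  obtain I E where IE: "I \<noteq> {}" "open I" "connected I" "E \<noteq> {}" "open E" "connected E"
      "I \<inter> E = {}" "I \<union> E = - ?\<Gamma>" "frontier I = ?\<Gamma>" "frontier E = ?\<Gamma>"
    using Jordan_curve [OF sp loop] im by metis
  obtain z where z: "z \<in> closure C" "z \<in> A" using C by blast
  have Cne: "C \<noteq> {}" using z by auto
  have side: "S \<subseteq> I \<or> S \<subseteq> E" if "connected S" "S \<inter> ?\<Gamma> = {}" for S
  proof (rule ccontr)
    assume "\<not> (S \<subseteq> I \<or> S \<subseteq> E)"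
    moreover have "S \<subseteq> I \<union> E" using that IE(8) by blast
    ultimately have "S \<inter> I \<noteq> {}" "S \<inter> E \<noteq> {}" by blast+
    then show False
      using connectedD [OF \<open>connected S\<close> \<open>open I\<close> \<open>open E\<close>] IE(7) \<open>S \<subseteq> I \<union> E\<close> by blast
  qed
  \<comment> \<open>\<open>U\<close> is open and contains a point of the closure of
    \<open>C\<close>, so it meets \<open>C\<close>; being connected and off the curve,
    \<open>C\<close> cannot change sides.\<close>
  have same: "C \<subseteq> U" if "A \<subseteq> U" "open U" "C \<subseteq> U \<or> C \<subseteq> V" "U \<inter> V = {}" for U V
  proof -
    have "U \<inter> C \<noteq> {}"
      using z that open_Int_closure_eq_empty [of U C] by blast
    with that show ?thesis by blast
  qed
  have clI: "?\<Gamma> \<subseteq> closure I" using IE(9) by (auto simp: frontier_def)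
  have clE: "?\<Gamma> \<subseteq> closure E" using IE(10) by (auto simp: frontier_def)
  show ?thesis
  proof (cases "A \<subseteq> I")
    case True
    have "C \<subseteq> I" using same [OF True \<open>open I\<close> side [OF C(1,2)] IE(7)] .
    then show ?thesis
      by (rule that [OF IE(2,3,5,6,4,7,8) clE True _ Cne])
  next
    case False
    then have AE: "A \<subseteq> E" using side A by blast
    have EI: "E \<inter> I = {}" "E \<union> I = - ?\<Gamma>" using IE(7,8) by blast+
    have "C \<subseteq> E"
      by (rule same [OF AE \<open>open E\<close> _ EI(1)]) (use side [OF C(1,2)] in blast)
    then show ?thesis
      by (rule that [OF IE(5,6,2,3,1) EI clI AE _ Cne])
  qed
qed

text \<open>Let \<open>\<Gamma>\<^sub>k\<close> be the closed curve omitting the \<open>k\<close>-th arc. The side of \<open>\<Gamma>\<^sub>1\<close> not containing \<open>C\<close>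
  lies on the same sides of \<open>\<Gamma>\<^sub>2\<close> and \<open>\<Gamma>\<^sub>3\<close> as \<open>C\<close>, so Janiszewski's theorem joins the two off the whole
  theta-curve.\<close>

lemma theta_curve_face_touches_at_most_two_arcs:
  fixes c1 c2 c3 :: "real \<Rightarrow> complex"
  assumes arcs: "arc c1" "arc c2" "arc c3"
    and ends: "pathstart c1 = a" "pathfinish c1 = b" "pathstart c2 = a" "pathfinish c2 = b"
      "pathstart c3 = a" "pathfinish c3 = b"
    and i12: "path_image c1 \<inter> path_image c2 = {a,b}"
    and i13: "path_image c1 \<inter> path_image c3 = {a,b}"
    and i23: "path_image c2 \<inter> path_image c3 = {a,b}"
    and C: "connected C" "C \<inter> (path_image c1 \<union> path_image c2 \<union> path_image c3) = {}"
    and t1: "closure C \<inter> (path_image c1 - {a,b}) \<noteq> {}"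
    and t2: "closure C \<inter> (path_image c2 - {a,b}) \<noteq> {}"
    and t3: "closure C \<inter> (path_image c3 - {a,b}) \<noteq> {}"
  shows False
proof -
  have con: "connected (path_image c1 - {a,b})" "connected (path_image c2 - {a,b})"
    "connected (path_image c3 - {a,b})"
    using connected_simple_path_endless [OF arc_imp_simple_path [OF arcs(1)], unfolded ends]
      connected_simple_path_endless [OF arc_imp_simple_path [OF arcs(2)], unfolded ends]
      connected_simple_path_endless [OF arc_imp_simple_path [OF arcs(3)], unfolded ends] .
  have ab: "a \<in> path_image c1" "b \<in> path_image c1" "a \<in> path_image c2" "b \<in> path_image c2"
    "a \<in> path_image c3" "b \<in> path_image c3"
    using ends pathstart_in_path_image pathfinish_in_path_image by metis+
  have d: "(path_image c1 - {a,b}) \<inter> (path_image c2 \<union> path_image c3) = {}"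
    "(path_image c2 - {a,b}) \<inter> (path_image c1 \<union> path_image c3) = {}"
    "(path_image c3 - {a,b}) \<inter> (path_image c1 \<union> path_image c2) = {}"
    unfolding Int_Un_distrib Diff_Int_distrib2 i12 i13 i23 by (simp_all add: Int_commute i12 i13 i23 ab)
  have dC: "C \<inter> (path_image c2 \<union> path_image c3) = {}" "C \<inter> (path_image c1 \<union> path_image c3) = {}"
    "C \<inter> (path_image c1 \<union> path_image c2) = {}"
    using C(2) by (simp_all add: Int_Un_distrib)
  obtain X1 Y1 where 1: "open X1" "connected X1" "open Y1" "connected Y1" "Y1 \<noteq> {}" "X1 \<inter> Y1 = {}"
    "X1 \<union> Y1 = - (path_image c2 \<union> path_image c3)"
    "path_image c2 \<union> path_image c3 \<subseteq> closure Y1" "path_image c1 - {a,b} \<subseteq> X1" "C \<subseteq> X1" "C \<noteq> {}"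
    by (rule Jordan_curve_sides [OF arcs(2,3) ends(3-6) i23 con(1) d(1) C(1) dC(1) t1])
  obtain X2 Y2 where 2: "open X2" "connected X2" "open Y2" "connected Y2" "Y2 \<noteq> {}" "X2 \<inter> Y2 = {}"
    "X2 \<union> Y2 = - (path_image c1 \<union> path_image c3)"
    "path_image c1 \<union> path_image c3 \<subseteq> closure Y2" "path_image c2 - {a,b} \<subseteq> X2" "C \<subseteq> X2" "C \<noteq> {}"
    by (rule Jordan_curve_sides [OF arcs(1,3) ends(1,2,5,6) i13 con(2) d(2) C(1) dC(2) t2])
  obtain X3 Y3 where 3: "open X3" "connected X3" "open Y3" "connected Y3" "Y3 \<noteq> {}" "X3 \<inter> Y3 = {}"
    "X3 \<union> Y3 = - (path_image c1 \<union> path_image c2)"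
    "path_image c1 \<union> path_image c2 \<subseteq> closure Y3" "path_image c3 - {a,b} \<subseteq> X3" "C \<subseteq> X3" "C \<noteq> {}"
    by (rule Jordan_curve_sides [OF arcs(1,2) ends(1-4) i12 con(3) d(3) C(1) dC(3) t3])
  have Y1: "Y1 \<subseteq> - (path_image c2 \<union> path_image c3)" using 1(7) by (metis Un_upper2)
  have Y1c1: "y \<notin> path_image c1" if "y \<in> Y1" for y
  proof
    assume "y \<in> path_image c1"
    moreover have "y \<noteq> a" "y \<noteq> b" using Y1 that ab by auto
    ultimately show False using 1(6,9) that by auto
  qed
  have Y1sub: "Y1 \<subseteq> X" if "open X" "open Y" "X \<inter> Y = {}" "Y1 \<subseteq> X \<union> Y" "q \<in> closure Y1" "q \<in> X" for X Y q
  proof -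
    have "Y1 \<inter> X \<noteq> {}" using that open_Int_closure_eq_empty [of X Y1] by auto
    then have "Y1 \<inter> Y = {}" using connectedD [OF \<open>connected Y1\<close> that(1,2)] that(3,4)
      by (metis Int_commute Int_left_commute inf_bot_right)
    then show ?thesis using that(4) by auto
  qed
  obtain q2 where q2: "q2 \<in> path_image c2 - {a,b}" using t2 by blast
  obtain q3 where q3: "q3 \<in> path_image c3 - {a,b}" using t3 by blast
  have Y12: "Y1 \<subseteq> X2"
  proof (rule Y1sub [OF 2(1,3,6)])
    show "Y1 \<subseteq> X2 \<union> Y2" unfolding 2(7) using Y1 Y1c1 by auto
    show "q2 \<in> closure Y1" using 1(8) q2 by auto
    show "q2 \<in> X2" using 2(9) q2 by auto
  qed
  have Y13: "Y1 \<subseteq> X3"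
  proof (rule Y1sub [OF 3(1,3,6)])
    show "Y1 \<subseteq> X3 \<union> Y3" unfolding 3(7) using Y1 Y1c1 by auto
    show "q3 \<in> closure Y1" using 1(8) q3 by auto
    show "q3 \<in> X3" using 3(9) q3 by auto
  qed
  obtain y c where yc: "y \<in> Y1" "c \<in> C" using 1(5,11) by auto
  have sub2: "X2 \<subseteq> - (path_image c1 \<union> path_image c3)" using 2(7) by (metis Un_upper1)
  have sub3: "X3 \<subseteq> - (path_image c1 \<union> path_image c2)" using 3(7) by (metis Un_upper1)
  have cc2: "connected_component (- (path_image c1 \<union> path_image c3)) y c"
    unfolding connected_component_def
    using 2(2) sub2 Y12 yc 2(10) by (intro exI[of _ X2]) auto
  have cc3: "connected_component (- (path_image c1 \<union> path_image c2)) y c"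
    unfolding connected_component_def
    using 3(2) sub3 Y13 yc 3(10) by (intro exI[of _ X3]) auto
  \<comment> \<open>Neither of the two closed curves separates \<open>y\<close> from
    \<open>c\<close>, and they share exactly the connected set \<open>c1\<close>, as Janiszewski's
    theorem requires.\<close>
  have "(path_image c1 \<union> path_image c3) \<inter> (path_image c1 \<union> path_image c2) = path_image c1"
    unfolding Un_Int_distrib [symmetric] using i23 ab by (simp add: Int_commute insert_absorb)
  then have con: "connected ((path_image c1 \<union> path_image c3) \<inter> (path_image c1 \<union> path_image c2))"
    using arcs(1) connected_arc_image by simp
  have "connected_component (- ((path_image c1 \<union> path_image c3) \<union> (path_image c1 \<union> path_image c2))) y c"
    by (rule Janiszewski_weak [OF _ _ con cc2 cc3]) (intro compact_Un compact_arc_image arcs)+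
  then obtain T where T: "connected T" "T \<subseteq> - ((path_image c1 \<union> path_image c3) \<union> (path_image c1 \<union> path_image c2))"
     "y \<in> T" "c \<in> T" unfolding connected_component_def by auto
  have "T \<subseteq> X1 \<union> Y1" unfolding 1(7) using T(2) by auto
  moreover have "c \<in> X1" using yc 1(10) by auto
  ultimately show False
    using connectedD [OF T(1) \<open>open X1\<close> \<open>open Y1\<close>] 1(6) T(3,4) yc(1) by auto
qed

text \<open>An arc \<open>\<gamma>\<close> that starts in \<open>p3\<close> is cut off at its first
  point on an arc \<open>\<alpha>\<close> from \<open>p1\<close> to \<open>p2\<close>. That point is
  the centre. It lies in \<open>S\<close>, because \<open>\<gamma>\<close> runs in
  \<open>insert p3 S\<close> and \<open>p3\<close> is not on \<open>\<alpha>\<close>.\<close>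

lemma path_connected_tripod:
  fixes S :: "'a::euclidean_space set"
  assumes pc: "path_connected (insert p1 (insert p2 S))" "path_connected (insert p3 S)"
    and p: "p1 \<noteq> p2" "p1 \<noteq> p3" "p2 \<noteq> p3" "p1 \<notin> S" "p2 \<notin> S" "p3 \<notin> S"
  obtains a g1 g2 g3 where "a \<in> S" "arc g1" "arc g2" "arc g3"
    "pathstart g1 = a" "pathstart g2 = a" "pathstart g3 = a"
    "pathfinish g1 = p1" "pathfinish g2 = p2" "pathfinish g3 = p3"
    "path_image g1 \<subseteq> insert p1 S" "path_image g2 \<subseteq> insert p2 S" "path_image g3 \<subseteq> insert p3 S"
    "path_image g1 \<inter> path_image g2 = {a}" "path_image g1 \<inter> path_image g3 = {a}"
    "path_image g2 \<inter> path_image g3 = {a}"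
proof -
  obtain \<alpha> where \<alpha>: "arc \<alpha>" "path_image \<alpha> \<subseteq> insert p1 (insert p2 S)" "pathstart \<alpha> = p1" "pathfinish \<alpha> = p2"
    using pc(1) p(1) unfolding path_connected_arcwise by blast
  have inj: "inj_on \<alpha> {0..1}" using \<alpha>(1) by (simp add: arc_def)
  have \<alpha>0: "\<alpha> 0 = p1" "\<alpha> 1 = p2" using \<alpha>(3,4) by (auto simp: pathstart_def pathfinish_def)
  have \<alpha>t: "\<alpha> t \<in> S" if "0 < t" "t < 1" for t
  proof -
    have "\<alpha> t \<in> insert p1 (insert p2 S)" by (rule subsetD [OF \<alpha>(2)]) (use that in \<open>auto simp: path_image_def\<close>)
    moreover have "\<alpha> t \<noteq> \<alpha> 0" "\<alpha> t \<noteq> \<alpha> 1" using inj_onD [OF inj, of t 0] inj_onD [OF inj, of t 1] that by auto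
    ultimately show ?thesis using \<alpha>0 by auto
  qed
  have half: "\<alpha> (1/2) \<in> S" by (rule \<alpha>t) auto
  then obtain \<gamma> where \<gamma>: "arc \<gamma>" "path_image \<gamma> \<subseteq> insert p3 S" "pathstart \<gamma> = p3" "pathfinish \<gamma> = \<alpha> (1/2)"
    using pc(2) p(6) unfolding path_connected_arcwise by (metis insertCI)
  define Z where "Z = {t \<in> {0..1}. \<gamma> t \<in> path_image \<alpha>}"
  have "continuous_on {0..1} \<gamma>" using \<gamma>(1) by (simp add: arc_def path_def)
  then have "closed ({0..1} \<inter> \<gamma> -` path_image \<alpha>)"
    using continuous_closed_preimage closed_arc_image [OF \<alpha>(1)] by blast
  moreover have Zeq: "Z = {0..1} \<inter> \<gamma> -` path_image \<alpha>" by (auto simp: Z_def)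
  ultimately have "closed Z" by simp
  moreover have "bounded Z" by (rule bounded_subset [of "{0..1}"]) (auto simp: Zeq)
  ultimately have "compact Z" by (simp add: compact_eq_bounded_closed)
  moreover have "1 \<in> Z" using \<gamma>(4) unfolding Z_def by (auto simp: path_image_def pathfinish_def)
  ultimately obtain u where u: "u \<in> Z" "\<And>t. t \<in> Z \<Longrightarrow> u \<le> t"
    using compact_attains_inf [of Z] by auto
  have uI: "0 \<le> u" "u \<le> 1" "\<gamma> u \<in> path_image \<alpha>" using u(1) by (auto simp: Z_def)
  have \<gamma>0: "\<gamma> 0 = p3" using \<gamma>(3) by (simp add: pathstart_def)
  have p3\<alpha>: "p3 \<notin> path_image \<alpha>" using \<alpha>(2) p by auto
  then have u0: "u > 0" using uI \<gamma>0 by (cases "u = 0") auto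
  obtain v where v: "0 \<le> v" "v \<le> 1" "\<gamma> u = \<alpha> v" using uI(3) by (auto simp: path_image_def)
  have "\<gamma> u \<in> insert p3 S" by (rule subsetD [OF \<gamma>(2)]) (use uI in \<open>auto simp: path_image_def\<close>)
  then have aS: "\<alpha> v \<in> S" using v uI(3) p3\<alpha> by auto
  have v01: "0 < v" "v < 1" using aS \<alpha>0 p v(1,2) by (cases "v = 0"; cases "v = 1"; auto)+
  define g1 where "g1 = subpath v 0 \<alpha>"
  define g2 where "g2 = subpath v 1 \<alpha>"
  define g3 where "g3 = subpath u 0 \<gamma>"
  have im1: "path_image g1 = \<alpha> ` {0..v}" and im2: "path_image g2 = \<alpha> ` {v..1}"
    and im3: "path_image g3 = \<gamma> ` {0..u}"
    using v01 u0 by (auto simp: g1_def g2_def g3_def path_image_subpath)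
  have \<gamma>\<alpha>: "\<gamma> ` {0..u} \<inter> path_image \<alpha> = {\<alpha> v}"
  proof
    show "{\<alpha> v} \<subseteq> \<gamma> ` {0..u} \<inter> path_image \<alpha>" using uI(3) u0 unfolding v(3) [symmetric] by auto
    show "\<gamma> ` {0..u} \<inter> path_image \<alpha> \<subseteq> {\<alpha> v}"
    proof
      fix x assume "x \<in> \<gamma> ` {0..u} \<inter> path_image \<alpha>"
      then obtain t where t: "0 \<le> t" "t \<le> u" "x = \<gamma> t" "x \<in> path_image \<alpha>" by auto
      then have "t \<in> Z" using uI by (auto simp: Z_def)
      then have "t = u" using u(2) t(2) by fastforce
      then show "x \<in> {\<alpha> v}" using t v by simp
    qed
  qed
  show ?thesis
  proof (rule that [of "\<alpha> v" g1 g2 g3])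
    show "\<alpha> v \<in> S" by fact
    show "arc g1" "arc g2" "arc g3" unfolding g1_def g2_def g3_def using v01 u0 uI \<alpha>(1) \<gamma>(1)
      by (auto intro!: arc_subpath_arc)
    show "pathstart g1 = \<alpha> v" "pathstart g2 = \<alpha> v" "pathstart g3 = \<alpha> v"
      "pathfinish g1 = p1" "pathfinish g2 = p2" "pathfinish g3 = p3"
      unfolding g1_def g2_def g3_def using v \<alpha>0 \<gamma>0 by auto
    show "path_image g1 \<subseteq> insert p1 S"
    proof -
      have "\<alpha> t \<in> insert p1 S" if "0 \<le> t" "t \<le> v" for t
        using \<alpha>t [of t] that v01 \<alpha>0 by (cases "t = 0") auto
      then show ?thesis unfolding im1 by (intro image_subsetI) simp
    qed
    show "path_image g2 \<subseteq> insert p2 S"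
    proof -
      have "\<alpha> t \<in> insert p2 S" if "v \<le> t" "t \<le> 1" for t
        using \<alpha>t [of t] that v01 \<alpha>0 by (cases "t = 1") auto
      then show ?thesis unfolding im2 by (intro image_subsetI) simp
    qed
    show "path_image g3 \<subseteq> insert p3 S"
      unfolding im3 by (rule order.trans [OF _ \<gamma>(2)]) (use uI in \<open>auto simp: path_image_def\<close>)
    show "path_image g1 \<inter> path_image g2 = {\<alpha> v}"
    proof -
      have "path_image g1 \<inter> path_image g2 = \<alpha> ` ({0..v} \<inter> {v..1})"
        unfolding im1 im2 by (rule inj_on_image_Int [OF inj, symmetric]) (use v01 in auto)
      also have "{0..v} \<inter> {v..1} = {v}" using v01 by auto
      finally show ?thesis by simp
    qed
    have "\<alpha> v \<in> path_image g1" "\<alpha> v \<in> path_image g2" using im1 im2 v01 by auto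
    moreover have "path_image g1 \<subseteq> path_image \<alpha>" "path_image g2 \<subseteq> path_image \<alpha>"
      using im1 im2 v01 by (auto simp: path_image_def)
    ultimately show "path_image g1 \<inter> path_image g3 = {\<alpha> v}" "path_image g2 \<inter> path_image g3 = {\<alpha> v}"
      using \<gamma>\<alpha> im3 by auto
  qed
qed

lemma less_3_cases: "(j::nat) < 3 \<longleftrightarrow> j = 0 \<or> j = 1 \<or> j = 2" by auto

lemma path_connected_tripod_indexed:
  fixes S :: "'a::euclidean_space set" and p :: "nat \<Rightarrow> 'a"
  assumes pc: "S \<noteq> {}" "\<And>j. j < 3 \<Longrightarrow> path_connected (insert (p j) S)"
    and p: "\<And>j k. \<lbrakk>j < 3; k < 3; j \<noteq> k\<rbrakk> \<Longrightarrow> p j \<noteq> p k" "\<And>j. j < 3 \<Longrightarrow> p j \<notin> S"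
  obtains a g where "a \<in> S" "\<And>j. j < 3 \<Longrightarrow> arc (g j)" "\<And>j. j < 3 \<Longrightarrow> pathstart (g j) = a"
    "\<And>j. j < 3 \<Longrightarrow> pathfinish (g j) = p j" "\<And>j. j < 3 \<Longrightarrow> path_image (g j) \<subseteq> insert (p j) S"
    "\<And>j k. \<lbrakk>j < 3; k < 3; j \<noteq> k\<rbrakk> \<Longrightarrow> path_image (g j) \<inter> path_image (g k) = {a}"
proof -
  have "path_connected (insert (p 0) S \<union> insert (p 1) S)"
    using pc by (intro path_connected_Un) auto
  then have "path_connected (insert (p 0) (insert (p 1) S))" by (simp add: insert_commute)
  moreover have "path_connected (insert (p 2) S)" using pc by simp
  ultimately obtain a g1 g2 g3 where g: "a \<in> S" "arc g1" "arc g2" "arc g3"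
    "pathstart g1 = a" "pathstart g2 = a" "pathstart g3 = a"
    "pathfinish g1 = p 0" "pathfinish g2 = p 1" "pathfinish g3 = p 2"
    "path_image g1 \<subseteq> insert (p 0) S" "path_image g2 \<subseteq> insert (p 1) S" "path_image g3 \<subseteq> insert (p 2) S"
    "path_image g1 \<inter> path_image g2 = {a}" "path_image g1 \<inter> path_image g3 = {a}"
    "path_image g2 \<inter> path_image g3 = {a}"
    by (rule path_connected_tripod) (use p in auto)
  define g where "g = (\<lambda>j::nat. if j = 0 then g1 else if j = 1 then g2 else g3)"
  show ?thesis
    by (rule that [of a g]) (use g in \<open>auto simp: g_def less_3_cases Int_commute\<close>)
qed

text \<open>\<open>H1\<close> and \<open>H2\<close> provide tripods with feet \<open>p j\<close> and
  \<open>q j\<close>; joined by the three segments they form a theta-curve. \<open>C\<close> avoids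
  this curve, yet its closure touches the interior of each of the three arcs, which no face can
  do.\<close>

lemma no_planar_K33:
  fixes p q :: "nat \<Rightarrow> complex"
  assumes H1: "H1 \<noteq> {}" "\<And>j. j < 3 \<Longrightarrow> path_connected (insert (p j) H1)"
    and H2: "H2 \<noteq> {}" "\<And>j. j < 3 \<Longrightarrow> path_connected (insert (q j) H2)"
    and HH: "H1 \<inter> H2 = {}"
    and pq: "\<And>j. j < 3 \<Longrightarrow> p j \<noteq> q j"
    and B: "\<And>j. j < 3 \<Longrightarrow> closed_segment (p j) (q j) \<inter> (H1 \<union> H2) = {}"
    and BB: "\<And>j k. \<lbrakk>j < 3; k < 3; j \<noteq> k\<rbrakk> \<Longrightarrow> closed_segment (p j) (q j) \<inter> closed_segment (p k) (q k) = {}"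
    and C: "connected C" "C \<inter> (H1 \<union> H2) = {}" "\<And>j. j < 3 \<Longrightarrow> C \<inter> closed_segment (p j) (q j) = {}"
    and CB: "\<And>j. j < 3 \<Longrightarrow> closure C \<inter> closed_segment (p j) (q j) \<noteq> {}"
  shows False
proof -
  have pB: "p j \<in> closed_segment (p j) (q j)" "q j \<in> closed_segment (p j) (q j)" for j by auto
  have pH: "p j \<notin> H1" "p j \<notin> H2" "q j \<notin> H1" "q j \<notin> H2" if "j < 3" for j
    using B [OF that] pB [of j] by auto
  have neq: "p j \<noteq> p k" "q j \<noteq> q k" "p j \<noteq> q k" if "j < 3" "k < 3" "j \<noteq> k" for j k
    using BB [OF that] pB [of j] pB [of k] by (metis disjoint_iff)+
  obtain a g where a: "a \<in> H1" and g: "\<And>j. j < 3 \<Longrightarrow> arc (g j)" "\<And>j. j < 3 \<Longrightarrow> pathstart (g j) = a"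
    "\<And>j. j < 3 \<Longrightarrow> pathfinish (g j) = p j" "\<And>j. j < 3 \<Longrightarrow> path_image (g j) \<subseteq> insert (p j) H1"
    "\<And>j k. \<lbrakk>j < 3; k < 3; j \<noteq> k\<rbrakk> \<Longrightarrow> path_image (g j) \<inter> path_image (g k) = {a}"
    by (rule path_connected_tripod_indexed [OF H1]) (use neq pH in auto)
  obtain b h where b: "b \<in> H2" and h: "\<And>j. j < 3 \<Longrightarrow> arc (h j)" "\<And>j. j < 3 \<Longrightarrow> pathstart (h j) = b"
    "\<And>j. j < 3 \<Longrightarrow> pathfinish (h j) = q j" "\<And>j. j < 3 \<Longrightarrow> path_image (h j) \<subseteq> insert (q j) H2"
    "\<And>j k. \<lbrakk>j < 3; k < 3; j \<noteq> k\<rbrakk> \<Longrightarrow> path_image (h j) \<inter> path_image (h k) = {b}"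
    by (rule path_connected_tripod_indexed [OF H2]) (use neq pH in auto)
  define c where "c j = g j +++ linepath (p j) (q j) +++ reversepath (h j)" for j
  define G where "G j = path_image (g j)" for j
  define K where "K j = path_image (h j)" for j
  define S where "S j = closed_segment (p j) (q j)" for j
  note pB = pB [folded S_def] and B = B [folded S_def] and BB = BB [folded S_def]
    and CB = CB [folded S_def] and C3 = C(3) [folded S_def]
  note gs = g(4,5) [folded G_def] and hs = h(4,5) [folded K_def]
  have ends: "pathstart (c j) = a" "pathfinish (c j) = b" if "j < 3" for j
    using that g h by (auto simp: c_def)
  have im: "path_image (c j) = G j \<union> S j \<union> K j" if "j < 3" for j
    using that g h by (simp add: c_def path_image_join G_def K_def S_def Un_assoc)
  have pin: "p j \<in> G j" "q j \<in> K j" "a \<in> G j" "b \<in> K j" if "j < 3" for j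
    using that g h pathfinish_in_path_image pathstart_in_path_image unfolding G_def K_def by metis+
  have disj: "G j \<inter> K k = {}" if jk: "j < 3" "k < 3" for j k
  proof -
    have "p j \<noteq> q k" using neq(3) [OF jk] pq [OF jk(1)] by (cases "j = k") auto
    then have "insert (p j) H1 \<inter> insert (q k) H2 = {}"
      using HH pH [OF jk(1)] pH [OF jk(2)] by auto
    then show ?thesis using gs(1) [OF jk(1)] hs(1) [OF jk(2)] by auto
  qed
  have GS: "G j \<inter> S j \<subseteq> {p j}" "K j \<inter> S j \<subseteq> {q j}" if "j < 3" for j
    using gs(1) [of j] hs(1) [of j] B [of j] that by blast+
  have GS0: "G j \<inter> S k = {}" "K j \<inter> S k = {}" if "j < 3" "k < 3" "j \<noteq> k" for j k
    using gs(1) [of j] hs(1) [of j] B [of k] BB [of j k] pB [of j] that by blast+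
  have arcs: "arc (c j)" if j: "j < 3" for j
  proof -
    have "arc (linepath (p j) (q j) +++ reversepath (h j))"
      by (rule arc_join) (use h(1-3) [OF j] pq [OF j] GS(2) [OF j] in \<open>auto simp: arc_reversepath S_def K_def\<close>)
    then show ?thesis unfolding c_def
    proof (rule arc_join [OF g(1) [OF j]])
      show "pathfinish (g j) = pathstart (linepath (p j) (q j) +++ reversepath (h j))"
        using j g by simp
      have "path_image (linepath (p j) (q j) +++ reversepath (h j)) = S j \<union> K j"
        using j h by (simp add: path_image_join S_def K_def)
      then show "path_image (g j) \<inter> path_image (linepath (p j) (q j) +++ reversepath (h j))
        \<subseteq> {pathstart (linepath (p j) (q j) +++ reversepath (h j))}"
        using GS(1) [OF j] disj [OF j j] by (auto simp: G_def)
    qed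
  qed
  have cc: "path_image (c j) \<inter> path_image (c k) = {a,b}" if jk: "j < 3" "k < 3" "j \<noteq> k" for j k
  proof -
    have "G j \<inter> G k = {a}" "K j \<inter> K k = {b}" "S j \<inter> S k = {}"
      "G j \<inter> S k = {}" "K j \<inter> S k = {}" "S j \<inter> G k = {}" "S j \<inter> K k = {}" "G j \<inter> K k = {}" "K j \<inter> G k = {}"
      using gs(2) [OF jk] hs(2) [OF jk] BB [OF jk] GS0 [OF jk] GS0 [of k j] jk disj [of j k] disj [of k j] by auto
    then show ?thesis unfolding im [OF jk(1)] im [OF jk(2)] by (simp add: Int_Un_distrib Int_Un_distrib2) auto
  qed
  have Cc: "C \<inter> path_image (c j) = {}" if "j < 3" for j
    using C(2) C3 [OF that] gs(1) [OF that] hs(1) [OF that] pB [of j] unfolding im [OF that] by blast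
  have Ccl: "closure C \<inter> (path_image (c j) - {a,b}) \<noteq> {}" if "j < 3" for j
    using CB [OF that] B [OF that] a b unfolding im [OF that] by blast
  have lt: "(0::nat) < 3" "(1::nat) < 3" "(2::nat) < 3" by auto
  show False
  proof (rule theta_curve_face_touches_at_most_two_arcs [of "c 0" "c 1" "c 2" a b C])
    show "C \<inter> (path_image (c 0) \<union> path_image (c 1) \<union> path_image (c 2)) = {}"
      using Cc [OF lt(1)] Cc [OF lt(2)] Cc [OF lt(3)] by (simp add: Int_Un_distrib)
  qed (use arcs ends cc C(1) Ccl in auto)
qed

lemma convex_segment_minus_end: "convex (closed_segment x y - {y})" for x y :: "'a::euclidean_space"
proof -
  have "y extreme_point_of closed_segment x y" by (simp add: extreme_point_of_segment)
  then show ?thesis using extreme_point_of_stillconvex convex_closed_segment by blast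
qed

lemma closure_segment_minus_end: "x \<noteq> y \<Longrightarrow> y \<in> closure (closed_segment x y - {y})" for x y :: "'a::euclidean_space"
proof -
  assume "x \<noteq> y"
  then have "y \<in> closure (open_segment x y)" by simp
  moreover have "open_segment x y \<subseteq> closed_segment x y - {y}" by (auto simp: open_segment_def)
  ultimately show ?thesis using closure_mono by blast
qed

text \<open>A face \<open>I\<close> bounded by three segments \<open>F j\<close>, each of which is crossed by a bar \<open>b j\<close>, would be a third
  vertex joined to all bars besides \<open>H1\<close> and \<open>H2\<close>.\<close>

lemma bars_force_inside:
  fixes F b :: "nat \<Rightarrow> complex set" and c p q :: "nat \<Rightarrow> complex"
  assumes I: "open I" "connected I"
    and F: "\<And>j. j < 3 \<Longrightarrow> F j \<inter> I = {}" "frontier I \<subseteq> (\<Union>j<3. F j)" "\<And>j. j < 3 \<Longrightarrow> closure I \<inter> F j \<noteq> {}"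
      "\<And>j. j < 3 \<Longrightarrow> convex (F j)"
    and b: "\<And>j. j < 3 \<Longrightarrow> convex (b j)" "\<And>j. j < 3 \<Longrightarrow> b j \<inter> F j = {c j}"
      "\<And>j k. \<lbrakk>j < 3; k < 3; j \<noteq> k\<rbrakk> \<Longrightarrow> b j \<inter> F k = {}" "\<And>j k. \<lbrakk>j < 3; k < 3; j \<noteq> k\<rbrakk> \<Longrightarrow> b j \<inter> b k = {}"
    and p: "\<And>j. j < 3 \<Longrightarrow> p j \<in> b j" "\<And>j. j < 3 \<Longrightarrow> q j \<in> b j" "\<And>j. j < 3 \<Longrightarrow> p j \<noteq> q j"
      "\<And>j. j < 3 \<Longrightarrow> p j \<noteq> c j" "\<And>j. j < 3 \<Longrightarrow> q j \<noteq> c j"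
    and H1: "H1 \<noteq> {}" "\<And>j. j < 3 \<Longrightarrow> path_connected (insert (p j) H1)"
      "\<And>j. j < 3 \<Longrightarrow> H1 \<inter> F j = {}" "\<And>j. j < 3 \<Longrightarrow> H1 \<inter> b j = {}"
    and H2: "H2 \<noteq> {}" "\<And>j. j < 3 \<Longrightarrow> path_connected (insert (q j) H2)"
      "\<And>j. j < 3 \<Longrightarrow> H2 \<inter> F j = {}" "\<And>j. j < 3 \<Longrightarrow> H2 \<inter> b j = {}"
    and HH: "H1 \<inter> H2 = {}"
  shows "H1 \<subseteq> I \<or> H2 \<subseteq> I"
proof (rule ccontr)
  assume "\<not> (H1 \<subseteq> I \<or> H2 \<subseteq> I)"
  then have nsub: "\<not> H1 \<subseteq> I" "\<not> H2 \<subseteq> I" by auto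
  have Icl: "I \<subseteq> closure I" by (rule closure_subset)
  \<comment> \<open>A connected set that meets \<open>I\<close> without lying in it meets the
    frontier and hence some \<open>F k\<close>. But \<open>H\<close> avoids all of them, and
    \<open>x\<close> is on a bar away from its crossing \<open>c j\<close>.\<close>
  have out: "insert x H \<inter> I = {}" if "path_connected (insert x H)" "x \<in> b j" "x \<noteq> c j" "j < 3"
    "\<And>j. j < 3 \<Longrightarrow> H \<inter> F j = {}" "\<not> H \<subseteq> I" for x j and H :: "complex set"
  proof (rule ccontr)
    assume "insert x H \<inter> I \<noteq> {}"
    then have "insert x H \<inter> frontier I \<noteq> {}"
      using connected_Int_frontier [OF path_connected_imp_connected [OF that(1)]] that(6) by blast
    then obtain k where k: "k < 3" "insert x H \<inter> F k \<noteq> {}" using F(2) by blast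
    then have "x \<in> F k" using that(5) [OF k(1)] by auto
    then show False using that b(2) [OF that(4)] b(3) [OF that(4) k(1)] by (cases "j = k") auto
  qed
  have pI: "p j \<notin> I" "q j \<notin> I" and HI: "H1 \<inter> I = {}" "H2 \<inter> I = {}" if j: "j < 3" for j
    using out [OF H1(2) [OF j] p(1) [OF j] p(4) [OF j] j H1(3) nsub(1)]
      out [OF H2(2) [OF j] p(2) [OF j] p(5) [OF j] j H2(3) nsub(2)] by auto
  define S where "S j = closed_segment (p j) (q j)" for j
  have Sb: "S j \<subseteq> b j" if "j < 3" for j
    unfolding S_def by (rule closed_segment_subset [OF p(1) [OF that] p(2) [OF that] b(1) [OF that]])
  \<comment> \<open>From a point of \<open>S j\<close> in \<open>I\<close>, each of the two ends
    would be reached through the frontier, which the bar meets only in \<open>c j\<close>. So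
    \<open>c j\<close> would lie on both sides of that point and coincide with it, although
    \<open>c j\<close> is outside \<open>I\<close>.\<close>
  have SI: "S j \<inter> I = {}" if j: "j < 3" for j
  proof (rule ccontr)
    assume "S j \<inter> I \<noteq> {}"
    then obtain z where z: "z \<in> S j" "z \<in> I" by auto
    have cin: "c j \<in> closed_segment z x" if x: "x \<in> b j" "x \<notin> I" for x
    proof -
      have "closed_segment z x \<inter> frontier I \<noteq> {}"
        using x z by (intro connected_Int_frontier) auto
      then obtain y k where y: "k < 3" "y \<in> closed_segment z x" "y \<in> F k" using F(2) by blast
      moreover have "y \<in> b j"
        using y(2) closed_segment_subset [OF _ _ b(1) [OF j]] x(1) z(1) Sb [OF j] by blast
      ultimately have "y = c j" using b(2) [OF j] b(3) [OF j y(1)] by (cases "j = k") blast+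
      then show ?thesis using y(2) by simp
    qed
    have "c j \<in> closed_segment z (p j)" "c j \<in> closed_segment z (q j)"
      using cin pI p j by auto
    moreover have "closed_segment (p j) z \<inter> closed_segment z (q j) = {z}"
      by (rule Int_closed_segment) (use z S_def in auto)
    ultimately have "c j = z" by (metis IntI closed_segment_commute singletonD)
    then show False using b(2) [OF j] F(1) [OF j] z by auto
  qed
  \<comment> \<open>The straight way from \<open>c j\<close> to the closest point \<open>w j\<close>
    of \<open>S j\<close> stays off \<open>S j\<close> until it arrives.\<close>
  define w where "w j = closest_point (S j) (c j)" for j
  have wS: "w j \<in> S j" for j unfolding w_def S_def by (intro closest_point_in_set) auto
  have cw: "closed_segment (c j) (w j) \<inter> S j \<subseteq> {w j}" for j
  proof
    fix z assume z: "z \<in> closed_segment (c j) (w j) \<inter> S j"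
    have "dist (c j) (w j) \<le> dist (c j) z"
      unfolding w_def using z by (intro closest_point_le) (auto simp: S_def)
    moreover have "dist (c j) (w j) = dist (c j) z + dist z (w j)"
      using z between [of "c j" "w j" z] by (auto simp: between_mem_segment)
    ultimately show "z \<in> {w j}" by auto
  qed
  obtain e where e: "\<And>j. j < 3 \<Longrightarrow> e j \<in> closure I" "\<And>j. j < 3 \<Longrightarrow> e j \<in> F j"
  proof -
    have "\<forall>j. \<exists>x. j < 3 \<longrightarrow> x \<in> closure I \<and> x \<in> F j" using F(3) by blast
    then obtain e where "\<And>j. j < 3 \<longrightarrow> e j \<in> closure I \<and> e j \<in> F j" by metis
    then show ?thesis using that by auto
  qed
  \<comment> \<open>\<open>T j\<close> leads from a point of the closure of \<open>I\<close> along
    \<open>F j\<close> to \<open>c j\<close> and then along the bar, with \<open>w j\<close> left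
    out. Attached to \<open>I\<close>, it reaches \<open>S j\<close> in the closure while staying
    disjoint from it.\<close>
  define T where "T j = (closed_segment (e j) (c j) \<union> closed_segment (c j) (w j)) - {w j}" for j
  have cj: "c j \<in> F j" "c j \<in> b j" if "j < 3" for j using b(2) [OF that] by auto
  have ecF: "closed_segment (e j) (c j) \<subseteq> F j" if "j < 3" for j
    by (rule closed_segment_subset [OF e(2) [OF that] cj(1) [OF that] F(4) [OF that]])
  have cwb: "closed_segment (c j) (w j) \<subseteq> b j" if "j < 3" for j
    by (rule closed_segment_subset [OF cj(2) [OF that] subsetD [OF Sb [OF that] wS] b(1) [OF that]])
  have wF: "w j = c j" if "w j \<in> closed_segment (e j) (c j)" "j < 3" for j
    using subsetD [OF ecF that(1)] b(2) [OF that(2)] subsetD [OF Sb wS, of j] that by auto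
  have T: "connected (I \<union> T j) \<and> w j \<in> closure (I \<union> T j)" if j: "j < 3" for j
  proof (cases "e j = w j")
    case True
    then have "w j = c j" using wF j by auto
    then have "T j = {}" using True by (auto simp: T_def)
    then show ?thesis using I e(1) [OF j] True by simp
  next
    case False
    have "connected (T j) \<and> w j \<in> closure (T j)"
    proof (cases "w j = c j")
      case True
      then have "T j = closed_segment (e j) (w j) - {w j}" by (auto simp: T_def)
      then show ?thesis using closure_segment_minus_end [OF False]
        by (simp add: convex_segment_minus_end convex_connected)
    next
      case wc: False
      then have eq: "T j = closed_segment (e j) (c j) \<union> (closed_segment (c j) (w j) - {w j})"
        using wF j by (auto simp: T_def)
      have "connected (T j)" unfolding eq
        by (intro connected_Un convex_connected convex_segment_minus_end) (use wc in auto)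
      moreover have "w j \<in> closure (closed_segment (c j) (w j) - {w j})"
        using closure_segment_minus_end wc by metis
      ultimately show ?thesis by (simp add: eq)
    qed
    moreover have "e j \<in> T j" using False by (simp add: T_def)
    moreover have "connected (insert (e j) I)"
      by (rule connected_intermediate_closure [OF I(2)]) (use e(1) [OF j] Icl in auto)
    ultimately have "connected (insert (e j) I \<union> T j)" "w j \<in> closure (T j)"
      using connected_Un [of "insert (e j) I" "T j"] by blast+
    moreover have "insert (e j) I \<union> T j = I \<union> T j" using \<open>e j \<in> T j\<close> by auto
    ultimately show ?thesis by auto
  qed
  have Ine: "I \<noteq> {}" using F(3) [of 0] by auto
  define C where "C = (\<Union>j<3. I \<union> T j)"
  have Csub: "C \<subseteq> I \<union> (\<Union>j<3. T j)" by (auto simp: C_def)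
  have Tsub: "T j \<subseteq> F j \<union> b j" if "j < 3" for j unfolding T_def using ecF cwb that by auto
  show False
  proof (rule no_planar_K33 [of H1 p H2 q C])
    show "connected C" unfolding C_def
      by (rule connected_Union) (use T Ine in auto)
    show "C \<inter> (H1 \<union> H2) = {}"
    proof -
      have "T j \<inter> (H1 \<union> H2) = {}" if j: "j < 3" for j
        using Tsub [OF j] H1(3,4) [OF j] H2(3,4) [OF j] by blast
      moreover have "I \<inter> (H1 \<union> H2) = {}" using HI [of 0] by auto
      ultimately show ?thesis unfolding C_def by auto
    qed
    show "closed_segment (p j) (q j) \<inter> (H1 \<union> H2) = {}" if "j < 3" for j
      using Sb [OF that] H1(4) [OF that] H2(4) [OF that] unfolding S_def by blast
    show "closed_segment (p j) (q j) \<inter> closed_segment (p k) (q k) = {}" if "j < 3" "k < 3" "j \<noteq> k" for j k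
      using Sb [OF that(1)] Sb [OF that(2)] b(4) [OF that] unfolding S_def by blast
    show "C \<inter> closed_segment (p j) (q j) = {}" if j: "j < 3" for j
    proof -
      have "T k \<inter> S j = {}" if k: "k < 3" for k
      proof (cases "k = j")
        case True
        show ?thesis
        proof (rule ccontr)
          assume "T k \<inter> S j \<noteq> {}"
          then obtain x where x: "x \<in> T j" "x \<in> S j" using True by auto
          then have "x \<noteq> w j" "x \<in> closed_segment (e j) (c j)" using cw [of j] by (auto simp: T_def)
          then have "x = c j" using subsetD [OF ecF [OF j]] subsetD [OF Sb [OF j]] b(2) [OF j] x(2) by blast
          then show False using cw [of j] x by (auto simp: T_def)
        qed
      next
        case False
        then show ?thesis using Tsub [OF k] Sb [OF j] b(3) [OF j k] b(4) [OF j k] by auto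
      qed
      then show ?thesis using SI [OF j] unfolding C_def S_def by auto
    qed
    show "closure C \<inter> closed_segment (p j) (q j) \<noteq> {}" if j: "j < 3" for j
    proof -
      have "I \<union> T j \<subseteq> C" using j by (auto simp: C_def)
      then have "w j \<in> closure C" using T [OF j] closure_mono by blast
      then show ?thesis using wS [of j] S_def by auto
    qed
  qed (use H1 H2 HH p in auto)
qed

section \<open>Signed areas, barycentric coordinates and the inner triangle\<close>

definition cr :: "complex \<Rightarrow> complex \<Rightarrow> real" where "cr u v = Re u * Im v - Im u * Re v"

definition side :: "complex \<Rightarrow> complex \<Rightarrow> complex \<Rightarrow> real" where "side p q z = cr (q - p) (z - p)"

lemma side_affine: "side p q ((1 - t) *\<^sub>R a + t *\<^sub>R b) = (1 - t) * side p q a + t * side p q b"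
  by (simp add: side_def cr_def algebra_simps)

lemma side_ends [simp]: "side p q p = 0" "side p q q = 0"
  by (simp_all add: side_def cr_def)

lemma continuous_on_side [continuous_intros]: "continuous_on S (side p q)"
  unfolding side_def cr_def by (intro continuous_intros)

lemma cr_scaleR [simp]: "cr (a *\<^sub>R u) v = a * cr u v" "cr u (a *\<^sub>R v) = a * cr u v" "cr u u = 0"
  by (simp_all add: cr_def algebra_simps)

lemma cr_add: "cr (u + w) v = cr u v + cr w v" "cr u (v + w) = cr u v + cr u w"
   "cr (u - w) v = cr u v - cr w v" "cr u (v - w) = cr u v - cr u w"
  by (simp_all add: cr_def algebra_simps)

lemma closed_segment_side: "z \<in> closed_segment p q \<Longrightarrow> side p q z = 0"
  by (auto simp: in_segment side_affine)

lemma diff_in_segment: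
  fixes p q x y :: "'a::real_vector"
  assumes "x \<in> closed_segment p q" "y \<in> closed_segment p q"
  shows "\<exists>a. y - x = a *\<^sub>R (q - p)"
proof -
  obtain s t where st: "x = (1 - s) *\<^sub>R p + s *\<^sub>R q" "y = (1 - t) *\<^sub>R p + t *\<^sub>R q"
    using assms by (auto simp: in_segment)
  have "y - x = (t - s) *\<^sub>R (q - p)" unfolding st by (simp add: algebra_simps)
  then show ?thesis ..
qed

lemma cr_zero_imp_multiple:
  assumes "cr u v = 0" "u \<noteq> 0" shows "\<exists>a. v = a *\<^sub>R u"
proof -
  define a where "a = (Re u * Re v + Im u * Im v) / ((Re u)\<^sup>2 + (Im u)\<^sup>2)"
  have n: "(Re u)\<^sup>2 + (Im u)\<^sup>2 \<noteq> 0" using assms(2) by (metis complex_neq_0 less_irrefl)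
  have e: "Re u * Im v = Im u * Re v" using assms(1) by (simp add: cr_def)
  have "(Re u * Re v + Im u * Im v) * Re u = Re v * ((Re u)\<^sup>2 + (Im u)\<^sup>2)"
    using e by (simp add: algebra_simps power2_eq_square)
  moreover have "(Re u * Re v + Im u * Im v) * Im u = Im v * ((Re u)\<^sup>2 + (Im u)\<^sup>2)"
    using e by (simp add: algebra_simps power2_eq_square)
  ultimately have "v = a *\<^sub>R u" using n by (simp add: a_def complex_eq_iff nonzero_eq_divide_eq)
  then show ?thesis ..
qed

lemma unique_crossing:
  assumes "cr (q - p) (q' - p') \<noteq> 0" "x \<in> closed_segment p q" "y \<in> closed_segment p q"
    "x \<in> closed_segment p' q'" "y \<in> closed_segment p' q'"
  shows "x = y"
proof -
  obtain a b where "y - x = a *\<^sub>R (q - p)" "y - x = b *\<^sub>R (q' - p')"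
    using diff_in_segment assms by metis
  then have "cr (a *\<^sub>R (q - p)) (b *\<^sub>R (q' - p')) = 0" "y - x = a *\<^sub>R (q - p)" "y - x = b *\<^sub>R (q' - p')"
    by (metis cr_scaleR(3))+
  then show ?thesis using assms(1) by auto
qed

lemma mod3: "(j::nat) < 3 \<Longrightarrow> (j + 1) mod 3 \<noteq> j \<and> (j + 2) mod 3 \<noteq> j \<and> (j + 1) mod 3 < 3 \<and> (j + 2) mod 3 < 3
    \<and> (j + 1) mod 3 \<noteq> (j + 2) mod 3"
  by presburger

lemma convex_comb_pos: "0 < (1 - w) * x + w * y" if "0 < x" "0 < y" "0 \<le> w" "w \<le> 1" for x y w :: real
proof (cases "w = 0")
  case False
  then have "0 < w * y" "0 \<le> (1 - w) * x" using that by auto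
  then show ?thesis by linarith
qed (use that in auto)

locale triangle =
  fixes v :: "nat \<Rightarrow> complex"
  assumes nondeg: "cr (v 1 - v 0) (v 2 - v 0) \<noteq> 0"
begin

definition bary :: "nat \<Rightarrow> complex \<Rightarrow> real" where
  "bary j z = cr (v ((j + 1) mod 3) - z) (v ((j + 2) mod 3) - z) / cr (v 1 - v 0) (v 2 - v 0)"

definition inside :: "complex set" where "inside = {z. \<forall>j<3. 0 < bary j z}"

lemma bary_012:
  "bary 0 z = cr (v 1 - z) (v 2 - z) / cr (v 1 - v 0) (v 2 - v 0)"
  "bary 1 z = cr (v 2 - z) (v 0 - z) / cr (v 1 - v 0) (v 2 - v 0)"
  "bary 2 z = cr (v 0 - z) (v 1 - z) / cr (v 1 - v 0) (v 2 - v 0)"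
  by (simp_all add: bary_def mod_Suc numeral_2_eq_2)

lemma all3: "(\<forall>j<3. R j) \<longleftrightarrow> R 0 \<and> R 1 \<and> R (2::nat)" by (auto simp: less_3_cases)

lemma bary_sum: "bary 0 z + bary 1 z + bary 2 z = 1"
  using nondeg unfolding bary_012 by (simp add: divide_simps) (simp add: cr_def algebra_simps)

lemma bary_combination: "z = bary 0 z *\<^sub>R v 0 + bary 1 z *\<^sub>R v 1 + bary 2 z *\<^sub>R v 2"
proof -
  have "cr (v 1 - v 0) (v 2 - v 0) *\<^sub>R z
    = cr (v 1 - z) (v 2 - z) *\<^sub>R v 0 + cr (v 2 - z) (v 0 - z) *\<^sub>R v 1 + cr (v 0 - z) (v 1 - z) *\<^sub>R v 2"
    by (simp add: complex_eq_iff cr_def algebra_simps)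
  then have "(1 / cr (v 1 - v 0) (v 2 - v 0)) *\<^sub>R cr (v 1 - v 0) (v 2 - v 0) *\<^sub>R z =
    (1 / cr (v 1 - v 0) (v 2 - v 0)) *\<^sub>R (cr (v 1 - z) (v 2 - z) *\<^sub>R v 0 + cr (v 2 - z) (v 0 - z) *\<^sub>R v 1 + cr (v 0 - z) (v 1 - z) *\<^sub>R v 2)"
    by simp
  then show ?thesis unfolding bary_012 using nondeg by (simp add: scaleR_add_right)
qed

lemma bary_affine: "bary j ((1 - t) *\<^sub>R a + t *\<^sub>R b) = (1 - t) * bary j a + t * bary j b"
proof -
  have "cr (x - ((1 - t) *\<^sub>R a + t *\<^sub>R b)) (y - ((1 - t) *\<^sub>R a + t *\<^sub>R b))
    = (1 - t) * cr (x - a) (y - a) + t * cr (x - b) (y - b)" for x y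
    by (simp add: cr_def algebra_simps)
  then show ?thesis unfolding bary_def by (simp add: add_divide_distrib)
qed

lemma continuous_on_bary [continuous_intros]: "continuous_on S (bary j)"
  unfolding bary_def cr_def using nondeg by (auto intro!: continuous_intros simp: cr_def)

lemma open_inside: "open inside"
proof -
  have "open {z. bary j z > 0}" for j
    by (intro open_Collect_less continuous_on_bary continuous_on_const)
  then have "open ({z. bary 0 z > 0} \<inter> {z. bary 1 z > 0} \<inter> {z. bary 2 z > 0})"
    by (intro open_Int)
  then show ?thesis unfolding inside_def all3 by (simp add: Collect_conj_eq Int_assoc)
qed

lemma convex_inside: "convex inside"
proof (rule convexI)
  fix u w :: real and a b assume *: "a \<in> inside" "b \<in> inside" "0 \<le> u" "0 \<le> w" "u + w = (1::real)"
  then have u: "u = 1 - w" by simp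
  show "u *\<^sub>R a + w *\<^sub>R b \<in> inside"
    using * unfolding inside_def u by (auto simp: bary_affine intro!: convex_comb_pos)
qed

lemma closure_inside: "z \<in> closure inside \<Longrightarrow> j < 3 \<Longrightarrow> 0 \<le> bary j z"
proof -
  assume z: "z \<in> closure inside" and j: "j < 3"
  have "closed {z. 0 \<le> bary j z}" by (intro closed_Collect_le continuous_intros)
  moreover have "inside \<subseteq> {z. 0 \<le> bary j z}" using j by (auto simp: inside_def less_eq_real_def)
  ultimately show ?thesis using z closure_minimal by blast
qed

lemma side_of_triangle: "z \<in> closed_segment (v i) (v k)"
  if "z \<in> closure inside" "bary j z = 0" "j < 3" "i < 3" "k < 3" "i \<noteq> j" "k \<noteq> j" "i \<noteq> k"
proof -
  have "bary 0 z *\<^sub>R v 0 + bary 1 z *\<^sub>R v 1 + bary 2 z *\<^sub>R v 2 = bary i z *\<^sub>R v i + bary k z *\<^sub>R v k"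
    "bary 0 z + bary 1 z + bary 2 z = bary i z + bary k z"
    using that(2-) unfolding less_3_cases by (auto simp: add.commute)
  then have "z = bary i z *\<^sub>R v i + bary k z *\<^sub>R v k" "bary i z = 1 - bary k z"
    using bary_combination [of z] bary_sum [of z] by auto
  then have "z = (1 - bary k z) *\<^sub>R v i + bary k z *\<^sub>R v k \<and> 0 \<le> bary k z \<and> bary k z \<le> 1"
    using closure_inside [OF that(1)] that(4,5) by (metis diff_ge_0_iff_ge)
  then show ?thesis unfolding in_segment by blast
qed

lemma vertex_in_closure: "v j \<in> closure inside" if "j < 3"
proof -
  define c where "c = (1/3) *\<^sub>R (v 0 + v 1 + v 2)"
  let ?d = "cr (v 1 - v 0) (v 2 - v 0)"
  have "bary 0 c = 1/3" "bary 1 c = 1/3" "bary 2 c = 1/3"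
    unfolding bary_012 c_def using nondeg by (simp_all add: divide_simps) (simp_all add: cr_def algebra_simps)
  then have c: "bary i c = 1/3" if "i < 3" for i using that by (auto simp: less_3_cases)
  have bv: "bary i (v j) = (if i = j then 1 else 0)" if "i < 3" for i
    using that \<open>j < 3\<close> nondeg unfolding less_3_cases
    by (auto simp: bary_012 [simplified] divide_simps) (auto simp: cr_def algebra_simps)
  have *: "(1 - t) *\<^sub>R v j + t *\<^sub>R c \<in> inside" if "0 < t" "t \<le> 1" for t
    unfolding inside_def using that by (auto simp: bary_affine bv c)
  obtain i where "i < 3" "i \<noteq> j" by (metis zero_less_numeral one_less_numeral_iff semiring_norm(77) zero_neq_one)
  then have "bary i (v j) \<noteq> bary i c" using bv [of i] c [of i] by simp
  then have "v j \<noteq> c" by auto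
  moreover have "open_segment (v j) c \<subseteq> inside" using * by (auto simp: in_segment)
  ultimately show ?thesis using closure_mono [of "open_segment (v j) c" inside] by auto
qed

text \<open>Let \<open>z\<close> have parameter \<open>r\<close> on the line from \<open>p\<close>
  to \<open>q\<close>. If \<open>r < 0\<close>, all three points \<open>x j\<close> lie ahead of
  \<open>z\<close>, so each barycentric coordinate, positive at \<open>z\<close> and zero at
  \<open>x j\<close>, decreases in the direction of \<open>q\<close>; but the three have constant
  sum. The case \<open>r > 1\<close> is symmetric.\<close>

lemma chord:
  assumes "p \<noteq> q" and x: "\<And>j. j < 3 \<Longrightarrow> x j \<in> closed_segment p q" "\<And>j. j < 3 \<Longrightarrow> bary j (x j) = 0"
    and z: "z \<in> inside" "side p q z = 0"
  shows "z \<in> closed_segment p q"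
proof -
  obtain r where r: "z - p = r *\<^sub>R (q - p)"
    using cr_zero_imp_multiple [of "q - p" "z - p"] z(2) assms(1) by (auto simp: side_def)
  have "\<exists>s. \<forall>j<3. 0 \<le> s j \<and> s j \<le> 1 \<and> x j = (1 - s j) *\<^sub>R p + s j *\<^sub>R q"
    using x(1) unfolding in_segment by metis
  then obtain s where "\<forall>j<3. 0 \<le> s j \<and> s j \<le> 1 \<and> x j = (1 - s j) *\<^sub>R p + s j *\<^sub>R q" ..
  then have s: "\<And>j. j < 3 \<Longrightarrow> 0 \<le> s j \<and> s j \<le> 1 \<and> x j = (1 - s j) *\<^sub>R p + s j *\<^sub>R q" by blast
  have zr: "z = (1 - r) *\<^sub>R p + r *\<^sub>R q" using r by (simp add: algebra_simps)
  define m where "m j = bary j q - bary j p" for j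
  have bz: "bary j z = bary j p + r * m j" for j unfolding zr bary_affine m_def by (simp add: algebra_simps)
  have bx: "bary j p + s j * m j = 0" if "j < 3" for j
  proof -
    have "x j = (1 - s j) *\<^sub>R p + s j *\<^sub>R q" using s [OF that] by blast
    then have "bary j (x j) = (1 - s j) * bary j p + s j * bary j q" by (simp only: bary_affine)
    then show ?thesis using x(2) [OF that] unfolding m_def by (simp add: algebra_simps)
  qed
  have pos: "0 < (r - s j) * m j" if "j < 3" for j
  proof -
    have "0 < bary j z" using z(1) that by (simp add: inside_def)
    then show ?thesis using bz [of j] bx [OF that] by (simp add: algebra_simps)
  qed
  have "m 0 + m 1 + m 2 = 0" using bary_sum [of p] bary_sum [of q] by (simp add: m_def)
  have "\<not> r < 0"
  proof
    assume "r < 0"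
    then have "r - s j < 0" if "j < 3" for j using s [OF that] by linarith
    then have "m j < 0" if "j < 3" for j using pos [OF that] that by (metis zero_less_mult_iff less_asym)
    from this [of 0] this [of 1] this [of 2] show False using \<open>m 0 + m 1 + m 2 = 0\<close> by simp
  qed
  moreover have "\<not> r > 1"
  proof
    assume "r > 1"
    then have "r - s j > 0" if "j < 3" for j using s [OF that] by linarith
    then have "m j > 0" if "j < 3" for j using pos [OF that] that by (metis zero_less_mult_iff less_asym)
    from this [of 0] this [of 1] this [of 2] show False using \<open>m 0 + m 1 + m 2 = 0\<close> by simp
  qed
  ultimately show ?thesis unfolding zr in_segment by (intro exI [of _ r]) auto
qed
end

lemma crossing_triangle:
  fixes P Q :: "nat \<Rightarrow> complex"
  defines "F \<equiv> \<lambda>j. closed_segment (P j) (Q j)"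
  assumes meet: "\<And>i j. \<lbrakk>i < 3; j < 3; i \<noteq> j\<rbrakk> \<Longrightarrow> F i \<inter> F j \<noteq> {}"
    and npar: "\<And>i j. \<lbrakk>i < 3; j < 3; i \<noteq> j\<rbrakk> \<Longrightarrow> cr (Q i - P i) (Q j - P j) \<noteq> 0"
    and ncon: "F 0 \<inter> F 1 \<inter> F 2 = {}"
  obtains I where "open I" "convex I" "\<And>j. j < 3 \<Longrightarrow> F j \<inter> I = {}" "frontier I \<subseteq> (\<Union>j<3. F j)"
    "\<And>j. j < 3 \<Longrightarrow> closure I \<inter> F j \<noteq> {}"
    "\<And>p q z. \<lbrakk>p \<noteq> q; \<And>j. j < 3 \<Longrightarrow> closed_segment p q \<inter> F j \<noteq> {}; z \<in> I; side p q z = 0\<rbrakk> \<Longrightarrow> z \<in> closed_segment p q"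
proof -
  obtain v0 v1 v2 where v: "v0 \<in> F 1" "v0 \<in> F 2" "v1 \<in> F 0" "v1 \<in> F 2" "v2 \<in> F 0" "v2 \<in> F 1"
    using meet [of 0 1] meet [of 0 2] meet [of 1 2] by auto
  \<comment> \<open>\<open>v j\<close> is the crossing point of the two segments other than
    \<open>F j\<close>, so the barycentric coordinate \<open>j\<close> vanishes along
    \<open>F j\<close>.\<close>
  define v where "v j = (if j = 0 then v0 else if j = 1 then v1 else v2)" for j :: nat
  have v012: "v 0 = v0" "v 1 = v1" "v 2 = v2" by (simp_all add: v_def)
  obtain a where a: "v2 - v1 = a *\<^sub>R (Q 0 - P 0)" using diff_in_segment v(3,5) unfolding F_def by blast
  obtain b where b: "v2 - v0 = b *\<^sub>R (Q 1 - P 1)" using diff_in_segment v(1,6) unfolding F_def by blast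
  have "a \<noteq> 0" "b \<noteq> 0" using a b v ncon by auto
  have "cr (v1 - v0) (v2 - v0) = cr ((v2 - v0) - (v2 - v1)) (v2 - v0)" by simp
  also have "\<dots> = - (a * b * cr (Q 0 - P 0) (Q 1 - P 1))" unfolding a b by (simp only: cr_add(3) cr_scaleR) (simp add: algebra_simps)
  finally have nd: "cr (v1 - v0) (v2 - v0) \<noteq> 0" using \<open>a \<noteq> 0\<close> \<open>b \<noteq> 0\<close> npar [of 0 1] by simp
  interpret T: triangle v by unfold_locales (use nd in \<open>simp add: v_def\<close>)
  have vF: "v i \<in> F j" if "i < 3" "j < 3" "i \<noteq> j" for i j
    using that v unfolding less_3_cases v_def by auto
  have bF: "T.bary j z = 0" if j: "j < 3" and z: "z \<in> F j" for j z
  proof -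
    have "(j + 1) mod 3 \<noteq> j" "(j + 2) mod 3 \<noteq> j" "(j + 1) mod 3 < 3" "(j + 2) mod 3 < 3"
      using mod3 j by auto
    then have "v ((j + 1) mod 3) \<in> F j" "v ((j + 2) mod 3) \<in> F j" using vF j by auto
    then obtain s t where "v ((j + 1) mod 3) - z = s *\<^sub>R (Q j - P j)" "v ((j + 2) mod 3) - z = t *\<^sub>R (Q j - P j)"
      using diff_in_segment [OF z [unfolded F_def]] unfolding F_def by blast
    then show ?thesis by (simp add: T.bary_def)
  qed
  have cF: "convex (F j)" for j by (simp add: F_def)
  show ?thesis
  proof
    show "open T.inside" "convex T.inside" by (rule T.open_inside T.convex_inside)+
    show "F j \<inter> T.inside = {}" if "j < 3" for j using bF that by (force simp: T.inside_def)
    show "closure T.inside \<inter> F j \<noteq> {}" if "j < 3" for j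
    proof -
      show ?thesis using vF [of "(j + 1) mod 3" j] mod3 [OF that] that T.vertex_in_closure [of "(j + 1) mod 3"] by blast
    qed
    show "frontier T.inside \<subseteq> (\<Union>j<3. F j)"
    proof
      fix z assume "z \<in> frontier T.inside"
      then have z: "z \<in> closure T.inside" "z \<notin> T.inside"
        using T.open_inside by (auto simp: frontier_def interior_open)
      then obtain j where j: "j < 3" "T.bary j z = 0"
        using T.closure_inside [OF z(1)] unfolding T.inside_def by (auto simp: less_eq_real_def)
      have ne: "(j + 1) mod 3 \<noteq> j" "(j + 2) mod 3 \<noteq> j" "(j + 1) mod 3 < 3" "(j + 2) mod 3 < 3"
        "(j + 1) mod 3 \<noteq> (j + 2) mod 3"
        using mod3 j(1) by auto
      have "z \<in> closed_segment (v ((j + 1) mod 3)) (v ((j + 2) mod 3))"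
        by (rule T.side_of_triangle [OF z(1) j(2,1)]) (use ne in auto)
      also have "\<dots> \<subseteq> F j" using ne vF j(1) by (intro closed_segment_subset cF) auto
      finally show "z \<in> (\<Union>j<3. F j)" using j(1) by auto
    qed
    show "z \<in> closed_segment p q" if pq: "p \<noteq> q" "\<And>j. j < 3 \<Longrightarrow> closed_segment p q \<inter> F j \<noteq> {}"
      "z \<in> T.inside" "side p q z = 0" for p q z
    proof -
      have "\<exists>x. j < 3 \<longrightarrow> x \<in> closed_segment p q \<and> x \<in> F j" for j using pq(2) by blast
      then obtain x where "\<And>j. j < 3 \<Longrightarrow> x j \<in> closed_segment p q \<and> x j \<in> F j" by metis
      then show ?thesis by (intro T.chord [OF pq(1) _ _ pq(3,4), of x]) (simp_all add: bF)
    qed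
  qed
qed

section \<open>Connected unions, and separation by chords of a convex set\<close>

lemma path_connected_star:
  assumes "path_connected B" "B \<noteq> {}" "\<And>X. X \<in> \<F> \<Longrightarrow> path_connected X \<and> X \<inter> B \<noteq> {}"
  shows "path_connected (B \<union> \<Union>\<F>)"
proof -
  obtain b where b: "b \<in> B" using assms(2) by auto
  have "path_component (B \<union> \<Union>\<F>) b x" if "x \<in> B \<union> \<Union>\<F>" for x
  proof -
    obtain Y where "x \<in> Y" "b \<in> Y" "path_connected Y" "Y \<subseteq> B \<union> \<Union>\<F>"
    proof (cases "x \<in> B")
      case True
      then show ?thesis using that [of B] b assms(1) by auto
    next
      case False
      then obtain X where X: "x \<in> X" "X \<in> \<F>" using \<open>x \<in> B \<union> \<Union>\<F>\<close> by auto
      then have "path_connected (B \<union> X)" using assms(1,3) by (intro path_connected_Un) auto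
      then show ?thesis using that [of "B \<union> X"] X b by auto
    qed
    then show ?thesis
      using path_component_of_subset path_connected_component by meson
  qed
  then show ?thesis
    by (meson path_connected_component path_component_sym path_component_trans)
qed

lemma three_on_segment:
  fixes x y z :: "'a::euclidean_space"
  assumes "x \<in> closed_segment a b" "y \<in> closed_segment a b" "z \<in> closed_segment a b"
  shows "x \<in> closed_segment y z \<or> y \<in> closed_segment x z \<or> z \<in> closed_segment x y"
proof -
  have "collinear {x, y, z}"
    by (rule collinear_subset [OF collinear_closed_segment [of a b]]) (use assms in auto)
  then show ?thesis
    by (metis collinear_between_cases between_mem_segment closed_segment_commute)
qed

text \<open>Inside \<open>I\<close> the segment coincides with its supporting line, so the sign of
  \<open>side\<close> can change within \<open>I\<close> only by crossing the segment.\<close>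

definition full_in :: "complex set \<Rightarrow> complex \<Rightarrow> complex \<Rightarrow> bool" where
  "full_in I p q \<longleftrightarrow> p \<noteq> q \<and> (\<forall>z\<in>I. side p q z = 0 \<longrightarrow> z \<in> closed_segment p q)"

lemma same_side:
  assumes "full_in I p q" "connected U" "U \<subseteq> I" "U \<inter> closed_segment p q = {}" "x \<in> U" "y \<in> U"
  shows "side p q x * side p q y > 0"
proof -
  have nz: "side p q z \<noteq> 0" if "z \<in> U" for z
    using assms(1,3,4) that unfolding full_in_def by blast
  have c: "connected (side p q ` U)"
    by (rule connected_continuous_image [OF continuous_on_side assms(2)])
  have "\<not> (side p q x < 0 \<and> 0 < side p q y)" "\<not> (side p q y < 0 \<and> 0 < side p q x)"
    using connectedD_interval [OF c, of "side p q x" "side p q y" 0]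
      connectedD_interval [OF c, of "side p q y" "side p q x" 0] nz assms(5,6) by auto
  then show ?thesis using nz [OF assms(5)] nz [OF assms(6)]
    by (metis linorder_neqE_linordered_idom mult_neg_neg mult_pos_pos)
qed

lemma opposite_sides:
  assumes "y \<in> closed_segment x z" "side p q y = 0" "side p q x \<noteq> 0"
  shows "side p q x * side p q z \<le> 0"
proof -
  obtain t where t: "0 \<le> t" "t \<le> 1" "y = (1 - t) *\<^sub>R x + t *\<^sub>R z" using assms(1) by (auto simp: in_segment)
  then have e: "(1 - t) * side p q x + t * side p q z = 0" using assms(2) by (simp add: side_affine)
  then have "t \<noteq> 0" using assms(3) by auto
  have "t * (side p q x * side p q z) = - (1 - t) * (side p q x)\<^sup>2"
    using e by (simp add: power2_eq_square algebra_simps) (metis add.commute add_diff_cancel distrib_left mult.assoc mult.commute mult.left_commute)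
  also have "\<dots> \<le> 0" using t by (intro mult_nonpos_nonneg) auto
  finally show ?thesis using t \<open>t \<noteq> 0\<close> by (simp add: mult_le_0_iff)
qed

text \<open>Since \<open>y\<close> lies between them, \<open>x\<close> and \<open>z\<close> are on
  different sides of the full chord \<open>p q\<close>. But the two other segments, joined by
  \<open>U\<close>, form a connected set off that chord. This excludes orders of crossings along a
  transversal.\<close>

lemma middle_chord_separates:
  assumes I: "convex I" and B: "full_in I p q"
    and x: "x \<in> closed_segment a a' \<inter> I" "y \<in> closed_segment p q" "z \<in> closed_segment c c' \<inter> I" "y \<in> closed_segment x z"
    and d: "closed_segment a a' \<inter> closed_segment p q = {}" "closed_segment c c' \<inter> closed_segment p q = {}"
    and U: "connected U" "U \<subseteq> I" "U \<inter> closed_segment p q = {}" "U \<inter> closed_segment a a' \<noteq> {}" "U \<inter> closed_segment c c' \<noteq> {}"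
  shows False
proof -
  have con: "connected (closed_segment u w \<inter> I)" for u w using I by (intro convex_connected convex_Int) auto
  have "connected (closed_segment a a' \<inter> I \<union> U \<union> closed_segment c c' \<inter> I)"
    using con U by (intro connected_Un) blast+
  then have pos: "side p q x * side p q z > 0"
    by (rule same_side [OF B]) (use U d x in auto)
  moreover have "side p q x \<noteq> 0" using pos by auto
  ultimately show False using opposite_sides [OF x(4) closed_segment_side [OF x(2)]] by auto
qed

section \<open>The gadget\<close>

text \<open>
  The names of the segments. The three \<open>Frm\<close> bound a triangle, and every line \<open>Lin l\<close> crosses all of them, so
  inside the triangle it is as good as a full straight line. The core consists of the walls \<open>Wl\<close>, their extensions
  \<open>Tp\<close> and \<open>Bt\<close> to the outermost lines \<open>Lup\<close> and \<open>Llo\<close>, the link \<open>Chi\<close> and the certificates \<open>Qs\<close>, \<open>Us\<close>, \<open>Ds\<close>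
  of the order in which two lines cross a wall. The far part \<open>Pole\<close>, \<open>PiA\<close>, \<open>PiB\<close>, \<open>PiC\<close>, \<open>Kap\<close> and the bars
  \<open>Bar\<close> with their ticks \<open>Ta\<close>, \<open>Tb\<close> force the core into the triangle. Crossing points of the lines \<open>lA i\<close>,
  \<open>lB i\<close>, \<open>lC i\<close> with the walls carry a number that is squared in each step.\<close>

datatype line = lE | lE2 | lS | lR | lF | lP | lG | lA nat | lB nat | lC nat
datatype wall = wD | wN | wM | wW
datatype nm = Frm nat | Lup | Llo | Mid | Lin line | Wl wall | Tp wall | Bt wall | Chi | Bar nat | Ta nat | Tb nat
  | Pole | PiA | PiB | PiC | Kap | Qs line line wall | Us line line wall | Ds line line wall | Pad nat

text \<open>With \<open>r i = (uu (lC i) - 1) / (uu lE2 - 1)\<close>, where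
  \<open>- 1 / uu l\<close> is the position of the crossing of \<open>l\<close> with
  \<open>wD\<close>, a step \<open>i > 0\<close> forces \<open>r i \<ge> (r (i - 1))^2\<close>.
  Applied to \<open>lE2\<close> itself, this would never leave the ratio 1. So step 0 takes
  \<open>lE2\<close> as its predecessor with another unit, \<open>lE\<close>, and another wall, and
  gives \<open>r 0 \<ge> 2\<close>.\<close>

definition unit_line :: "nat \<Rightarrow> line" where "unit_line i = (if i = 0 then lE else lE2)"
definition prev_line :: "nat \<Rightarrow> line" where "prev_line i = (if i = 0 then lE2 else lC (i - 1))"
definition step_wall :: "nat \<Rightarrow> wall" where "step_wall i = (if i = 0 then wM else wW)"

text \<open>A triple \<open>(a, b, w)\<close> demands that the line \<open>a\<close> crosses the wall \<open>w\<close> below the line \<open>b\<close>.\<close>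

definition step_certs :: "nat \<Rightarrow> (line \<times> line \<times> wall) set" where
  "step_certs i = {(lA i, prev_line i, wD), (lB i, prev_line i, wD), (unit_line i, lA i, wN), (lC i, lB i, wN),
     (lB i, unit_line i, step_wall i), (lA i, lC i, step_wall i),
     (lS, lA i, wD), (lS, lB i, wD), (lS, lC i, wD), (lC i, lP, wW)}"

definition certs :: "nat \<Rightarrow> (line \<times> line \<times> wall) set" where
  "certs K = (\<Union>i\<le>K. step_certs i) \<union>
     {(lS, lE, wD), (lS, lE2, wD), (lR, lS, wN), (lP, lF, wN), (lP, lF, wD), (lE2, lP, wW), (lC K, lG, wW), (lG, lP, wW)}"

definition lines :: "nat \<Rightarrow> line set" where
  "lines K = {lE, lE2, lS, lR, lF, lP, lG} \<union> lA ` {..K} \<union> lB ` {..K} \<union> lC ` {..K}"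

definition core :: "nat \<Rightarrow> nm set" where
  "core K = Wl ` {wD, wN, wM, wW} \<union> Tp ` {wD, wN, wM, wW} \<union> Bt ` {wD, wN, wM, wW} \<union> {Chi} \<union>
     (\<Union>(a, b, w) \<in> certs K. {Qs a b w, Us a b w, Ds a b w})"

definition far :: "nm set" where "far = {Pole, PiA, PiB, PiC, Kap}"

lemma step_certs_lines: "(a, b, w) \<in> step_certs i \<Longrightarrow> i \<le> K \<Longrightarrow> a \<in> lines K \<and> b \<in> lines K"
  by (auto simp: step_certs_def lines_def prev_line_def unit_line_def)

lemma certs_lines: "(a, b, w) \<in> certs K \<Longrightarrow> a \<in> lines K \<and> b \<in> lines K"
  using step_certs_lines by (auto simp: certs_def) (auto simp: lines_def)

text \<open>Only adjacency of names is recorded here, so that it can be verified once in the drawing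
  and then holds in every realization of the same graph.\<close>

locale gadget_hits =
  fixes K :: nat and hit :: "nm \<Rightarrow> nm \<Rightarrow> bool"
  assumes frames: "\<And>i j. \<lbrakk>i < 3; j < 3; i \<noteq> j\<rbrakk> \<Longrightarrow> hit (Frm i) (Frm j)"
    and line_frame: "\<And>l j. \<lbrakk>l \<in> lines K; j < 3\<rbrakk> \<Longrightarrow> hit (Lin l) (Frm j)"
      "\<And>j. j < 3 \<Longrightarrow> hit Lup (Frm j)" "\<And>j. j < 3 \<Longrightarrow> hit Llo (Frm j)" "\<And>j. j < 3 \<Longrightarrow> hit Mid (Frm j)"
    and core_avoids: "\<And>x j. \<lbrakk>x \<in> core K; j < 3\<rbrakk> \<Longrightarrow> \<not> hit x (Frm j)" "\<And>x j. \<lbrakk>x \<in> core K; j < 3\<rbrakk> \<Longrightarrow> \<not> hit x (Bar j)"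
      "\<And>x y. \<lbrakk>x \<in> core K; y \<in> far\<rbrakk> \<Longrightarrow> \<not> hit x y" "\<And>x j. \<lbrakk>x \<in> core K; j < 3\<rbrakk> \<Longrightarrow> \<not> hit x (Tb j)"
    and far_avoids: "\<And>x j. \<lbrakk>x \<in> far; j < 3\<rbrakk> \<Longrightarrow> \<not> hit x (Frm j)" "\<And>x j. \<lbrakk>x \<in> far; j < 3\<rbrakk> \<Longrightarrow> \<not> hit x (Bar j)"
    and ticks: "\<And>j. j < 3 \<Longrightarrow> hit (Ta j) (Bar j)" "\<And>j. j < 3 \<Longrightarrow> hit (Ta j) (Wl wN)"
      "\<And>j. j < 3 \<Longrightarrow> hit (Tb j) (Bar j)" "\<And>j. j < 3 \<Longrightarrow> hit (Tb j) Pole"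
      "\<And>j k. \<lbrakk>j < 3; k < 3\<rbrakk> \<Longrightarrow> \<not> hit (Ta j) (Frm k)" "\<And>j k. \<lbrakk>j < 3; k < 3\<rbrakk> \<Longrightarrow> \<not> hit (Tb j) (Frm k)"
      "\<And>j k. \<lbrakk>j < 3; k < 3\<rbrakk> \<Longrightarrow> \<not> hit (Ta j) (Tb k)" "\<And>j y. \<lbrakk>j < 3; y \<in> far\<rbrakk> \<Longrightarrow> \<not> hit (Ta j) y"
      "\<And>j k. \<lbrakk>j < 3; k < 3; j \<noteq> k\<rbrakk> \<Longrightarrow> \<not> hit (Ta j) (Bar k)" "\<And>j k. \<lbrakk>j < 3; k < 3; j \<noteq> k\<rbrakk> \<Longrightarrow> \<not> hit (Tb j) (Bar k)"
    and bars: "\<And>j. j < 3 \<Longrightarrow> hit (Bar j) (Frm j)" "\<And>j k. \<lbrakk>j < 3; k < 3; j \<noteq> k\<rbrakk> \<Longrightarrow> \<not> hit (Bar j) (Frm k)"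
      "\<And>j k. \<lbrakk>j < 3; k < 3; j \<noteq> k\<rbrakk> \<Longrightarrow> \<not> hit (Bar j) (Bar k)"
    and far_hits: "hit PiA Pole" "hit PiB Pole" "hit Kap Pole" "hit Kap PiC"
      "hit Pole Lup" "hit Pole Mid" "hit Pole Llo" "hit PiA Mid" "hit PiA Llo" "\<not> hit PiA Lup"
      "hit PiB Mid" "hit PiB Lup" "\<not> hit PiB Llo" "hit PiC Lup" "hit PiC Llo" "\<not> hit PiC Mid"
    and Ldisj: "\<not> hit Lup Llo" "\<not> hit Lup Mid" "\<not> hit Llo Mid"
    and line_L: "\<And>l. l \<in> lines K \<Longrightarrow> \<not> hit (Lin l) Lup" "\<And>l. l \<in> lines K \<Longrightarrow> \<not> hit (Lin l) Llo"
      "\<And>l. l \<in> lines K \<Longrightarrow> hit (Lin l) (Wl wN)" "\<And>l. \<lbrakk>l \<in> lines K; l \<noteq> lR\<rbrakk> \<Longrightarrow> hit (Lin l) (Wl wD)"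
    and wall_L: "hit (Wl wN) Lup" "hit (Wl wN) Llo" "\<not> hit (Wl wD) Lup" "\<not> hit (Wl wD) Llo" "\<not> hit (Wl wW) Lup" "\<not> hit (Wl wW) Llo"
    and ends_L: "\<And>w. hit (Tp w) (Wl w)" "\<And>w. hit (Bt w) (Wl w)" "\<And>w. hit (Tp w) Lup" "\<And>w. hit (Bt w) Llo"
      "\<And>w. \<not> hit (Tp w) Llo" "\<And>w. \<not> hit (Bt w) Lup"
    and certs_hit: "\<And>a b w. (a, b, w) \<in> certs K \<Longrightarrow> hit (Qs a b w) (Wl w) \<and> hit (Us a b w) (Wl w) \<and> hit (Ds a b w) (Wl w)
        \<and> hit (Qs a b w) (Us a b w) \<and> hit (Qs a b w) (Ds a b w) \<and> hit (Us a b w) (Tp w) \<and> hit (Ds a b w) (Bt w)"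
    and certs_avoid: "\<And>a b w. (a, b, w) \<in> certs K \<Longrightarrow> \<not> hit (Qs a b w) (Lin a) \<and> \<not> hit (Qs a b w) (Lin b) \<and>
       \<not> hit (Us a b w) (Lin a) \<and> \<not> hit (Ds a b w) (Lin b) \<and>
       \<not> hit (Tp w) (Lin a) \<and> \<not> hit (Bt w) (Lin a) \<and> \<not> hit (Tp w) (Lin b) \<and> \<not> hit (Bt w) (Lin b)"
    and pins: "hit (Tp wD) (Lin lR)" "hit (Bt wW) (Lin lR)" "\<not> hit (Wl wD) (Lin lR)" "\<not> hit (Bt wD) (Lin lR)"
      "\<not> hit (Wl wW) (Lin lE)" "\<not> hit (Bt wW) (Lin lE)" "\<not> hit (Wl wW) (Lin lF)" "\<not> hit (Tp wW) (Lin lF)"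
      "\<not> hit (Bt wW) (Lin (lA 0))" "\<not> hit (Wl wM) (Wl wN)" "hit (Wl wM) Llo"
      "\<not> hit (Lin lG) (Lin (lC K))"
    and chi: "hit Chi (Wl wM)" "hit Chi (Wl wW)" "hit Chi (Bt wW)" "\<not> hit Chi (Wl wN)" "\<not> hit Chi (Lin lE2)"
      "\<not> hit Chi Lup" "\<not> hit Chi Llo"
    and walls: "hit (Wl wD) (Wl wN)" "hit (Wl wW) (Wl wN)" "hit (Wl wD) (Wl wW)"
      "\<And>l. l \<in> {lE, lE2, lA 0, lB 0, lC 0} \<Longrightarrow> hit (Wl wM) (Lin l)"

text \<open>General position is added to the incidences; \<open>generic_parameters\<close> supplies
  it by a perturbation. The plane is the complex one, where the Jordan curve theorem is
  stated.\<close>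

locale gadget =
  fixes P Q :: "nm \<Rightarrow> complex" and K :: nat
  fixes S :: "nm \<Rightarrow> complex set" and hit :: "nm \<Rightarrow> nm \<Rightarrow> bool"
  defines "S \<equiv> \<lambda>x. closed_segment (P x) (Q x)"
    and "hit \<equiv> \<lambda>x y. S x \<inter> S y \<noteq> {}"
  assumes line_ne: "\<And>l. l \<in> lines K \<Longrightarrow> P (Lin l) \<noteq> Q (Lin l)" "P Lup \<noteq> Q Lup" "P Llo \<noteq> Q Llo" "P Mid \<noteq> Q Mid"
    and frame_npar: "\<And>i j. \<lbrakk>i < 3; j < 3; i \<noteq> j\<rbrakk> \<Longrightarrow> cr (Q (Frm i) - P (Frm i)) (Q (Frm j) - P (Frm j)) \<noteq> 0"
    and frame_ncon: "S (Frm 0) \<inter> S (Frm 1) \<inter> S (Frm 2) = {}"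
    and bar_npar: "\<And>j. j < 3 \<Longrightarrow> cr (Q (Bar j) - P (Bar j)) (Q (Frm j) - P (Frm j)) \<noteq> 0"
      "\<And>j. j < 3 \<Longrightarrow> cr (Q (Bar j) - P (Bar j)) (Q (Ta j) - P (Ta j)) \<noteq> 0"
      "\<And>j. j < 3 \<Longrightarrow> cr (Q (Bar j) - P (Bar j)) (Q (Tb j) - P (Tb j)) \<noteq> 0"
    and DN_npar: "cr (Q (Wl wD) - P (Wl wD)) (Q (Wl wN) - P (Wl wN)) \<noteq> 0"
    and gadget_hits: "gadget_hits K hit"
begin

sublocale gadget_hits K hit by (rule gadget_hits)

lemma S_eq: "S x = closed_segment (P x) (Q x)" by (simp add: S_def)

lemma hit_commute: "hit x y \<longleftrightarrow> hit y x" by (auto simp: hit_def)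

lemma S_simps [simp]: "connected (S x)" "path_connected (S x)" "convex (S x)" "S x \<noteq> {}"
  by (auto simp: S_def convex_imp_path_connected)

lemma core_mem [simp]: "Wl w \<in> core K" "Tp w \<in> core K" "Bt w \<in> core K" "Chi \<in> core K"
  by (cases w; simp add: core_def)+

lemma core_cases: "x \<in> core K \<Longrightarrow> (\<exists>w. x = Wl w \<or> x = Tp w \<or> x = Bt w) \<or> x = Chi \<or>
   (\<exists>a b w. (a, b, w) \<in> certs K \<and> (x = Qs a b w \<or> x = Us a b w \<or> x = Ds a b w))"
  by (auto simp: core_def)

lemma core_certs: "(a, b, w) \<in> certs K \<Longrightarrow> Qs a b w \<in> core K \<and> Us a b w \<in> core K \<and> Ds a b w \<in> core K"
  by (force simp: core_def)

definition core_set :: "complex set" where "core_set = (\<Union>x\<in>core K. S x)"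
definition far_set :: "complex set" where "far_set = (\<Union>x\<in>far. S x)"

lemma path_connected_core: "path_connected core_set"
proof -
  define B0 where "B0 = S (Wl wN) \<union> \<Union>{S (Wl wD), S (Wl wW)}"
  define B1 where "B1 = B0 \<union> \<Union>{S Chi}"
  define B2 where "B2 = B1 \<union> \<Union>{S (Wl wM)}"
  have "path_connected B0" unfolding B0_def
    by (rule path_connected_star) (use walls in \<open>auto simp: hit_def Int_commute\<close>)
  then have "path_connected B1" unfolding B1_def
    by (rule path_connected_star) (use chi in \<open>auto simp: hit_def B0_def\<close>)
  then have "path_connected B2" unfolding B2_def
    by (rule path_connected_star) (use chi in \<open>auto simp: hit_def B1_def\<close>)
  then have "path_connected (B2 \<union> \<Union>(S ` core K))"
  proof (rule path_connected_star)
    have W: "S (Wl w) \<subseteq> B2" for w by (cases w) (auto simp: B2_def B1_def B0_def)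
    fix X assume "X \<in> S ` core K"
    then obtain x where x: "x \<in> core K" "X = S x" by auto
    have "\<exists>w. S x \<inter> S (Wl w) \<noteq> {}"
      using core_cases [OF x(1)] ends_L(1,2) certs_hit chi(1) by (fastforce simp: hit_def)
    then show "path_connected X \<and> X \<inter> B2 \<noteq> {}" using W x by fastforce
  qed (simp add: B2_def)
  moreover have "B2 \<subseteq> \<Union>(S ` core K)" unfolding B2_def B1_def B0_def using core_mem by blast
  ultimately show ?thesis by (simp add: core_set_def Un_absorb1)
qed

lemma path_connected_far: "path_connected far_set"
proof -
  define B1 where "B1 = S Pole \<union> \<Union>{S PiA, S PiB, S Kap}"
  have "path_connected B1" unfolding B1_def
    by (rule path_connected_star) (use far_hits in \<open>auto simp: hit_def\<close>)
  then have "path_connected (B1 \<union> \<Union>{S PiC})"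
    by (rule path_connected_star) (use far_hits in \<open>auto simp: hit_def B1_def Int_commute\<close>)
  moreover have "B1 \<union> \<Union>{S PiC} = far_set" by (auto simp: B1_def far_set_def far_def)
  ultimately show ?thesis by simp
qed

lemma path_connected_with_ticks:
  fixes p :: "nat \<Rightarrow> complex"
  assumes B: "path_connected B" and x: "\<And>j. j < 3 \<Longrightarrow> x j \<in> B" "\<And>j. j < (3::nat) \<Longrightarrow> x j \<noteq> p j" and k: "k < 3"
  shows "path_connected (insert (p k) (B \<union> (\<Union>j<3. closed_segment (x j) (p j) - {p j})))"
proof -
  let ?T = "\<lambda>j. closed_segment (x j) (p j) - {p j}"
  have "path_connected (B \<union> \<Union>(insert (closed_segment (x k) (p k)) (?T ` {..<3})))"
  proof (rule path_connected_star [OF B])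
    show "B \<noteq> {}" using x(1) k by auto
    fix X assume "X \<in> insert (closed_segment (x k) (p k)) (?T ` {..<3})"
    then consider "X = closed_segment (x k) (p k)" | j where "j < 3" "X = ?T j" by auto
    then show "path_connected X \<and> X \<inter> B \<noteq> {}"
    proof cases
      case 1
      then show ?thesis using x(1) [OF k] by (auto simp: convex_imp_path_connected)
    next
      case 2
      then have "x j \<in> X" using x(2) by auto
      then show ?thesis using 2 x(1) by (auto simp: convex_imp_path_connected convex_segment_minus_end)
    qed
  qed
  moreover have "B \<union> \<Union>(insert (closed_segment (x k) (p k)) (?T ` {..<3})) = insert (p k) (B \<union> (\<Union>j<3. ?T j))"
    using k by auto
  ultimately show ?thesis by simp
qed

text \<open>\<open>H1\<close> is the core with the ticks \<open>Ta\<close>, and \<open>H2\<close>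
  the far part with the ticks \<open>Tb\<close>, every tick being cut off where it meets its bar.
  The three bars and the triangle of the frame then satisfy
  \<open>bars_force_inside\<close>.\<close>

lemma core_or_far_inside:
  obtains I where "open I" "convex I" "core_set \<subseteq> I \<or> far_set \<subseteq> I"
    "\<And>l. l \<in> lines K \<Longrightarrow> full_in I (P (Lin l)) (Q (Lin l))"
    "full_in I (P Lup) (Q Lup)" "full_in I (P Llo) (Q Llo)" "full_in I (P Mid) (Q Mid)"
proof -
  let ?F = "\<lambda>j. S (Frm j)" and ?b = "\<lambda>j. S (Bar j)"
  have "\<exists>I. open I \<and> convex I \<and> (\<forall>j<3. ?F j \<inter> I = {}) \<and> frontier I \<subseteq> (\<Union>j<3. ?F j) \<and> (\<forall>j<3. closure I \<inter> ?F j \<noteq> {})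
    \<and> (\<forall>p q z. p \<noteq> q \<longrightarrow> (\<forall>j<3. closed_segment p q \<inter> ?F j \<noteq> {}) \<longrightarrow> z \<in> I \<longrightarrow> side p q z = 0 \<longrightarrow> z \<in> closed_segment p q)"
  proof (rule crossing_triangle [of "\<lambda>j. P (Frm j)" "\<lambda>j. Q (Frm j)", folded S_eq, OF frames [unfolded hit_def] frame_npar frame_ncon])
    fix I assume *: "open I" "convex I" "frontier I \<subseteq> (\<Union>j<3. ?F j)"
      and 1: "\<And>j. j < 3 \<Longrightarrow> ?F j \<inter> I = {}" and 2: "\<And>j. j < 3 \<Longrightarrow> closure I \<inter> ?F j \<noteq> {}"
      and 3: "\<And>p q z. \<lbrakk>p \<noteq> q; \<And>j. j < 3 \<Longrightarrow> closed_segment p q \<inter> ?F j \<noteq> {}; z \<in> I; side p q z = 0\<rbrakk> \<Longrightarrow> z \<in> closed_segment p q"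
    show ?thesis by (intro exI [of _ I] conjI allI impI * 1 2 3) auto
  qed
  then obtain I where I: "open I" "convex I" "\<And>j. j < 3 \<Longrightarrow> ?F j \<inter> I = {}" "frontier I \<subseteq> (\<Union>j<3. ?F j)"
    "\<And>j. j < 3 \<Longrightarrow> closure I \<inter> ?F j \<noteq> {}"
    and full: "\<And>p q z. \<lbrakk>p \<noteq> q; \<And>j. j < 3 \<Longrightarrow> closed_segment p q \<inter> ?F j \<noteq> {}; z \<in> I; side p q z = 0\<rbrakk> \<Longrightarrow> z \<in> closed_segment p q"
    by metis
  have uniq: "\<exists>c. S x \<inter> S y = {c}" if h: "hit x y" and n: "cr (Q x - P x) (Q y - P y) \<noteq> 0" for x y
  proof -
    obtain c where c: "c \<in> S x" "c \<in> S y" using h by (auto simp: hit_def)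
    then have "S x \<inter> S y = {c}" using unique_crossing [OF n] by (auto simp: S_def)
    then show ?thesis ..
  qed
  have "\<forall>j. \<exists>c. j < 3 \<longrightarrow> ?b j \<inter> ?F j = {c}" using uniq bars(1) bar_npar(1) by blast
  then obtain c where c: "\<And>j. j < 3 \<Longrightarrow> ?b j \<inter> ?F j = {c j}" by metis
  have "\<forall>j. \<exists>c. j < 3 \<longrightarrow> ?b j \<inter> S (Ta j) = {c}" using uniq ticks(1) bar_npar(2) by (metis hit_commute)
  then obtain p where p: "\<And>j. j < 3 \<Longrightarrow> ?b j \<inter> S (Ta j) = {p j}" by metis
  have "\<forall>j. \<exists>c. j < 3 \<longrightarrow> ?b j \<inter> S (Tb j) = {c}" using uniq ticks(3) bar_npar(3) by (metis hit_commute)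
  then obtain q where q: "\<And>j. j < 3 \<Longrightarrow> ?b j \<inter> S (Tb j) = {q j}" by metis
  have "\<forall>j. \<exists>x. j < 3 \<longrightarrow> x \<in> S (Ta j) \<and> x \<in> S (Wl wN)" using ticks(2) by (auto simp: hit_def)
  then obtain x where x: "\<And>j. j < 3 \<Longrightarrow> x j \<in> S (Ta j) \<and> x j \<in> S (Wl wN)" by metis
  have "\<forall>j. \<exists>x. j < 3 \<longrightarrow> x \<in> S (Tb j) \<and> x \<in> S Pole" using ticks(4) by (auto simp: hit_def)
  then obtain y where y: "\<And>j. j < 3 \<Longrightarrow> y j \<in> S (Tb j) \<and> y j \<in> S Pole" by metis
  have pin: "p j \<in> ?b j" "p j \<in> S (Ta j)" "q j \<in> ?b j" "q j \<in> S (Tb j)" if "j < 3" for j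
    using p [OF that] q [OF that] by auto
  have segx: "closed_segment (x j) (p j) \<subseteq> S (Ta j)" "closed_segment (y j) (q j) \<subseteq> S (Tb j)" if "j < 3" for j
    using closed_segment_subset [OF _ _ S_simps(3)] x [OF that] y [OF that] pin [OF that] by auto
  have disj: "core_set \<inter> S z = {}" if "\<And>x. x \<in> core K \<Longrightarrow> \<not> hit x z" for z
    using that by (auto simp: core_set_def hit_def)
  have disf: "far_set \<inter> S z = {}" if "\<And>x. x \<in> far \<Longrightarrow> \<not> hit x z" for z
    using that by (auto simp: far_set_def hit_def)
  have xB: "x j \<in> core_set" "y j \<in> far_set" if "j < 3" for j
    using x [OF that] y [OF that] core_mem(1) unfolding core_set_def far_set_def far_def by blast+
  have xp: "x j \<noteq> p j" "y j \<noteq> q j" if "j < 3" for j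
    using xB [OF that] pin [OF that] disj [OF core_avoids(2)] disf [OF far_avoids(2)] that by fastforce+
  define H1 where "H1 = core_set \<union> (\<Union>j<3. closed_segment (x j) (p j) - {p j})"
  define H2 where "H2 = far_set \<union> (\<Union>j<3. closed_segment (y j) (q j) - {q j})"
  have H1sub: "H1 \<subseteq> core_set \<union> (\<Union>j<3. S (Ta j))" and H2sub: "H2 \<subseteq> far_set \<union> (\<Union>j<3. S (Tb j))"
    using segx unfolding H1_def H2_def by fast+
  have dTa: "S (Ta j) \<inter> S z = {}" "S (Tb j) \<inter> S w = {}" if "\<not> hit (Ta j) z" "\<not> hit (Tb j) w" for j z w
    using that by (auto simp: hit_def)
  have dH1: "H1 \<inter> S z = {}" if "\<And>x. x \<in> core K \<Longrightarrow> \<not> hit x z" "\<And>j. j < 3 \<Longrightarrow> \<not> hit (Ta j) z" for z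
  proof -
    have "S (Ta j) \<inter> S z = {}" if "j < 3" for j using \<open>\<And>j. j < 3 \<Longrightarrow> \<not> hit (Ta j) z\<close> [OF that] by (auto simp: hit_def)
    then show ?thesis using H1sub disj [OF that(1)] by blast
  qed
  have dH2: "H2 \<inter> S z = {}" if "\<And>x. x \<in> far \<Longrightarrow> \<not> hit x z" "\<And>j. j < 3 \<Longrightarrow> \<not> hit (Tb j) z" for z
  proof -
    have "S (Tb j) \<inter> S z = {}" if "j < 3" for j using \<open>\<And>j. j < 3 \<Longrightarrow> \<not> hit (Tb j) z\<close> [OF that] by (auto simp: hit_def)
    then show ?thesis using H2sub disf [OF that(1)] by blast
  qed
  have "H1 \<subseteq> I \<or> H2 \<subseteq> I"
  proof (rule bars_force_inside [of I ?F ?b c p q H1 H2])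
    show "path_connected (insert (p j) H1)" if "j < 3" for j
      unfolding H1_def by (rule path_connected_with_ticks [OF path_connected_core _ _ that]) (use xB xp in auto)
    show "path_connected (insert (q j) H2)" if "j < 3" for j
      unfolding H2_def by (rule path_connected_with_ticks [OF path_connected_far _ _ that]) (use xB xp in auto)
    show "H1 \<noteq> {}" "H2 \<noteq> {}" using xB [of 0] by (auto simp: H1_def H2_def)
    show "H1 \<inter> ?F j = {}" "H2 \<inter> ?F j = {}" if "j < 3" for j
      using core_avoids(1) far_avoids(1) ticks(5,6) that by (intro dH1 dH2; blast)+
    show "p j \<in> ?b j" "q j \<in> ?b j" if "j < 3" for j using pin that by auto
    show "p j \<noteq> q j" "p j \<noteq> c j" "q j \<noteq> c j" if j: "j < 3" for j
      using pin [OF j] c [OF j] ticks(5-7) [OF j j] by (auto simp: hit_def)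
    show "H1 \<inter> ?b j = {}" if j: "j < 3" for j
    proof -
      have "(closed_segment (x k) (p k) - {p k}) \<inter> ?b j = {}" if k: "k < 3" for k
        using segx(1) [OF k] p [OF j] ticks(9) [OF k j] by (cases "k = j") (auto simp: hit_def)
      then show ?thesis using disj [OF core_avoids(2)] j unfolding H1_def by blast
    qed
    show "H2 \<inter> ?b j = {}" if j: "j < 3" for j
    proof -
      have "(closed_segment (y k) (q k) - {q k}) \<inter> ?b j = {}" if k: "k < 3" for k
        using segx(2) [OF k] q [OF j] ticks(10) [OF k j] by (cases "k = j") (auto simp: hit_def)
      then show ?thesis using disf [OF far_avoids(2)] j unfolding H2_def by blast
    qed
    show "H1 \<inter> H2 = {}"
    proof -
      have "H1 \<inter> S z = {}" if "z \<in> far" for z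
        using core_avoids(3) ticks(8) that by (intro dH1) auto
      moreover have "H1 \<inter> S (Tb j) = {}" if "j < 3" for j
        using core_avoids(4) ticks(7) that by (intro dH1) auto
      ultimately show ?thesis using H2sub unfolding far_set_def by blast
    qed
  qed (use I c bars in \<open>auto simp: hit_def convex_connected\<close>)
  then have *: "core_set \<subseteq> I \<or> far_set \<subseteq> I" by (auto simp: H1_def H2_def)
  show ?thesis
    by (rule that [OF I(1,2) *])
      (use line_ne line_frame full in \<open>auto simp: full_in_def S_def hit_def\<close>)
qed

text \<open>If the far part were inside, \<open>Lup\<close>, \<open>Mid\<close> and
  \<open>Llo\<close> would be disjoint full chords met by \<open>Pole\<close>, and one of them would
  be the middle one along \<open>Pole\<close>. Each choice is excluded by a connection of the other
  two that avoids it: \<open>PiA\<close> for \<open>Lup\<close>, \<open>PiC\<close> for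
  \<open>Mid\<close>, \<open>PiB\<close> for \<open>Llo\<close>.\<close>

lemma core_inside:
  obtains I where "open I" "convex I" "core_set \<subseteq> I"
    "\<And>l. l \<in> lines K \<Longrightarrow> full_in I (P (Lin l)) (Q (Lin l))" "full_in I (P Lup) (Q Lup)" "full_in I (P Llo) (Q Llo)"
proof -
  obtain I where I: "open I" "convex I" "core_set \<subseteq> I \<or> far_set \<subseteq> I"
    "\<And>l. l \<in> lines K \<Longrightarrow> full_in I (P (Lin l)) (Q (Lin l))"
    "full_in I (P Lup) (Q Lup)" "full_in I (P Llo) (Q Llo)" "full_in I (P Mid) (Q Mid)"
    by (rule core_or_far_inside) blast
  have "\<not> far_set \<subseteq> I"
  proof
    assume "far_set \<subseteq> I"
    then have f: "S Pole \<subseteq> I" "S PiA \<subseteq> I" "S PiB \<subseteq> I" "S PiC \<subseteq> I" by (auto simp: far_set_def far_def)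
    obtain u m w where "u \<in> S Pole" "u \<in> S Lup" "m \<in> S Pole" "m \<in> S Mid" "w \<in> S Pole" "w \<in> S Llo"
      using far_hits(5-7) by (auto simp: hit_def)
    note uw = this
    note sep = middle_chord_separates [OF I(2), folded S_eq]
    have "u \<in> closed_segment m w \<or> m \<in> closed_segment u w \<or> w \<in> closed_segment u m"
      using uw three_on_segment unfolding S_def by blast
    then show False
    proof (elim disjE)
      assume "u \<in> closed_segment m w"
      then show False
        by (intro sep [OF I(5), of m "P Mid" "Q Mid" u w "P Llo" "Q Llo" "S PiA", folded S_eq])
          (use uw f far_hits Ldisj in \<open>auto simp: hit_def S_def Int_commute\<close>)
    next
      assume "m \<in> closed_segment u w"
      then show False
        by (intro middle_chord_separates [OF I(2,7), of u "P Lup" "Q Lup" m w "P Llo" "Q Llo" "S PiC", folded S_eq])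
          (use uw f far_hits Ldisj in \<open>auto simp: hit_def S_def Int_commute\<close>)
    next
      assume "w \<in> closed_segment u m"
      then show False
        by (intro middle_chord_separates [OF I(2,6), of u "P Lup" "Q Lup" w m "P Mid" "Q Mid" "S PiB", folded S_eq])
          (use uw f far_hits Ldisj in \<open>auto simp: hit_def S_def Int_commute\<close>)
    qed
  qed
  then show ?thesis using that I by blast
qed

end

section \<open>Coordinates inside the triangle\<close>

locale gadget_inside = gadget +
  fixes I :: "complex set"
  assumes I: "convex I" "core_set \<subseteq> I"
    and full: "\<And>l. l \<in> lines K \<Longrightarrow> full_in I (P (Lin l)) (Q (Lin l))" "full_in I (P Lup) (Q Lup)" "full_in I (P Llo) (Q Llo)"
begin

lemma core_in: "x \<in> core K \<Longrightarrow> S x \<subseteq> I" using I(2) by (auto simp: core_set_def)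

lemma wall_in [simp]: "z \<in> S (Wl w) \<Longrightarrow> z \<in> I" "z \<in> S (Tp w) \<Longrightarrow> z \<in> I" "z \<in> S (Bt w) \<Longrightarrow> z \<in> I" "z \<in> S Chi \<Longrightarrow> z \<in> I"
  using core_in core_mem by blast+

definition pu :: complex where "pu = (SOME z. z \<in> S (Wl wN) \<inter> S Lup)"
definition pl :: complex where "pl = (SOME z. z \<in> S (Wl wN) \<inter> S Llo)"

lemma pu: "pu \<in> S (Wl wN)" "pu \<in> S Lup" and pl: "pl \<in> S (Wl wN)" "pl \<in> S Llo"
  using someI_ex [of "\<lambda>z. z \<in> S (Wl wN) \<inter> S Lup"] someI_ex [of "\<lambda>z. z \<in> S (Wl wN) \<inter> S Llo"] wall_L(1,2)
  unfolding pu_def pl_def hit_def by blast+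

text \<open>A crossing beyond \<open>pu\<close> or \<open>pl\<close> on \<open>wN\<close> is
  excluded by connecting the line to \<open>Llo\<close> without meeting \<open>Lup\<close>, and to
  \<open>Lup\<close> without meeting \<open>Llo\<close>. The connections use \<open>wD\<close> with
  \<open>Bt wD\<close> or \<open>Tp wD\<close>; as \<open>lR\<close> avoids \<open>wD\<close>, its
  pins \<open>Bt wW\<close> and \<open>Tp wD\<close> take over.\<close>

lemma between_L:
  assumes l: "l \<in> lines K" and x: "x \<in> S (Lin l)" "x \<in> S (Wl wN)"
  shows "x \<in> closed_segment pu pl"
proof -
  obtain UL where UL: "connected UL" "UL \<subseteq> I" "UL \<inter> S Lup = {}" "UL \<inter> S (Lin l) \<noteq> {}" "UL \<inter> S Llo \<noteq> {}"
  proof (cases "l = lR")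
    case True
    then show ?thesis using that [of "S (Bt wW)"] core_in [of "Bt wW"] pins(2) ends_L(4,6) by (auto simp: hit_def)
  next
    case False
    have "connected (S (Wl wD) \<union> S (Bt wD))" using ends_L(2) [of wD] by (intro connected_Un) (auto simp: hit_def Int_commute)
    then show ?thesis using that [of "S (Wl wD) \<union> S (Bt wD)"] core_in [of "Bt wD"] core_in [of "Wl wD"]
        line_L(4) [OF l False] ends_L(4,6) [of wD] wall_L(3) by (auto simp: hit_def Int_Un_distrib2 Int_commute)
  qed
  obtain UU where UU: "connected UU" "UU \<subseteq> I" "UU \<inter> S Llo = {}" "UU \<inter> S (Lin l) \<noteq> {}" "UU \<inter> S Lup \<noteq> {}"
  proof (cases "l = lR")
    case True
    then show ?thesis using that [of "S (Tp wD)"] core_in [of "Tp wD"] pins(1) ends_L(3,5) by (auto simp: hit_def)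
  next
    case False
    have "connected (S (Wl wD) \<union> S (Tp wD))" using ends_L(1) [of wD] by (intro connected_Un) (auto simp: hit_def Int_commute)
    then show ?thesis using that [of "S (Wl wD) \<union> S (Tp wD)"] core_in [of "Tp wD"] core_in [of "Wl wD"]
        line_L(4) [OF l False] ends_L(3,5) [of wD] wall_L(4) by (auto simp: hit_def Int_Un_distrib2 Int_commute)
  qed
  have nh: "S (Lin l) \<inter> S Lup = {}" "S (Lin l) \<inter> S Llo = {}" "S Lup \<inter> S Llo = {}" "S Llo \<inter> S Lup = {}"
    using line_L(1,2) [OF l] Ldisj(1) by (auto simp: hit_def)
  have "x \<in> closed_segment pu pl \<or> pu \<in> closed_segment x pl \<or> pl \<in> closed_segment x pu"
    using three_on_segment [of x "P (Wl wN)" "Q (Wl wN)" pu pl] x pu(1) pl(1)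
    unfolding S_eq by (metis closed_segment_commute)
  moreover have "pu \<notin> closed_segment x pl"
    using middle_chord_separates [OF I(1) full(2), folded S_eq, of x "P (Lin l)" "Q (Lin l)" pu pl "P Llo" "Q Llo" UL, folded S_eq]
      x pu pl nh UL by auto
  moreover have "pl \<notin> closed_segment x pu"
    using middle_chord_separates [OF I(1) full(3), folded S_eq, of x "P (Lin l)" "Q (Lin l)" pl pu "P Lup" "Q Lup" UU, folded S_eq]
      x pu pl nh UU by auto
  ultimately show ?thesis by blast
qed

text \<open>Affine functionals vanishing on a line, positive on the inner side of \<open>Lup\<close> and \<open>Llo\<close> and above \<open>l\<close>,
  respectively.\<close>

definition sU :: "complex \<Rightarrow> real" where "sU z = side (P Lup) (Q Lup) pl * side (P Lup) (Q Lup) z"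
definition sL :: "complex \<Rightarrow> real" where "sL z = side (P Llo) (Q Llo) pu * side (P Llo) (Q Llo) z"
definition h :: "line \<Rightarrow> complex \<Rightarrow> real" where
  "h l z = side (P (Lin l)) (Q (Lin l)) pu * side (P (Lin l)) (Q (Lin l)) z"

lemma affines: "h l ((1 - t) *\<^sub>R a + t *\<^sub>R b) = (1 - t) * h l a + t * h l b"
  "sU ((1 - t) *\<^sub>R a + t *\<^sub>R b) = (1 - t) * sU a + t * sU b"
  "sL ((1 - t) *\<^sub>R a + t *\<^sub>R b) = (1 - t) * sL a + t * sL b"
  by (simp_all only: h_def sU_def sL_def side_affine) (simp_all add: algebra_simps)

lemma on_line: "z \<in> S (Lin l) \<Longrightarrow> h l z = 0" "z \<in> S Lup \<Longrightarrow> sU z = 0" "z \<in> S Llo \<Longrightarrow> sL z = 0"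
  using closed_segment_side by (auto simp: h_def sU_def sL_def S_eq)

lemma side_nz: "l \<in> lines K \<Longrightarrow> side (P (Lin l)) (Q (Lin l)) pu \<noteq> 0" "side (P Lup) (Q Lup) pl \<noteq> 0" "side (P Llo) (Q Llo) pu \<noteq> 0"
proof -
  have "pu \<in> I" "pl \<in> I" using pu pl by auto
  moreover have "l \<in> lines K \<Longrightarrow> pu \<notin> S (Lin l)" "pl \<notin> S Lup" "pu \<notin> S Llo"
    using pu pl line_L(1) Ldisj(1) by (auto simp: hit_def)
  ultimately show "l \<in> lines K \<Longrightarrow> side (P (Lin l)) (Q (Lin l)) pu \<noteq> 0" "side (P Lup) (Q Lup) pl \<noteq> 0" "side (P Llo) (Q Llo) pu \<noteq> 0"
    using full unfolding full_in_def S_eq by blast+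
qed

lemma h_same:
  assumes "l \<in> lines K" "connected U" "U \<subseteq> I" "U \<inter> S (Lin l) = {}" "x \<in> U" "y \<in> U"
  shows "h l x * h l y > 0"
proof -
  have "side (P (Lin l)) (Q (Lin l)) x * side (P (Lin l)) (Q (Lin l)) y > 0"
    using same_side [OF full(1) [OF assms(1)] assms(2,3) _ assms(5,6)] assms(4) by (simp add: S_eq)
  moreover have "h l x * h l y = (side (P (Lin l)) (Q (Lin l)) pu)\<^sup>2 * (side (P (Lin l)) (Q (Lin l)) x * side (P (Lin l)) (Q (Lin l)) y)"
    by (simp add: h_def power2_eq_square)
  ultimately show ?thesis using side_nz(1) [OF assms(1)] by simp
qed

lemma s_same:
  assumes "connected U" "U \<subseteq> I" "x \<in> U" "y \<in> U"
  shows "U \<inter> S Lup = {} \<Longrightarrow> sU x * sU y > 0" "U \<inter> S Llo = {} \<Longrightarrow> sL x * sL y > 0"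
proof -
  have "sU x * sU y = (side (P Lup) (Q Lup) pl)\<^sup>2 * (side (P Lup) (Q Lup) x * side (P Lup) (Q Lup) y)"
    "sL x * sL y = (side (P Llo) (Q Llo) pu)\<^sup>2 * (side (P Llo) (Q Llo) x * side (P Llo) (Q Llo) y)"
    by (simp_all add: sU_def sL_def power2_eq_square)
  then show "U \<inter> S Lup = {} \<Longrightarrow> sU x * sU y > 0" "U \<inter> S Llo = {} \<Longrightarrow> sL x * sL y > 0"
    using same_side [OF full(2) assms(1,2) _ assms(3,4)] same_side [OF full(3) assms(1,2) _ assms(3,4)] side_nz(2,3)
    by (auto simp: S_eq)
qed

lemma base_signs: "sU pl > 0" "sL pu > 0" "l \<in> lines K \<Longrightarrow> h l pu > 0"
  using side_nz by (auto simp: sU_def sL_def h_def zero_less_mult_iff linorder_neq_iff)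

lemma con_I: "connected (S x \<inter> I)" using I(1) by (intro convex_connected convex_Int) auto

lemma h_pl: assumes l: "l \<in> lines K" shows "h l pl < 0"
proof -
  obtain x where x: "x \<in> S (Lin l)" "x \<in> S (Wl wN)" using line_L(3) [OF l] by (auto simp: hit_def)
  have "side (P (Lin l)) (Q (Lin l)) pu * side (P (Lin l)) (Q (Lin l)) pl \<le> 0"
    by (rule opposite_sides [OF between_L [OF l x]]) (use x closed_segment_side side_nz(1) [OF l] in \<open>auto simp: S_eq\<close>)
  moreover have "side (P (Lin l)) (Q (Lin l)) pl \<noteq> 0"
    using full(1) [OF l] pl line_L(2) [OF l] wall_in(1) unfolding full_in_def S_eq hit_def by blast
  ultimately show ?thesis using side_nz(1) [OF l] by (simp add: h_def less_le)
qed

lemma h_up: assumes l: "l \<in> lines K" and z: "z \<in> S Lup" "z \<in> I" shows "h l z > 0"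
proof -
  have "h l pu * h l z > 0"
    by (rule h_same [OF l con_I [of Lup]]) (use z pu line_L(1) [OF l] in \<open>auto simp: hit_def\<close>)
  then show ?thesis using base_signs(3) [OF l] by (simp add: zero_less_mult_iff)
qed

lemma h_lo: assumes l: "l \<in> lines K" and z: "z \<in> S Llo" "z \<in> I" shows "h l z < 0"
proof -
  have "h l pl * h l z > 0"
    by (rule h_same [OF l con_I [of Llo]]) (use z pl line_L(2) [OF l] in \<open>auto simp: hit_def\<close>)
  then show ?thesis using h_pl [OF l] by (simp add: zero_less_mult_iff)
qed

lemma line_between:
  assumes l: "l \<in> lines K" and z: "z \<in> S (Lin l)" "z \<in> I" shows "sU z > 0" "sL z > 0"
proof -
  obtain x where x: "x \<in> S (Lin l)" "x \<in> S (Wl wN)" using line_L(3) [OF l] by (auto simp: hit_def)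
  obtain t where t: "0 \<le> t" "t \<le> 1" "x = (1 - t) *\<^sub>R pu + t *\<^sub>R pl"
    using between_L [OF l x] by (auto simp: in_segment)
  have "sU x = t * sU pl" "sL x = (1 - t) * sL pu"
    unfolding t(3) affines using on_line pu pl by auto
  then have "sU x \<ge> 0" "sL x \<ge> 0" using base_signs t by auto
  moreover have "S (Lin l) \<inter> I \<inter> S Lup = {}" "S (Lin l) \<inter> I \<inter> S Llo = {}" using line_L(1,2) [OF l] by (auto simp: hit_def)
  then have "sU x * sU z > 0" "sL x * sL z > 0"
    using s_same [OF con_I [of "Lin l"], of x z] x z by auto
  ultimately show "sU z > 0" "sL z > 0" by (auto simp: zero_less_mult_iff)
qed

lemma h_above:
  assumes "l \<in> lines K" "x \<in> core K" "\<not> hit x (Lin l)" "hit x Lup" "z \<in> S x" shows "h l z > 0"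
proof -
  obtain u where u: "u \<in> S x" "u \<in> S Lup" using assms(4) by (auto simp: hit_def)
  have "h l u > 0" using h_up assms(1) u core_in [OF assms(2)] by auto
  moreover have "h l u * h l z > 0"
    by (rule h_same [OF assms(1) _ core_in [OF assms(2)] _ u(1) assms(5)]) (use assms(3) in \<open>auto simp: hit_def\<close>)
  ultimately show ?thesis by (simp add: zero_less_mult_iff)
qed

lemma h_below:
  assumes "l \<in> lines K" "x \<in> core K" "\<not> hit x (Lin l)" "hit x Llo" "z \<in> S x" shows "h l z < 0"
proof -
  obtain u where u: "u \<in> S x" "u \<in> S Llo" using assms(4) by (auto simp: hit_def)
  have "h l u < 0" using h_lo assms(1) u core_in [OF assms(2)] by auto
  moreover have "h l u * h l z > 0"
    by (rule h_same [OF assms(1) _ core_in [OF assms(2)] _ u(1) assms(5)]) (use assms(3) in \<open>auto simp: hit_def\<close>)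
  ultimately show ?thesis by (simp add: zero_less_mult_iff)
qed

lemma h_transfer:
  assumes "l \<in> lines K" "x \<in> core K" "\<not> hit x (Lin l)" "u \<in> S x" "z \<in> S x"
  shows "h l u > 0 \<Longrightarrow> h l z > 0" "h l u < 0 \<Longrightarrow> h l z < 0"
proof -
  have "h l u * h l z > 0"
    by (rule h_same [OF assms(1) _ core_in [OF assms(2)] _ assms(4,5)]) (use assms(3) in \<open>auto simp: hit_def\<close>)
  then show "h l u > 0 \<Longrightarrow> h l z > 0" "h l u < 0 \<Longrightarrow> h l z < 0" by (auto simp: zero_less_mult_iff)
qed

definition tp :: "wall \<Rightarrow> complex" where "tp w = (SOME z. z \<in> S (Tp w) \<inter> S (Wl w))"
definition bt :: "wall \<Rightarrow> complex" where "bt w = (SOME z. z \<in> S (Bt w) \<inter> S (Wl w))"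

lemma tp: "tp w \<in> S (Tp w)" "tp w \<in> S (Wl w)" and bt: "bt w \<in> S (Bt w)" "bt w \<in> S (Wl w)"
  using someI_ex [of "\<lambda>z. z \<in> S (Tp w) \<inter> S (Wl w)"] someI_ex [of "\<lambda>z. z \<in> S (Bt w) \<inter> S (Wl w)"] ends_L(1,2) [of w]
  unfolding tp_def bt_def hit_def by blast+

lemma cert_ends:
  assumes "(a, b, w) \<in> certs K" shows "h a (tp w) > 0" "h b (tp w) > 0" "h a (bt w) < 0" "h b (bt w) < 0"
  using assms certs_lines certs_avoid ends_L(3,4) tp bt by (auto intro!: h_above [of _ "Tp w"] h_below [of _ "Bt w"])

text \<open>\<open>Qs\<close> touches the wall and avoids both lines. It is linked to the top by
  \<open>Us\<close> without crossing \<open>a\<close>, hence lies above \<open>a\<close>, and to the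
  bottom by \<open>Ds\<close> without crossing \<open>b\<close>, hence lies below
  \<open>b\<close>.\<close>

lemma cert_point:
  assumes c: "(a, b, w) \<in> certs K" obtains z where "z \<in> S (Wl w)" "h a z > 0" "h b z < 0"
proof -
  note ab = certs_lines [OF c] and ch = certs_hit [OF c] and ca = certs_avoid [OF c] and cc = core_certs [OF c]
  obtain z where z: "z \<in> S (Qs a b w)" "z \<in> S (Wl w)" using ch by (auto simp: hit_def)
  obtain u where u: "u \<in> S (Qs a b w)" "u \<in> S (Us a b w)" using ch by (auto simp: hit_def)
  obtain v where v: "v \<in> S (Us a b w)" "v \<in> S (Tp w)" using ch by (auto simp: hit_def)
  obtain d where d: "d \<in> S (Qs a b w)" "d \<in> S (Ds a b w)" using ch by (auto simp: hit_def)
  obtain e where e: "e \<in> S (Ds a b w)" "e \<in> S (Bt w)" using ch by (auto simp: hit_def)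
  have "h a v > 0" using h_above [of a "Tp w"] ab ca ends_L v by auto
  then have "h a u > 0" using h_transfer(1) [of a "Us a b w" v u] ab ca cc u v by auto
  then have "h a z > 0" using h_transfer(1) [of a "Qs a b w" u z] ab ca cc u z by auto
  moreover have "h b e < 0" using h_below [of b "Bt w"] ab ca ends_L e by auto
  then have "h b d < 0" using h_transfer(2) [of b "Ds a b w" e d] ab ca cc d e by auto
  then have "h b z < 0" using h_transfer(2) [of b "Qs a b w" d z] ab ca cc d z by auto
  ultimately show ?thesis using that z by auto
qed

end

text \<open>As quotients: \<open>op / je \<le> oa / ja \<le> oc / jc\<close> and
  \<open>op / jc \<le> ob / jb \<le> oe / je\<close>. The product of the two chains gives the
  square.\<close>

lemma step_inequality:
  fixes op oa ob oc oe ja jb jc je :: real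
  assumes "0 < op" "op \<le> oa" "op \<le> ob" "0 < ja" "0 < jb" "0 < jc" "0 < je" "ja \<le> je" "jb \<le> jc"
    and r: "oa * jc \<le> oc * ja" "ob * je \<le> oe * jb"
  shows "op\<^sup>2 \<le> oc * oe" "op * jc \<le> oc * je" "0 < oc" "0 < oe"
proof -
  have 1: "op * jc \<le> oc * ja" using assms(2,6) r(1) mult_right_mono [of op oa jc] by linarith
  then have "0 < oc * ja" using assms(1,6) mult_pos_pos [of op jc] by linarith
  then show oc: "0 < oc" using assms(4) by (simp add: zero_less_mult_iff)
  show 2: "op * jc \<le> oc * je" using 1 mult_left_mono [of ja je oc] assms(8) oc by linarith
  have 3: "op * je \<le> oe * jb" using assms(3,7) r(2) mult_right_mono [of op ob je] by linarith
  then have "0 < oe * jb" using assms(1,7) mult_pos_pos [of op je] by linarith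
  then show oe: "0 < oe" using assms(5) by (simp add: zero_less_mult_iff)
  have 4: "op * je \<le> oe * jc" using 3 mult_left_mono [of jb jc oe] assms(9) oe by linarith
  have "(op * jc) * (op * je) \<le> (oc * je) * (oe * jc)"
    by (rule mult_mono [OF 2 4]) (use assms(1,6,7) oc in auto)
  then have "op\<^sup>2 * (jc * je) \<le> (oc * oe) * (jc * je)" by (simp add: power2_eq_square algebra_simps)
  then show "op\<^sup>2 \<le> oc * oe" using assms(6,7) by (simp add: mult_le_cancel_right)
qed

lemma on_common_segment:
  fixes z a b :: "'a::real_vector"
  assumes "z \<in> closed_segment p q" "a \<in> closed_segment p q" "b \<in> closed_segment p q" "a \<noteq> b"
  obtains s where "z = (1 - s) *\<^sub>R a + s *\<^sub>R b"
proof -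
  obtain \<alpha> \<beta> where e: "z - a = \<alpha> *\<^sub>R (q - p)" "b - a = \<beta> *\<^sub>R (q - p)"
    using diff_in_segment [OF assms(2,1)] diff_in_segment [OF assms(2,3)] by auto
  then have "\<beta> \<noteq> 0" using assms(4) by auto
  then have "z - a = (\<alpha> / \<beta>) *\<^sub>R (b - a)" unfolding e by simp
  then have "z = (1 - \<alpha> / \<beta>) *\<^sub>R a + (\<alpha> / \<beta>) *\<^sub>R b" by (simp add: algebra_simps)
  then show ?thesis using that by blast
qed

lemma pos_of_product: "1 < x * y \<Longrightarrow> 0 < y \<Longrightarrow> 0 < (x::real)" "1 < x * y \<Longrightarrow> 0 < x \<Longrightarrow> 0 < (y::real)"
  by (metis less_trans zero_less_one zero_less_mult_pos zero_less_mult_pos2)+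

lemma cr_multiples: "u = a *\<^sub>R w \<Longrightarrow> v = b *\<^sub>R w \<Longrightarrow> cr u v = 0" by simp

lemma cr_on_segment:
  assumes "x \<in> closed_segment p q" "y \<in> closed_segment p q" "x' \<in> closed_segment p q" "y' \<in> closed_segment p q"
  shows "cr (y - x) (y' - x') = 0"
  using diff_in_segment [OF assms(1,2)] diff_in_segment [OF assms(3,4)] by (auto intro: cr_multiples)

context gadget_inside begin

lemma mem_lines [simp]: "lE \<in> lines K" "lE2 \<in> lines K" "lS \<in> lines K" "lR \<in> lines K" "lF \<in> lines K" "lP \<in> lines K" "lG \<in> lines K"
  "i \<le> K \<Longrightarrow> lA i \<in> lines K" "i \<le> K \<Longrightarrow> lB i \<in> lines K" "i \<le> K \<Longrightarrow> lC i \<in> lines K"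
  by (auto simp: lines_def)

lemma pin_certs: "(lS, lE, wD) \<in> certs K" "(lS, lE2, wD) \<in> certs K" "(lR, lS, wN) \<in> certs K" "(lP, lF, wN) \<in> certs K"
  "(lP, lF, wD) \<in> certs K" "(lE2, lP, wW) \<in> certs K" "(lC K, lG, wW) \<in> certs K" "(lG, lP, wW) \<in> certs K"
  by (auto simp: certs_def)

lemma step_cert: "i \<le> K \<Longrightarrow> c \<in> step_certs i \<Longrightarrow> c \<in> certs K" by (auto simp: certs_def)

lemma on_common:
  assumes "z \<in> S x" "a \<in> S x" "b \<in> S x" "a \<noteq> b"
  obtains s where "z = (1 - s) *\<^sub>R a + s *\<^sub>R b"
  using on_common_segment assms unfolding S_eq by blast

text \<open>From \<open>tp w\<close> towards \<open>bt w\<close> both functionals decrease, and the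
  certificate shows a point where \<open>b\<close> is already passed and \<open>a\<close> is not
  yet. The wall may extend beyond \<open>tp w\<close> and \<open>bt w\<close>, so affine parameters
  are compared rather than betweenness.\<close>

lemma wall_order:
  assumes c: "(a, b, w) \<in> certs K" and z: "z \<in> S (Wl w)"
  shows "h a z \<le> 0 \<Longrightarrow> h b z < 0" "h b z \<ge> 0 \<Longrightarrow> h a z > 0"
proof -
  obtain y where y: "y \<in> S (Wl w)" "h a y > 0" "h b y < 0" by (rule cert_point [OF c])
  note e = cert_ends [OF c]
  have ne: "tp w \<noteq> bt w" using e by auto
  obtain r where r: "y = (1 - r) *\<^sub>R tp w + r *\<^sub>R bt w"
    by (rule on_common [OF y(1) tp(2) bt(2) ne])
  obtain s where s: "z = (1 - s) *\<^sub>R tp w + s *\<^sub>R bt w"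
    by (rule on_common [OF z tp(2) bt(2) ne])
  have *: "h b z < 0" if "h a z \<le> 0"
  proof -
    have "0 < h a (tp w) - r * (h a (tp w) - h a (bt w))" "h a (tp w) - s * (h a (tp w) - h a (bt w)) \<le> 0"
      using y(2) that unfolding r s affines by (simp_all add: algebra_simps)
    then have "r * (h a (tp w) - h a (bt w)) < s * (h a (tp w) - h a (bt w))" by linarith
    then have "r < s" using e by (simp add: mult_less_cancel_right)
    then have "r * (h b (tp w) - h b (bt w)) < s * (h b (tp w) - h b (bt w))" using e by (intro mult_strict_right_mono) auto
    moreover have "h b (tp w) - r * (h b (tp w) - h b (bt w)) < 0" using y(3) unfolding r affines by (simp add: algebra_simps)
    ultimately show ?thesis unfolding s affines by (simp add: algebra_simps)
  qed
  show "h a z \<le> 0 \<Longrightarrow> h b z < 0" by (rule *)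
  show "h b z \<ge> 0 \<Longrightarrow> h a z > 0" using * by force
qed

section \<open>Affine coordinates attached to three of the walls\<close>

definition pI :: complex where "pI = (SOME z. z \<in> S (Wl wD) \<inter> S (Wl wN))"
definition pO :: complex where "pO = (SOME z. z \<in> S (Wl wD) \<inter> S (Wl wW))"
definition pJ :: complex where "pJ = (SOME z. z \<in> S (Wl wW) \<inter> S (Wl wN))"

lemma pI: "pI \<in> S (Wl wD)" "pI \<in> S (Wl wN)" and pO: "pO \<in> S (Wl wD)" "pO \<in> S (Wl wW)"
  and pJ: "pJ \<in> S (Wl wW)" "pJ \<in> S (Wl wN)"
  using someI_ex [of "\<lambda>z. z \<in> S (Wl wD) \<inter> S (Wl wN)"] someI_ex [of "\<lambda>z. z \<in> S (Wl wD) \<inter> S (Wl wW)"]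
    someI_ex [of "\<lambda>z. z \<in> S (Wl wW) \<inter> S (Wl wN)"] walls(1-3) unfolding pI_def pO_def pJ_def hit_def by blast+

text \<open>\<open>lR\<close> avoids \<open>wD\<close> and \<open>Bt wD\<close>, so all of
  \<open>wD\<close> is below it, and on \<open>wN\<close> it passes below \<open>lS\<close>. As
  every line of \<open>low\<close> passes above \<open>lS\<close> on \<open>wD\<close>, this places
  \<open>pI\<close> below all of them.\<close>

lemma hS_pI: "h lS pI < 0"
proof -
  have "h lR (bt wD) < 0" using h_below [of lR "Bt wD"] pins(4) ends_L(4) bt by auto
  then have "h lR pI < 0" using h_transfer(2) [of lR "Wl wD" "bt wD" pI] pins(3) bt pI by auto
  then show ?thesis using wall_order(1) [OF pin_certs(3) pI(2)] by simp
qed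

definition low :: "line set" where "low = {lE, lE2} \<union> lA ` {..K} \<union> lB ` {..K} \<union> lC ` {..K}"

lemma low_lines: "l \<in> low \<Longrightarrow> l \<in> lines K" by (auto simp: low_def)

lemma low_mem [simp]: "lE \<in> low" "lE2 \<in> low" "i \<le> K \<Longrightarrow> lA i \<in> low" "i \<le> K \<Longrightarrow> lB i \<in> low" "i \<le> K \<Longrightarrow> lC i \<in> low"
  by (auto simp: low_def)

lemma h_pI: assumes "l \<in> low" shows "h l pI < 0"
proof -
  have "(lS, l, wD) \<in> certs K" using assms pin_certs unfolding low_def
    by (auto intro: step_cert simp: step_certs_def)
  then show ?thesis using wall_order(1) [OF _ pI(1)] hS_pI by simp
qed

lemma hF_W: "z \<in> S (Wl wW) \<Longrightarrow> h lF z > 0"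
proof -
  have "h lF (tp wW) > 0" using h_above [of lF "Tp wW"] pins(8) ends_L(3) tp by auto
  then show "z \<in> S (Wl wW) \<Longrightarrow> h lF z > 0" using h_transfer(1) [of lF "Wl wW" "tp wW" z] pins(7) tp by auto
qed

lemma hE_W: "z \<in> S (Wl wW) \<Longrightarrow> h lE z < 0"
proof -
  have "h lE (bt wW) < 0" using h_below [of lE "Bt wW"] pins(6) ends_L(4) bt by auto
  then show "z \<in> S (Wl wW) \<Longrightarrow> h lE z < 0" using h_transfer(2) [of lE "Wl wW" "bt wW" z] pins(5) bt by auto
qed

text \<open>\<open>lF\<close> avoids \<open>wW\<close> and \<open>Tp wW\<close>, so all of
  \<open>wW\<close> is above it; \<open>lP\<close> passes below \<open>lF\<close> on both
  \<open>wN\<close> and \<open>wD\<close>. From here every line certified below \<open>lP\<close> on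
  \<open>wW\<close> inherits that \<open>pJ\<close> and \<open>pO\<close> are above it.\<close>

lemma hP: "h lP pJ > 0" "h lP pO > 0"
  using wall_order(2) [OF pin_certs(4) pJ(2)] wall_order(2) [OF pin_certs(5) pO(1)] hF_W [OF pJ(1)] hF_W [OF pO(2)] by auto

lemma top_lines: "(l, lP, wW) \<in> certs K \<Longrightarrow> h l pJ > 0 \<and> h l pO > 0 \<and> h l (bt wW) < 0"
  using wall_order(2) [OF _ pJ(1)] wall_order(2) [OF _ pO(2)] hP cert_ends(3) by (meson less_imp_le)

lemma C_cert: "i \<le> K \<Longrightarrow> (lC i, lP, wW) \<in> certs K" by (auto intro: step_cert simp: step_certs_def)

lemma e2_signs: "h lE2 pJ > 0" "h lE2 pO > 0" "h lE2 (bt wW) < 0" using top_lines [OF pin_certs(6)] by auto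

lemma C_signs: "i \<le> K \<Longrightarrow> h (lC i) pJ > 0 \<and> h (lC i) pO > 0 \<and> h (lC i) (bt wW) < 0" by (intro top_lines C_cert)

text \<open>Affine coordinates in which \<open>pI\<close>, \<open>pO\<close>, \<open>pJ\<close> are \<open>(0, 0)\<close>, \<open>(- 1, 0)\<close>, \<open>(0, 1)\<close>; the line \<open>l\<close> has the equation
  \<open>Y * vv l = 1 + X * uu l\<close>.\<close>

definition del :: real where "del = cr (pI - pO) (pJ - pI)"
definition X :: "complex \<Rightarrow> real" where "X z = cr (z - pI) (pJ - pI) / del"
definition Y :: "complex \<Rightarrow> real" where "Y z = cr (pI - pO) (z - pI) / del"

lemma del_nz: "del \<noteq> 0"
proof -
  obtain a where a: "pI - pO = a *\<^sub>R (Q (Wl wD) - P (Wl wD))" using diff_in_segment [OF pO(1) [unfolded S_eq] pI(1) [unfolded S_eq]] ..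
  obtain b where b: "pJ - pI = b *\<^sub>R (Q (Wl wN) - P (Wl wN))" using diff_in_segment [OF pI(2) [unfolded S_eq] pJ(2) [unfolded S_eq]] ..
  have "pI \<noteq> pO" "pJ \<noteq> pI" using h_pI [of lE2] e2_signs by auto
  then have "a \<noteq> 0" "b \<noteq> 0" using a b by auto
  then show ?thesis using DN_npar unfolding del_def a b by simp
qed

lemma XY_affine: "X ((1 - t) *\<^sub>R a + t *\<^sub>R b) = (1 - t) * X a + t * X b" "Y ((1 - t) *\<^sub>R a + t *\<^sub>R b) = (1 - t) * Y a + t * Y b"
  using del_nz unfolding X_def Y_def by (simp_all add: field_simps) (simp_all add: cr_def algebra_simps)

lemma coordinates: "z = pI + X z *\<^sub>R (pI - pO) + Y z *\<^sub>R (pJ - pI)"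
proof -
  have "del *\<^sub>R (z - pI) = cr (z - pI) (pJ - pI) *\<^sub>R (pI - pO) + cr (pI - pO) (z - pI) *\<^sub>R (pJ - pI)"
    unfolding del_def by (simp add: complex_eq_iff cr_def algebra_simps)
  then have "(1 / del) *\<^sub>R del *\<^sub>R (z - pI) = (1 / del) *\<^sub>R (cr (z - pI) (pJ - pI) *\<^sub>R (pI - pO) + cr (pI - pO) (z - pI) *\<^sub>R (pJ - pI))"
    by simp
  then have "z - pI = X z *\<^sub>R (pI - pO) + Y z *\<^sub>R (pJ - pI)" using del_nz by (simp add: X_def Y_def scaleR_add_right)
  then show ?thesis by (simp add: algebra_simps)
qed

lemma side_coordinates: "side p q (a + x *\<^sub>R (a - b) + y *\<^sub>R (c - a)) = side p q a + x * (side p q a - side p q b) + y * (side p q c - side p q a)"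
  by (simp add: side_def cr_def algebra_simps)

text \<open>The line crosses \<open>wD\<close> at \<open>X = - 1 / uu l\<close> and
  \<open>wN\<close> at \<open>Y = 1 / vv l\<close>, where defined. As \<open>h l pI < 0\<close>, the
  condition \<open>uu l > 1\<close> says that \<open>pO\<close> is above \<open>l\<close>, and
  \<open>vv l > 1\<close> that \<open>pJ\<close> is.\<close>

definition uu :: "line \<Rightarrow> real" where "uu l = 1 + h l pO / (- h l pI)"
definition vv :: "line \<Rightarrow> real" where "vv l = 1 + h l pJ / (- h l pI)"

lemma h_XY: assumes "l \<in> low" shows "h l z = - h l pI * (- 1 - X z * uu l + Y z * vv l)"
proof -
  have "h l z = h l pI + X z * (h l pI - h l pO) + Y z * (h l pJ - h l pI)"
    by (subst (1) coordinates [of z], unfold h_def side_coordinates) (simp add: algebra_simps)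
  moreover have e: "h l pI * uu l = h l pI - h l pO" "h l pI * vv l = h l pI - h l pJ"
    using h_pI [OF assms] by (simp_all add: uu_def vv_def field_simps)
  ultimately have "h l z = h l pI + X z * (h l pI * uu l) - Y z * (h l pI * vv l)" unfolding e by (simp add: algebra_simps)
  then show ?thesis by (simp add: algebra_simps)
qed

lemma sL_XY: "sL z = sL pI + X z * (sL pI - sL pO) + Y z * (sL pJ - sL pI)"
  by (subst (1) coordinates [of z], unfold sL_def side_coordinates) (simp add: algebra_simps)

lemma h_sign: assumes "l \<in> low"
  shows "h l z > 0 \<longleftrightarrow> - 1 - X z * uu l + Y z * vv l > 0" "h l z < 0 \<longleftrightarrow> - 1 - X z * uu l + Y z * vv l < 0"
    "h l z = 0 \<longleftrightarrow> - 1 - X z * uu l + Y z * vv l = 0"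
  unfolding h_XY [OF assms, of z] using h_pI [OF assms] by (auto simp: mult_less_0_iff zero_less_mult_iff)

lemma D_coord: "z \<in> S (Wl wD) \<Longrightarrow> Y z = 0"
  using cr_on_segment pI(1) pO(1) unfolding Y_def S_eq by simp

lemma N_coord: "z \<in> S (Wl wN) \<Longrightarrow> X z = 0"
  using cr_on_segment pI(2) pJ(2) unfolding X_def S_eq by simp

lemma W_coord: assumes "z \<in> S (Wl wW)" shows "Y z = 1 + X z"
proof -
  have "cr (z - pJ) (pO - pJ) = 0" using cr_on_segment assms pJ(1) pO(2) unfolding S_eq by blast
  then have "cr (pI - pO) (z - pI) = del + cr (z - pI) (pJ - pI)" unfolding del_def by (simp add: cr_def algebra_simps)
  then show ?thesis using del_nz by (simp add: X_def Y_def field_simps)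
qed

lemma uu_gt1: "l \<in> low \<Longrightarrow> h l pO > 0 \<Longrightarrow> uu l > 1" and vv_gt1: "l \<in> low \<Longrightarrow> h l pJ > 0 \<Longrightarrow> vv l > 1"
  using h_pI by (auto simp: uu_def vv_def divide_pos_neg)

text \<open>The top of \<open>wD\<close> is at negative \<open>X\<close> and the crossing of
  \<open>l\<close> at \<open>- 1 / uu l\<close>, so the lower of two crossings is the one closer to
  \<open>pI\<close> and has the larger \<open>uu\<close>.\<close>

lemma D_order:
  assumes c: "(a, b, wD) \<in> certs K" and ab: "a \<in> low" "b \<in> low" "uu b > 0"
  shows "uu b \<le> uu a"
proof -
  obtain r where r: "r \<in> S (Wl wD)" "h a r > 0" "h b r < 0" by (rule cert_point [OF c])
  note e = cert_ends [OF c]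
  have 1: "1 < - X r * uu a" "- X r * uu b < 1" using r(2,3) h_sign(1) [OF ab(1)] h_sign(2) [OF ab(2)] D_coord [OF r(1)] by auto
  have 2: "1 < - X (tp wD) * uu a" "1 < - X (tp wD) * uu b"
    using e h_sign(1) [OF ab(1)] h_sign(1) [OF ab(2)] D_coord [OF tp(2)] by auto
  have "0 < - X (tp wD)" using 2(2) ab(3) by (rule pos_of_product(1))
  with 2(1) have "0 < uu a" by (rule pos_of_product(2))
  with 1(1) have r0: "0 < - X r" by (rule pos_of_product(1))
  have "- X r * uu b < - X r * uu a" using 1 by linarith
  then show ?thesis using r0 by (simp add: mult_less_cancel_left)
qed

lemma tpN_pos: "Y (tp wN) > 0"
proof -
  have "(lC 0, lB 0, wN) \<in> certs K" by (auto intro!: step_cert [of 0] simp: step_certs_def)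
  then have "1 < Y (tp wN) * vv (lC 0)" using cert_ends(1) [of "lC 0" "lB 0" wN] h_sign(1) [of "lC 0" "tp wN"] N_coord [OF tp(2)] by simp
  moreover have "vv (lC 0) > 0" using vv_gt1 [of "lC 0"] C_signs [of 0] by simp
  ultimately show ?thesis by (rule pos_of_product(1))
qed

lemma N_order:
  assumes c: "(a, b, wN) \<in> certs K" and ab: "a \<in> low" "b \<in> low"
  shows "vv b \<le> vv a" "0 < vv a" "0 < vv b"
proof -
  obtain r where r: "r \<in> S (Wl wN)" "h a r > 0" "h b r < 0" by (rule cert_point [OF c])
  note e = cert_ends [OF c]
  have 1: "1 < Y r * vv a" "Y r * vv b < 1" using r(2,3) h_sign(1) [OF ab(1)] h_sign(2) [OF ab(2)] N_coord [OF r(1)] by auto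
  have 2: "1 < Y (tp wN) * vv a" "1 < Y (tp wN) * vv b"
    using e h_sign(1) [OF ab(1)] h_sign(1) [OF ab(2)] N_coord [OF tp(2)] by auto
  show va: "0 < vv a" and vb: "0 < vv b" using pos_of_product(2) [OF _ tpN_pos] 2 by auto
  from 1(1) va have r0: "0 < Y r" by (rule pos_of_product(1))
  have "Y r * vv b < Y r * vv a" using 1 by linarith
  then show "vv b \<le> vv a" using r0 by (simp add: mult_less_cancel_left)
qed

lemma W_val: "l \<in> low \<Longrightarrow> z \<in> S (Wl wW) \<Longrightarrow> - 1 - X z * uu l + Y z * vv l = (vv l - 1) - X z * (uu l - vv l)"
  using W_coord [of z] by (simp add: algebra_simps)

text \<open>\<open>lP\<close> passes below \<open>pO\<close> and \<open>pJ\<close> but above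
  \<open>bt wW\<close>, so \<open>bt wW\<close> is not between these two. The line
  \<open>lA 0\<close> decides the direction: \<open>pO\<close> is above it, \<open>pJ\<close> and
  \<open>bt wW\<close> are below, so \<open>bt wW\<close> lies beyond \<open>pJ\<close>.\<close>

lemma X_btW: "X (bt wW) > 0"
proof -
  let ?b = "bt wW"
  have "h lP ?b < 0" using cert_ends(4) [OF pin_certs(6)] .
  have "cr (pO - pI) (pJ - pI) = - del" by (simp add: del_def cr_def algebra_simps)
  then have XJ: "X pJ = 0" "X pO = - 1" using del_nz by (simp_all add: X_def)
  have ne: "pO \<noteq> pJ" using XJ by auto
  obtain s where s: "?b = (1 - s) *\<^sub>R pJ + s *\<^sub>R pO"
    by (rule on_common [OF bt(2) pJ(1) pO(2) ne [symmetric]])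
  have Xb: "X ?b = - s" unfolding s XY_affine XJ by simp
  have "\<not> (0 \<le> s \<and> s \<le> 1)"
  proof
    assume "0 \<le> s \<and> s \<le> 1"
    then have "h lP ?b \<ge> 0" unfolding s affines using hP by (auto intro!: add_nonneg_nonneg mult_nonneg_nonneg)
    then show False using \<open>h lP ?b < 0\<close> by simp
  qed
  moreover have "s < 1"
  proof -
    have c1: "(lA 0, lE2, wD) \<in> certs K" "(lE, lA 0, wN) \<in> certs K"
      by (auto intro!: step_cert [of 0] simp: step_certs_def prev_line_def unit_line_def)
    have "h (lA 0) pO > 0" using wall_order(2) [OF c1(1) pO(1)] e2_signs by auto
    moreover have "h (lA 0) pJ < 0" using wall_order(1) [OF c1(2) pJ(2)] hE_W [OF pJ(1)] by auto
    moreover have "h (lA 0) ?b < 0" using h_below [of "lA 0" "Bt wW"] pins(9) ends_L(4) bt by auto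
    ultimately have "(1 - s) * h (lA 0) pJ + s * h (lA 0) pO < 0" "h (lA 0) pJ < 0" "h (lA 0) pO > 0" unfolding s affines by auto
    then show ?thesis
      using mult_nonpos_nonpos [of "1 - s" "h (lA 0) pJ"] mult_nonneg_nonneg [of s "h (lA 0) pO"] by linarith
  qed
  ultimately show ?thesis using Xb by auto
qed

lemma W_right:
  assumes l: "l \<in> low" "h l pJ > 0" "h l (bt wW) < 0" and z: "z \<in> S (Wl wW)"
  shows "uu l > vv l" "h l z < 0 \<Longrightarrow> X z > 0"
proof -
  have "(vv l - 1) - X (bt wW) * (uu l - vv l) < 0" using l(3) h_sign(2) [OF l(1)] W_val [OF l(1) bt(2)] by simp
  moreover have v: "vv l > 1" using vv_gt1 l by auto
  ultimately have "X (bt wW) * (uu l - vv l) > 0" by linarith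
  then show *: "uu l > vv l" using X_btW by (simp add: zero_less_mult_iff)
  show "X z > 0" if "h l z < 0"
  proof -
    have "(vv l - 1) - X z * (uu l - vv l) < 0" using that h_sign(2) [OF l(1)] W_val [OF l(1) z] by simp
    then have "X z * (uu l - vv l) > 0" using v by linarith
    then show ?thesis using * by (simp add: zero_less_mult_iff)
  qed
qed

end

context gadget_inside begin

text \<open>Ratio inequality read off from a point of a wall between the lines \<open>a\<close> and \<open>b\<close>; on the wall
  \<open>p X + q Y = 1\<close> the normalised functional of \<open>l\<close> is \<open>X (- (uu l + p) + (vv l - q) Y / X)\<close>.\<close>

lemma ratio:
  assumes "a \<in> low" "b \<in> low" "h a z > 0" "h b z < 0" "p * X z + q * Y z = 1" "X z > 0" "vv a - q > 0" "vv b - q > 0"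
  shows "(uu a + p) * (vv b - q) \<le> (uu b + p) * (vv a - q)"
proof -
  have "(vv a - q) * Y z > (uu a + p) * X z"
    using h_sign(1) [OF assms(1)] assms(3,5) by (simp add: algebra_simps)
  then have "((uu a + p) * X z) * (vv b - q) < ((vv a - q) * Y z) * (vv b - q)" using assms(8) by simp
  moreover have "(vv b - q) * Y z < (uu b + p) * X z"
    using h_sign(2) [OF assms(2)] assms(4,5) by (simp add: algebra_simps)
  then have "((vv b - q) * Y z) * (vv a - q) < ((uu b + p) * X z) * (vv a - q)" using assms(7) by simp
  ultimately have "X z * ((uu a + p) * (vv b - q)) < X z * ((uu b + p) * (vv a - q))" by (simp add: algebra_simps)
  then show ?thesis using assms(6) by simp
qed

text \<open>In the strip between \<open>Lup\<close> and \<open>Llo\<close>, a point with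
  \<open>X z = 0\<close> lies between \<open>pu\<close> and \<open>pl\<close>, hence on
  \<open>wN\<close> itself. So a connected set in the strip that avoids \<open>wN\<close> keeps the
  sign of \<open>X\<close>.\<close>

lemma strip_right_of_N:
  assumes U: "connected U" "U \<subseteq> I" "U \<inter> S (Wl wN) = {}" "\<And>z. z \<in> U \<Longrightarrow> sU z \<ge> 0 \<and> sL z \<ge> 0"
    and x: "x \<in> U" "X x > 0" and y: "y \<in> U"
  shows "X y > 0"
proof -
  have nz: "X z \<noteq> 0" if z: "z \<in> U" for z
  proof
    assume X0: "X z = 0"
    have ne: "pu \<noteq> pl" using base_signs on_line pl pu by auto
    have "cr (z - pI) (pJ - pI) = 0" "pJ - pI \<noteq> 0" using X0 del_nz by (auto simp: X_def del_def cr_def)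
    then obtain a where a: "z - pI = a *\<^sub>R (pJ - pI)"
      using cr_zero_imp_multiple [of "pJ - pI" "z - pI"] by (auto simp: cr_def algebra_simps)
    obtain b where b: "pJ - pI = b *\<^sub>R (pl - pu)"
    proof -
      obtain c d where cd: "pJ - pI = c *\<^sub>R (Q (Wl wN) - P (Wl wN))" "pl - pu = d *\<^sub>R (Q (Wl wN) - P (Wl wN))"
        using diff_in_segment [OF pI(2) [unfolded S_eq] pJ(2) [unfolded S_eq]]
          diff_in_segment [OF pu(1) [unfolded S_eq] pl(1) [unfolded S_eq]] by auto
      then have "d \<noteq> 0" using ne by auto
      then have "pJ - pI = (c / d) *\<^sub>R (pl - pu)" using cd by simp
      then show ?thesis using that by blast
    qed
    obtain d where d: "pI = (1 - d) *\<^sub>R pu + d *\<^sub>R pl" by (rule on_common [OF pI(2) pu(1) pl(1) ne])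
    have "z = pI + (z - pI)" by simp
    also have "\<dots> = (1 - d) *\<^sub>R pu + d *\<^sub>R pl + a *\<^sub>R b *\<^sub>R (pl - pu)" unfolding a b by (subst (1) d) simp
    also have "\<dots> = (1 - (d + a * b)) *\<^sub>R pu + (d + a * b) *\<^sub>R pl" by (simp add: algebra_simps)
    finally have "z = (1 - (d + a * b)) *\<^sub>R pu + (d + a * b) *\<^sub>R pl" .
    then obtain s where s: "z = (1 - s) *\<^sub>R pu + s *\<^sub>R pl" by blast
    have "sU z = s * sU pl" "sL z = (1 - s) * sL pu" unfolding s affines using on_line pu pl by auto
    then have "0 \<le> s" "s \<le> 1" using U(4) [OF z] base_signs by (auto simp: zero_le_mult_iff)
    then have "z \<in> closed_segment pu pl" using s by (auto simp: in_segment)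
    then have "z \<in> S (Wl wN)" using closed_segment_subset [OF pu(1) pl(1) S_simps(3)] by auto
    then show False using U(3) z by auto
  qed
  have "continuous_on U X" unfolding X_def cr_def by (intro continuous_intros) (use del_nz in auto)
  then have "connected (X ` U)" using U(1) connected_continuous_image by blast
  then show ?thesis using connectedD_interval [of "X ` U" "X y" "X x" 0] nz x y by (metis imageE imageI less_eq_real_def not_less)
qed

lemma base_strip: "z \<in> S Chi \<union> S (Wl wW) \<union> S (Wl wD) \<Longrightarrow> sU z > 0 \<and> sL z > 0"
proof -
  assume z: "z \<in> S Chi \<union> S (Wl wW) \<union> S (Wl wD)"
  let ?U = "S Chi \<union> S (Wl wW) \<union> S (Wl wD)"
  have con: "connected ?U" using chi(2) walls(3) by (intro connected_Un) (auto simp: hit_def)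
  have sub: "?U \<subseteq> I" by auto
  obtain e where e: "e \<in> S (Lin lE)" "e \<in> S (Wl wD)" using line_L(4) [of lE] by (auto simp: hit_def)
  then have e2: "sU e > 0" "sL e > 0" "e \<in> ?U" using line_between [of lE e] by auto
  have "?U \<inter> S Lup = {}" "?U \<inter> S Llo = {}" using chi(6,7) wall_L by (auto simp: hit_def)
  then have "sU e * sU z > 0" "sL e * sL z > 0" using s_same [OF con sub e2(3) z] by auto
  then show ?thesis using e2 by (auto simp: zero_less_mult_iff)
qed

text \<open>\<open>Chi\<close> avoids \<open>lE2\<close> and starts below it on
  \<open>Bt wW\<close>, so it meets \<open>wW\<close> below \<open>lE2\<close>, where
  \<open>X\<close> is positive by \<open>W_right\<close>. Positivity is carried along
  \<open>Chi\<close> to \<open>wM\<close> and then along \<open>wM\<close>.\<close>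

lemma M_strip_right: assumes z: "z \<in> S (Wl wM)" "sU z \<ge> 0" "sL z \<ge> 0" shows "X z > 0"
proof -
  obtain c where c: "c \<in> S Chi" "c \<in> S (Wl wW)" using chi(2) by (auto simp: hit_def)
  obtain m where m: "m \<in> S Chi" "m \<in> S (Wl wM)" using chi(1) by (auto simp: hit_def)
  obtain b where b: "b \<in> S Chi" "b \<in> S (Bt wW)" using chi(3) by (auto simp: hit_def)
  have "h lE2 b < 0" using h_below [of lE2 "Bt wW" b] b ends_L(4) certs_avoid [OF pin_certs(6)] by auto
  then have "h lE2 c < 0" using h_transfer(2) [of lE2 Chi b c] chi(5) b c by auto
  then have "X c > 0" using W_right(2) [of lE2 c] e2_signs c by auto
  then have Xm: "X m > 0"
    using strip_right_of_N [of "S Chi" c m] chi(4) c(1) m(1) base_strip core_in [of Chi] by (auto simp: hit_def less_imp_le)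
  let ?U = "closed_segment m z"
  have sub: "?U \<subseteq> S (Wl wM)" by (rule closed_segment_subset [OF m(2) z(1) S_simps(3)])
  show ?thesis
  proof (rule strip_right_of_N [of ?U m z])
    show "?U \<subseteq> I" using sub by auto
    show "?U \<inter> S (Wl wN) = {}" using sub pins(10) by (auto simp: hit_def)
    show "sU y \<ge> 0 \<and> sL y \<ge> 0" if y: "y \<in> ?U" for y
    proof -
      obtain s where s: "0 \<le> s" "s \<le> 1" "y = (1 - s) *\<^sub>R m + s *\<^sub>R z" using y by (auto simp: in_segment)
      then show ?thesis using base_strip [of m] m z(2,3) unfolding s(3) affines by auto
    qed
  qed (use Xm in auto)
qed

text \<open>The part of \<open>I\<close> below \<open>b\<close> is convex, contains
  \<open>pl\<close> and avoids \<open>Lup\<close>; the part above \<open>a\<close> is convex,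
  contains \<open>pu\<close> and avoids \<open>Llo\<close>.\<close>

lemma cert_point_strip:
  assumes ab: "a \<in> lines K" "b \<in> lines K" and z: "z \<in> I" "h a z > 0" "h b z < 0"
  shows "sU z > 0" "sL z > 0"
proof -
  have cv: "convex {z. h l z < 0}" "convex {z. h l z > 0}" for l
  proof -
    show "convex {z. h l z < 0}"
    proof (rule convexI)
      fix u v :: real and x y assume *: "x \<in> {z. h l z < 0}" "y \<in> {z. h l z < 0}" "0 \<le> u" "0 \<le> v" "u + v = 1"
      then have u: "u = 1 - v" by simp
      have "0 < (1 - v) * (- h l x) + v * (- h l y)" using * by (intro convex_comb_pos) auto
      then show "u *\<^sub>R x + v *\<^sub>R y \<in> {z. h l z < 0}" unfolding u mem_Collect_eq affines by (simp add: algebra_simps)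
    qed
    show "convex {z. h l z > 0}"
    proof (rule convexI)
      fix u v :: real and x y assume *: "x \<in> {z. h l z > 0}" "y \<in> {z. h l z > 0}" "0 \<le> u" "0 \<le> v" "u + v = 1"
      then have u: "u = 1 - v" by simp
      have "0 < (1 - v) * (h l x) + v * (h l y)" using * by (intro convex_comb_pos) auto
      then show "u *\<^sub>R x + v *\<^sub>R y \<in> {z. h l z > 0}" unfolding u mem_Collect_eq affines by (simp add: algebra_simps)
    qed
  qed
  let ?A = "{z. h b z < 0} \<inter> I" and ?B = "{z. h a z > 0} \<inter> I"
  have "connected ?A" "connected ?B" using cv I(1) by (auto intro!: convex_connected convex_Int)
  moreover have "?A \<inter> S Lup = {}" "?B \<inter> S Llo = {}" using h_up h_lo ab by force+
  moreover have "pl \<in> ?A" "pu \<in> ?B" using h_pl base_signs(3) ab pl pu by auto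
  ultimately have "sU pl * sU z > 0" "sL pu * sL z > 0" using s_same(1) [of ?A pl z] s_same(2) [of ?B pu z] z by auto
  then show "sU z > 0" "sL z > 0" using base_signs by (auto simp: zero_less_mult_iff)
qed

text \<open>\<open>pl\<close> is below \<open>lE2\<close>, which gives \<open>Y pl < 1\<close>.
  Moreover \<open>sL\<close> vanishes at \<open>pl\<close> but is positive between \<open>pI\<close>
  and \<open>pJ\<close>.\<close>

lemma Y_pl: "Y pl < 0"
proof -
  have e: "vv lE2 > 1" using vv_gt1 e2_signs by auto
  have X0: "X pl = 0" "X pu = 0" using N_coord pl pu by auto
  have "Y pl * vv lE2 < 1" using h_pl [of lE2] h_sign(2) [of lE2 pl] X0 by simp
  then have "Y pl < 1" using e by (smt (verit) mult_less_cancel_left1 mult_le_cancel_left1)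
  moreover have "\<not> (0 \<le> Y pl \<and> Y pl \<le> 1)"
  proof
    assume Y: "0 \<le> Y pl \<and> Y pl \<le> 1"
    have "sL pl = (1 - Y pl) * sL pI + Y pl * sL pJ" unfolding sL_XY [of pl] X0 by (simp add: algebra_simps)
    moreover have "sL pI > 0" "sL pJ > 0" using base_strip pI pJ by auto
    ultimately have "sL pl > 0" using Y convex_comb_pos [of "sL pI" "sL pJ" "Y pl"] by simp
    then show False using on_line(3) pl by auto
  qed
  ultimately show ?thesis by linarith
qed

text \<open>This is the orientation of the triangle \<open>pI\<close>, \<open>z\<close>,
  \<open>y\<close>; it fixes the sign of the normalisation of the equation of \<open>wM\<close>. If
  \<open>X y \<le> X z\<close>, it follows since \<open>z\<close> is below \<open>l\<close>;
  otherwise since \<open>y\<close> is above \<open>Llo\<close>.\<close>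

lemma cross_positive:
  assumes l: "l \<in> low" "vv l > 0" and z: "z \<in> S (Wl wM)" "z \<in> S Llo" and y: "y \<in> S (Wl wM)" "y \<in> S (Lin l)"
  shows "X z > 0" "X y > 0" "X z * Y y - X y * Y z > 0"
proof -
  have zI: "z \<in> I" "y \<in> I" using z y by auto
  have "S Llo \<inter> I \<inter> S Lup = {}" using Ldisj(1) by (auto simp: hit_def)
  then have "sU pl * sU z > 0" using s_same(1) [OF con_I [of Llo], of pl z] pl z zI by auto
  then have "sU z > 0" using base_signs(1) by (simp add: zero_less_mult_iff)
  then show Xz: "X z > 0" using M_strip_right [OF z(1)] on_line(3) [OF z(2)] by simp
  have sy: "sU y > 0" "sL y > 0" using line_between [OF low_lines [OF l(1)] y(2) zI(2)] by auto
  then show Xy: "X y > 0" using M_strip_right [OF y(1)] by simp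
  show "X z * Y y - X y * Y z > 0"
  proof (cases "X y \<le> X z")
    case True
    have "h l z < 0" using h_lo [OF low_lines [OF l(1)] z(2) zI(1)] .
    then have 1: "vv l * Y z < 1 + X z * uu l" using h_sign(2) [OF l(1)] by (simp add: algebra_simps)
    have 2: "vv l * Y y = 1 + X y * uu l" using h_sign(3) [OF l(1), of y] on_line(1) [OF y(2)] by (simp add: algebra_simps)
    have "vv l * (X z * Y y - X y * Y z) = X z * (vv l * Y y) - X y * (vv l * Y z)" by (simp add: algebra_simps)
    also have "\<dots> > X z * (1 + X y * uu l) - X y * (1 + X z * uu l)" using 1 2 Xy by simp
    also have "X z * (1 + X y * uu l) - X y * (1 + X z * uu l) = X z - X y" by (simp add: algebra_simps)
    finally show ?thesis using True l(2) by (smt (verit) zero_less_mult_pos)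
  next
    case False
    define \<beta> where "\<beta> = sL pJ - sL pI"
    have c: "sL pI > 0" using base_strip pI by auto
    have "sL pI + Y pl * \<beta> = 0" using sL_XY [of pl] N_coord [OF pl(1)] on_line(3) [OF pl(2)] by (simp add: \<beta>_def)
    then have "\<beta> > 0" using c Y_pl by (smt (verit) mult_nonneg_nonpos mult_nonpos_nonpos mult.commute)
    have 1: "\<beta> * Y z = X z * (sL pO - sL pI) - sL pI" using sL_XY [of z] on_line(3) [OF z(2)] by (simp add: \<beta>_def algebra_simps)
    have 2: "\<beta> * Y y > X y * (sL pO - sL pI) - sL pI" using sL_XY [of y] sy(2) by (simp add: \<beta>_def algebra_simps)
    have "\<beta> * (X z * Y y - X y * Y z) = X z * (\<beta> * Y y) - X y * (\<beta> * Y z)" by (simp add: algebra_simps)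
    also have "\<dots> > X z * (X y * (sL pO - sL pI) - sL pI) - X y * (X z * (sL pO - sL pI) - sL pI)" using 1 2 Xz by simp
    also have "X z * (X y * (sL pO - sL pI) - sL pI) - X y * (X z * (sL pO - sL pI) - sL pI) = sL pI * (X y - X z)"
      by (simp add: algebra_simps)
    finally have "\<beta> * (X z * Y y - X y * Y z) > sL pI * (X y - X z)" .
    moreover have "sL pI * (X y - X z) \<ge> 0" using c False by simp
    ultimately show ?thesis using \<open>\<beta> > 0\<close> by (smt (verit) zero_less_mult_pos)
  qed
qed

end

context gadget_inside begin

section \<open>The doubling step, the squaring steps and the resulting distances\<close>

lemma step_D: assumes "i \<le> K" "h (prev_line i) pO > 0"
  shows "uu (prev_line i) \<le> uu (lA i)" "uu (prev_line i) \<le> uu (lB i)"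
proof -
  have "prev_line i \<in> low" "(lA i, prev_line i, wD) \<in> certs K" "(lB i, prev_line i, wD) \<in> certs K"
    using assms(1) by (auto intro: step_cert simp: step_certs_def prev_line_def)
  then show "uu (prev_line i) \<le> uu (lA i)" "uu (prev_line i) \<le> uu (lB i)"
    using D_order assms uu_gt1 [of "prev_line i"] by auto
qed

lemma step_N: assumes "i \<le> K"
  shows "vv (lA i) \<le> vv (unit_line i)" "vv (lB i) \<le> vv (lC i)"
     "0 < vv (lA i)" "0 < vv (lB i)" "0 < vv (lC i)" "0 < vv (unit_line i)"
proof -
  have "unit_line i \<in> low" "(unit_line i, lA i, wN) \<in> certs K" "(lC i, lB i, wN) \<in> certs K"
    using assms(1) by (auto intro: step_cert simp: step_certs_def unit_line_def)
  then show "vv (lA i) \<le> vv (unit_line i)" "vv (lB i) \<le> vv (lC i)"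
     "0 < vv (lA i)" "0 < vv (lB i)" "0 < vv (lC i)" "0 < vv (unit_line i)"
    using N_order [of "unit_line i" "lA i"] N_order [of "lC i" "lB i"] assms by auto
qed

text \<open>On \<open>wM\<close>, with equation \<open>p X + q Y = 1\<close>, the two certificates
  give \<open>A^2 \<le> B * C\<close> for the values \<open>uu + p\<close> of \<open>lE2\<close>,
  \<open>lE\<close> and \<open>lC 0\<close>. The position of \<open>wM\<close> is unknown, but
  \<open>2 * A \<le> B + C\<close> is linear and \<open>p\<close> cancels. Finally
  \<open>uu lE \<le> 1\<close>, because \<open>wW\<close> is below \<open>lE\<close>.\<close>

lemma first_step: "uu (lC 0) - 1 \<ge> 2 * (uu lE2 - 1)"
proof -
  have vs: "0 < vv lE" "0 < vv (lA 0)" "0 < vv (lB 0)" "0 < vv (lC 0)" "vv (lA 0) \<le> vv lE" "vv (lB 0) \<le> vv (lC 0)"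
    using step_N [of 0] by (auto simp: unit_line_def)
  have ve: "vv lE2 > 1" "uu lE2 > 1" using vv_gt1 uu_gt1 e2_signs by auto
  have us: "uu lE2 \<le> uu (lA 0)" "uu lE2 \<le> uu (lB 0)"
    using step_D [of 0] e2_signs by (auto simp: prev_line_def)
  obtain z where z: "z \<in> S (Wl wM)" "z \<in> S Llo" using pins(11) by (auto simp: hit_def)
  obtain ze where ze: "ze \<in> S (Wl wM)" "ze \<in> S (Lin lE)" using walls(4) [of lE] by (auto simp: hit_def)
  define d where "d = X z * Y ze - X ze * Y z"
  note cz = cross_positive [OF _ vs(1) z ze, folded d_def, simplified]
  define p where "p = (Y ze - Y z) / d"
  define q where "q = (X z - X ze) / d"
  have pq: "p * X z + q * Y z = 1" "p * X ze + q * Y ze = 1"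
    using cz(3) by (simp_all add: p_def q_def divide_simps) (simp_all add: d_def algebra_simps)
  have zne: "z \<noteq> ze" using cz(3) by (auto simp: d_def)
  have M: "p * X y + q * Y y = 1" if y: "y \<in> S (Wl wM)" for y
  proof -
    obtain s where s: "y = (1 - s) *\<^sub>R z + s *\<^sub>R ze" by (rule on_common [OF y z(1) ze(1) zne])
    have "p * X y + q * Y y = (1 - s) * (p * X z + q * Y z) + s * (p * X ze + q * Y ze)"
      unfolding s XY_affine by (simp add: algebra_simps)
    then show ?thesis unfolding pq by simp
  qed
  have crossing: "\<exists>y. y \<in> S (Lin l) \<and> X y > 0 \<and> X y * (uu l + p) = Y y * (vv l - q) \<and> vv l - q > 0"
    if l: "l \<in> {lE, lE2, lA 0, lB 0, lC 0}" for l
  proof -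
    have ll: "l \<in> low" "vv l > 0" using l vs ve by auto
    obtain y where y: "y \<in> S (Wl wM)" "y \<in> S (Lin l)" using walls(4) [OF l] by (auto simp: hit_def)
    note c = cross_positive [OF ll z y]
    have "- 1 - X y * uu l + Y y * vv l = 0" using h_sign(3) [OF ll(1), of y] on_line(1) [OF y(2)] by simp
    then have 1: "X y * (uu l + p) = Y y * (vv l - q)" using M [OF y(1)] by (simp add: algebra_simps)
    have "- 1 - X z * uu l + Y z * vv l < 0" using h_sign(2) [OF ll(1)] h_lo [OF low_lines [OF ll(1)] z(2)] z(1) by auto
    then have "Y z * (vv l - q) < X z * (uu l + p)" using pq(1) by (simp add: algebra_simps)
    then have "X y * (Y z * (vv l - q)) < X z * (X y * (uu l + p))" using c(2) by (simp add: mult.left_commute)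
    then have "0 < (vv l - q) * (X z * Y y - X y * Y z)" unfolding 1 by (simp add: algebra_simps)
    then have "vv l - q > 0" using c(3) by (simp add: zero_less_mult_iff)
    then show ?thesis using y(2) c(2) 1 by blast
  qed
  have j: "vv lE - q > 0" "vv lE2 - q > 0" "vv (lA 0) - q > 0" "vv (lB 0) - q > 0" "vv (lC 0) - q > 0"
    using crossing by auto
  have op: "0 < uu lE2 + p"
  proof -
    obtain y where y: "y \<in> S (Lin lE2)" "X y > 0" "X y * (uu lE2 + p) = Y y * (vv lE2 - q)" using crossing [of lE2] by auto
    have "Y y * vv lE2 = 1 + X y * uu lE2" using h_sign(3) [of lE2 y] on_line(1) [OF y(1)] by simp
    moreover have "0 < X y * uu lE2" using y ve by simp
    ultimately have "0 < Y y * vv lE2" by linarith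
    then have "0 < Y y" using ve by (simp add: zero_less_mult_iff)
    then have "0 < X y * (uu lE2 + p)" using y(3) j by simp
    then show ?thesis using y(2) by (simp add: zero_less_mult_iff)
  qed
  have rat: "(uu a + p) * (vv b - q) \<le> (uu b + p) * (vv a - q)"
    if ce: "(a, b, wM) \<in> certs K" and ab: "a \<in> low" "b \<in> low" and jj: "vv a - q > 0" "vv b - q > 0" for a b
  proof -
    obtain r where r: "r \<in> S (Wl wM)" "h a r > 0" "h b r < 0" by (rule cert_point [OF ce])
    have "sU r > 0" "sL r > 0" using cert_point_strip [OF _ _ _ r(2,3)] r(1) low_lines ab by auto
    then have "X r > 0" using M_strip_right r(1) by simp
    then show ?thesis by (intro ratio [OF ab r(2,3) M [OF r(1)] _ jj])
  qed
  have c: "(lB 0, lE, wM) \<in> certs K" "(lA 0, lC 0, wM) \<in> certs K"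
    by (auto intro!: step_cert [of 0] simp: step_certs_def unit_line_def step_wall_def)
  have sq: "(uu lE2 + p)\<^sup>2 \<le> (uu (lC 0) + p) * (uu lE + p)" and pos: "0 < uu lE + p"
    using step_inequality [of "uu lE2 + p" "uu (lA 0) + p" "uu (lB 0) + p" "vv (lA 0) - q" "vv (lB 0) - q" "vv (lC 0) - q" "vv lE - q"
        "uu (lC 0) + p" "uu lE + p"] op us j vs rat [OF c(1)] rat [OF c(2)] by auto
  let ?A = "uu lE2 + p" and ?B = "uu lE + p" and ?C = "uu (lC 0) + p"
  have "0 \<le> (?A - ?B)\<^sup>2" by simp
  then have "(2 * ?A - ?B) * ?B \<le> ?A\<^sup>2" by (simp add: power2_eq_square algebra_simps)
  also have "\<dots> \<le> ?C * ?B" by (rule sq)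
  finally have "2 * ?A - ?B \<le> ?C" using pos by (simp add: mult_le_cancel_right)
  then have "2 * uu lE2 - uu lE \<le> uu (lC 0)" by (simp add: algebra_simps)
  moreover have "uu lE \<le> 1" using hE_W [OF pO(2)] h_pI [of lE] by (simp add: uu_def zero_le_divide_iff)
  ultimately have "2 * uu lE2 - 1 \<le> uu (lC 0)" by simp
  then show ?thesis by simp
qed

lemma W_ratio:
  assumes c: "(a, b, wW) \<in> certs K" and ab: "a \<in> low" "b \<in> low" and b: "h b pJ > 0" "h b pO > 0" "h b (bt wW) < 0"
  shows "(uu a - 1) * (vv b - 1) \<le> (uu b - 1) * (vv a - 1)" "vv a > 1"
proof -
  obtain r where r: "r \<in> S (Wl wW)" "h a r > 0" "h b r < 0" by (rule cert_point [OF c])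
  have "X r > 0" using W_right(2) [OF ab(2) b(1,3) r(1,3)] .
  moreover have "h a pJ > 0" using wall_order(2) [OF c pJ(1)] b(1) by simp
  then show va: "vv a > 1" using vv_gt1 ab by auto
  moreover have "vv b > 1" using vv_gt1 ab b by auto
  ultimately show "(uu a - 1) * (vv b - 1) \<le> (uu b - 1) * (vv a - 1)"
    using ratio [OF ab r(2,3), of "- 1" 1] W_coord [OF r(1)] by auto
qed

text \<open>On \<open>wW\<close>, where \<open>Y = 1 + X\<close>, the inequality
  \<open>ratio\<close> holds with \<open>p = - 1\<close> and \<open>q = 1\<close>. These offsets are
  the same in every step, so the inequalities can be iterated.\<close>

lemma later_step: assumes i: "0 < i" "i \<le> K"
  shows "(uu (lC (i - 1)) - 1)\<^sup>2 \<le> (uu (lC i) - 1) * (uu lE2 - 1)"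
    "(uu (lC (i - 1)) - 1) * (vv (lC i) - 1) \<le> (uu (lC i) - 1) * (vv lE2 - 1)"
proof -
  have ul: "unit_line i = lE2" "prev_line i = lC (i - 1)" using i by (auto simp: unit_line_def prev_line_def)
  have c: "(lB i, lE2, wW) \<in> certs K" "(lA i, lC i, wW) \<in> certs K"
    using i by (auto intro!: step_cert [of i] simp: step_certs_def unit_line_def step_wall_def)
  note Ci = C_signs [OF i(2)] and Cp = C_signs [of "i - 1"]
  have "uu (lC (i - 1)) > 1" "vv (lC i) > 1" "vv lE2 > 1" using uu_gt1 vv_gt1 Ci Cp i e2_signs by auto
  moreover have "uu (lC (i - 1)) \<le> uu (lA i)" "uu (lC (i - 1)) \<le> uu (lB i)" using step_D [OF i(2)] Cp i unfolding ul by auto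
  moreover have "vv (lA i) \<le> vv lE2" "vv (lB i) \<le> vv (lC i)" using step_N [OF i(2)] unfolding ul by auto
  ultimately show "(uu (lC (i - 1)) - 1)\<^sup>2 \<le> (uu (lC i) - 1) * (uu lE2 - 1)"
    "(uu (lC (i - 1)) - 1) * (vv (lC i) - 1) \<le> (uu (lC i) - 1) * (vv lE2 - 1)"
    using step_inequality [of "uu (lC (i - 1)) - 1" "uu (lA i) - 1" "uu (lB i) - 1" "vv (lA i) - 1" "vv (lB i) - 1"
        "vv (lC i) - 1" "vv lE2 - 1" "uu (lC i) - 1" "uu lE2 - 1"] W_ratio [OF c(1)] W_ratio [OF c(2)] Ci e2_signs i(2)
    by auto
qed

lemma growth: "i \<le> K \<Longrightarrow> 2 ^ (2 ^ i) * (uu lE2 - 1) \<le> uu (lC i) - 1"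
proof (induction i)
  case 0
  then show ?case using first_step by simp
next
  case (Suc i)
  have e: "uu lE2 - 1 > 0" using uu_gt1 e2_signs by auto
  have "(2::real) ^ (2 ^ Suc i) = (2 ^ (2 ^ i))\<^sup>2" by (simp add: mult.commute flip: power_mult)
  then have "(2 ^ (2 ^ Suc i) * (uu lE2 - 1)) * (uu lE2 - 1) = (2 ^ (2 ^ i) * (uu lE2 - 1))\<^sup>2"
    by (simp add: power2_eq_square)
  also have "\<dots> \<le> (uu (lC i) - 1)\<^sup>2" using Suc e by (intro power_mono) auto
  also have "\<dots> \<le> (uu (lC (Suc i)) - 1) * (uu lE2 - 1)" using later_step(1) [of "Suc i"] Suc.prems by simp
  finally show ?case using e by (simp add: mult_le_cancel_right)
qed

lemma W_crossing:
  assumes l: "l \<in> lines K" "h l (tp wW) > 0" "h l (bt wW) < 0"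
  obtains y where "y \<in> S (Wl wW)" "y \<in> S (Lin l)"
proof -
  define A B where "A = h l (tp wW)" and "B = h l (bt wW)"
  define s where "s = A / (A - B)"
  define y where "y = (1 - s) *\<^sub>R tp wW + s *\<^sub>R bt wW"
  have AB: "A > 0" "B < 0" using l by (simp_all add: A_def B_def)
  then have "0 \<le> s" "s \<le> 1" by (auto simp: s_def divide_simps)
  then have "y \<in> closed_segment (tp wW) (bt wW)" by (auto simp: y_def in_segment)
  then have y: "y \<in> S (Wl wW)" using closed_segment_subset [OF tp(2) bt(2) S_simps(3)] by auto
  have "h l y = (1 - s) * A + s * B" by (simp add: y_def affines A_def B_def)
  also have "\<dots> = 0" using AB by (simp add: s_def field_simps)
  finally have "side (P (Lin l)) (Q (Lin l)) y = 0" using side_nz(1) [OF l(1)] by (simp add: h_def)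
  then have "y \<in> S (Lin l)" using full(1) [OF l(1)] wall_in(1) [OF y] unfolding full_in_def S_eq by auto
  then show ?thesis using that y by blast
qed

lemma W_zero: assumes "l \<in> low" "y \<in> S (Wl wW)" "y \<in> S (Lin l)" shows "vv l - 1 = X y * (uu l - vv l)"
  using h_sign(3) [OF assms(1), of y] on_line(1) [OF assms(3)] W_val [OF assms(1,2)] by simp

lemma W_dist: assumes "a \<in> S (Wl wW)" "b \<in> S (Wl wW)" shows "dist a b = \<bar>X a - X b\<bar> * norm (pJ - pO)"
proof -
  have "a - b = (pI + X a *\<^sub>R (pI - pO) + Y a *\<^sub>R (pJ - pI)) - (pI + X b *\<^sub>R (pI - pO) + Y b *\<^sub>R (pJ - pI))"
    by (rule arg_cong2 [where f = "(-)", OF coordinates coordinates])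
  also have "\<dots> = (X a - X b) *\<^sub>R (pI - pO) + (Y a - Y b) *\<^sub>R (pJ - pI)" by (simp add: algebra_simps)
  finally have "a - b = (X a - X b) *\<^sub>R (pI - pO) + (Y a - Y b) *\<^sub>R (pJ - pI)" .
  moreover have "Y a - Y b = X a - X b" using W_coord assms by simp
  ultimately have "a - b = (X a - X b) *\<^sub>R (pJ - pO)" by (simp flip: scaleR_add_right)
  then show ?thesis by (simp add: dist_norm)
qed

text \<open>Along the wall \<open>wW\<close> one finds \<open>pJ\<close>, then \<open>lG\<close>, then \<open>lC K\<close>, and much farther \<open>lE2\<close>.\<close>

lemma distance_ratio:
  assumes K: "0 < K"
  obtains a b x y where "a \<in> S (Wl wW)" "b \<in> S (Wl wW)" "x \<in> S (Lin lG)" "y \<in> S (Lin (lC K))" "x \<noteq> y"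
    "2 ^ (2 ^ (K - 1)) * dist x y \<le> dist a b"
proof -
  have CK: "h (lC K) pJ > 0" "h (lC K) pO > 0" "h (lC K) (bt wW) < 0" using C_signs [of K] by auto
  have ee: "h lE2 (tp wW) > 0" "h (lC K) (tp wW) > 0" "h lG (tp wW) > 0" "h lG (bt wW) < 0"
    using cert_ends(1) [OF pin_certs(6)] cert_ends(1,3) [OF pin_certs(7)] cert_ends [OF pin_certs(8)] by auto
  obtain e where e: "e \<in> S (Wl wW)" "e \<in> S (Lin lE2)" by (rule W_crossing [of lE2]) (use ee e2_signs in auto)
  obtain y where y: "y \<in> S (Wl wW)" "y \<in> S (Lin (lC K))" by (rule W_crossing [of "lC K"]) (use ee CK in auto)
  obtain x where x: "x \<in> S (Wl wW)" "x \<in> S (Lin lG)" by (rule W_crossing [of lG]) (use ee in auto)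
  have XJ: "X pJ = 0" by (rule N_coord [OF pJ(2)])
  have wl: "uu lE2 > vv lE2" "uu (lC K) > vv (lC K)" using W_right(1) [OF _ _ _ pJ(1)] e2_signs CK by auto
  have v1: "vv lE2 > 1" "vv (lC K) > 1" using vv_gt1 e2_signs CK by auto
  have ze: "vv lE2 - 1 = X e * (uu lE2 - vv lE2)" "vv (lC K) - 1 = X y * (uu (lC K) - vv (lC K))"
    using W_zero e y by auto
  have "0 < X e * (uu lE2 - vv lE2)" "0 < X y * (uu (lC K) - vv (lC K))" using v1 unfolding ze [symmetric] by auto
  then have Xp: "0 < X e" "0 < X y" using wl by (auto simp: zero_less_mult_iff)
  have xc: "0 \<le> X x" "X x \<le> X y"
  proof -
    have "h lG x = 0" using on_line(1) x(2) by simp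
    then have "h lP x < 0" "h (lC K) x > 0" using wall_order [OF pin_certs(8) x(1)] wall_order [OF pin_certs(7) x(1)] by auto
    then have "(vv (lC K) - 1) - X x * (uu (lC K) - vv (lC K)) > 0"
      using h_sign(1) [of "lC K" x] W_val [of "lC K" x] x(1) by simp
    then have "X x * (uu (lC K) - vv (lC K)) < X y * (uu (lC K) - vv (lC K))" using ze by simp
    then show "X x \<le> X y" using wl by (simp add: mult_less_cancel_right)
    show "0 \<le> X x"
    proof (rule ccontr)
      assume neg: "\<not> 0 \<le> X x"
      have ne: "pJ \<noteq> bt wW" using XJ X_btW by auto
      obtain s where s: "x = (1 - s) *\<^sub>R pJ + s *\<^sub>R bt wW" by (rule on_common [OF x(1) pJ(1) bt(2) ne])
      have "X x = s * X (bt wW)" unfolding s XY_affine XJ by simp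
      then have "s < 0" using neg X_btW by (simp add: mult_less_0_iff not_le)
      have "h lP x = (1 - s) * h lP pJ + s * h lP (bt wW)" unfolding s affines by simp
      moreover have "(1 - s) * h lP pJ > 0" using \<open>s < 0\<close> hP by simp
      moreover have "s * h lP (bt wW) > 0" using \<open>s < 0\<close> cert_ends(4) [OF pin_certs(8)] by (simp add: mult_neg_neg)
      ultimately show False using \<open>h lP x < 0\<close> by linarith
    qed
  qed
  define \<rho> where "\<rho> = (2::real) ^ (2 ^ (K - 1))"
  define oe je oc jc where "oe = uu lE2 - 1" and "je = vv lE2 - 1" and "oc = uu (lC K) - 1" and "jc = vv (lC K) - 1"
  have pos: "0 < oe" "0 < je" "0 < oc" "0 < jc" "je < oe" "jc < oc"
    using uu_gt1 e2_signs CK v1 wl by (auto simp: oe_def je_def oc_def jc_def)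
  \<comment> \<open>The second inequality of \<open>later_step\<close> compares \<open>uu\<close> of
    step \<open>K - 1\<close> with \<open>vv\<close> of step \<open>K\<close>, hence the exponent
    \<open>K - 1\<close>.\<close>
  have "\<rho> * oe \<le> uu (lC (K - 1)) - 1" using growth [of "K - 1"] by (simp add: \<rho>_def oe_def)
  then have "\<rho> * oe * jc \<le> (uu (lC (K - 1)) - 1) * jc" using pos by simp
  also have "\<dots> \<le> oc * je" using later_step(2) [OF K order_refl] by (simp add: jc_def oc_def je_def)
  finally have big: "\<rho> * oe * jc \<le> oc * je" .
  have "\<rho> \<ge> 1" by (simp add: \<rho>_def)
  have eqs: "je = X e * (oe - je)" "jc = X y * (oc - jc)" using ze by (simp_all add: oe_def je_def oc_def jc_def)
  \<comment> \<open>\<open>X e = je / (oe - je)\<close> and \<open>X y = jc / (oc - jc)\<close>;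
    after clearing denominators the claim is \<open>big\<close> combined with
    \<open>je * jc \<le> \<rho> * (je * jc)\<close>.\<close>
  have "\<rho> * X y \<le> X e"
  proof -
    have "1 * (je * jc) \<le> \<rho> * (je * jc)" using \<open>\<rho> \<ge> 1\<close> pos by (intro mult_right_mono) auto
    then have "\<rho> * jc * (oe - je) \<le> je * (oc - jc)" using big by (simp add: algebra_simps)
    also have "\<dots> = X e * (oe - je) * (oc - jc)" using eqs(1) by simp
    finally have "\<rho> * (X y * (oc - jc)) * (oe - je) \<le> X e * (oe - je) * (oc - jc)"
      unfolding eqs(2) [symmetric] .
    then have "\<rho> * X y * ((oc - jc) * (oe - je)) \<le> X e * ((oc - jc) * (oe - je))" by (simp add: mult.assoc mult.commute mult.left_commute)
    moreover have "0 < (oc - jc) * (oe - je)" using pos by simp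
    ultimately show ?thesis by (meson mult_le_cancel_right_pos)
  qed
  have "dist x y \<le> X y * norm (pJ - pO)" unfolding W_dist [OF x(1) y(1)] using xc by (intro mult_right_mono) auto
  then have "\<rho> * dist x y \<le> \<rho> * (X y * norm (pJ - pO))" using \<open>\<rho> \<ge> 1\<close> by (intro mult_left_mono) auto
  also have "\<dots> = (\<rho> * X y) * norm (pJ - pO)" by simp
  also have "\<dots> \<le> X e * norm (pJ - pO)" using \<open>\<rho> * X y \<le> X e\<close> by (intro mult_right_mono) auto
  also have "\<dots> = dist e pJ" unfolding W_dist [OF e(1) pJ(1)] XJ using Xp by simp
  finally have "\<rho> * dist x y \<le> dist e pJ" .
  moreover have "x \<noteq> y" using pins(12) x y by (auto simp: hit_def)
  ultimately show ?thesis using that [OF e(1) pJ(1) x(2) y(2)] by (simp add: \<rho>_def)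
qed

end

section \<open>A drawing of the gadget\<close>

definition orient :: "real \<times> real \<Rightarrow> real \<times> real \<Rightarrow> real \<times> real \<Rightarrow> real" where
  "orient p q z = (fst q - fst p) * (snd z - snd p) - (snd q - snd p) * (fst z - fst p)"

section \<open>Meeting and separation of explicit segments\<close>

lemma segments_meet:
  assumes "orient p q r * orient p q s \<le> 0" "orient r s p * orient r s q \<le> 0" "orient p q r \<noteq> orient p q s"
  shows "closed_segment p q \<inter> closed_segment r s \<noteq> {}"
proof -
  define t u where "t = orient p q r / (orient p q r - orient p q s)" and "u = orient r s p / (orient r s p - orient r s q)"
  have e: "orient r s p - orient r s q = - (orient p q r - orient p q s)" by (simp add: orient_def algebra_simps)
  have ratio: "0 \<le> x / (x - y) \<and> x / (x - y) \<le> 1" if "x * y \<le> 0" "x \<noteq> y" for x y :: real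
    using that by (cases "x < y") (auto simp: mult_le_0_iff divide_simps)
  have b: "0 \<le> t \<and> t \<le> 1" "0 \<le> u \<and> u \<le> 1" unfolding t_def u_def using assms e by (intro ratio; force)+
  have "(1 - t) *\<^sub>R r + t *\<^sub>R s = (1 - u) *\<^sub>R p + u *\<^sub>R q"
  proof -
    define D where "D = orient p q r - orient p q s"
    have D: "D \<noteq> 0" "t * D = orient p q r" "u * D = - orient r s p"
      unfolding t_def u_def e D_def using assms(3) by (auto simp: field_simps)
    have "D * ((1 - t) * fst r + t * fst s) = D * fst r + (t * D) * (fst s - fst r)"
         "D * ((1 - t) * snd r + t * snd s) = D * snd r + (t * D) * (snd s - snd r)"
         "D * ((1 - u) * fst p + u * fst q) = D * fst p + (u * D) * (fst q - fst p)"
         "D * ((1 - u) * snd p + u * snd q) = D * snd p + (u * D) * (snd q - snd p)"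
      by (simp_all add: algebra_simps)
    moreover have "D * fst r + orient p q r * (fst s - fst r) = D * fst p + (- orient r s p) * (fst q - fst p)"
      "D * snd r + orient p q r * (snd s - snd r) = D * snd p + (- orient r s p) * (snd q - snd p)"
      unfolding D_def orient_def by algebra+
    ultimately have "D * ((1 - t) * fst r + t * fst s) = D * ((1 - u) * fst p + u * fst q)"
        "D * ((1 - t) * snd r + t * snd s) = D * ((1 - u) * snd p + u * snd q)"
      by (simp_all only: D(2,3))
    then show ?thesis using D(1) by (simp add: prod_eq_iff)
  qed
  moreover have "(1 - t) *\<^sub>R r + t *\<^sub>R s \<in> closed_segment r s" "(1 - u) *\<^sub>R p + u *\<^sub>R q \<in> closed_segment p q"
    using b unfolding in_segment by blast+
  ultimately show ?thesis by force
qed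

lemma segment_functional:
  fixes a b c :: real
  assumes "z \<in> closed_segment p q"
  shows "a * fst p + b * snd p < c \<Longrightarrow> a * fst q + b * snd q < c \<Longrightarrow> a * fst z + b * snd z < c"
    "a * fst p + b * snd p \<le> c \<Longrightarrow> a * fst q + b * snd q \<le> c \<Longrightarrow> a * fst z + b * snd z \<le> c"
proof -
  obtain t where t: "0 \<le> t" "t \<le> 1" "z = (1 - t) *\<^sub>R p + t *\<^sub>R q" using assms by (auto simp: in_segment)
  have z: "a * fst z + b * snd z = (1 - t) * (a * fst p + b * snd p) + t * (a * fst q + b * snd q)"
    unfolding t(3) by (simp add: algebra_simps)
  show "a * fst z + b * snd z < c" if "a * fst p + b * snd p < c" "a * fst q + b * snd q < c"
    unfolding z by (rule convex_bound_lt) (use that t in auto)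
  show "a * fst z + b * snd z \<le> c" if "a * fst p + b * snd p \<le> c" "a * fst q + b * snd q \<le> c"
    unfolding z by (rule convex_bound_le) (use that t in auto)
qed

lemma segments_separated:
  fixes a b c :: real
  assumes "a * fst p + b * snd p < c" "a * fst q + b * snd q < c" "c \<le> a * fst r + b * snd r" "c \<le> a * fst s + b * snd s"
  shows "closed_segment p q \<inter> closed_segment r s = {}"
proof -
  have False if "z \<in> closed_segment p q" "z \<in> closed_segment r s" for z
    using segment_functional(1) [OF that(1) assms(1,2)] segment_functional(2) [OF that(2), of "- a" "- b" "- c"] assms(3,4) by simp
  then show ?thesis by blast
qed

lemma segments_apart:
  assumes "orient p q r * orient p q s > 0 \<or> orient r s p * orient r s q > 0 \<or> max (fst p) (fst q) < min (fst r) (fst s)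
    \<or> max (fst r) (fst s) < min (fst p) (fst q) \<or> max (snd p) (snd q) < min (snd r) (snd s) \<or> max (snd r) (snd s) < min (snd p) (snd q)"
  shows "closed_segment p q \<inter> closed_segment r s = {}"
proof -
  have 1: "closed_segment p q \<inter> closed_segment r s = {}" if "orient p q r * orient p q s > 0" for p q r s
  proof -
    define a b where "a = - (snd q - snd p)" and "b = fst q - fst p"
    have o: "orient p q z = a * fst z + b * snd z - (a * fst p + b * snd p)" for z
      by (simp add: orient_def a_def b_def algebra_simps)
    have "a * fst q + b * snd q = a * fst p + b * snd p" by (simp add: a_def b_def algebra_simps)
    moreover have "(orient p q r > 0 \<and> orient p q s > 0) \<or> (orient p q r < 0 \<and> orient p q s < 0)"
      using that by (auto simp: zero_less_mult_iff)
    ultimately show ?thesis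
      using segments_separated [of a r b "a * fst p + b * snd p" s p q] segments_separated [of "- a" r "- b" "- (a * fst p + b * snd p)" s p q]
      unfolding o by auto
  qed
  have 2: "closed_segment p q \<inter> closed_segment r s = {}" if "max (fst p) (fst q) < min (fst r) (fst s)" for p q r s :: "real \<times> real"
    using segments_separated [of 1 p 0 "min (fst r) (fst s)" q r s] that by simp
  have 3: "closed_segment p q \<inter> closed_segment r s = {}" if "max (snd p) (snd q) < min (snd r) (snd s)" for p q r s :: "real \<times> real"
    using segments_separated [of 0 p 1 "min (snd r) (snd s)" q r s] that by simp
  show ?thesis using assms 1 [of p q r s] 1 [of r s p q] 2 [of p q r s] 2 [of r s p q] 3 [of p q r s] 3 [of r s p q]
    by (auto simp: Int_commute)
qed

lemma in_vertical: "y0 \<le> y \<Longrightarrow> y \<le> y1 \<Longrightarrow> (c, y) \<in> closed_segment (c :: real, y0 :: real) (c, y1)"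
proof -
  assume y: "y0 \<le> y" "y \<le> y1"
  then have "y \<in> closed_segment y0 y1" by (simp add: closed_segment_eq_real_ivl)
  then obtain u where u: "0 \<le> u" "u \<le> 1" "y = (1 - u) * y0 + u * y1" by (auto simp: in_segment)
  show ?thesis unfolding in_segment by (rule exI [of _ u]) (use u in \<open>simp add: algebra_simps\<close>)
qed

lemma in_graph: "x0 \<le> x \<Longrightarrow> x \<le> x1 \<Longrightarrow> (x, m + s * x) \<in> closed_segment (x0 :: real, m + s * x0 :: real) (x1, m + s * x1)"
proof -
  assume y: "x0 \<le> x" "x \<le> x1"
  then have "x \<in> closed_segment x0 x1" by (simp add: closed_segment_eq_real_ivl)
  then obtain u where u: "0 \<le> u" "u \<le> 1" "x = (1 - u) * x0 + u * x1" by (auto simp: in_segment)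
  have "(x, m + s * x) = (1 - u) *\<^sub>R (x0, m + s * x0) + u *\<^sub>R (x1, m + s * x1)"
    unfolding u(3) by (simp add: algebra_simps)
  then show ?thesis unfolding in_segment using u(1,2) by blast
qed

lemma in_horizontal: "x0 \<le> x \<Longrightarrow> x \<le> x1 \<Longrightarrow> (x, c) \<in> closed_segment (x0 :: real, c :: real) (x1, c)"
  using in_graph [of x0 x x1 c 0] by simp

text \<open>The ratio after step \<open>i\<close> in the drawing, with \<open>lE2\<close> as unit.
  The factor 64 leaves room above the squaring that the gadget forces.\<close>

fun xval :: "nat \<Rightarrow> real" where
  "xval 0 = 512" |
  "xval (Suc i) = 64 * (xval i)\<^sup>2"

text \<open>Large enough for \<open>lS\<close> to pass below all lines compared with it on
  \<open>wD\<close>, and for \<open>lP\<close> to pass above all lines compared with it on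
  \<open>wW\<close>.\<close>

definition steep :: "nat \<Rightarrow> real" where "steep K = 1600 * xval K"
text \<open>Flattens the drawing: \<open>eps K * steep K = 1 / 100\<close>, so even the steepest
  line stays near the horizontal axis and crosses all three sides of the frame.\<close>

definition eps :: "nat \<Rightarrow> real" where "eps K = 1 / (100 * steep K)"

text \<open>Intercept and slope, in units of \<^term>\<open>eps K\<close>. The ratio of slope and intercept of \<open>lC i\<close> is
  \<open>1 + xval i\<close>, and that of \<open>lA (i + 1)\<close> and \<open>lB (i + 1)\<close> is \<open>1 + 2 * xval i\<close>.\<close>

fun icept :: "nat \<Rightarrow> line \<Rightarrow> real" where
  "icept K lE = 4" |
  "icept K lE2 = 4 / 5" |
  "icept K lS = 2" |
  "icept K lR = 3 / 2" |
  "icept K lF = 1 / 2" |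
  "icept K lP = 1 / 4" |
  "icept K (lA i) = (if i = 0 then 8 else 8 / 9)" |
  "icept K (lB i) = (if i = 0 then 1 / 2 else 1 / (1 + xval (i - 1)))" |
  "icept K (lC i) = (if i = 0 then 1 / 4 else 1 / (1 + 2 * xval (i - 1)))" |
  "icept K lG = (if K = 0 then 1 / 4 else 1 / (1 + 2 * xval (K - 1))) + 1 / 4"

fun slope :: "nat \<Rightarrow> line \<Rightarrow> real" where
  "slope K lE = 2" |
  "slope K lE2 = 8 / 5" |
  "slope K lS = steep K" |
  "slope K lR = 1 / 4" |
  "slope K lF = 1" |
  "slope K lP = steep K" |
  "slope K (lA i) = (if i = 0 then 40 else 8 / 9 * (1 + 2 * xval (i - 1)))" |
  "slope K (lB i) = (if i = 0 then 5 / 2 else (1 + 2 * xval (i - 1)) / (1 + xval (i - 1)))" |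
  "slope K (lC i) = (if i = 0 then 513 / 4 else (1 + 64 * (xval (i - 1))\<^sup>2) / (1 + 2 * xval (i - 1)))" |
  "slope K lG = (if K = 0 then 513 / 4 else (1 + 64 * (xval (K - 1))\<^sup>2) / (1 + 2 * xval (K - 1)))"

text \<open>The points where \<open>Bt w\<close> and, for \<open>tip\<close>, \<open>Tp w\<close>
  are attached. On \<open>wD\<close> and \<open>wW\<close> the right end counts as the lower one,
  because it is below the certified lines, which rise faster than these walls.\<close>

fun foot :: "nat \<Rightarrow> wall \<Rightarrow> real \<times> real" where
  "foot K wD = (1 / 10, 0)" |
  "foot K wN = (0, 0)" |
  "foot K wM = (1, 0)" |
  "foot K wW = (3 / 2, 5 / 2 * eps K)"

fun tip :: "nat \<Rightarrow> wall \<Rightarrow> real \<times> real" where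
  "tip K wD = (- 3, 0)" |
  "tip K wN = (0, 10 * eps K)" |
  "tip K wM = (1, 200 * eps K)" |
  "tip K wW = (0, eps K)"

text \<open>Positive below the line, so the sign is opposite to that of \<open>h\<close> in
  \<open>gadget_inside\<close>.\<close>

definition height :: "nat \<Rightarrow> line \<Rightarrow> real \<times> real \<Rightarrow> real" where
  "height K l z = eps K * (icept K l + slope K l * fst z) - snd z"

definition spot :: "nat \<Rightarrow> wall \<Rightarrow> real \<Rightarrow> real \<times> real" where
  "spot K w t = (1 - t) *\<^sub>R foot K w + t *\<^sub>R tip K w"

text \<open>The zero of \<open>height\<close> along the wall, that is, the parameter
  \<open>t\<close> at which \<open>spot K w t\<close> is on the line.\<close>

definition para :: "nat \<Rightarrow> line \<Rightarrow> wall \<Rightarrow> real" where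
  "para K l w = height K l (foot K w) / (height K l (foot K w) - height K l (tip K w))"

definition pt3 :: "nat \<Rightarrow> 'a \<Rightarrow> 'a \<Rightarrow> 'a \<Rightarrow> 'a" where
  "pt3 j a b c = (if j = 0 then a else if j = 1 then b else c)"

text \<open>The certificates lie on their wall: \<open>Qs\<close> is the middle third between the
  two crossings, and \<open>Us\<close> and \<open>Ds\<close> run from its midpoint to the tip and to
  the foot.\<close>

primrec ends :: "nat \<Rightarrow> nm \<Rightarrow> (real \<times> real) \<times> (real \<times> real)" where
  "ends K (Frm j) = pt3 j ((- 6, - 1), (9 / 2, 19 / 2)) ((4, - 19 / 2), (4, 19 / 2)) ((- 6, 1), (9 / 2, - 19 / 2))" |
  "ends K Lup = ((- 6, 1), (7, 1))" |
  "ends K Llo = ((- 6, - 1), (7, - 1))" |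
  "ends K Mid = ((- 6, 0), (6, 0))" |
  "ends K (Lin l) = ((- 6, eps K * icept K l + eps K * slope K l * (- 6)), (5, eps K * icept K l + eps K * slope K l * 5))" |
  "ends K (Wl w) = (case w of wD \<Rightarrow> ((- 3, 0), (1 / 10, 0)) | wN \<Rightarrow> ((0, - 1), (0, 1)) | wM \<Rightarrow> ((1, - 1), (1, 1))
      | wW \<Rightarrow> ((- 1, eps K + eps K * (- 1)), (3 / 2, eps K + eps K * (3 / 2))))" |
  "ends K (Tp w) = (tip K w, (fst (tip K w), 1))" |
  "ends K (Bt w) = ((fst (foot K w), - 1), foot K w)" |
  "ends K Chi = ((1, 2 * eps K), (3 / 2, 5 / 2 * eps K))" |
  "ends K (Bar j) = pt3 j ((3, 7), (3, 12)) ((7 / 2, 5), (9 / 2, 5)) ((3, - 7), (3, - 12))" |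
  "ends K (Ta j) = pt3 j ((0, 1), (3, 15 / 2)) ((0, 1), (15 / 4, 5)) ((0, - 1), (3, - 15 / 2))" |
  "ends K (Tb j) = pt3 j ((5, 20), (3, 11)) ((5, 5), (17 / 4, 5)) ((5, - 20), (3, - 11))" |
  "ends K Pole = ((5, - 20), (5, 20))" |
  "ends K PiA = ((5, - 1), (5, 0))" |
  "ends K PiB = ((5, 0), (5, 1))" |
  "ends K PiC = ((7, - 1), (7, 1))" |
  "ends K Kap = ((5, 1 / 2), (7, 1 / 2))" |
  "ends K (Qs a b w) = (spot K w ((2 * para K a w + para K b w) / 3), spot K w ((para K a w + 2 * para K b w) / 3))" |
  "ends K (Us a b w) = (spot K w ((para K a w + para K b w) / 2), tip K w)" |
  "ends K (Ds a b w) = (spot K w ((para K a w + para K b w) / 2), foot K w)" |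
  "ends K (Pad i) = ((- 6, 0), (6, 0))"

definition draw :: "nat \<Rightarrow> nm \<Rightarrow> (real \<times> real) set" where "draw K x = closed_segment (fst (ends K x)) (snd (ends K x))"
definition dhit :: "nat \<Rightarrow> nm \<Rightarrow> nm \<Rightarrow> bool" where "dhit K x y \<longleftrightarrow> draw K x \<inter> draw K y \<noteq> {}"

lemma dhit_meet:
  assumes "orient (fst (ends K x)) (snd (ends K x)) (fst (ends K y)) * orient (fst (ends K x)) (snd (ends K x)) (snd (ends K y)) \<le> 0"
    "orient (fst (ends K y)) (snd (ends K y)) (fst (ends K x)) * orient (fst (ends K y)) (snd (ends K y)) (snd (ends K x)) \<le> 0"
    "orient (fst (ends K x)) (snd (ends K x)) (fst (ends K y)) \<noteq> orient (fst (ends K x)) (snd (ends K x)) (snd (ends K y))"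
  shows "dhit K x y"
  unfolding dhit_def draw_def using assms by (rule segments_meet)

lemma not_dhit:
  assumes "let p = fst (ends K x); q = snd (ends K x); r = fst (ends K y); s = snd (ends K y) in
    orient p q r * orient p q s > 0 \<or> orient r s p * orient r s q > 0 \<or> max (fst p) (fst q) < min (fst r) (fst s)
    \<or> max (fst r) (fst s) < min (fst p) (fst q) \<or> max (snd p) (snd q) < min (snd r) (snd s) \<or> max (snd r) (snd s) < min (snd p) (snd q)"
  shows "\<not> dhit K x y"
  unfolding dhit_def draw_def using segments_apart assms by (simp add: Let_def)

lemma skeleton_hits_indexed:
  "\<lbrakk>i < 3; j < 3; i \<noteq> j\<rbrakk> \<Longrightarrow> dhit K (Frm i) (Frm j)"
  "j < 3 \<Longrightarrow> dhit K Lup (Frm j)" "j < 3 \<Longrightarrow> dhit K Llo (Frm j)" "j < 3 \<Longrightarrow> dhit K Mid (Frm j)"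
  "j < 3 \<Longrightarrow> dhit K (Ta j) (Bar j)" "j < 3 \<Longrightarrow> dhit K (Ta j) (Wl wN)"
  "j < 3 \<Longrightarrow> dhit K (Tb j) Pole" "j < 3 \<Longrightarrow> dhit K (Bar j) (Frm j)"
  by (drule less_3_cases [THEN iffD1]; (drule less_3_cases [THEN iffD1])?; elim disjE; hypsubst; (simp; fail)?; rule dhit_meet; simp add: orient_def pt3_def)+

lemma skeleton_hits:
  "dhit K Kap Pole" "dhit K Kap PiC" "dhit K Pole Lup" "dhit K Pole Mid" "dhit K Pole Llo" "dhit K PiA Mid" "dhit K PiA Llo"
  "dhit K PiB Mid" "dhit K PiB Lup" "dhit K PiC Lup" "dhit K PiC Llo" "dhit K (Wl wN) Lup" "dhit K (Wl wN) Llo" "dhit K (Wl wM) Llo" "dhit K (Wl wD) (Wl wN)"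
  by (rule dhit_meet; simp add: orient_def)+

lemma Tb_Bar: "j < 3 \<Longrightarrow> dhit K (Tb j) (Bar j)"
proof -
  assume "j < 3"
  then consider "j = 1" | "j = 0 \<or> j = 2" by linarith
  then show ?thesis
  proof cases
    case 1
    have "(17 / 4, 5) \<in> draw K (Tb j)" "(17 / 4, 5) \<in> draw K (Bar j)"
      using in_horizontal [of "7 / 2" "17 / 4" "9 / 2" 5] 1 by (simp_all add: draw_def pt3_def)
    then show ?thesis by (auto simp: dhit_def)
  next
    case 2
    then show ?thesis by - (rule dhit_meet; auto simp: orient_def pt3_def)
  qed
qed

lemma Pi_Pole: "dhit K PiA Pole" "dhit K PiB Pole"
proof -
  have "(5, 0) \<in> draw K PiA" "(5, 0) \<in> draw K PiB" "(5, 0) \<in> draw K Pole"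
    using in_vertical [of "- 20" 0 20 5] by (simp_all add: draw_def)
  then show "dhit K PiA Pole" "dhit K PiB Pole" by (auto simp: dhit_def)
qed

lemma skeleton_misses_indexed:
  "\<lbrakk>j < 3; k < 3\<rbrakk> \<Longrightarrow> \<not> dhit K (Ta j) (Frm k)" "\<lbrakk>j < 3; k < 3\<rbrakk> \<Longrightarrow> \<not> dhit K (Tb j) (Frm k)"
  "\<lbrakk>j < 3; k < 3\<rbrakk> \<Longrightarrow> \<not> dhit K (Ta j) (Tb k)" "\<lbrakk>j < 3; k < 3; j \<noteq> k\<rbrakk> \<Longrightarrow> \<not> dhit K (Ta j) (Bar k)"
  "\<lbrakk>j < 3; k < 3; j \<noteq> k\<rbrakk> \<Longrightarrow> \<not> dhit K (Tb j) (Bar k)" "\<lbrakk>j < 3; k < 3; j \<noteq> k\<rbrakk> \<Longrightarrow> \<not> dhit K (Bar j) (Frm k)"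
  "\<lbrakk>j < 3; k < 3; j \<noteq> k\<rbrakk> \<Longrightarrow> \<not> dhit K (Bar j) (Bar k)"
  by (drule less_3_cases [THEN iffD1], drule less_3_cases [THEN iffD1]; elim disjE; hypsubst; (simp; fail)?; rule not_dhit; simp add: orient_def pt3_def)+

lemma far_misses:
  assumes "y \<in> far" "j < 3"
  shows "\<not> dhit K (Ta j) y" "\<not> dhit K y (Frm j)" "\<not> dhit K y (Bar j)"
  using assms(1) less_3_cases [THEN iffD1, OF assms(2)] unfolding far_def insert_iff empty_iff
  by - (elim disjE; hypsubst; (simp; fail)?; rule not_dhit; simp add: pt3_def)+

lemma skeleton_misses:
  "\<not> dhit K PiA Lup" "\<not> dhit K PiB Llo" "\<not> dhit K PiC Mid" "\<not> dhit K Lup Llo" "\<not> dhit K Lup Mid" "\<not> dhit K Llo Mid"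
  "\<not> dhit K (Wl wD) Lup" "\<not> dhit K (Wl wD) Llo" "\<not> dhit K (Wl wM) (Wl wN)"
  by (rule not_dhit; simp add: orient_def)+

section \<open>Order of the crossings along the walls\<close>

lemma xval_ge: "512 \<le> xval i"
proof (induction i)
  case (Suc i)
  then have "512 * 1 \<le> 64 * xval i * xval i" by (intro mult_mono) auto
  then show ?case by (simp add: power2_eq_square)
qed simp

lemma xval_mono: "i \<le> j \<Longrightarrow> xval i \<le> xval j"
proof (rule lift_Suc_mono_le)
  fix n
  have "1 * xval n \<le> (64 * xval n) * xval n" using xval_ge [of n] by (intro mult_right_mono) auto
  then show "xval n \<le> xval (Suc n)" by (simp add: power2_eq_square)
qed

lemma steep_ge: "i \<le> K \<Longrightarrow> 1600 * xval i \<le> steep K" "819200 \<le> steep K"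
  using xval_mono [of i K] xval_ge [of K] by (auto simp: steep_def)

lemma eps_pos: "0 < eps K" "eps K * steep K = 1 / 100" "eps K \<le> 1 / 81920000"
  using steep_ge(2) [of K] by (auto simp: eps_def field_simps)

lemma icept_lC: "0 < icept K (lC i)" "icept K (lC i) \<le> 1 / 4"
  using xval_ge [of "i - 1"] by (auto simp: field_simps)

lemma slope_lC: "slope K (lC i) = icept K (lC i) * (1 + xval i)" "100 \<le> slope K (lC i)" "i \<le> K \<Longrightarrow> slope K (lC i) \<le> steep K / 4"
proof -
  show e: "slope K (lC i) = icept K (lC i) * (1 + xval i)" by (cases i) (auto simp: divide_simps)
  show "100 \<le> slope K (lC i)"
  proof (cases i)
    case (Suc j)
    have x: "512 \<le> xval j" by (rule xval_ge)
    then have "4 * xval j \<le> (xval j)\<^sup>2" by (simp add: power2_eq_square)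
    then show ?thesis using Suc x by (simp add: field_simps)
  qed simp
  show "slope K (lC i) \<le> steep K / 4" if "i \<le> K"
  proof -
    have "slope K (lC i) \<le> 1 / 4 * (1 + xval i)" unfolding e using icept_lC [of K i] xval_ge [of i] by (intro mult_right_mono) auto
    also have "1 + xval i \<le> steep K" using steep_ge(1) [OF that] xval_ge [of i] by linarith
    finally show ?thesis by simp
  qed
qed

lemma lG_eq: "icept K lG = icept K (lC K) + 1 / 4" "slope K lG = slope K (lC K)" by auto

lemma lB_Suc: "0 < icept K (lB (Suc j))" "icept K (lB (Suc j)) < 1" "slope K (lB (Suc j)) = 2 - icept K (lB (Suc j))"
  "slope K (lB (Suc j)) = icept K (lB (Suc j)) * (1 + 2 * xval j)" "icept K (lC (Suc j)) < icept K (lB (Suc j))"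
  "icept K (lB (Suc j)) < 1 / 100"
  using xval_ge [of j] by (auto simp: field_simps)

declare icept.simps(7-10) [simp del] slope.simps(7-10) [simp del]

lemma line_bounds:
  assumes "l \<in> lines K"
  shows "0 < icept K l \<and> icept K l \<le> 8 \<and> 0 < slope K l \<and> slope K l \<le> steep K \<and> (l \<noteq> lR \<longrightarrow> icept K l < 3 * slope K l)"
proof -
  consider "l \<in> {lE, lE2, lS, lR, lF, lP}" | "l = lG" | i where "i \<le> K" "l = lC i" | "l = lA 0" | "l = lB 0"
    | j where "Suc j \<le> K" "l = lA (Suc j)" | j where "Suc j \<le> K" "l = lB (Suc j)"
    using assms unfolding lines_def by (auto elim: nat.exhaust) (metis not0_implies_Suc)+
  then show ?thesis
  proof cases
    case 2
    then show ?thesis unfolding 2 lG_eq using icept_lC [of K K] slope_lC(2) [of K K] slope_lC(3) [OF order_refl, of K] by simp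
  next
    case (3 i)
    then show ?thesis unfolding 3 using icept_lC [of K i] slope_lC(2) [of K i] slope_lC(3) [OF 3(1)] steep_ge(2) [of K] by simp
  next
    case (6 j)
    then show ?thesis using xval_ge [of j] steep_ge(1) [of j K] by (simp add: icept.simps slope.simps field_simps)
  next
    case (7 j)
    then show ?thesis unfolding 7 using lB_Suc [of K j] steep_ge(2) [of K] by linarith
  qed (use steep_ge(2) [of K] in \<open>auto simp: icept.simps slope.simps\<close>)
qed

text \<open>On each wall the positions of the crossings, measured from the bottom, are compared without division.\<close>

fun below :: "nat \<Rightarrow> wall \<Rightarrow> line \<Rightarrow> line \<Rightarrow> bool" where
  "below K wD a b \<longleftrightarrow> icept K a < 3 * slope K a \<and> icept K b < 3 * slope K b \<and> icept K a * slope K b < icept K b * slope K a"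
| "below K wN a b \<longleftrightarrow> icept K a < icept K b \<and> icept K b < 10"
| "below K wM a b \<longleftrightarrow> icept K a + slope K a < icept K b + slope K b \<and> icept K b + slope K b < 200"
| "below K wW a b \<longleftrightarrow> icept K a < 1 \<and> icept K b < 1 \<and> 5 / 2 < icept K a + 3 / 2 * slope K a \<and> 5 / 2 < icept K b + 3 / 2 * slope K b
     \<and> (slope K a - 1) * (1 - icept K b) < (slope K b - 1) * (1 - icept K a)"

text \<open>The line \<open>a\<close> meets the horizontal axis at \<open>- 1 / s\<close> and
  \<open>b\<close> at \<open>- 1 / t\<close>, and further right means lower. The bound
  \<open>1 / 3\<close> keeps both crossings to the right of the tip at \<open>- 3\<close>.\<close>

lemma below_wD:
  assumes "0 < icept K a" "0 < icept K b" "slope K a = icept K a * s" "slope K b = icept K b * t" "1 / 3 < t" "t < s"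
  shows "below K wD a b"
proof -
  have "icept K a * 1 < icept K a * (3 * s)" "icept K b * 1 < icept K b * (3 * t)" using assms by (intro mult_strict_left_mono; simp)+
  moreover have "(icept K a * icept K b) * t < (icept K a * icept K b) * s" using assms by (intro mult_strict_left_mono) auto
  ultimately show ?thesis unfolding below.simps assms(3,4) by (simp add: ac_simps)
qed

lemma below_step:
  assumes "(a, b, w) \<in> step_certs i" "i \<le> K"
  shows "below K w a b"
proof -
  have st: "819200 \<le> steep K" "1600 * xval i \<le> steep K" using steep_ge(1) [OF assms(2)] steep_ge(2) by auto
  have C: "below K wD lS (lC i)"
    by (rule below_wD [where s = "steep K / 2" and t = "1 + xval i"]) (use icept_lC [of K i] slope_lC(1) [of K i] xval_ge [of i] st in auto)
  have CP: "below K wW (lC i) lP"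
  proof -
    have "(slope K (lC i) - 1) * (3 / 4) < (steep K - 1) * (3 / 4)"
      using slope_lC(3) [OF assms(2)] st by simp
    also have "\<dots> \<le> (steep K - 1) * (1 - icept K (lC i))" using icept_lC [of K i] st by (intro mult_left_mono) auto
    finally show ?thesis using icept_lC [of K i] slope_lC(2) [of K i] st by simp
  qed
  show ?thesis
  proof (cases i)
    case 0
    have "below K w a b \<or> (a, b, w) = (lS, lC i, wD) \<or> (a, b, w) = (lC i, lP, wW)"
      using assms(1) st unfolding 0 step_certs_def prev_line_def unit_line_def step_wall_def by (auto simp: icept.simps slope.simps)
    then show ?thesis using C CP by auto
  next
    case (Suc j)
    define x where "x = xval j"
    have x: "512 \<le> x" unfolding x_def by (rule xval_ge)
    have A: "icept K (lA i) = 8 / 9" "slope K (lA i) = 8 / 9 * (1 + 2 * x)" by (auto simp: Suc x_def icept.simps slope.simps)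
    have A': "slope K (lA i) = icept K (lA i) * (1 + 2 * x)" "0 < icept K (lA i)" unfolding A by auto
    note B = lB_Suc [of K j, folded x_def Suc]
    note Cj = icept_lC [of K j] slope_lC(1) [of K j, folded x_def]
    have jK: "1600 * x \<le> steep K" using steep_ge(1) [of j K] assms(2) Suc by (simp add: x_def)
    have 1: "below K wD (lA i) (lC j)" by (rule below_wD [where s = "1 + 2 * x" and t = "1 + x"]) (use A' Cj x in auto)
    have 2: "below K wD (lB i) (lC j)" by (rule below_wD [where s = "1 + 2 * x" and t = "1 + x"]) (use B Cj x in auto)
    have 3: "below K wN lE2 (lA i)" using A by simp
    have 4: "below K wN (lC i) (lB i)" using B by simp
    have 5: "below K wW (lB i) lE2" using B unfolding below.simps B(3) by simp
    \<comment> \<open>After clearing denominators the decisive comparison is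
      \<open>32 * x^2 < 64 * x^2\<close>; this is what the factor 64 in \<open>xval\<close> is
      for.\<close>
    have 6: "below K wW (lA i) (lC i)"
    proof -
      have c: "icept K (lC i) = 1 / (1 + 2 * x)" "slope K (lC i) = (1 + 64 * x\<^sup>2) / (1 + 2 * x)" by (auto simp: Suc x_def icept.simps slope.simps)
      have "2 * x < 32 * x\<^sup>2" using x by (simp add: power2_eq_square)
      then have "(8 / 9 * (1 + 2 * x) - 1) * (1 - 1 / (1 + 2 * x)) < ((1 + 64 * x\<^sup>2) / (1 + 2 * x) - 1) * (1 - 8 / 9)"
        using x by (auto simp: field_simps power2_eq_square intro!: add_pos_pos mult_pos_pos)
      then have "(slope K (lA i) - 1) * (1 - icept K (lC i)) < (slope K (lC i) - 1) * (1 - icept K (lA i))" unfolding A c .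
      moreover have "icept K (lA i) < 1" "5 / 2 < icept K (lA i) + 3 / 2 * slope K (lA i)" using A x by simp_all
      moreover have "icept K (lC i) < 1" "5 / 2 < icept K (lC i) + 3 / 2 * slope K (lC i)"
        using icept_lC [of K i] slope_lC(2) [of K i] by linarith+
      ultimately show ?thesis unfolding below.simps by blast
    qed
    have 7: "below K wD lS (lA i)" by (rule below_wD [where s = "steep K / 2" and t = "1 + 2 * x"]) (use A' x jK in auto)
    have 8: "below K wD lS (lB i)" by (rule below_wD [where s = "steep K / 2" and t = "1 + 2 * x"]) (use B x jK in auto)
    show ?thesis
    proof -
      have "(a, b, w) \<in> {(lA i, lC j, wD), (lB i, lC j, wD), (lE2, lA i, wN), (lC i, lB i, wN), (lB i, lE2, wW), (lA i, lC i, wW),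
          (lS, lA i, wD), (lS, lB i, wD), (lS, lC i, wD), (lC i, lP, wW)}"
        using assms(1) by (simp add: step_certs_def prev_line_def unit_line_def step_wall_def Suc)
      then show ?thesis unfolding insert_iff empty_iff prod.inject
        by - (elim disjE conjE FalseE; hypsubst; rule 1 2 3 4 5 6 7 8 C CP)
    qed
  qed
qed

lemma below_certs:
  assumes "(a, b, w) \<in> certs K"
  shows "below K w a b"
proof -
  have st: "819200 \<le> steep K" by (rule steep_ge)
  have 1: "below K wD lS lE" "below K wD lS lE2" "below K wN lR lS" "below K wN lP lF" "below K wD lP lF" "below K wW lE2 lP"
    using st by auto
  note C = icept_lC [of K K] slope_lC(2) [of K K] slope_lC(3) [OF order_refl, of K]
  have 2: "below K wW (lC K) lG"
  proof -
    have "(slope K (lC K) - 1) * (1 - (icept K (lC K) + 1 / 4)) < (slope K (lC K) - 1) * (1 - icept K (lC K))"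
      using C by (intro mult_strict_left_mono) auto
    then show ?thesis unfolding below.simps lG_eq using C by linarith
  qed
  have 3: "below K wW lG lP"
  proof -
    have "(slope K (lC K) - 1) * (3 / 4) < (steep K - 1) * (1 / 2)" using C st by simp
    also have "\<dots> \<le> (steep K - 1) * (1 - (icept K (lC K) + 1 / 4))" using C st by (intro mult_left_mono) auto
    finally show ?thesis unfolding below.simps lG_eq using C st by simp
  qed
  have 4: "below K w a b"
    if "(a, b, w) \<in> {(lS, lE, wD), (lS, lE2, wD), (lR, lS, wN), (lP, lF, wN), (lP, lF, wD), (lE2, lP, wW), (lC K, lG, wW), (lG, lP, wW)}"
    using that unfolding insert_iff empty_iff prod.inject by - (elim disjE conjE FalseE; hypsubst; rule 1 2 3)
  show ?thesis using assms unfolding certs_def by (elim UnE UN_E) (rule below_step, assumption, simp, rule 4)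
qed

text \<open>The last inequality is the order of \<open>para K a w\<close> and
  \<open>para K b w\<close> with denominators cleared; on each wall it is \<open>below\<close> up to
  the factor \<open>eps K * eps K\<close>.\<close>

lemma heights:
  assumes "(a, b, w) \<in> certs K"
  shows "0 < height K a (foot K w)" "height K a (tip K w) < 0" "0 < height K b (foot K w)" "height K b (tip K w) < 0"
    "height K b (foot K w) * height K a (tip K w) < height K a (foot K w) * height K b (tip K w)"
proof -
  have l: "0 < icept K a" "0 < slope K a" "0 < icept K b" "0 < slope K b" using line_bounds certs_lines [OF assms] by auto
  have bl: "below K w a b" by (rule below_certs [OF assms])
  define e where "e = eps K"
  have e: "e > 0" unfolding e_def by (rule eps_pos)
  have edge: "(3 / 2 * x - z) * y < (3 / 2 * u - y) * z" if "x * y < u * z" for x y z u :: real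
    using that by (simp add: algebra_simps)
  have sym: "x * (c - y) < y * (c - x)" if "x < y" "0 < c" for x y c :: real using that by (simp add: algebra_simps)
  obtain p q r s where h: "height K a (foot K w) = e * p" "height K a (tip K w) = - (e * q)" "height K b (foot K w) = e * r" "height K b (tip K w) = - (e * s)"
    and pq: "p > 0" "q > 0" "r > 0" "s > 0" "p * s < r * q"
  proof (cases w)
  case wD
    show ?thesis
    proof (rule that [of "icept K a + slope K a / 10" "3 * slope K a - icept K a" "icept K b + slope K b / 10" "3 * slope K b - icept K b"])
      show "(icept K a + slope K a / 10) * (3 * slope K b - icept K b) < (icept K b + slope K b / 10) * (3 * slope K a - icept K a)" using bl by (simp add: wD algebra_simps)
    qed (use bl l in \<open>simp_all add: wD height_def e_def algebra_simps\<close>)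
  next
  case wN
    show ?thesis
    proof (rule that [of "icept K a" "10 - icept K a" "icept K b" "10 - icept K b"])
      show "(icept K a) * (10 - icept K b) < (icept K b) * (10 - icept K a)" by (rule sym) (use bl in \<open>auto simp: wN\<close>)
    qed (use bl l in \<open>simp_all add: wN height_def e_def algebra_simps\<close>)
  next
  case wM
    show ?thesis
    proof (rule that [of "icept K a + slope K a" "200 - (icept K a + slope K a)" "icept K b + slope K b" "200 - (icept K b + slope K b)"])
      show "(icept K a + slope K a) * (200 - (icept K b + slope K b)) < (icept K b + slope K b) * (200 - (icept K a + slope K a))" by (rule sym) (use bl in \<open>auto simp: wM\<close>)
    qed (use bl l in \<open>simp_all add: wM height_def e_def algebra_simps\<close>)
  next
  case wW
    show ?thesis
    proof (rule that [of "icept K a + 3 / 2 * slope K a - 5 / 2" "1 - icept K a" "icept K b + 3 / 2 * slope K b - 5 / 2" "1 - icept K b"])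
      show "(icept K a + 3 / 2 * slope K a - 5 / 2) * (1 - icept K b) < (icept K b + 3 / 2 * slope K b - 5 / 2) * (1 - icept K a)"
      proof -
        have e: "icept K l + 3 / 2 * slope K l - 5 / 2 = 3 / 2 * (slope K l - 1) - (1 - icept K l)" for l by (simp add: field_simps)
        show ?thesis unfolding e by (rule edge) (use bl in \<open>simp add: wW\<close>)
      qed
    qed (use bl l in \<open>simp_all add: wW height_def e_def algebra_simps\<close>)
  qed
  have "(e * e) * (p * s) < (e * e) * (r * q)" using e pq by (intro mult_strict_left_mono) auto
  then show "height K b (foot K w) * height K a (tip K w) < height K a (foot K w) * height K b (tip K w)" unfolding h by (simp add: ac_simps)
  show "0 < height K a (foot K w)" "height K a (tip K w) < 0" "0 < height K b (foot K w)" "height K b (tip K w) < 0"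
    unfolding h using e pq by auto
qed

lemma para_bounds:
  assumes "(a, b, w) \<in> certs K"
  shows "0 < para K a w" "para K a w < para K b w" "para K b w < 1"
proof -
  have "0 < x / (x + y) \<and> x / (x + y) < u / (u + v) \<and> u / (u + v) < 1" if "0 < x" "0 < y" "0 < u" "0 < v" "x * v < u * y" for x y u v :: real
  proof -
    have "x * (u + v) < u * (x + y)" using that by (simp add: algebra_simps)
    then show ?thesis using that by (simp add: divide_simps)
  qed
  from this [of "height K a (foot K w)" "- height K a (tip K w)" "height K b (foot K w)" "- height K b (tip K w)"] heights [OF assms]
  show "0 < para K a w" "para K a w < para K b w" "para K b w < 1" by (auto simp: para_def)
qed

lemma height_spot: "height K l (spot K w t) = (1 - t) * height K l (foot K w) + t * height K l (tip K w)"
  by (simp add: height_def spot_def algebra_simps)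

lemma height_spot_sign:
  assumes "0 < height K l (foot K w)" "height K l (tip K w) < 0"
  shows "t < para K l w \<Longrightarrow> 0 < height K l (spot K w t)" "para K l w < t \<Longrightarrow> height K l (spot K w t) < 0"
proof -
  define D where "D = height K l (foot K w) - height K l (tip K w)"
  have D: "D > 0" "para K l w * D = height K l (foot K w)" using assms by (auto simp: D_def para_def)
  have e: "height K l (spot K w t) = (para K l w - t) * D" unfolding height_spot left_diff_distrib D(2) by (simp add: D_def algebra_simps)
  show "t < para K l w \<Longrightarrow> 0 < height K l (spot K w t)" "para K l w < t \<Longrightarrow> height K l (spot K w t) < 0"
    unfolding e using D(1) by (auto simp: mult_pos_pos mult_neg_pos)
qed

lemma height_line:
  assumes "z \<in> draw K (Lin l)" shows "height K l z = 0"
  using segment_functional(2) [of z "fst (ends K (Lin l))" "snd (ends K (Lin l))" "- eps K * slope K l" 1 "eps K * icept K l"]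
    segment_functional(2) [of z "fst (ends K (Lin l))" "snd (ends K (Lin l))" "eps K * slope K l" "- 1" "- (eps K * icept K l)"] assms
  by (simp add: draw_def height_def algebra_simps)

lemma avoids_line:
  assumes "height K l (fst (ends K x)) < 0 \<and> height K l (snd (ends K x)) < 0 \<or> 0 < height K l (fst (ends K x)) \<and> 0 < height K l (snd (ends K x))"
  shows "\<not> dhit K x (Lin l)"
proof -
  let ?p = "fst (ends K x)" and ?q = "snd (ends K x)"
  have n: "height K l z < 0" if "z \<in> closed_segment ?p ?q" "height K l ?p < 0" "height K l ?q < 0" for z
    using segment_functional(1) [OF that(1), of "eps K * slope K l" "- 1" "- (eps K * icept K l)"] that(2,3)
    by (simp add: height_def algebra_simps)
  have p: "0 < height K l z" if "z \<in> closed_segment ?p ?q" "0 < height K l ?p" "0 < height K l ?q" for z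
    using segment_functional(1) [OF that(1), of "- eps K * slope K l" 1 "eps K * icept K l"] that(2,3)
    by (simp add: height_def algebra_simps)
  show ?thesis
  proof
    assume "dhit K x (Lin l)"
    then obtain z where "z \<in> closed_segment ?p ?q" "height K l z = 0"
      using height_line unfolding dhit_def draw_def [of K x] by blast
    then show False using assms n [of z] p [of z] by auto
  qed
qed

section \<open>Incidences of lines, walls and certificates in the drawing\<close>

lemma dhit_point: "z \<in> draw K x \<Longrightarrow> z \<in> draw K y \<Longrightarrow> dhit K x y"
  by (auto simp: dhit_def)

lemma draw_ends [simp]: "fst (ends K x) \<in> draw K x" "snd (ends K x) \<in> draw K x"
  by (auto simp: draw_def)

lemma convex_draw: "convex (draw K x)" by (simp add: draw_def)

lemma on_line: "- 6 \<le> t \<Longrightarrow> t \<le> 5 \<Longrightarrow> (t, eps K * icept K l + eps K * slope K l * t) \<in> draw K (Lin l)"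
  unfolding draw_def using in_graph [of "- 6" t 5 "eps K * icept K l" "eps K * slope K l"] by simp

lemma on_wall:
  "- 3 \<le> t \<Longrightarrow> t \<le> 1 / 10 \<Longrightarrow> (t, 0) \<in> draw K (Wl wD)"
  "\<bar>t\<bar> \<le> 1 \<Longrightarrow> (0, t) \<in> draw K (Wl wN)"
  "\<bar>t\<bar> \<le> 1 \<Longrightarrow> (1, t) \<in> draw K (Wl wM)"
  "- 1 \<le> t \<Longrightarrow> t \<le> 3 / 2 \<Longrightarrow> (t, eps K + eps K * t) \<in> draw K (Wl wW)"
  using in_horizontal [of "- 3" t "1 / 10" 0] in_vertical [of "- 1" t 1 0] in_vertical [of "- 1" t 1 1] in_graph [of "- 1" t "3 / 2" "eps K" "eps K"]
  by (simp_all add: draw_def abs_le_iff)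

lemma touch_on_wall: "foot K w \<in> draw K (Wl w)" "tip K w \<in> draw K (Wl w)"
proof -
  have e: "0 < eps K" "eps K \<le> 1 / 81920000" using eps_pos by auto
  show "foot K w \<in> draw K (Wl w)"
    using on_wall(1) [of "1 / 10" K] on_wall(2) [of 0 K] on_wall(3) [of 0 K] on_wall(4) [of "3 / 2" K] by (cases w) simp_all
  show "tip K w \<in> draw K (Wl w)"
    using on_wall(1) [of "- 3" K] on_wall(2) [of "10 * eps K" K] on_wall(3) [of "200 * eps K" K] on_wall(4) [of 0 K] e by (cases w) simp_all
qed

lemma spot_on_wall: "0 \<le> t \<Longrightarrow> t \<le> 1 \<Longrightarrow> spot K w t \<in> draw K (Wl w)"
  unfolding spot_def by (rule convexD_alt [OF convex_draw touch_on_wall])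

lemma spot_between: "spot K w ((s + t) / 2) \<in> closed_segment (spot K w s) (spot K w t)"
proof -
  have "spot K w ((s + t) / 2) = (1 - 1 / 2) *\<^sub>R spot K w s + (1 / 2) *\<^sub>R spot K w t"
    by (simp add: spot_def prod_eq_iff field_simps)
  moreover have "0 \<le> (1 / 2 :: real)" "(1 / 2 :: real) \<le> 1" by auto
  ultimately show ?thesis unfolding in_segment by blast
qed

lemma touch_ends: "tip K w \<in> draw K (Tp w)" "foot K w \<in> draw K (Bt w)" "tip K w \<in> draw K (Us a b w)" "foot K w \<in> draw K (Ds a b w)"
  using draw_ends [of K "Tp w"] draw_ends [of K "Bt w"] draw_ends [of K "Us a b w"] draw_ends [of K "Ds a b w"] by auto

lemma certs_dhit:
  assumes c: "(a, b, w) \<in> certs K"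
  shows "dhit K (Qs a b w) (Wl w) \<and> dhit K (Us a b w) (Wl w) \<and> dhit K (Ds a b w) (Wl w)
        \<and> dhit K (Qs a b w) (Us a b w) \<and> dhit K (Qs a b w) (Ds a b w) \<and> dhit K (Us a b w) (Tp w) \<and> dhit K (Ds a b w) (Bt w)"
proof -
  let ?s = "para K a w" and ?t = "para K b w"
  note p = para_bounds [OF c]
  have m: "((2 * ?s + ?t) / 3 + (?s + 2 * ?t) / 3) / 2 = (?s + ?t) / 2" by (simp add: field_simps)
  have mid: "spot K w ((?s + ?t) / 2) \<in> draw K (Qs a b w)" "spot K w ((?s + ?t) / 2) \<in> draw K (Us a b w)" "spot K w ((?s + ?t) / 2) \<in> draw K (Ds a b w)"
    using spot_between [of K w "(2 * ?s + ?t) / 3" "(?s + 2 * ?t) / 3"] unfolding m draw_def by simp_all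
  have w: "spot K w ((?s + ?t) / 2) \<in> draw K (Wl w)" using p by (intro spot_on_wall) auto
  show ?thesis using dhit_point [OF mid(1) w] dhit_point [OF mid(1,2)] dhit_point [OF mid(1,3)] dhit_point [OF mid(2) w] dhit_point [OF mid(3) w]
      dhit_point [OF touch_ends(3,1)] dhit_point [OF touch_ends(4,2)] by blast
qed

lemma certs_not_dhit:
  assumes c: "(a, b, w) \<in> certs K"
  shows "\<not> dhit K (Qs a b w) (Lin a) \<and> \<not> dhit K (Qs a b w) (Lin b) \<and> \<not> dhit K (Us a b w) (Lin a) \<and> \<not> dhit K (Ds a b w) (Lin b) \<and>
       \<not> dhit K (Tp w) (Lin a) \<and> \<not> dhit K (Bt w) (Lin a) \<and> \<not> dhit K (Tp w) (Lin b) \<and> \<not> dhit K (Bt w) (Lin b)"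
proof -
  note p = para_bounds [OF c] and h = heights [OF c]
  note sa = height_spot_sign [OF h(1,2)] and sb = height_spot_sign [OF h(3,4)]
  have t: "snd (tip K w) \<le> 1" "- 1 \<le> snd (foot K w)" using eps_pos(1,3) [of K] by (cases w; simp)+
  have "height K l (fst (tip K w), 1) \<le> height K l (tip K w)" "height K l (foot K w) \<le> height K l (fst (foot K w), - 1)" for l
    using t by (auto simp: height_def)
  note ht = le_less_trans [OF this(1)] less_le_trans [OF _ this(2)]
  show ?thesis
    by (intro conjI avoids_line) (use p h(1-4) in \<open>simp_all add: sa sb ht\<close>)
qed

text \<open>The core is drawn in a box that the frame, the bars and the far part avoid.\<close>

definition in_box :: "real \<times> real \<Rightarrow> bool" where
  "in_box z \<longleftrightarrow> - 3 \<le> fst z \<and> fst z \<le> 3 / 2 \<and> - 1 \<le> snd z \<and> snd z \<le> 1"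

lemma touch_in_box: "in_box (foot K w)" "in_box (tip K w)"
  using eps_pos(1,3) [of K] by (cases w; simp add: in_box_def)+

lemma spot_in_box:
  assumes "0 \<le> t" "t \<le> 1"
  shows "in_box (spot K w t)"
proof -
  have "spot K w t \<in> closed_segment (foot K w) (tip K w)" using assms unfolding spot_def in_segment by blast
  note z = segment_functional(2) [OF this]
  show ?thesis using z [of 1 0 "3 / 2"] z [of "- 1" 0 3] z [of 0 1 1] z [of 0 "- 1" 1] touch_in_box [of K w]
    unfolding in_box_def by simp
qed

lemma core_in_box:
  assumes "x \<in> core K"
  shows "in_box (fst (ends K x)) \<and> in_box (snd (ends K x))"
proof -
  consider w where "x = Wl w" | w where "x = Tp w" | w where "x = Bt w" | "x = Chi"
    | a b w where "(a, b, w) \<in> certs K" "x = Qs a b w \<or> x = Us a b w \<or> x = Ds a b w"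
    using assms unfolding core_def by blast
  then show ?thesis
  proof cases
    case (1 w)
    then show ?thesis using eps_pos(1,3) [of K] by (cases w) (simp_all add: in_box_def)
  next
    case (5 a b w)
    then show ?thesis using para_bounds [OF 5(1)] touch_in_box spot_in_box by auto
  qed (use touch_in_box [of K] eps_pos(1,3) [of K] in \<open>auto simp: in_box_def\<close>)
qed

text \<open>The half-plane \<open>a x + b y < c\<close> contains the box: the first alternative uses
  \<open>\<bar>x\<bar> \<le> 3\<close>, the second the sharper \<open>x \<le> 3 / 2\<close> for
  \<open>a \<ge> 0\<close>.\<close>

lemma box_misses:
  assumes x: "x \<in> core K" and ab: "3 * \<bar>a\<bar> + \<bar>b\<bar> < c \<or> a \<ge> 0 \<and> 3 / 2 * a + \<bar>b\<bar> < c"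
    and y: "c \<le> a * fst (fst (ends K y)) + b * snd (fst (ends K y))" "c \<le> a * fst (snd (ends K y)) + b * snd (snd (ends K y))"
  shows "\<not> dhit K x y"
proof -
  have "a * fst z + b * snd z < c" if z: "in_box z" for z
  proof -
    have "\<bar>b * snd z\<bar> \<le> \<bar>b\<bar> * 1" unfolding abs_mult using z by (intro mult_left_mono) (auto simp: in_box_def)
    moreover have "\<bar>a * fst z\<bar> \<le> \<bar>a\<bar> * 3" unfolding abs_mult using z by (intro mult_left_mono) (auto simp: in_box_def)
    moreover have "a * fst z \<le> a * (3 / 2)" if "a \<ge> 0" using z that by (intro mult_left_mono) (auto simp: in_box_def)
    ultimately show ?thesis using ab by argo
  qed
  then have "draw K x \<inter> draw K y = {}" unfolding draw_def using core_in_box [OF x] y by (intro segments_separated [where a = a and b = b and c = c]) auto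
  then show ?thesis by (simp add: dhit_def)
qed

lemma core_not_dhit:
  assumes x: "x \<in> core K"
  shows "j < 3 \<Longrightarrow> \<not> dhit K x (Frm j)" "j < 3 \<Longrightarrow> \<not> dhit K x (Bar j)" "y \<in> far \<Longrightarrow> \<not> dhit K x y" "j < 3 \<Longrightarrow> \<not> dhit K x (Tb j)"
proof -
  show "\<not> dhit K x y" if "y \<in> far"
    by (rule box_misses [OF x, where a = 1 and b = 0 and c = 4]) (use that in \<open>auto simp: far_def\<close>)
  show "\<not> dhit K x (Tb j)" if "j < 3"
    by (rule box_misses [OF x, where a = 1 and b = 0 and c = 3]) (use less_3_cases [THEN iffD1, OF that] in \<open>auto simp: pt3_def\<close>)
  have "\<not> dhit K x (Frm 0)" by (rule box_misses [OF x, where a = "- 1" and b = 1 and c = 5]) (auto simp: pt3_def)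
  moreover have "\<not> dhit K x (Frm 1)" by (rule box_misses [OF x, where a = 1 and b = 0 and c = 4]) (auto simp: pt3_def)
  moreover have "\<not> dhit K x (Frm 2)" by (rule box_misses [OF x, where a = "- 1" and b = "- 1" and c = 5]) (auto simp: pt3_def)
  ultimately show "\<not> dhit K x (Frm j)" if "j < 3" using less_3_cases [THEN iffD1, OF that] by auto
  show "\<not> dhit K x (Bar j)" if "j < 3"
    by (rule box_misses [OF x, where a = 1 and b = 0 and c = 3]) (use less_3_cases [THEN iffD1, OF that] in \<open>auto simp: pt3_def\<close>)
qed

lemma line_flat:
  assumes "l \<in> lines K"
  shows "\<bar>eps K * icept K l + eps K * slope K l * (- 6)\<bar> < 1 / 10" "\<bar>eps K * icept K l + eps K * slope K l * 5\<bar> < 1 / 10"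
    "\<bar>eps K * icept K l + eps K * slope K l * 1\<bar> < 1 / 10" "0 < eps K * icept K l" "eps K * icept K l < 1 / 1000"
proof -
  note l = line_bounds [OF assms]
  have "eps K * icept K l \<le> eps K * 8" "eps K * slope K l \<le> eps K * steep K" using l eps_pos(1) by (intro mult_left_mono; simp add: less_imp_le)+
  moreover have "0 < eps K * slope K l" and p: "0 < eps K * icept K l" using l eps_pos(1) by simp_all
  ultimately have "eps K * icept K l \<le> 8 / 81920000" "0 < eps K * icept K l" "0 < eps K * slope K l" "eps K * slope K l \<le> 1 / 100"
    using eps_pos(2,3) [of K] by auto
  then show "\<bar>eps K * icept K l + eps K * slope K l * (- 6)\<bar> < 1 / 10" "\<bar>eps K * icept K l + eps K * slope K l * 5\<bar> < 1 / 10"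
    "\<bar>eps K * icept K l + eps K * slope K l * 1\<bar> < 1 / 10" "0 < eps K * icept K l" "eps K * icept K l < 1 / 1000" by linarith+
qed

lemma line_dhit_frame:
  assumes l: "l \<in> lines K" and j: "j < 3"
  shows "dhit K (Lin l) (Frm j)"
proof -
  define u v where "u = eps K * icept K l + eps K * slope K l * (- 6)" and "v = eps K * icept K l + eps K * slope K l * 5"
  have uv: "\<bar>u\<bar> < 1 / 10" "\<bar>v\<bar> < 1 / 10" unfolding u_def v_def by (rule line_flat [OF l])+
  have e: "ends K (Lin l) = ((- 6, u), (5, v))" by (simp add: u_def v_def)
  have uv: "u < 1 / 10" "v < 1 / 10" "- (1 / 10) < u" "- (1 / 10) < v" using uv by auto
  consider "j = 0" | "j = 1" | "j = 2" using less_3_cases [THEN iffD1, OF j] by blast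
  then show ?thesis
  proof cases
    case 1
    show ?thesis unfolding 1 by (rule dhit_meet [OF mult_nonpos_nonneg mult_nonneg_nonpos less_imp_neq]) (use uv in \<open>auto simp: e orient_def pt3_def field_simps simp del: ends.simps(5)\<close>)
  next
    case 2
    show ?thesis unfolding 2 by (rule dhit_meet [OF mult_nonpos_nonneg mult_nonneg_nonpos less_imp_neq]) (use uv in \<open>auto simp: e orient_def pt3_def field_simps simp del: ends.simps(5)\<close>)
  next
    case 3
    show ?thesis unfolding 3 by (rule dhit_meet [OF mult_nonneg_nonpos mult_nonpos_nonneg less_imp_neq [THEN not_sym]]) (use uv in \<open>auto simp: e orient_def pt3_def field_simps simp del: ends.simps(5)\<close>)
  qed
qed

lemma line_not_dhit:
  assumes l: "l \<in> lines K"
  shows "\<not> dhit K (Lin l) Lup" "\<not> dhit K (Lin l) Llo"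
proof -
  define u v where "u = eps K * icept K l + eps K * slope K l * (- 6)" and "v = eps K * icept K l + eps K * slope K l * 5"
  have uv: "\<bar>u\<bar> < 1 / 10" "\<bar>v\<bar> < 1 / 10" unfolding u_def v_def by (rule line_flat [OF l])+
  have e: "ends K (Lin l) = ((- 6, u), (5, v))" by (simp add: u_def v_def)
  have "draw K (Lin l) \<inter> draw K Lup = {}" unfolding draw_def
    by (rule segments_separated [where a = 0 and b = 1 and c = "1 / 2"]) (use uv in \<open>auto simp: e simp del: ends.simps(5)\<close>)
  then show "\<not> dhit K (Lin l) Lup" by (simp add: dhit_def)
  have "draw K (Lin l) \<inter> draw K Llo = {}" unfolding draw_def
    by (rule segments_separated [where a = 0 and b = "- 1" and c = "1 / 2"]) (use uv in \<open>auto simp: e simp del: ends.simps(5)\<close>)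
  then show "\<not> dhit K (Lin l) Llo" by (simp add: dhit_def)
qed

lemma line_dhit_wall:
  assumes l: "l \<in> lines K"
  shows "dhit K (Lin l) (Wl wN)" "l \<noteq> lR \<Longrightarrow> dhit K (Lin l) (Wl wD)" "dhit K (Wl wM) (Lin l)"
proof -
  show "dhit K (Lin l) (Wl wN)"
    using dhit_point [of "(0, eps K * icept K l)"] on_line [of 0 K l] on_wall(2) [of "eps K * icept K l" K] line_flat(4,5) [OF l] by simp
  show "dhit K (Wl wM) (Lin l)"
    using dhit_point [of "(1, eps K * icept K l + eps K * slope K l)"] on_wall(3) [of "eps K * icept K l + eps K * slope K l" K] on_line [of 1 K l]
      line_flat(3) [OF l] by simp
  show "dhit K (Lin l) (Wl wD)" if "l \<noteq> lR"
  proof -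
    note b = line_bounds [OF l]
    define t where "t = - icept K l / slope K l"
    have t: "- 3 \<le> t" "t \<le> 0" using b that by (auto simp: t_def divide_simps)
    have "icept K l + slope K l * t = 0" using b by (simp add: t_def)
    then have "eps K * icept K l + eps K * slope K l * t = 0" by (metis distrib_left mult.assoc mult_zero_right)
    then show ?thesis using dhit_point [of "(t, 0)"] on_line [of t K l] on_wall(1) [of t K] t by simp
  qed
qed

lemma ends_dhit:
  "dhit K (Tp w) (Wl w)" "dhit K (Bt w) (Wl w)" "dhit K (Tp w) Lup" "dhit K (Bt w) Llo" "\<not> dhit K (Tp w) Llo" "\<not> dhit K (Bt w) Lup"
proof -
  show "dhit K (Tp w) (Wl w)" "dhit K (Bt w) (Wl w)" by (rule dhit_point [OF touch_ends(1) touch_on_wall(2)] dhit_point [OF touch_ends(2) touch_on_wall(1)])+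
  have f: "- 6 \<le> fst (tip K w)" "fst (tip K w) \<le> 7" "- 6 \<le> fst (foot K w)" "fst (foot K w) \<le> 7" "- 1 < snd (tip K w)" "snd (foot K w) < 1"
    using eps_pos(1,3) [of K] by (cases w; simp)+
  have "(fst (tip K w), 1) \<in> draw K Lup" "(fst (foot K w), - 1) \<in> draw K Llo" using f by (auto simp: draw_def intro!: in_horizontal)
  moreover have "(fst (tip K w), 1) \<in> draw K (Tp w)" "(fst (foot K w), - 1) \<in> draw K (Bt w)" by (auto simp: draw_def)
  ultimately show "dhit K (Tp w) Lup" "dhit K (Bt w) Llo" by (auto intro: dhit_point)
  show "\<not> dhit K (Tp w) Llo" "\<not> dhit K (Bt w) Lup" using f by - (rule not_dhit; simp add: Let_def)+
qed

lemma pins_dhit: "dhit K (Tp wD) (Lin lR)" "dhit K (Bt wW) (Lin lR)"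
proof -
  have e: "0 < eps K" "eps K \<le> 1 / 81920000" using eps_pos by auto
  have "(- 3, eps K * icept K lR + eps K * slope K lR * (- 3)) \<in> draw K (Tp wD)"
    unfolding draw_def ends.simps tip.simps fst_conv snd_conv using e by (intro in_vertical) simp_all
  then show "dhit K (Tp wD) (Lin lR)" using on_line [of "- 3" K lR] by (intro dhit_point) auto
  have "(3 / 2, eps K * icept K lR + eps K * slope K lR * (3 / 2)) \<in> draw K (Bt wW)"
    unfolding draw_def ends.simps foot.simps fst_conv snd_conv using e by (intro in_vertical) simp_all
  then show "dhit K (Bt wW) (Lin lR)" using on_line [of "3 / 2" K lR] by (intro dhit_point) auto
qed

lemma pins_not_dhit:
  "\<not> dhit K (Wl wD) (Lin lR)" "\<not> dhit K (Bt wD) (Lin lR)" "\<not> dhit K (Wl wW) (Lin lE)" "\<not> dhit K (Bt wW) (Lin lE)"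
  "\<not> dhit K (Wl wW) (Lin lF)" "\<not> dhit K (Tp wW) (Lin lF)" "\<not> dhit K (Bt wW) (Lin (lA 0))" "\<not> dhit K Chi (Lin lE2)"
  "\<not> dhit K (Lin lG) (Lin (lC K))"
proof -
  have e: "0 < eps K" "eps K \<le> 1 / 81920000" using eps_pos by auto
  show "\<not> dhit K (Wl wD) (Lin lR)" "\<not> dhit K (Bt wD) (Lin lR)" "\<not> dhit K (Wl wW) (Lin lE)" "\<not> dhit K (Bt wW) (Lin lE)"
    "\<not> dhit K (Wl wW) (Lin lF)" "\<not> dhit K (Tp wW) (Lin lF)" "\<not> dhit K (Bt wW) (Lin (lA 0))" "\<not> dhit K Chi (Lin lE2)"
    "\<not> dhit K (Lin lG) (Lin (lC K))"
    by (rule avoids_line; use e in \<open>simp add: height_def algebra_simps lG_eq icept.simps(7) slope.simps(7)\<close>)+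
qed

lemma chi_walls:
  "dhit K Chi (Wl wM)" "dhit K Chi (Wl wW)" "dhit K Chi (Bt wW)" "\<not> dhit K Chi (Wl wN)" "\<not> dhit K Chi Lup" "\<not> dhit K Chi Llo"
  "dhit K (Wl wW) (Wl wN)" "dhit K (Wl wD) (Wl wW)" "\<not> dhit K (Wl wW) Lup" "\<not> dhit K (Wl wW) Llo"
proof -
  have e: "0 < eps K" "eps K \<le> 1 / 81920000" using eps_pos by auto
  have c: "(1, 2 * eps K) \<in> draw K Chi" "(3 / 2, 5 / 2 * eps K) \<in> draw K Chi" by (auto simp: draw_def)
  show "dhit K Chi (Wl wM)" using dhit_point [OF c(1) on_wall(3)] e by simp
  show "dhit K Chi (Wl wW)" "dhit K Chi (Bt wW)" using dhit_point [OF c(2)] touch_on_wall(1) [of K wW] touch_ends(2) [of K wW] by auto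
  show "dhit K (Wl wW) (Wl wN)" using dhit_point [of "(0, eps K)"] on_wall(4) [of 0 K] on_wall(2) [of "eps K" K] e by simp
  show "dhit K (Wl wD) (Wl wW)" using dhit_point [OF on_wall(1) [of "- 1" K] , of "Wl wW"] on_wall(4) [of "- 1" K] by simp
  show "\<not> dhit K Chi (Wl wN)" "\<not> dhit K Chi Lup" "\<not> dhit K Chi Llo" "\<not> dhit K (Wl wW) Lup" "\<not> dhit K (Wl wW) Llo"
    using e by - (rule not_dhit; simp add: Let_def)+
qed

theorem gadget_hits_draw: "gadget_hits K (dhit K)"
proof
  show "dhit K (Ta j) (Bar j)" "dhit K (Ta j) (Wl wN)" "dhit K (Tb j) (Bar j)" "dhit K (Tb j) Pole" "dhit K (Bar j) (Frm j)"
    "dhit K Lup (Frm j)" "dhit K Llo (Frm j)" "dhit K Mid (Frm j)" if "j < 3" for j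
    using that skeleton_hits_indexed Tb_Bar by auto
  show "dhit K (Wl wM) (Lin l)" if "l \<in> {lE, lE2, lA 0, lB 0, lC 0}" for l
    using that by (intro line_dhit_wall(3)) (auto simp: lines_def)
qed (rule skeleton_hits_indexed skeleton_misses_indexed far_misses skeleton_misses skeleton_hits Pi_Pole core_not_dhit
   line_dhit_frame line_not_dhit line_dhit_wall ends_dhit certs_dhit certs_not_dhit pins_dhit pins_not_dhit chi_walls; assumption)+

section \<open>Rational realizations of the gadget need many bits\<close>

definition names :: "nat \<Rightarrow> nm set" where
  "names K = Frm ` {..<3} \<union> Bar ` {..<3} \<union> Ta ` {..<3} \<union> Tb ` {..<3} \<union> {Lup, Llo, Mid} \<union> Lin ` lines K \<union> core K \<union> far"

lemma names_iff [simp]: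
  "Frm j \<in> names K \<longleftrightarrow> j < 3" "Bar j \<in> names K \<longleftrightarrow> j < 3" "Ta j \<in> names K \<longleftrightarrow> j < 3" "Tb j \<in> names K \<longleftrightarrow> j < 3"
  "Lup \<in> names K" "Llo \<in> names K" "Mid \<in> names K" "Lin l \<in> names K \<longleftrightarrow> l \<in> lines K" "Wl w \<in> names K" "Tp w \<in> names K" "Bt w \<in> names K"
  "Chi \<in> names K" "Pole \<in> names K" "PiA \<in> names K" "PiB \<in> names K" "PiC \<in> names K" "Kap \<in> names K" "Pad i \<notin> names K"
  by (auto simp: names_def far_def core_def wall.exhaust; (cases w; simp)?)+

lemma names_certs: "(a, b, w) \<in> certs K \<Longrightarrow> Qs a b w \<in> names K \<and> Us a b w \<in> names K \<and> Ds a b w \<in> names K"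
  unfolding names_def core_def by force

lemma names_core: "x \<in> core K \<Longrightarrow> x \<in> names K" by (simp add: names_def)
lemma names_far: "x \<in> far \<Longrightarrow> x \<in> names K" by (simp add: names_def)

lemma core_neq: "x \<in> core K \<Longrightarrow> x \<noteq> Frm j \<and> x \<noteq> Bar j \<and> x \<noteq> Tb j \<and> x \<notin> far"
  by (auto simp: core_def far_def)

lemma far_neq: "x \<in> far \<Longrightarrow> x \<noteq> Frm j \<and> x \<noteq> Bar j \<and> x \<noteq> Ta j"
  by (auto simp: far_def)

lemma special_lines: "lE \<in> lines K" "lE2 \<in> lines K" "lR \<in> lines K" "lF \<in> lines K" "lG \<in> lines K" "lC K \<in> lines K"
    "lA 0 \<in> lines K" "lB 0 \<in> lines K" "lC 0 \<in> lines K"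
  by (auto simp: lines_def)

text \<open>All conditions in \<open>gadget_hits\<close> concern pairs of distinct names from
  \<open>names K\<close>, which is what an isomorphism of intersection graphs controls.\<close>

lemma gadget_hits_cong:
  assumes g: "gadget_hits K h" and e: "\<And>x y. x \<in> names K \<Longrightarrow> y \<in> names K \<Longrightarrow> x \<noteq> y \<Longrightarrow> h' x y = h x y"
  shows "gadget_hits K h'"
proof -
  interpret gadget_hits K h by (rule g)
  show ?thesis
  proof
    fix x y j assume x: "x \<in> core K"
    note n = names_core [OF x] core_neq [OF x]
    show "\<not> h' x (Frm j)" "\<not> h' x (Bar j)" "\<not> h' x (Tb j)" if "j < 3"
      using e [OF n(1)] n(2) core_avoids x that by auto
    show "\<not> h' x y" if "y \<in> far" using e [OF n(1)] n(2) core_avoids x that names_far by metis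
  next
    fix x j assume x: "x \<in> far" and j: "j < (3 :: nat)"
    show "\<not> h' x (Frm j)" "\<not> h' x (Bar j)" using e [OF names_far [OF x]] far_neq [OF x] far_avoids x j by auto
    show "\<not> h' (Ta j) x" using e [OF _ names_far [OF x], of "Ta j"] far_neq [OF x] ticks(8) x j by auto
  next
    fix a b w assume c: "(a, b, w) \<in> certs K"
    note n = names_certs [OF c] certs_lines [OF c]
    show "h' (Qs a b w) (Wl w) \<and> h' (Us a b w) (Wl w) \<and> h' (Ds a b w) (Wl w) \<and> h' (Qs a b w) (Us a b w) \<and> h' (Qs a b w) (Ds a b w)
        \<and> h' (Us a b w) (Tp w) \<and> h' (Ds a b w) (Bt w)"
      using certs_hit [OF c] n by (simp add: e)
    show "\<not> h' (Qs a b w) (Lin a) \<and> \<not> h' (Qs a b w) (Lin b) \<and> \<not> h' (Us a b w) (Lin a) \<and> \<not> h' (Ds a b w) (Lin b) \<and>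
       \<not> h' (Tp w) (Lin a) \<and> \<not> h' (Bt w) (Lin a) \<and> \<not> h' (Tp w) (Lin b) \<and> \<not> h' (Bt w) (Lin b)"
      using certs_avoid [OF c] n by (simp add: e)
  next
    fix l assume "l \<in> {lE, lE2, lA 0, lB 0, lC 0}"
    then show "h' (Wl wM) (Lin l)" using walls(4) [of l] special_lines by (auto simp: e)
  qed (simp_all add: e frames line_frame ticks bars far_hits Ldisj line_L wall_L ends_L pins chi walls special_lines)
qed

lemma card_names: "finite (names K) \<and> card (names K) \<le> 200 + 40 * K"
proof -
  have un: "finite (A \<union> B) \<and> card (A \<union> B) \<le> m + n" if "finite A \<and> card A \<le> m" "finite B \<and> card B \<le> n" for A B :: "'b set" and m n
    using that card_Un_le [of A B] by auto
  have im: "finite (f ` A) \<and> card (f ` A) \<le> m" if "finite A \<and> card A \<le> m" for f :: "'b \<Rightarrow> 'c" and A m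
    using that card_image_le [of A f] by auto
  have s: "finite (step_certs i) \<and> card (step_certs i) \<le> 10" for i
    unfolding step_certs_def by (rule conjI, simp, intro card_insert_le_m1; simp)
  have su: "finite (\<Union>i\<le>K. step_certs i) \<and> card (\<Union>i\<le>K. step_certs i) \<le> 10 * (K + 1)"
    using card_UN_le [of "{..K}" step_certs] sum_mono [of "{..K}" "\<lambda>i. card (step_certs i)" "\<lambda>i. 10"] s by auto
  have c: "finite (certs K) \<and> card (certs K) \<le> 10 * (K + 1) + 8"
    unfolding certs_def by (rule un [OF su], rule conjI, simp, intro card_insert_le_m1; simp)
  have l: "finite (lines K) \<and> card (lines K) \<le> 7 + (K + 1) + (K + 1) + (K + 1)"
    unfolding lines_def by (intro un im; simp?; intro card_insert_le_m1; simp)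
  have q: "finite (\<Union>(a, b, w)\<in>certs K. {Qs a b w, Us a b w, Ds a b w}) \<and>
      card (\<Union>(a, b, w)\<in>certs K. {Qs a b w, Us a b w, Ds a b w}) \<le> 3 * (10 * (K + 1) + 8)"
  proof -
    have t: "finite (case z of (a, b, w) \<Rightarrow> {Qs a b w, Us a b w, Ds a b w}) \<and> card (case z of (a, b, w) \<Rightarrow> {Qs a b w, Us a b w, Ds a b w}) \<le> 3" for z
      by (cases z) simp
    have "card (\<Union>(a, b, w)\<in>certs K. {Qs a b w, Us a b w, Ds a b w}) \<le> (\<Sum>z\<in>certs K. 3)"
      using c t by (intro order_trans [OF card_UN_le] sum_mono) auto
    also have "\<dots> \<le> 3 * (10 * (K + 1) + 8)" using c by simp
    finally show ?thesis using c t by blast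
  qed
  have w: "finite {wD, wN, wM, wW} \<and> card {wD, wN, wM, wW} \<le> 4" by simp
  have 3: "finite {..<3 :: nat} \<and> card {..<3 :: nat} \<le> 3" "finite {Lup, Llo, Mid} \<and> card {Lup, Llo, Mid} \<le> 3"
    "finite {Chi} \<and> card {Chi} \<le> 1" "finite far \<and> card far \<le> 5" by (auto simp: far_def)
  have "finite (core K) \<and> card (core K) \<le> 4 + 4 + 4 + 1 + 3 * (10 * (K + 1) + 8)"
    unfolding core_def by (intro un im w q 3)
  then have "finite (names K) \<and> card (names K) \<le> 3 + 3 + 3 + 3 + 3 + (7 + (K + 1) + (K + 1) + (K + 1)) + (4 + 4 + 4 + 1 + 3 * (10 * (K + 1) + 8)) + 5"
    unfolding names_def by (intro un im l 3)
  then show ?thesis by simp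
qed

lemma draw_nondegenerate:
  assumes "x \<in> names K \<or> x = Pad i"
  shows "fst (ends K x) \<noteq> snd (ends K x)"
proof -
  have e: "0 < eps K" "eps K \<le> 1 / 81920000" using eps_pos by auto
  have "fst (ends K x) \<noteq> snd (ends K x)" if c: "(a, b, w) \<in> certs K" and x: "x = Qs a b w \<or> x = Us a b w \<or> x = Ds a b w" for a b w
  proof -
    note h = height_spot_sign [OF heights(1,2) [OF c]] height_spot_sign [OF heights(3,4) [OF c]] and p = para_bounds [OF c]
    have s: "spot K w s \<noteq> spot K w t" if "s < t" for s t
    proof
      assume "spot K w s = spot K w t"
      then have "(t - s) * (height K a (tip K w) - height K a (foot K w)) = 0"
        using height_spot [of K a w s] height_spot [of K a w t] by (simp add: algebra_simps)
      then show False using heights(1,2) [OF c] that by auto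
    qed
    have "spot K w 0 = foot K w" "spot K w 1 = tip K w" by (auto simp: spot_def)
    then show ?thesis using x s [of "(2 * para K a w + para K b w) / 3" "(para K a w + 2 * para K b w) / 3"]
        s [of 0 "(para K a w + para K b w) / 2"] s [of "(para K a w + para K b w) / 2" 1] p by auto
  qed
  moreover have "fst (ends K (Wl w)) \<noteq> snd (ends K (Wl w))" "fst (ends K (Tp w)) \<noteq> snd (ends K (Tp w))" "fst (ends K (Bt w)) \<noteq> snd (ends K (Bt w))" for w
    using e by (cases w; simp add: prod_eq_iff)+
  moreover have "fst (ends K y) \<noteq> snd (ends K y)" if "y \<in> {Lup, Llo, Mid, Chi, Pole, PiA, PiB, PiC, Kap, Frm j, Bar j, Ta j, Tb j, Pad i, Lin l}" for y j l
    using that by (auto simp: pt3_def split: if_splits)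
  ultimately show ?thesis
    using assms unfolding names_def far_def core_def by blast
qed

text \<open>Padding vertices bring the drawing to any prescribed number of vertices.\<close>

lemma gadget_graph:
  assumes n: "200 + 40 * K \<le> n"
  obtains \<phi> G where "G \<in> SEG n" "inj_on \<phi> (names K)" "\<phi> ` names K \<subseteq> verts G"
    "\<And>A :: nat \<Rightarrow> (real \<times> real) set. realizes A G \<Longrightarrow> gadget_hits K (\<lambda>x y. A (\<phi> x) \<inter> A (\<phi> y) \<noteq> {})"
proof -
  define V where "V = names K \<union> Pad ` {..<n - card (names K)}"
  have "card V = card (names K) + card (Pad ` {..<n - card (names K)})"
    unfolding V_def by (rule card_Un_disjoint) (use card_names in auto)
  also have "card (Pad ` {..<n - card (names K)}) = n - card (names K)" by (subst card_image) (auto simp: inj_on_def)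
  finally have V: "finite V" "card V = n" using card_names [of K] n by (auto simp: V_def)
  then obtain \<phi> where \<phi>: "bij_betw \<phi> V {..<n}" by (metis bij_betw_iff_card card_lessThan finite_lessThan)
  define \<psi> where "\<psi> = inv_into V \<phi>"
  have \<psi>: "\<psi> i \<in> V" if "i < n" for i using \<phi> that by (auto simp: \<psi>_def bij_betw_def inv_into_into)
  have \<phi>': "\<phi> x < n" "\<psi> (\<phi> x) = x" if "x \<in> V" for x using \<phi> that by (auto simp: \<psi>_def bij_betw_def)
  define G where "G = intersection_graph {..<n} (\<lambda>i. draw K (\<psi> i))"
  have G: "verts G = {..<n}" by (simp add: G_def)
  have "is_line_segment (draw K (\<psi> i))" if "i < n" for i
    using draw_nondegenerate [of "\<psi> i" K] \<psi> [OF that] unfolding is_line_segment_def draw_def V_def by blast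
  moreover have "simple_graph G" by (auto simp: simple_graph_def G_def intersection_graph_def)
  moreover have "isomorphic (intersection_graph {..<n} (\<lambda>i. draw K (\<psi> i))) G"
    unfolding isomorphic_def G_def [symmetric] by (rule exI [of _ id]) auto
  ultimately have "G \<in> SEG n" unfolding SEG_def segment_graph_def using G
    by (auto intro!: exI [of _ "{..<n}"] exI [of _ "\<lambda>i. draw K (\<psi> i)"])
  moreover have "names K \<subseteq> V" by (simp add: V_def)
  moreover from this have "inj_on \<phi> (names K)" using \<phi> inj_on_subset by (auto simp: bij_betw_def)
  moreover have "gadget_hits K (\<lambda>x y. A (\<phi> x) \<inter> A (\<phi> y) \<noteq> {})" if A: "realizes A G" for A :: "nat \<Rightarrow> 'p set"
  proof (rule gadget_hits_cong [OF gadget_hits_draw])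
    fix x y assume xy: "x \<in> names K" "y \<in> names K" "x \<noteq> y"
    then have v: "x \<in> V" "y \<in> V" by (auto simp: V_def)
    have "\<phi> x \<noteq> \<phi> y" using \<phi>'(2) v xy(3) by metis
    moreover have "intersection_graph {..<n} A = intersection_graph {..<n} (\<lambda>i. draw K (\<psi> i))"
      using A unfolding realizes_def G by (simp add: G_def)
    from intersection_graph_eqD [OF this, of "\<phi> x" "\<phi> y"]
    show "(A (\<phi> x) \<inter> A (\<phi> y) \<noteq> {}) = dhit K x y"
      using \<phi>' v \<open>\<phi> x \<noteq> \<phi> y\<close> by (simp add: dhit_def)
  qed
  ultimately show thesis using that [of G \<phi>] \<phi>' G by auto
qed

text \<open>After \<open>perturb\<close>, the intercept of \<open>u\<close> is raised by a small
  \<open>t\<close>. Proper crossings and misses survive, and only the single value \<open>t0\<close>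
  would send the line of \<open>u\<close> through the common point of the other two.\<close>

lemma generic_parameters:
  fixes a b l r :: "nat \<Rightarrow> real"
  assumes V: "finite V" and lr: "\<And>i. i \<in> V \<Longrightarrow> l i < r i" and \<delta>: "\<delta> > 0"
    and uvw: "u \<in> V" "v \<in> V" "w \<in> V" "u \<noteq> v" "u \<noteq> w" "v \<noteq> w" "meets a b l r v w"
  obtains a' b' l' r' where "\<And>i. i \<in> V \<Longrightarrow> \<bar>a' i - a i\<bar> < \<delta> \<and> \<bar>b' i - b i\<bar> < \<delta> \<and> \<bar>l' i - l i\<bar> < \<delta> \<and> \<bar>r' i - r i\<bar> < \<delta>"
    "\<And>i. i \<in> V \<Longrightarrow> l' i < r' i"
    "\<And>i j. i \<in> V \<Longrightarrow> j \<in> V \<Longrightarrow> i \<noteq> j \<Longrightarrow> meets a b l r i j \<Longrightarrow> crosses a' b' l' r' i j"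
    "\<And>i j. i \<in> V \<Longrightarrow> j \<in> V \<Longrightarrow> i \<noteq> j \<Longrightarrow> \<not> meets a b l r i j \<Longrightarrow> \<not> meets a' b' l' r' i j"
    "graph_seg (a' u) (b' u) (l' u) (r' u) \<inter> graph_seg (a' v) (b' v) (l' v) (r' v) \<inter> graph_seg (a' w) (b' w) (l' w) (r' w) = {}"
proof -
  have d2: "\<delta> / 2 > 0" using \<delta> by simp
  obtain a' b' l' r' where 1: "\<And>i. i \<in> V \<Longrightarrow> \<bar>a' i - a i\<bar> < \<delta> / 2 \<and> \<bar>b' i - b i\<bar> < \<delta> / 2 \<and> \<bar>l' i - l i\<bar> < \<delta> / 2 \<and> \<bar>r' i - r i\<bar> < \<delta> / 2"
    and 2: "\<And>i. i \<in> V \<Longrightarrow> l' i < r' i"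
    and 3: "\<And>i j. i \<in> V \<Longrightarrow> j \<in> V \<Longrightarrow> i \<noteq> j \<Longrightarrow> meets a b l r i j \<Longrightarrow> crosses a' b' l' r' i j"
    and 4: "\<And>i j. i \<in> V \<Longrightarrow> j \<in> V \<Longrightarrow> i \<noteq> j \<Longrightarrow> \<not> meets a b l r i j \<Longrightarrow> \<not> meets a' b' l' r' i j"
    by (rule perturb [where a = a and b = b, OF V lr d2]) (auto simp only:)
  define c where "c t = b'(u := b' u + t)" for t :: real
  have lim: "((\<lambda>t. gap a' (c t) i j x * gap a' (c t) i j y) \<longlongrightarrow> gap a' b' i j x * gap a' b' i j y) (at_right 0)" for i j x y
  proof -
    have g: "((\<lambda>t. gap a' (c t) i j x) \<longlongrightarrow> gap a' b' i j x) (at_right 0)" for x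
    proof -
      have e: "gap a' (c t) i j x = gap a' b' i j x + (if i = u then t else 0) - (if j = u then t else 0)" for t
        by (simp add: gap_def c_def)
      show ?thesis unfolding e by (cases "i = u"; cases "j = u"; auto intro!: tendsto_eq_intros)
    qed
    show ?thesis by (intro tendsto_mult g)
  qed
  have ev1: "eventually (\<lambda>t. \<forall>i\<in>V. \<forall>j\<in>V. i \<noteq> j \<longrightarrow> meets a b l r i j \<longrightarrow> crosses a' (c t) l' r' i j) (at_right 0)"
  proof (rule eventually_pair [OF V])
    fix i j assume ij: "i \<in> V" "j \<in> V" "i \<noteq> j"
    show "eventually (\<lambda>t. meets a b l r i j \<longrightarrow> crosses a' (c t) l' r' i j) (at_right 0)"
    proof (cases "meets a b l r i j")
      case True
      then have cr: "crosses a' b' l' r' i j" using 3 ij by blast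
      then have "gap a' b' i j (max (l' i) (l' j)) * gap a' b' i j (min (r' i) (r' j)) < 0" by (simp add: crosses_def)
      from order_tendstoD(2) [OF lim this] show ?thesis by (rule eventually_mono) (use cr in \<open>simp add: crosses_def\<close>)
    qed auto
  qed
  have ev2: "eventually (\<lambda>t. \<forall>i\<in>V. \<forall>j\<in>V. i \<noteq> j \<longrightarrow> \<not> meets a b l r i j \<longrightarrow> \<not> meets a' (c t) l' r' i j) (at_right 0)"
  proof (rule eventually_pair [OF V])
    fix i j assume ij: "i \<in> V" "j \<in> V" "i \<noteq> j"
    show "eventually (\<lambda>t. \<not> meets a b l r i j \<longrightarrow> \<not> meets a' (c t) l' r' i j) (at_right 0)"
    proof (cases "\<not> meets a b l r i j \<and> max (l' i) (l' j) \<le> min (r' i) (r' j)")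
      case True
      then have "\<not> meets a' b' l' r' i j" using 4 ij by blast
      then have "0 < gap a' b' i j (max (l' i) (l' j)) * gap a' b' i j (min (r' i) (r' j))" using True unfolding meets_def by linarith
      from order_tendstoD(1) [OF lim this] show ?thesis by (rule eventually_mono) (simp add: meets_def)
    next
      case False
      then show ?thesis by (auto simp: meets_def)
    qed
  qed
  define x0 where "x0 = (b' w - b' v) / (a' v - a' w)"
  define t0 where "t0 = a' v * x0 + b' v - a' u * x0 - b' u"
  have "eventually (\<lambda>t. t \<noteq> t0) (at_right 0)" by (rule eventually_neq_at_within)
  moreover have "eventually (\<lambda>t. t \<in> {0<..<\<delta> / 2}) (at_right 0)" using d2 by (rule eventually_at_right_real)
  ultimately have "eventually (\<lambda>t. t \<noteq> t0 \<and> t \<in> {0<..<\<delta> / 2} \<and> (\<forall>i\<in>V. \<forall>j\<in>V. i \<noteq> j \<longrightarrow> meets a b l r i j \<longrightarrow> crosses a' (c t) l' r' i j) \<and>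
     (\<forall>i\<in>V. \<forall>j\<in>V. i \<noteq> j \<longrightarrow> \<not> meets a b l r i j \<longrightarrow> \<not> meets a' (c t) l' r' i j)) (at_right 0)"
    using ev1 ev2 by eventually_elim auto
  from eventually_happens' [OF trivial_limit_at_right_real this]
  obtain t where t: "t \<noteq> t0" "0 < t" "t < \<delta> / 2"
    "\<forall>i\<in>V. \<forall>j\<in>V. i \<noteq> j \<longrightarrow> meets a b l r i j \<longrightarrow> crosses a' (c t) l' r' i j"
    "\<forall>i\<in>V. \<forall>j\<in>V. i \<noteq> j \<longrightarrow> \<not> meets a b l r i j \<longrightarrow> \<not> meets a' (c t) l' r' i j" by auto
  show ?thesis
  proof (rule that [of a' "c t" l' r'])
    fix i assume i: "i \<in> V"
    then show "\<bar>a' i - a i\<bar> < \<delta> \<and> \<bar>c t i - b i\<bar> < \<delta> \<and> \<bar>l' i - l i\<bar> < \<delta> \<and> \<bar>r' i - r i\<bar> < \<delta>"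
    proof -
      have "c t i - b i = (b' i - b i) + (if i = u then t else 0)" by (simp add: c_def)
      then have "\<bar>c t i - b i\<bar> \<le> \<bar>b' i - b i\<bar> + \<bar>if i = u then t else 0\<bar>" by (metis abs_triangle_ineq)
      moreover have "\<bar>if i = u then t else 0\<bar> < \<delta> / 2" using t(2,3) by simp
      ultimately show ?thesis using 1 [OF i] \<delta> by auto
    qed
    show "l' i < r' i" by (rule 2 [OF i])
  next
    show "crosses a' (c t) l' r' i j" if "i \<in> V" "j \<in> V" "i \<noteq> j" "meets a b l r i j" for i j using t(4) that by blast
    show "\<not> meets a' (c t) l' r' i j" if "i \<in> V" "j \<in> V" "i \<noteq> j" "\<not> meets a b l r i j" for i j using t(5) that by blast
    have "a' v \<noteq> a' w" using 3 [OF uvw(2,3,6,7)] by (rule crosses_slopes)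
    have False if "a' u * x + (b' u + t) = a' v * x + b' v" "a' v * x + b' v = a' w * x + b' w" for x
    proof -
      have "x = x0" using that(2) \<open>a' v \<noteq> a' w\<close> by (simp add: x0_def field_simps)
      then show False using that(1) t(1) by (simp add: t0_def)
    qed
    then show "graph_seg (a' u) (c t u) (l' u) (r' u) \<inter> graph_seg (a' v) (c t v) (l' v) (r' v) \<inter> graph_seg (a' w) (c t w) (l' w) (r' w) = {}"
      using uvw(4,5) unfolding graph_seg_def c_def by fastforce
  qed
qed

section \<open>From an arbitrary realization to a generic one in the complex plane\<close>

definition cpx :: "real \<times> real \<Rightarrow> complex" where "cpx z = Complex (fst z) (snd z)"

lemma linear_cpx: "linear cpx" by (rule linearI) (auto simp: cpx_def complex_eq_iff)
lemma inj_cpx: "inj cpx" by (rule injI) (auto simp: cpx_def prod_eq_iff)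
lemma dist_cpx: "dist (cpx x) (cpx y) = dist x y"
  by (simp add: cpx_def dist_norm cmod_def norm_prod_def)

lemma cpx_segment: "closed_segment (cpx p) (cpx q) = cpx ` closed_segment p q"
  by (rule closed_segment_linear_image [OF linear_cpx, symmetric, THEN sym])

text \<open>The estimate of \<open>distance_ratio\<close> needs general position, so it is obtained
  for a sheared and perturbed copy. Points are moved back by at most \<open>\<eta> / 2\<close> each,
  which changes distances by at most \<open>\<eta>\<close>.\<close>

lemma realization_ratio:
  fixes p q :: "nat \<Rightarrow> real \<times> real"
  assumes V: "finite V" "\<And>v. v \<in> V \<Longrightarrow> p v \<noteq> q v" and \<phi>: "inj_on \<phi> (names K)" "\<phi> ` names K \<subseteq> V"
    and g: "gadget_hits K (\<lambda>x y. closed_segment (p (\<phi> x)) (q (\<phi> x)) \<inter> closed_segment (p (\<phi> y)) (q (\<phi> y)) \<noteq> {})"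
    and K: "K > 0" and \<eta>: "\<eta> > 0"
  shows "\<exists>s t x y. s \<in> closed_segment (p (\<phi> (Wl wW))) (q (\<phi> (Wl wW))) \<and> t \<in> closed_segment (p (\<phi> (Wl wW))) (q (\<phi> (Wl wW)))
    \<and> x \<in> closed_segment (p (\<phi> (Lin lG))) (q (\<phi> (Lin lG))) \<and> y \<in> closed_segment (p (\<phi> (Lin (lC K)))) (q (\<phi> (Lin (lC K))))
    \<and> 2 ^ 2 ^ (K - 1) * (dist x y - \<eta>) \<le> dist s t + \<eta>"
proof -
  define A where "A v = closed_segment (p v) (q v)" for v
  have "bounded (\<Union>v\<in>V. A v)" using V(1) by (intro bounded_UN) (auto simp: A_def intro: compact_imp_bounded)
  then obtain B where B: "B > 0" "\<And>v z. v \<in> V \<Longrightarrow> z \<in> A v \<Longrightarrow> norm z \<le> B" unfolding bounded_pos by auto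
  have pos: "\<eta> / (4 * B) > 0" using \<eta> B(1) by simp
  obtain c a b l r where c: "0 < c" "c < \<eta> / (4 * B)" and lr: "\<And>v. v \<in> V \<Longrightarrow> l v < r v"
    and sh: "\<And>v. v \<in> V \<Longrightarrow> shear c ` A v = graph_seg (a v) (b v) (l v) (r v)"
  proof (rule sheared_graphs [where p = p and q = q, OF V pos, folded A_def])
    fix c a b l r
    assume "0 < c" "c < \<eta> / (4 * B)" "\<And>v. v \<in> V \<Longrightarrow> l v < r v" "\<And>v. v \<in> V \<Longrightarrow> shear c ` A v = graph_seg (a v) (b v) (l v) (r v)"
    then show thesis by (rule that)
  qed
  define M where "M = 3 + (\<Sum>v\<in>V. \<bar>a v\<bar> + \<bar>l v\<bar> + \<bar>r v\<bar>)"
  have M: "\<bar>a v\<bar> + \<bar>l v\<bar> + \<bar>r v\<bar> + 3 \<le> M" if "v \<in> V" for v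
    using member_le_sum [of v V "\<lambda>v. \<bar>a v\<bar> + \<bar>l v\<bar> + \<bar>r v\<bar>"] V(1) that by (simp add: M_def)
  have M3: "M \<ge> 3" unfolding M_def by (simp add: sum_nonneg)
  define \<delta> where "\<delta> = min 1 (\<eta> / (4 * M))"
  have \<delta>: "\<delta> > 0" "\<delta> \<le> 1" "\<delta> * M \<le> \<eta> / 4"
  proof -
    show "\<delta> > 0" "\<delta> \<le> 1" using \<eta> M3 by (auto simp: \<delta>_def)
    have "\<delta> * M \<le> \<eta> / (4 * M) * M" using M3 by (intro mult_right_mono) (auto simp: \<delta>_def)
    then show "\<delta> * M \<le> \<eta> / 4" using M3 by simp
  qed
  interpret g: gadget_hits K "\<lambda>x y. A (\<phi> x) \<inter> A (\<phi> y) \<noteq> {}" using g by (simp add: A_def)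
  have mt: "(A u \<inter> A v \<noteq> {}) = meets a b l r u v" if "u \<in> V" "v \<in> V" for u v
    using shear_image_meets [of c "A u" "A v"] unfolding sh [OF that(1)] sh [OF that(2)] graph_seg_meets by simp
  have \<phi>V: "\<phi> x \<in> V" if "x \<in> names K" for x using \<phi>(2) that by auto
  have \<phi>n: "\<phi> x \<noteq> \<phi> y" if "x \<in> names K" "y \<in> names K" "x \<noteq> y" for x y using \<phi>(1) that by (auto simp: inj_on_eq_iff)
  have fr: "\<phi> (Frm 0) \<in> V" "\<phi> (Frm 1) \<in> V" "\<phi> (Frm 2) \<in> V" "\<phi> (Frm 0) \<noteq> \<phi> (Frm 1)" "\<phi> (Frm 0) \<noteq> \<phi> (Frm 2)" "\<phi> (Frm 1) \<noteq> \<phi> (Frm 2)"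
    by (rule \<phi>V \<phi>n; simp)+
  have fm: "meets a b l r (\<phi> (Frm 1)) (\<phi> (Frm 2))" using g.frames [of 1 2] mt [OF fr(2,3)] by simp
  obtain a' b' l' r' where
      1: "\<And>i. i \<in> V \<Longrightarrow> \<bar>a' i - a i\<bar> < \<delta> \<and> \<bar>b' i - b i\<bar> < \<delta> \<and> \<bar>l' i - l i\<bar> < \<delta> \<and> \<bar>r' i - r i\<bar> < \<delta>"
    and 2: "\<And>i. i \<in> V \<Longrightarrow> l' i < r' i"
    and 3: "\<And>i j. i \<in> V \<Longrightarrow> j \<in> V \<Longrightarrow> i \<noteq> j \<Longrightarrow> meets a b l r i j \<Longrightarrow> crosses a' b' l' r' i j"
    and 4: "\<And>i j. i \<in> V \<Longrightarrow> j \<in> V \<Longrightarrow> i \<noteq> j \<Longrightarrow> \<not> meets a b l r i j \<Longrightarrow> \<not> meets a' b' l' r' i j"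
    and 5: "graph_seg (a' (\<phi> (Frm 0))) (b' (\<phi> (Frm 0))) (l' (\<phi> (Frm 0))) (r' (\<phi> (Frm 0)))
      \<inter> graph_seg (a' (\<phi> (Frm 1))) (b' (\<phi> (Frm 1))) (l' (\<phi> (Frm 1))) (r' (\<phi> (Frm 1)))
      \<inter> graph_seg (a' (\<phi> (Frm 2))) (b' (\<phi> (Frm 2))) (l' (\<phi> (Frm 2))) (r' (\<phi> (Frm 2))) = {}"
    by (rule generic_parameters [where a = a and b = b, OF V(1) lr \<delta>(1) fr fm]) (auto simp only:)
  define A' where "A' v = graph_seg (a' v) (b' v) (l' v) (r' v)" for v
  \<comment> \<open>The shear accounts for \<open>\<eta> / 4\<close>, by the bound \<open>B\<close>
    on the norms, and the change of the parameters for another \<open>\<eta> / 4\<close>, by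
    \<open>M\<close>.\<close>
  have near: "\<exists>z\<in>A v. dist z z' \<le> \<eta> / 2" if v: "v \<in> V" and z': "z' \<in> A' v" for v z'
  proof -
    obtain x where x: "z' = (x, a' v * x + b' v)" "l' v \<le> x" "x \<le> r' v" using z' by (auto simp: A'_def graph_seg_def)
    define x0 where "x0 = max (l v) (min x (r v))"
    have x0: "l v \<le> x0" "x0 \<le> r v" "\<bar>x - x0\<bar> \<le> \<delta>" "\<bar>x\<bar> \<le> \<bar>l v\<bar> + \<bar>r v\<bar> + 1"
      using x(2,3) 1 [OF v] lr [OF v] \<delta>(2) by (auto simp: x0_def)
    then have "(x0, a v * x0 + b v) \<in> shear c ` A v" unfolding sh [OF v] by (auto simp: graph_seg_def)
    then obtain z where z: "z \<in> A v" "shear c z = (x0, a v * x0 + b v)" by auto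
    have "\<bar>snd z\<bar> \<le> B" using B(2) [OF v z(1)] norm_snd_le [of "snd z" "fst z"] by simp
    then have "c * \<bar>snd z\<bar> \<le> \<eta> / (4 * B) * B" using c by (intro mult_mono) auto
    then have d1: "dist z (shear c z) \<le> \<eta> / 4" using B(1) c(1) by (simp add: dist_norm norm_prod_def shear_def abs_mult)
    have "\<bar>(a v * x0 + b v) - (a' v * x + b' v)\<bar> = \<bar>a v * (x0 - x) - (a' v - a v) * x - (b' v - b v)\<bar>" by (simp add: algebra_simps)
    also have "\<dots> \<le> \<bar>a v\<bar> * \<bar>x0 - x\<bar> + \<bar>a' v - a v\<bar> * \<bar>x\<bar> + \<bar>b' v - b v\<bar>" unfolding abs_mult [symmetric] by linarith
    also have "\<dots> \<le> \<bar>a v\<bar> * \<delta> + \<delta> * (\<bar>l v\<bar> + \<bar>r v\<bar> + 1) + \<delta>"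
      using x0 1 [OF v] by (intro add_mono mult_mono) auto
    finally have "\<bar>(a v * x0 + b v) - (a' v * x + b' v)\<bar> \<le> \<delta> * (\<bar>a v\<bar> + \<bar>l v\<bar> + \<bar>r v\<bar> + 2)" by (simp add: algebra_simps)
    moreover have "dist (x0, a v * x0 + b v) z' \<le> \<bar>x0 - x\<bar> + \<bar>(a v * x0 + b v) - (a' v * x + b' v)\<bar>"
      unfolding x(1) dist_Pair_Pair using sqrt_sum_squares_le_sum_abs by (simp add: dist_real_def)
    ultimately have "dist (x0, a v * x0 + b v) z' \<le> \<delta> * (\<bar>a v\<bar> + \<bar>l v\<bar> + \<bar>r v\<bar> + 3)"
      using x0(3) abs_minus_commute [of x x0] distrib_left [of \<delta> "\<bar>a v\<bar> + \<bar>l v\<bar> + \<bar>r v\<bar> + 2" 1] by (simp add: add.assoc)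
    also have "\<dots> \<le> \<delta> * M" using M [OF v] \<delta>(1) by (intro mult_left_mono) auto
    finally have "dist (shear c z) z' \<le> \<eta> / 4" using \<delta>(3) z(2) by simp
    then have "dist z z' \<le> \<eta> / 2" using d1 dist_triangle [of z z' "shear c z"] by linarith
    then show ?thesis using z(1) by blast
  qed
  define P Q where "P x = cpx (l' (\<phi> x), a' (\<phi> x) * l' (\<phi> x) + b' (\<phi> x))" and "Q x = cpx (r' (\<phi> x), a' (\<phi> x) * r' (\<phi> x) + b' (\<phi> x))" for x
  have S: "closed_segment (P x) (Q x) = cpx ` A' (\<phi> x)" if "x \<in> names K" for x
    unfolding P_def Q_def A'_def cpx_segment using 2 [OF \<phi>V [OF that]] by (simp add: graph_seg_closed_segment)
  have crosscr: "cr (Q x - P x) (Q y - P y) \<noteq> 0" if "x \<in> names K" "y \<in> names K" "x \<noteq> y" "A (\<phi> x) \<inter> A (\<phi> y) \<noteq> {}" for x y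
  proof -
    have "crosses a' b' l' r' (\<phi> x) (\<phi> y)" using 3 \<phi>V \<phi>n mt that by simp
    then have s: "a' (\<phi> x) \<noteq> a' (\<phi> y)" by (rule crosses_slopes)
    have "cr (Q x - P x) (Q y - P y) = (r' (\<phi> x) - l' (\<phi> x)) * (r' (\<phi> y) - l' (\<phi> y)) * (a' (\<phi> y) - a' (\<phi> x))"
      by (simp add: cr_def P_def Q_def cpx_def algebra_simps)
    then show ?thesis using s 2 [OF \<phi>V [OF that(1)]] 2 [OF \<phi>V [OF that(2)]] by simp
  qed
  have hit': "(closed_segment (P x) (Q x) \<inter> closed_segment (P y) (Q y) \<noteq> {}) = (A (\<phi> x) \<inter> A (\<phi> y) \<noteq> {})"
    if "x \<in> names K" "y \<in> names K" "x \<noteq> y" for x y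
  proof -
    have "(cpx ` A' (\<phi> x) \<inter> cpx ` A' (\<phi> y) \<noteq> {}) = (A' (\<phi> x) \<inter> A' (\<phi> y) \<noteq> {})" by (simp flip: image_Int [OF inj_cpx])
    also have "\<dots> = meets a' b' l' r' (\<phi> x) (\<phi> y)" unfolding A'_def graph_seg_meets ..
    also have "\<dots> = meets a b l r (\<phi> x) (\<phi> y)" using 3 4 \<phi>V \<phi>n that crosses_imp_meets by metis
    finally show ?thesis unfolding S [OF that(1)] S [OF that(2)] using mt \<phi>V that by simp
  qed
  have gh: "gadget_hits K (\<lambda>x y. closed_segment (P x) (Q x) \<inter> closed_segment (P y) (Q y) \<noteq> {})"
    by (rule gadget_hits_cong [OF g.gadget_hits_axioms hit'])
  have PQ: "P x \<noteq> Q x" if "x \<in> names K" for x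
    using 2 [OF \<phi>V [OF that]] by (simp add: P_def Q_def cpx_def)
  have ncon: "closed_segment (P (Frm 0)) (Q (Frm 0)) \<inter> closed_segment (P (Frm 1)) (Q (Frm 1)) \<inter> closed_segment (P (Frm 2)) (Q (Frm 2)) = {}"
    using 5 by (simp add: S A'_def flip: image_Int [OF inj_cpx])
  interpret gadget P Q K "\<lambda>x. closed_segment (P x) (Q x)" "\<lambda>x y. closed_segment (P x) (Q x) \<inter> closed_segment (P y) (Q y) \<noteq> {}"
  proof (rule gadget.intro)
    show "P (Lin l) \<noteq> Q (Lin l)" if "l \<in> lines K" for l using that by (intro PQ) simp
    show "P Lup \<noteq> Q Lup" "P Llo \<noteq> Q Llo" "P Mid \<noteq> Q Mid" by (rule PQ; simp)+
    show "cr (Q (Frm i) - P (Frm i)) (Q (Frm j) - P (Frm j)) \<noteq> 0" if "i < 3" "j < 3" "i \<noteq> j" for i j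
      using g.frames [OF that] that by (intro crosscr) simp_all
    show "cr (Q (Bar j) - P (Bar j)) (Q (Frm j) - P (Frm j)) \<noteq> 0" if "j < 3" for j using g.bars(1) [OF that] that by (intro crosscr) simp_all
    show "cr (Q (Bar j) - P (Bar j)) (Q (Ta j) - P (Ta j)) \<noteq> 0" if "j < 3" for j
      using g.ticks(1) [OF that] that by (intro crosscr) (simp_all add: Int_commute)
    show "cr (Q (Bar j) - P (Bar j)) (Q (Tb j) - P (Tb j)) \<noteq> 0" if "j < 3" for j
      using g.ticks(3) [OF that] that by (intro crosscr) (simp_all add: Int_commute)
    show "cr (Q (Wl wD) - P (Wl wD)) (Q (Wl wN) - P (Wl wN)) \<noteq> 0" using g.walls(1) by (intro crosscr) simp_all
  qed (use ncon gh in auto)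
  obtain I where I: "open I" "convex I" "core_set \<subseteq> I"
    "\<And>l. l \<in> lines K \<Longrightarrow> full_in I (P (Lin l)) (Q (Lin l))" "full_in I (P Lup) (Q Lup)" "full_in I (P Llo) (Q Llo)"
    by (rule core_inside) blast
  interpret gadget_inside P Q K "\<lambda>x. closed_segment (P x) (Q x)" "\<lambda>x y. closed_segment (P x) (Q x) \<inter> closed_segment (P y) (Q y) \<noteq> {}" I
    by unfold_locales (use I in auto)
  note sl = special_lines [of K]
  obtain s t x y where st: "s \<in> A' (\<phi> (Wl wW))" "t \<in> A' (\<phi> (Wl wW))" "x \<in> A' (\<phi> (Lin lG))" "y \<in> A' (\<phi> (Lin (lC K)))"
    "2 ^ 2 ^ (K - 1) * dist x y \<le> dist s t"
  proof (rule distance_ratio [OF K])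
    fix s t x y assume h: "s \<in> closed_segment (P (Wl wW)) (Q (Wl wW))" "t \<in> closed_segment (P (Wl wW)) (Q (Wl wW))"
      "x \<in> closed_segment (P (Lin lG)) (Q (Lin lG))" "y \<in> closed_segment (P (Lin (lC K))) (Q (Lin (lC K)))"
      "2 ^ 2 ^ (K - 1) * dist x y \<le> dist s t"
    then obtain s' t' x' y' where "s = cpx s'" "t = cpx t'" "x = cpx x'" "y = cpx y'"
      "s' \<in> A' (\<phi> (Wl wW))" "t' \<in> A' (\<phi> (Wl wW))" "x' \<in> A' (\<phi> (Lin lG))" "y' \<in> A' (\<phi> (Lin (lC K)))"
      using sl by (auto simp: S)
    then show thesis using that h(5) by (auto simp: dist_cpx)
  qed
  have vs: "\<phi> (Wl wW) \<in> V" "\<phi> (Lin lG) \<in> V" "\<phi> (Lin (lC K)) \<in> V" using sl by (auto intro!: \<phi>V)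
  obtain s0 t0 x0 y0 where n: "s0 \<in> A (\<phi> (Wl wW))" "dist s0 s \<le> \<eta> / 2" "t0 \<in> A (\<phi> (Wl wW))" "dist t0 t \<le> \<eta> / 2"
    "x0 \<in> A (\<phi> (Lin lG))" "dist x0 x \<le> \<eta> / 2" "y0 \<in> A (\<phi> (Lin (lC K)))" "dist y0 y \<le> \<eta> / 2"
    using near [OF vs(1) st(1)] near [OF vs(1) st(2)] near [OF vs(2) st(3)] near [OF vs(3) st(4)] by blast
  have "dist x0 y0 \<le> dist x y + \<eta>" using n dist_triangle [of x0 y0 x] dist_triangle [of x y0 y] by (simp add: dist_commute)
  moreover have "dist s t \<le> dist s0 t0 + \<eta>" using n dist_triangle [of s t s0] dist_triangle [of s0 t t0] by (simp add: dist_commute)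
  moreover have "2 ^ 2 ^ (K - 1) * (dist x0 y0 - \<eta>) \<le> 2 ^ 2 ^ (K - 1) * dist x y" using calculation(1) by (intro mult_left_mono) auto
  ultimately have "2 ^ 2 ^ (K - 1) * (dist x0 y0 - \<eta>) \<le> dist s0 t0 + \<eta>" using st(5) by linarith
  then show ?thesis using n unfolding A_def by blast
qed

section \<open>Distance of disjoint segments with rational ends\<close>

lemma on_line_param:
  assumes "p \<noteq> q" "orient p q r = 0"
  shows "\<exists>\<rho>. r = p + \<rho> *\<^sub>R (q - p)"
proof (cases "fst p = fst q")
  case True
  then have "snd q - snd p \<noteq> 0" using assms(1) by (simp add: prod_eq_iff)
  moreover from this have "fst r = fst p" using assms(2) True by (simp add: orient_def)
  ultimately show ?thesis using True by (intro exI [of _ "(snd r - snd p) / (snd q - snd p)"]) (simp add: prod_eq_iff)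
next
  case False
  then have "snd r - snd p = (fst r - fst p) / (fst q - fst p) * (snd q - snd p)"
    using assms(2) by (simp add: orient_def field_simps)
  then show ?thesis using False by (intro exI [of _ "(fst r - fst p) / (fst q - fst p)"]) (simp add: prod_eq_iff)
qed

text \<open>The converse of \<open>segments_apart\<close>. If the segments are not collinear, it is
  the contraposition of \<open>segments_meet\<close>; collinear ones are disjoint intervals on a
  line and separated in any coordinate that is not constant on it.\<close>

lemma disjoint_segments:
  assumes pq: "p \<noteq> q" and d: "closed_segment p q \<inter> closed_segment r s = {}"
  shows "orient p q r * orient p q s > 0 \<or> orient r s p * orient r s q > 0 \<or> max (fst p) (fst q) < min (fst r) (fst s)
    \<or> max (fst r) (fst s) < min (fst p) (fst q) \<or> max (snd p) (snd q) < min (snd r) (snd s) \<or> max (snd r) (snd s) < min (snd p) (snd q)"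
proof (cases "orient p q r = 0 \<and> orient p q s = 0")
  case False
  show ?thesis
  proof (rule ccontr)
    assume n: "\<not> ?thesis"
    have "orient p q r \<noteq> orient p q s"
    proof
      assume "orient p q r = orient p q s"
      then have "orient p q s \<noteq> 0" "orient p q s * orient p q s \<le> 0" using False n by auto
      then show False using not_real_square_gt_zero [of "orient p q s"] by linarith
    qed
    then show False using segments_meet [of p q r s] n d by auto
  qed
next
  case True
  then obtain \<rho> \<sigma> where r: "r = p + \<rho> *\<^sub>R (q - p)" and s: "s = p + \<sigma> *\<^sub>R (q - p)" using on_line_param [OF pq] by metis
  have img: "closed_segment (p + x *\<^sub>R (q - p)) (p + y *\<^sub>R (q - p)) = (\<lambda>t. p + t *\<^sub>R (q - p)) ` closed_segment x y" for x y
  proof -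
    have "linear (\<lambda>t. t *\<^sub>R (q - p))" by (rule linearI) (auto simp: algebra_simps)
    from closed_segment_linear_image [OF this, of x y] show ?thesis by (simp only: closed_segment_translation image_image)
  qed
  have "closed_segment 0 1 \<inter> closed_segment \<rho> \<sigma> = {}"
    using img [of 0 1] img [of \<rho> \<sigma>] d unfolding r s by auto
  moreover have "closed_segment 0 1 \<inter> closed_segment \<rho> \<sigma> \<noteq> {}" if "max 0 (min \<rho> \<sigma>) \<le> min 1 (max \<rho> \<sigma>)"
  proof -
    have "max 0 (min \<rho> \<sigma>) \<in> closed_segment 0 1 \<inter> closed_segment \<rho> \<sigma>" using that by (auto simp: closed_segment_eq_real_ivl)
    then show ?thesis by blast
  qed
  ultimately have sep: "\<not> max 0 (min \<rho> \<sigma>) \<le> min 1 (max \<rho> \<sigma>)"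
    by blast
  from sep consider "\<rho> < 0" "\<sigma> < 0" | "1 < \<rho>" "1 < \<sigma>" by linarith
  then have out: "(\<rho> < 0 \<and> \<sigma> < 0) \<or> (1 < \<rho> \<and> 1 < \<sigma>)" by cases auto
  have side: "max a b < min (a + \<rho> * (b - a)) (a + \<sigma> * (b - a)) \<or> max (a + \<rho> * (b - a)) (a + \<sigma> * (b - a)) < min a b" if "a \<noteq> b" for a b :: real
  proof -
    have neg: "a < b \<Longrightarrow> \<tau> * (b - a) < 0" "b < a \<Longrightarrow> 0 < \<tau> * (b - a)" if "\<tau> < 0" for \<tau>
      using that by (auto intro: mult_neg_pos mult_neg_neg)
    have pos: "a < b \<Longrightarrow> b - a < \<tau> * (b - a)" "b < a \<Longrightarrow> \<tau> * (b - a) < b - a" if "1 < \<tau>" for \<tau>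
      using that mult_strict_right_mono [of 1 \<tau> "b - a"] mult_strict_right_mono_neg [of 1 \<tau> "b - a"] by auto
    show ?thesis
    proof (cases "a < b")
      case True
      show ?thesis using out
      proof
        assume "\<rho> < 0 \<and> \<sigma> < 0"
        then show ?thesis using neg(1) [OF _ True, of \<rho>] neg(1) [OF _ True, of \<sigma>] True by (intro disjI2) linarith
      next
        assume "1 < \<rho> \<and> 1 < \<sigma>"
        then show ?thesis using pos(1) [OF _ True, of \<rho>] pos(1) [OF _ True, of \<sigma>] True by (intro disjI1) linarith
      qed
    next
      case False
      then have ba: "b < a" using that by simp
      show ?thesis using out
      proof
        assume "\<rho> < 0 \<and> \<sigma> < 0"
        then show ?thesis using neg(2) [OF _ ba, of \<rho>] neg(2) [OF _ ba, of \<sigma>] ba by (intro disjI1) linarith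
      next
        assume "1 < \<rho> \<and> 1 < \<sigma>"
        then show ?thesis using pos(2) [OF _ ba, of \<rho>] pos(2) [OF _ ba, of \<sigma>] ba by (intro disjI2) linarith
      qed
    qed
  qed
  have "fst p \<noteq> fst q \<or> snd p \<noteq> snd q" using pq by (simp add: prod_eq_iff)
  moreover have "fst r = fst p + \<rho> * (fst q - fst p)" "fst s = fst p + \<sigma> * (fst q - fst p)"
    "snd r = snd p + \<rho> * (snd q - snd p)" "snd s = snd p + \<sigma> * (snd q - snd p)" by (simp_all add: r s)
  ultimately show ?thesis using side [of "fst p" "fst q"] side [of "snd p" "snd q"] by metis
qed

definition on_grid :: "real \<Rightarrow> real \<Rightarrow> real \<times> real \<Rightarrow> bool" where
  "on_grid B M z \<longleftrightarrow> fst z * M \<in> \<int> \<and> snd z * M \<in> \<int> \<and> \<bar>fst z\<bar> \<le> B \<and> \<bar>snd z\<bar> \<le> B"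

lemma segment_coords:
  fixes x p q :: "real \<times> real"
  assumes "x \<in> closed_segment p q"
  shows "min (fst p) (fst q) \<le> fst x" "fst x \<le> max (fst p) (fst q)" "min (snd p) (snd q) \<le> snd x" "snd x \<le> max (snd p) (snd q)"
  using segment_functional(2) [OF assms, of "- 1" 0 "- min (fst p) (fst q)"] segment_functional(2) [OF assms, of 1 0 "max (fst p) (fst q)"]
    segment_functional(2) [OF assms, of 0 "- 1" "- min (snd p) (snd q)"] segment_functional(2) [OF assms, of 0 1 "max (snd p) (snd q)"]
  by auto

lemma dist_le_coords: "dist x y \<le> \<bar>fst x - fst y\<bar> + \<bar>snd x - snd (y :: real \<times> real)\<bar>"
  using sqrt_sum_squares_le_sum_abs by (simp add: dist_prod_def dist_real_def)

text \<open>Disjoint segments are separated by a coordinate or by \<open>orient\<close> along one of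
  them. On the grid these take values in multiples of \<open>1 / M\<close> and
  \<open>1 / M^2\<close>, so the gap is at least one such unit; with coefficients at most
  \<open>2 * B\<close>, the functional changes by at most \<open>4 * B\<close> times the
  distance.\<close>

lemma grid_dist:
  assumes g: "on_grid B M p" "on_grid B M q" "on_grid B M r" "on_grid B M s" and BM: "1 \<le> B" "1 \<le> M"
    and pq: "p \<noteq> q" and d: "closed_segment p q \<inter> closed_segment r s = {}"
    and x: "x \<in> closed_segment p q" and y: "y \<in> closed_segment r s"
  shows "1 \<le> 4 * B * M\<^sup>2 * dist x y"
proof -
  have coord: "1 \<le> 4 * B * M\<^sup>2 * dist x y" if "u * M \<in> \<int>" "v * M \<in> \<int>" "u < v" "v - u \<le> dist x y" for u v
  proof -
    have "(v - u) * M \<in> \<int>" "(v - u) * M > 0" using that BM by (auto simp: left_diff_distrib)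
    then have "1 \<le> (v - u) * M" using Ints_nonzero_abs_ge1 [of "(v - u) * M"] by linarith
    also have "\<dots> \<le> dist x y * M\<^sup>2"
      using that BM by (intro mult_mono) (auto simp: power2_eq_square)
    also have "\<dots> \<le> (4 * B) * (dist x y * M\<^sup>2)" using BM mult_right_mono [of 1 "4 * B" "dist x y * M\<^sup>2"] by simp
    finally show ?thesis by (simp add: ac_simps)
  qed
  have turn: "1 \<le> 4 * B * M\<^sup>2 * dist x y" if "orient p q r * orient p q s > 0" "x \<in> closed_segment p q" "y \<in> closed_segment r s"
      and g: "on_grid B M p" "on_grid B M q" "on_grid B M r" "on_grid B M s" for p q r s x y
  proof -
    define a b where "a = - (snd q - snd p)" and "b = fst q - fst p"
    have o: "orient p q z = a * fst z + b * snd z - (a * fst p + b * snd p)" for z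
      by (simp add: orient_def a_def b_def algebra_simps)
    have ab: "\<bar>a\<bar> \<le> 2 * B" "\<bar>b\<bar> \<le> 2 * B" using g(1,2) unfolding a_def b_def on_grid_def by linarith+
    have big: "1 \<le> \<bar>orient p q z\<bar> * M\<^sup>2" if "on_grid B M z" "orient p q z \<noteq> 0" for z
    proof -
      have "orient p q z * M\<^sup>2 = (fst q * M - fst p * M) * (snd z * M - snd p * M) - (snd q * M - snd p * M) * (fst z * M - fst p * M)"
        by (simp add: orient_def power2_eq_square algebra_simps)
      also have "\<dots> \<in> \<int>" using g that(1) unfolding on_grid_def
        by - (rule Ints_diff [OF Ints_mult [OF Ints_diff Ints_diff] Ints_mult [OF Ints_diff Ints_diff]]; blast)
      finally have "1 \<le> \<bar>orient p q z * M\<^sup>2\<bar>" using that(2) BM by (intro Ints_nonzero_abs_ge1) auto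
      then show ?thesis by (simp add: abs_mult)
    qed
    define e where "e = min \<bar>orient p q r\<bar> \<bar>orient p q s\<bar>"
    have ne: "orient p q r \<noteq> 0" "orient p q s \<noteq> 0" using that(1) by auto
    have e: "1 \<le> e * M\<^sup>2" using big [OF g(3) ne(1)] big [OF g(4) ne(2)] by (simp add: e_def min_def)
    have x0: "a * fst x + b * snd x = a * fst p + b * snd p"
    proof -
      have q: "a * fst q + b * snd q = a * fst p + b * snd p" by (simp add: a_def b_def algebra_simps)
      show ?thesis using segment_functional(2) [OF that(2), of a b "a * fst p + b * snd p"]
          segment_functional(2) [OF that(2), of "- a" "- b" "- (a * fst p + b * snd p)"] q by simp
    qed
    have es: "e \<le> \<bar>orient p q r\<bar>" "e \<le> \<bar>orient p q s\<bar>" by (auto simp: e_def)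
    have "e \<le> \<bar>orient p q y\<bar>"
    proof (cases "orient p q r > 0")
      case True
      then have "orient p q s > 0" using that(1) by (simp add: zero_less_mult_iff)
      then have "- a * fst y + - b * snd y \<le> - (a * fst p + b * snd p) - e"
        using True es unfolding o by (intro segment_functional(2) [OF that(3)]) linarith+
      then show ?thesis unfolding o by linarith
    next
      case False
      then have "orient p q r < 0" "orient p q s < 0" using ne that(1) by (auto simp: zero_less_mult_iff)
      then have "a * fst y + b * snd y \<le> a * fst p + b * snd p - e"
        using es unfolding o by (intro segment_functional(2) [OF that(3)]) linarith+
      then show ?thesis unfolding o by linarith
    qed
    also have "orient p q y = a * (fst y - fst x) + b * (snd y - snd x)" unfolding o x0 [symmetric] by (simp add: algebra_simps)
    also have "\<bar>\<dots>\<bar> \<le> \<bar>a\<bar> * \<bar>fst y - fst x\<bar> + \<bar>b\<bar> * \<bar>snd y - snd x\<bar>" unfolding abs_mult [symmetric] by (rule abs_triangle_ineq)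
    also have "\<dots> \<le> 2 * B * dist x y + 2 * B * dist x y"
      using ab BM dist_fst_le [of x y] dist_snd_le [of x y] by (intro add_mono mult_mono) (auto simp: dist_real_def abs_minus_commute)
    finally have "e * M\<^sup>2 \<le> (4 * B * dist x y) * M\<^sup>2" by (intro mult_right_mono) auto
    then show ?thesis using e by (simp add: ac_simps)
  qed
  have fs: "\<bar>fst x - fst y\<bar> \<le> dist x y" "\<bar>snd x - snd y\<bar> \<le> dist x y"
    using dist_fst_le [of x y] dist_snd_le [of x y] by (auto simp: dist_real_def)
  have mx: "max u v * M \<in> \<int>" "min u v * M \<in> \<int>" if "u * M \<in> \<int>" "v * M \<in> \<int>" for u v using that by (auto simp: max_def min_def)
  note c = segment_coords [OF x] segment_coords [OF y]
  have sep: "v - u \<le> e" if "x' \<le> u" "v \<le> y'" "\<bar>x' - y'\<bar> \<le> e \<or> \<bar>y' - x'\<bar> \<le> e" for u v x' y' e :: real using that by linarith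
  have gI: "fst z * M \<in> \<int>" "snd z * M \<in> \<int>" if "on_grid B M z" for z using that by (auto simp: on_grid_def)
  consider "orient p q r * orient p q s > 0" | "orient r s p * orient r s q > 0" | "max (fst p) (fst q) < min (fst r) (fst s)"
    | "max (fst r) (fst s) < min (fst p) (fst q)" | "max (snd p) (snd q) < min (snd r) (snd s)" | "max (snd r) (snd s) < min (snd p) (snd q)"
    using disjoint_segments [OF pq d] by blast
  then show ?thesis
  proof cases
    case 1
    then show ?thesis using turn [OF 1 x y] g by blast
  next
    case 2
    then show ?thesis using turn [OF 2 y x] g by (simp add: dist_commute)
  next
    case 3
    have "min (fst r) (fst s) - max (fst p) (fst q) \<le> dist x y" by (rule sep [OF c(2) c(5)]) (use fs(1) in blast)
    then show ?thesis
      by (rule coord [OF mx(1) [OF gI(1) [OF g(1)] gI(1) [OF g(2)]] mx(2) [OF gI(1) [OF g(3)] gI(1) [OF g(4)]] 3])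
  next
    case 4
    have "min (fst p) (fst q) - max (fst r) (fst s) \<le> dist x y" by (rule sep [OF c(6) c(1)]) (use fs(1) in blast)
    then show ?thesis
      by (rule coord [OF mx(1) [OF gI(1) [OF g(3)] gI(1) [OF g(4)]] mx(2) [OF gI(1) [OF g(1)] gI(1) [OF g(2)]] 4])
  next
    case 5
    have "min (snd r) (snd s) - max (snd p) (snd q) \<le> dist x y" by (rule sep [OF c(4) c(7)]) (use fs(2) in blast)
    then show ?thesis
      by (rule coord [OF mx(1) [OF gI(2) [OF g(1)] gI(2) [OF g(2)]] mx(2) [OF gI(2) [OF g(3)] gI(2) [OF g(4)]] 5])
  next
    case 6
    have "min (snd p) (snd q) - max (snd r) (snd s) \<le> dist x y" by (rule sep [OF c(8) c(3)]) (use fs(2) in blast)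
    then show ?thesis
      by (rule coord [OF mx(1) [OF gI(2) [OF g(3)] gI(2) [OF g(4)]] mx(2) [OF gI(2) [OF g(1)] gI(2) [OF g(2)]] 6])
  qed
qed

lemma abs_le_bitsize_int: "\<bar>real_of_int n\<bar> \<le> 2 ^ bitsize_int n"
proof -
  define m where "m = nat \<lceil>log 2 (real_of_int \<bar>n\<bar> + 1)\<rceil>"
  have b: "bitsize_int n = 1 + m" unfolding bitsize_int_def m_def ..
  have "log 2 (real_of_int \<bar>n\<bar> + 1) \<le> real m" unfolding m_def by (rule real_nat_ceiling_ge)
  then have "real_of_int \<bar>n\<bar> + 1 \<le> 2 powr real m" by (subst (asm) log_le_iff) auto
  also have "\<dots> = 2 ^ m" by (simp add: powr_realpow)
  also have "\<dots> \<le> 2 ^ bitsize_int n" by (rule power_increasing) (auto simp: b)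
  finally show ?thesis by simp
qed

definition rden :: "rat \<Rightarrow> real" where "rden x = of_int (snd (quotient_of x))"

lemma rden: "1 \<le> rden x" "rden x \<le> 2 ^ bitsize_rat x" "real_of_rat x * rden x \<in> \<int>" "\<bar>real_of_rat x\<bar> \<le> 2 ^ bitsize_rat x"
proof -
  obtain n m where q: "quotient_of x = (n, m)" by (cases "quotient_of x")
  have m: "m > 0" "x = of_int n / of_int m" using quotient_of_denom_pos [OF q] quotient_of_div [OF q] by auto
  have xr: "real_of_rat x = of_int n / of_int m" unfolding m(2) by (simp add: of_rat_divide)
  have d: "rden x = of_int m" and b: "bitsize_rat x = bitsize_int n + bitsize_int m" by (auto simp: rden_def bitsize_rat_def q)
  show 1: "1 \<le> rden x" using m(1) by (simp add: d)
  have "of_int m \<le> (2 :: real) ^ bitsize_int m" using abs_le_bitsize_int [of m] m(1) by simp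
  also have "\<dots> \<le> 2 ^ bitsize_rat x" unfolding b by (rule power_increasing) auto
  finally show "rden x \<le> 2 ^ bitsize_rat x" by (simp add: d)
  show "real_of_rat x * rden x \<in> \<int>" using m(1) by (simp add: xr d)
  have "\<bar>real_of_rat x\<bar> \<le> \<bar>of_int n\<bar>" using 1 unfolding xr d[symmetric] abs_divide by (simp add: divide_le_eq mult_left_le mult_le_cancel_left1)
  also have "\<dots> \<le> (2 :: real) ^ bitsize_int n" by (rule abs_le_bitsize_int)
  also have "\<dots> \<le> 2 ^ bitsize_rat x" unfolding b by (rule power_increasing) auto
  finally show "\<bar>real_of_rat x\<bar> \<le> 2 ^ bitsize_rat x" .
qed

definition pden :: "rat \<times> rat \<Rightarrow> real" where "pden z = rden (fst z) * rden (snd z)"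

lemma pden:
  "1 \<le> pden z" "pden z \<le> 2 ^ bitsize_point z" "fst (real_point z) * pden z \<in> \<int>" "snd (real_point z) * pden z \<in> \<int>"
  "\<bar>fst (real_point z)\<bar> \<le> 2 ^ bitsize_point z" "\<bar>snd (real_point z)\<bar> \<le> 2 ^ bitsize_point z"
proof -
  note f = rden [of "fst z"] and s = rden [of "snd z"]
  have 1: "1 * 1 \<le> rden (fst z) * rden (snd z)" using f s by (intro mult_mono) auto
  then show "1 \<le> pden z" by (simp add: pden_def)
  have "rden (fst z) * rden (snd z) \<le> 2 ^ bitsize_rat (fst z) * 2 ^ bitsize_rat (snd z)" using f s by (intro mult_mono) auto
  then show "pden z \<le> 2 ^ bitsize_point z" by (simp add: pden_def bitsize_point_def power_add)
  have i: "rden x \<in> \<int>" for x by (simp add: rden_def)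
  show "fst (real_point z) * pden z \<in> \<int>" "snd (real_point z) * pden z \<in> \<int>"
    using Ints_mult [OF f(3) i [of "snd z"]] Ints_mult [OF s(3) i [of "fst z"]] by (auto simp: pden_def real_point_def ac_simps)
  have "(2 :: real) ^ bitsize_rat (fst z) \<le> 2 ^ bitsize_point z" "(2 :: real) ^ bitsize_rat (snd z) \<le> 2 ^ bitsize_point z"
    by (rule power_increasing; simp add: bitsize_point_def)+
  then show "\<bar>fst (real_point z)\<bar> \<le> 2 ^ bitsize_point z" "\<bar>snd (real_point z)\<bar> \<le> 2 ^ bitsize_point z"
    unfolding real_point_def fst_conv snd_conv by - (rule order_trans [OF f(4)] order_trans [OF s(4)], assumption)+
qed

lemma pden_Ints: "pden z \<in> \<int>" by (simp add: pden_def rden_def)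

text \<open>With total bit size \<open>S\<close>, the segments of \<open>lG\<close> and
  \<open>lC K\<close> are at distance at least \<open>1 / 2 ^ (3 * S + 2)\<close>, while points of
  \<open>wW\<close> are at distance at most \<open>2 ^ (S + 2)\<close>. The forced ratio
  \<open>2 ^ 2 ^ (K - 1)\<close> is thus at most \<open>2 ^ (4 * S + 4)\<close>.\<close>

lemma hard_graph:
  assumes n: "200 + 40 * K \<le> n" and K: "K > 0"
  obtains G where "G \<in> SEG n"
    "\<And>P Q. rational_realization P Q G \<Longrightarrow> 2 ^ (K - 1) \<le> 4 * (\<Sum>v\<in>verts G. bitsize_point (P v) + bitsize_point (Q v)) + 4"
proof (rule gadget_graph [OF n])
  fix \<phi> G
  assume G: "G \<in> SEG n" and \<phi>: "inj_on \<phi> (names K)" "\<phi> ` names K \<subseteq> verts G"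
    and hits: "\<And>A :: nat \<Rightarrow> (real \<times> real) set. realizes A G \<Longrightarrow> gadget_hits K (\<lambda>x y. A (\<phi> x) \<inter> A (\<phi> y) \<noteq> {})"
  have fin: "finite (verts G)" using G by (auto simp: SEG_def segment_graph_def simple_graph_def)
  show thesis
  proof (rule that [OF G])
    fix P Q assume R: "rational_realization P Q G"
    define S where "S = (\<Sum>v\<in>verts G. bitsize_point (P v) + bitsize_point (Q v))"
    define p q where "p v = real_point (P v)" and "q v = real_point (Q v)" for v
    have pq: "p v \<noteq> q v" if "v \<in> verts G" for v
      using R that by (auto simp: rational_realization_def p_def q_def real_point_def prod_eq_iff)
    have g: "gadget_hits K (\<lambda>x y. closed_segment (p (\<phi> x)) (q (\<phi> x)) \<inter> closed_segment (p (\<phi> y)) (q (\<phi> y)) \<noteq> {})"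
      using R unfolding rational_realization_def p_def q_def by (intro hits) blast
    interpret g: gadget_hits K "\<lambda>x y. closed_segment (p (\<phi> x)) (q (\<phi> x)) \<inter> closed_segment (p (\<phi> y)) (q (\<phi> y)) \<noteq> {}" by (rule g)
    define w u v where "w = \<phi> (Wl wW)" and "u = \<phi> (Lin lG)" and "v = \<phi> (Lin (lC K))"
    have nn: "Wl wW \<in> names K" "Lin lG \<in> names K" "Lin (lC K) \<in> names K" using special_lines [of K] by simp_all
    have V: "w \<in> verts G" "u \<in> verts G" "v \<in> verts G" "u \<noteq> v"
      using \<phi> nn unfolding w_def u_def v_def by (auto simp: inj_on_eq_iff)
    have d: "closed_segment (p u) (q u) \<inter> closed_segment (p v) (q v) = {}" using g.pins(12) by (simp add: u_def v_def)
    have b1: "bitsize_point (P x) + bitsize_point (Q x) \<le> S" if "x \<in> verts G" for x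
      unfolding S_def using fin that by (intro member_le_sum) auto
    have b2: "bitsize_point (P u) + bitsize_point (Q u) + (bitsize_point (P v) + bitsize_point (Q v)) \<le> S"
    proof -
      have "(\<Sum>x\<in>{u, v}. bitsize_point (P x) + bitsize_point (Q x)) \<le> S" unfolding S_def using fin V by (intro sum_mono2) auto
      then show ?thesis using V(4) by simp
    qed
    \<comment> \<open>A common denominator of the four end points. As \<open>u\<close> and
      \<open>v\<close> are different vertices, their bit sizes are separate summands of
      \<open>S\<close>, which yields \<open>M \<le> 2 ^ S\<close>.\<close>
    define M where "M = pden (P u) * pden (Q u) * (pden (P v) * pden (Q v))"
    have M1: "1 \<le> M"
    proof -
      have "1 * 1 * (1 * 1) \<le> M" unfolding M_def by (intro mult_mono pden) (use pden(1) in \<open>auto simp: order_trans [OF zero_le_one]\<close>)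
      then show ?thesis by simp
    qed
    have M: "M \<le> 2 ^ S"
    proof -
      have "M \<le> 2 ^ bitsize_point (P u) * 2 ^ bitsize_point (Q u) * (2 ^ bitsize_point (P v) * 2 ^ bitsize_point (Q v))"
        unfolding M_def by (intro mult_mono pden) (use pden(1) in \<open>auto simp: order_trans [OF zero_le_one]\<close>)
      also have "\<dots> = 2 ^ (bitsize_point (P u) + bitsize_point (Q u) + (bitsize_point (P v) + bitsize_point (Q v)))" by (simp only: power_add)
      also have "\<dots> \<le> 2 ^ S" using b2 by (intro power_increasing) auto
      finally show ?thesis .
    qed
    have cb: "\<bar>fst (p x)\<bar> \<le> 2 ^ S \<and> \<bar>snd (p x)\<bar> \<le> 2 ^ S \<and> \<bar>fst (q x)\<bar> \<le> 2 ^ S \<and> \<bar>snd (q x)\<bar> \<le> 2 ^ S" if x: "x \<in> verts G" for x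
    proof -
      have "(2 :: real) ^ bitsize_point (P x) \<le> 2 ^ S" "(2 :: real) ^ bitsize_point (Q x) \<le> 2 ^ S"
        using b1 [OF x] by (intro power_increasing; simp)+
      then show ?thesis using pden(5,6) [of "P x"] pden(5,6) [of "Q x"] unfolding p_def q_def by linarith
    qed
    have int: "fst (real_point z) * (pden z * k) \<in> \<int>" "snd (real_point z) * (pden z * k) \<in> \<int>" if "k \<in> \<int>" for z k
      using Ints_mult [OF pden(3) that] Ints_mult [OF pden(4) that] by (simp_all add: mult.assoc)
    have grid: "on_grid (2 ^ S) M (p u)" "on_grid (2 ^ S) M (q u)" "on_grid (2 ^ S) M (p v)" "on_grid (2 ^ S) M (q v)"
    proof -
      have m: "M = pden (P u) * (pden (Q u) * pden (P v) * pden (Q v))" "M = pden (Q u) * (pden (P u) * pden (P v) * pden (Q v))"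
        "M = pden (P v) * (pden (Q u) * pden (P u) * pden (Q v))" "M = pden (Q v) * (pden (Q u) * pden (P v) * pden (P u))"
        by (simp_all add: M_def ac_simps)
      show "on_grid (2 ^ S) M (p u)" using cb [OF V(2)] int [of _ "P u"] unfolding on_grid_def m(1) p_def by (auto simp: pden_Ints)
      show "on_grid (2 ^ S) M (q u)" using cb [OF V(2)] int [of _ "Q u"] unfolding on_grid_def m(2) q_def by (auto simp: pden_Ints)
      show "on_grid (2 ^ S) M (p v)" using cb [OF V(3)] int [of _ "P v"] unfolding on_grid_def m(3) p_def by (auto simp: pden_Ints)
      show "on_grid (2 ^ S) M (q v)" using cb [OF V(3)] int [of _ "Q v"] unfolding on_grid_def m(4) q_def by (auto simp: pden_Ints)
    qed
    define \<mu> where "\<mu> = 1 / (2 :: real) ^ (3 * S + 2)"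
    have far: "\<mu> \<le> dist x y" if "x \<in> closed_segment (p u) (q u)" "y \<in> closed_segment (p v) (q v)" for x y
    proof -
      have "1 \<le> 4 * 2 ^ S * M\<^sup>2 * dist x y" by (rule grid_dist [OF grid _ M1 pq [OF V(2)] d that]) simp
      also have "\<dots> \<le> 4 * 2 ^ S * (2 ^ S)\<^sup>2 * dist x y" using M M1 by (intro mult_right_mono mult_left_mono power_mono) auto
      also have "4 * 2 ^ S * ((2 :: real) ^ S)\<^sup>2 = 2 ^ (3 * S + 2)" by (simp add: power_add power_mult power2_eq_square power3_eq_cube flip: power_mult_distrib)
      finally show ?thesis by (simp add: \<mu>_def field_simps)
    qed
    have near: "dist x y \<le> 2 ^ (S + 2)" if "x \<in> closed_segment (p w) (q w)" "y \<in> closed_segment (p w) (q w)" for x y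
    proof -
      have bd: "\<bar>z\<bar> \<le> B" if "min a b \<le> z" "z \<le> max a b" "\<bar>a\<bar> \<le> B" "\<bar>b\<bar> \<le> B" for a b z B :: real using that by linarith
      have pt: "\<bar>fst z\<bar> \<le> 2 ^ S \<and> \<bar>snd z\<bar> \<le> 2 ^ S" if "z \<in> closed_segment (p w) (q w)" for z
        using bd [OF segment_coords(1,2) [OF that], of "2 ^ S"] bd [OF segment_coords(3,4) [OF that], of "2 ^ S"] cb [OF V(1)] by blast
      have "\<bar>a - b\<bar> + \<bar>c - d\<bar> \<le> 4 * B" if "\<bar>a\<bar> \<le> B" "\<bar>b\<bar> \<le> B" "\<bar>c\<bar> \<le> B" "\<bar>d\<bar> \<le> B" for a b c d B :: real using that by linarith
      from this [of "fst x" "2 ^ S" "fst y" "snd x" "snd y"] have "dist x y \<le> 4 * 2 ^ S" using dist_le_coords [of x y] pt [OF that(1)] pt [OF that(2)] by (meson order_trans)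
      then show ?thesis by (simp add: power_add)
    qed
    define N where "N = (2 :: nat) ^ (K - 1)"
    have "2 ^ N * \<mu> \<le> 2 ^ (S + 2)"
    \<comment> \<open>The perturbation error tends to 0: \<open>\<eta>\<close> is chosen so that the
      total error is exactly \<open>e\<close>.\<close>
    proof (rule field_le_epsilon)
      fix e :: real assume e: "0 < e"
      define \<eta> where "\<eta> = e / (1 + 2 ^ N)"
      have "(0 :: real) < 1 + 2 ^ N" by (simp add: add_pos_pos)
      then have "\<eta> > 0" "(1 + 2 ^ N) * \<eta> = e" using e by (simp_all add: \<eta>_def)
      then have \<eta>: "\<eta> > 0" "\<eta> + 2 ^ N * \<eta> = e" by (simp_all add: distrib_right)
      obtain s t x y where st: "s \<in> closed_segment (p w) (q w)" "t \<in> closed_segment (p w) (q w)" "x \<in> closed_segment (p u) (q u)"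
        "y \<in> closed_segment (p v) (q v)" "2 ^ N * (dist x y - \<eta>) \<le> dist s t + \<eta>"
        using realization_ratio [OF fin pq \<phi> g K \<eta>(1)] unfolding w_def [symmetric] u_def [symmetric] v_def [symmetric] N_def by blast
      have "2 ^ N * \<mu> \<le> 2 ^ N * dist x y" using far [OF st(3,4)] by (rule mult_left_mono) simp
      then show "2 ^ N * \<mu> \<le> 2 ^ (S + 2) + e"
        using near [OF st(1,2)] st(5) \<eta>(2) unfolding right_diff_distrib by linarith
    qed
    then have "(2 :: real) ^ N \<le> 2 ^ (S + 2) * 2 ^ (3 * S + 2)" by (simp add: \<mu>_def field_simps)
    also have "\<dots> = 2 ^ (S + 2 + (3 * S + 2))" by (simp only: power_add)
    also have "S + 2 + (3 * S + 2) = 4 * S + 4" by simp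
    finally have "N \<le> 4 * S + 4" by (simp only: power_increasing_iff one_less_numeral_iff semiring_norm)
    then show "2 ^ (K - 1) \<le> 4 * (\<Sum>v\<in>verts G. bitsize_point (P v) + bitsize_point (Q v)) + 4" unfolding N_def S_def .
  qed
qed

theorem corollary1p6:
  "\<exists>(c1 :: real) (c2 :: real) (n0 :: nat). c1 > 0 \<and> c2 > 0 \<and>
     (\<forall>n\<ge>n0. 2 powr (c1 * real n) \<le> real (g_SEG n) \<and>
              real (g_SEG n) \<le> 2 powr (c2 * real n))"
proof (intro exI conjI allI impI)
  fix n :: nat assume n: "n \<ge> 800"
  have up: "g_SEG_graph G \<le> 2 ^ (29 * n)" if G: "G \<in> SEG n" for G
  proof -
    obtain P Q where PQ: "rational_realization P Q G" "(\<Sum>v\<in>verts G. bitsize_point (P v) + bitsize_point (Q v)) \<le> 2 ^ (29 * n)"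
      using short_realization [OF G] n by auto
    then have "g_SEG_graph G \<le> (\<Sum>v\<in>verts G. bitsize_point (P v) + bitsize_point (Q v))"
      unfolding g_SEG_graph_def by (intro Least_le) blast
    then show ?thesis using PQ(2) by (rule order_trans)
  qed
  \<comment> \<open>The uniform upper bound also makes the set of values finite, so that
    \<open>Max\<close> is meaningful.\<close>
  then have fin: "finite (g_SEG_graph ` SEG n)" by (intro finite_subset [OF _ finite_atMost [of "2 ^ (29 * n)"]]) auto
  \<comment> \<open>From \<open>n \<ge> 800\<close> this gives \<open>K \<ge> 10\<close>, so
    \<open>200 + 40 * K \<le> 80 * K \<le> n\<close>; and \<open>n < 80 * K + 80\<close> yields
    \<open>n / 160 \<le> K - 4\<close>.\<close>
  define K where "K = n div 80"
  have K: "10 \<le> K" "200 + 40 * K \<le> n" "n < 80 * K + 80" using n by (auto simp: K_def)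
  obtain G where G: "G \<in> SEG n"
    and hard: "\<And>P Q. rational_realization P Q G \<Longrightarrow> 2 ^ (K - 1) \<le> 4 * (\<Sum>v\<in>verts G. bitsize_point (P v) + bitsize_point (Q v)) + 4"
    by (rule hard_graph [OF K(2)]) (use K(1) in auto)
  have "\<exists>s P Q. rational_realization P Q G \<and> s = (\<Sum>v\<in>verts G. bitsize_point (P v) + bitsize_point (Q v))"
    using short_realization [OF G] n by auto
  from LeastI_ex [OF this] obtain P Q where "rational_realization P Q G"
    "g_SEG_graph G = (\<Sum>v\<in>verts G. bitsize_point (P v) + bitsize_point (Q v))" unfolding g_SEG_graph_def by blast
  then have "2 ^ (K - 1) \<le> 4 * g_SEG_graph G + 4" using hard by simp
  moreover have "g_SEG_graph G \<le> g_SEG n" unfolding g_SEG_def using G fin by (intro Max_ge) auto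
  ultimately have g: "2 ^ (K - 1) \<le> 4 * g_SEG n + 4" by linarith
  \<comment> \<open>Three factors 2 are split off to absorb the constants in
    \<open>4 * g_SEG n + 4\<close>.\<close>
  have "2 ^ (K - 1) = 8 * (2 :: nat) ^ (K - 4)"
    using power_add [of "2 :: nat" 3 "K - 4"] K(1) by simp
  then have "2 * 2 ^ (K - 4) \<le> g_SEG n + 1" using g by linarith
  moreover have "1 \<le> (2 :: nat) ^ (K - 4)" by simp
  ultimately have "2 ^ (K - 4) \<le> g_SEG n" by linarith
  then have "real (2 ^ (K - 4)) \<le> real (g_SEG n)" by (simp only: of_nat_le_iff)
  moreover have "2 powr (1 / 160 * real n) \<le> 2 powr real (K - 4)" using K by (intro powr_mono) auto
  moreover have "real (2 ^ (K - 4)) = 2 powr real (K - 4)" by (subst powr_realpow) auto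
  ultimately show "2 powr (1 / 160 * real n) \<le> real (g_SEG n)" by linarith
  have "g_SEG n \<in> g_SEG_graph ` SEG n" unfolding g_SEG_def using G fin by (intro Max_in) auto
  then have "g_SEG n \<le> 2 ^ (29 * n)" using up by auto
  then have "real (g_SEG n) \<le> real (2 ^ (29 * n))" by (simp only: of_nat_le_iff)
  also have "\<dots> = 2 powr real (29 * n)" by (subst powr_realpow) auto
  finally show "real (g_SEG n) \<le> 2 powr (29 * real n)" by (simp only: of_nat_mult of_nat_numeral)
qed auto

end
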